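(* There exists $\delta>0$ such that for every integer $n\ge 0$: if $q\in X_{n+1}$ and $\|q\|_{X_1}<\delta$, then the scattering coefficients $a(\lambda),b(\lambda)$ ($\lambda\in\mathbb R$) of $q$ satisfy $$\lambda^{-1}\frac{b(\lambda)}{a(\lambda)}\in H^1(\mathbb R),\qquad \lambda^{j}\frac{b(\lambda)}{a(\lambda)}\in H^1(\mathbb R)\quad\text{for } j=0,1,\dots,n .$$
   Context: Notation: $\langle x\rangle=\sqrt{1+x^2}$; for an integer $n\ge0$, $X_n=\{f\in L^2(\mathbb R):\langle x\rangle\partial_x^jf\in L^2(\mathbb R),\ j=0,\dots,n\}$ (complex-valued functions, weak derivatives), and $\|q\|_{X_1}=\|\langle x\rangle q\|_{L^2}+\|\langle x\rangle\partial_xq\|_{L^2}$. $H^1(\mathbb R)$ is the usual Sobolev space in the variable $\lambda$. Scattering data: let $\sigma_3=\mathrm{diag}(1,-1)$ and $\mathcal M=\begin{pmatrix}0&q\\-\bar q&0\end{pmatrix}$. For $q\in X_1$ and $\lambda\in\mathbb R$, $m^{(\pm)}(x;\lambda)$ is the unique solution, bounded in $x$, of $$m^{(\pm)}(x)=I-\lambda\int_{\pm\infty}^x e^{i\lambda(x-y)\sigma_3}\mathcal M(y)m^{(\pm)}(y)e^{-i\lambda(x-y)\sigma_3}\,dy,$$ and $\psi_\pm=m^{(\pm)}e^{i\lambda\sigma_3x}$, so $\psi_\pm$ solves $\psi_x=[i\lambda\sigma_3-\lambda\mathcal M]\psi$ and $\psi_\pm e^{-i\lambda\sigma_3x}\to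 I$ as $x\to\pm\infty$. The coefficients $a,b$ are defined by $\psi_+=\psi_-T$ with $T=\begin{pmatrix}a(\lambda)&-\overline{b(\lambda)}\\ b(\lambda)&\overline{a(\lambda)}\end{pmatrix}$; equivalently $a=\det((\psi_+)_1,(\psi_-)_2)$ and $b=\det((\psi_-)_1,(\psi_+)_1)$, where $(\cdot)_j$ denotes the $j$-th column. *)

theory Defs
  imports "HOL-Analysis.Analysis"
begin

section \<open>Function spaces on the real line\<close>

text \<open>
  Elements of \<open>L\<^sup>2\<close>, \<open>X\<^sub>n\<close> and \<open>H\<^sup>1\<close> are represented by
  Lebesgue-measurable functions. All the notions below are invariant under changing a function on a
  null set.
\<close>

definition L2 :: "(real \<Rightarrow> complex) set" where
  "L2 = {f. f \<in> borel_measurable lebesgue \<and> integrable lebesgue (\<lambda>x. (cmod (f x))\<^sup>2)}"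

definition L2_norm :: "(real \<Rightarrow> complex) \<Rightarrow> real" where
  "L2_norm f = sqrt (\<integral>x. (cmod (f x))\<^sup>2 \<partial>lebesgue)"

definition test_function :: "(real \<Rightarrow> real) \<Rightarrow> bool" where
  "test_function \<phi> \<longleftrightarrow>
     (\<forall>k x. (deriv ^^ k) \<phi> differentiable (at x)) \<and> compact (closure {x. \<phi> x \<noteq> 0})"

definition locally_integrable :: "(real \<Rightarrow> complex) \<Rightarrow> bool" where
  "locally_integrable f \<longleftrightarrow> (\<forall>K. compact K \<longrightarrow> set_integrable lebesgue K f)"

definition has_weak_derivative ::
    "nat \<Rightarrow> (real \<Rightarrow> complex) \<Rightarrow> (real \<Rightarrow> complex) \<Rightarrow> bool" where
  "has_weak_derivative j f g \<longleftrightarrow>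
     locally_integrable f \<and> locally_integrable g \<and>
     (\<forall>\<phi>. test_function \<phi> \<longrightarrow>
        (\<integral>x. complex_of_real ((deriv ^^ j) \<phi> x) * f x \<partial>lebesgue)
          = (-1) ^ j * (\<integral>x. complex_of_real (\<phi> x) * g x \<partial>lebesgue))"

text \<open>A weak derivative is unique up to a null set, so the choice made here is immaterial.\<close>

definition weak_derivative :: "nat \<Rightarrow> (real \<Rightarrow> complex) \<Rightarrow> real \<Rightarrow> complex" where
  "weak_derivative j f = (SOME g. has_weak_derivative j f g)"

definition bracket :: "real \<Rightarrow> real" where
  "bracket x = sqrt (1 + x\<^sup>2)"

definition X_space :: "nat \<Rightarrow> (real \<Rightarrow> complex) set" where
  "X_space n =
     {f \<in> L2. \<forall>j\<le>n. \<exists>g. has_weak_derivative j f g \<and>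
                          (\<lambda>x. complex_of_real (bracket x) * g x) \<in> L2}"

definition X1_norm :: "(real \<Rightarrow> complex) \<Rightarrow> real" where
  "X1_norm q =
     L2_norm (\<lambda>x. complex_of_real (bracket x) * q x) +
     L2_norm (\<lambda>x. complex_of_real (bracket x) * weak_derivative 1 q x)"

definition H1_space :: "(real \<Rightarrow> complex) set" where
  "H1_space = {f \<in> L2. \<exists>g \<in> L2. has_weak_derivative 1 f g}"


section \<open>Scattering data\<close>

text \<open>\<open>exp_i_sigma3 t\<close> is the matrix exponential of \<open>i t diag(1, -1)\<close>.\<close>

definition exp_i_sigma3 :: "real \<Rightarrow> complex^2^2" where
  "exp_i_sigma3 t = vector [vector [cis t, 0], vector [0, cis (- t)]]"

definition potential :: "(real \<Rightarrow> complex) \<Rightarrow> real \<Rightarrow> complex^2^2" where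
  "potential q x = vector [vector [0, q x], vector [- cnj (q x), 0]]"

text \<open>
  The spectral parameter is \<open>l\<close>. The base point \<open>s\<close> is \<open>\<infinity>\<close> for the plus sign and \<open>-\<infinity>\<close> for the
  minus sign; the interval integral carries the orientation of the integral from \<open>s\<close>
  to \<open>x\<close>. Integrability is required explicitly because non-integrable functions have
  integral \<open>0\<close>.
\<close>

definition jost_integrand ::
    "(real \<Rightarrow> complex) \<Rightarrow> real \<Rightarrow> (real \<Rightarrow> complex^2^2) \<Rightarrow> real \<Rightarrow> real \<Rightarrow> complex^2^2" where
  "jost_integrand q l m x y =
     exp_i_sigma3 (l * (x - y)) ** potential q y ** m y ** exp_i_sigma3 (- (l * (x - y)))"

definition jost_equation ::
    "ereal \<Rightarrow> (real \<Rightarrow> complex) \<Rightarrow> real \<Rightarrow> (real \<Rightarrow> complex^2^2) \<Rightarrow> bool" where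
  "jost_equation s q l m \<longleftrightarrow>
     (\<forall>x. interval_lebesgue_integrable lebesgue s (ereal x) (jost_integrand q l m x) \<and>
          m x = mat 1 - l *\<^sub>R
            interval_lebesgue_integral lebesgue s (ereal x) (jost_integrand q l m x))"

definition jost_m :: "ereal \<Rightarrow> (real \<Rightarrow> complex) \<Rightarrow> real \<Rightarrow> real \<Rightarrow> complex^2^2" where
  "jost_m s q l = (THE m. bounded (range m) \<and> jost_equation s q l m)"

definition jost_psi :: "ereal \<Rightarrow> (real \<Rightarrow> complex) \<Rightarrow> real \<Rightarrow> real \<Rightarrow> complex^2^2" where
  "jost_psi s q l x = jost_m s q l x ** exp_i_sigma3 (l * x)"

definition transition_matrix :: "complex \<Rightarrow> complex \<Rightarrow> complex^2^2" where
  "transition_matrix a b = vector [vector [a, - cnj b], vector [b, cnj a]]"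

definition scattering_coeffs :: "(real \<Rightarrow> complex) \<Rightarrow> real \<Rightarrow> complex \<times> complex" where
  "scattering_coeffs q l =
     (THE (a, b). \<forall>x. jost_psi \<infinity> q l x = jost_psi (-\<infinity>) q l x ** transition_matrix a b)"

definition scattering_a :: "(real \<Rightarrow> complex) \<Rightarrow> real \<Rightarrow> complex" where
  "scattering_a q l = fst (scattering_coeffs q l)"

definition scattering_b :: "(real \<Rightarrow> complex) \<Rightarrow> real \<Rightarrow> complex" where
  "scattering_b q l = snd (scattering_coeffs q l)"

end

theory Submission
 imports Defs "HOL-Probability.Probability"
begin

text \<open>For a small potential the Riccati equation \<open>w' = - 2 i l w + l q\<^sup>* + l q w\<^sup>2\<close>, \<open>w \<rightarrow> 0\<close> at \<open>+\<infinity>\<close>, describes the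
 ratio of the components of the Jost solution, and \<open>b / a\<close> is the limit of \<open>exp (2 i l x) w\<close> at \<open>-\<infinity>\<close>.
 A Moebius transformation removes the terms of order \<open>l\<close> that are not diagonal and leads to
 \<open>v' = p (- 2 i l v + f + \<mu>(l) f\<^sup>* v\<^sup>2)\<close> with \<open>p \<ge> 1\<close>. Bessel's inequality for the phase \<open>\<integral> p\<close> and absorption
 bound \<open>v(x, \<cdot>)\<close> and its difference quotients in \<open>L\<^sup>2\<close> for \<open>x \<ge> 0\<close>. The difference of the solutions that decay at the
 two ends gives \<open>b / a\<close> at the single point \<open>x = 0\<close>; each further derivative of \<open>q\<close> trades a factor \<open>l\<close>
 for a derivative of \<open>v\<close>. For \<open>\<bar>l\<bar> \<le> 1\<close> the substitution \<open>w = l v\<close> without Moebius map yields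
 \<open>(1 / l) b / a\<close>.\<close>

text \<open>The obstacle is the factor l before the potential: at large l the forcing of the Riccati
  equation is large, however small q is. The Moebius map moves the origin to a root of the terms of
  order l, so the source that remains comes from the x-derivative of that root, that is from q'.
  Here one derivative is spent (q in X_{n+1}, powers up to n), and this is why smallness is asked of
  the X_1 norm. The bound \<delta> does not depend on n since the equations for the higher
  derivatives of v are linear, with the small coefficient of the first one. The weight <x> helps on
  a half line only: it bounds tails and pays for the derivative in l when integrating away from the
  origin. So no estimate is propagated to -\<infinity>; the second solution comes from the reflected
  potential, and a conserved expression in both solutions carries the limit at -\<infinity> to x =
  0. The constant 1/32: Cauchy-Schwarz against 1/<x> costs sqrt pi < 2, which leaves an L1 norm of
  1/16, the smallness behind the contraction and every absorption.\<close>

abbreviation (input) cor :: "real => complex" where "cor \<equiv> complex_of_real"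
abbreviation (input) bor :: "('b::topological_space => 'a::topological_space) set" where "bor \<equiv> borel_measurable borel"
abbreviation (input) nn_lborel :: "(real => ennreal) => ennreal" (binder "NN " 10)
 where "nn_lborel f \<equiv> nn_integral lborel f"

section \<open>Absolutely continuous functions\<close>

text \<open>The second argument is a fixed Borel version of the almost everywhere derivative. With
  it the rules of calculus become pointwise identities, which \<open>AC_cong\<close> reduces to
  algebra.\<close>

definition AC :: "(real => complex) => (real => complex) => bool" where
 "AC F f \<longleftrightarrow> f \<in> bor \<and> (\<forall>a b. set_integrable lborel {a..b} f) \<and>
  (\<forall>a b. a <= b \<longrightarrow> F b - F a = (LINT x:{a..b}|lborel. f x))"

lemma AC_borel [measurable_dest]: "AC F f ==> f \<in> bor"
 and AC_integrable: "AC F f ==> set_integrable lborel {a..b} f"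
 and AC_eq: "AC F f ==> a <= b ==> F b - F a = (LINT x:{a..b}|lborel. f x)"
 by (auto simp: AC_def)

lemma AC_HK:
 assumes "AC F f"
 shows "f absolutely_integrable_on {a..b}" "a <= b ==> F b - F a = integral {a..b} f"
  "(\<lambda>x. cmod (f x)) integrable_on {a..b}" "f integrable_on {a..b}"
proof -
 have m: "set_integrable lborel {a..b} f" using assms by (rule AC_integrable)
 show 1: "f absolutely_integrable_on {a..b}"
  using m unfolding set_integrable_def
  by (metis (no_types, lifting) borel_measurable_integrable integrable_completion)
 show "a <= b ==> F b - F a = integral {a..b} f"
  using AC_eq[OF assms, of a b] set_borel_integral_eq_integral(2)[OF m] by simp
 show "(\<lambda>x. cmod (f x)) integrable_on {a..b}" "f integrable_on {a..b}"
  using 1 by (auto simp: absolutely_integrable_on_def)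
qed

lemma ACI_HK:
 assumes [measurable]: "f \<in> bor"
  and "\<And>a b. f absolutely_integrable_on {a..b}"
  and "\<And>a b. a <= b ==> F b - F a = integral {a..b} f"
 shows "AC F f"
proof -
 have m: "set_integrable lborel {a..b} f" for a b
  using assms(2)[of a b] unfolding set_integrable_def
  by (subst (asm) integrable_completion) auto
 show ?thesis
  unfolding AC_def using m assms(3) set_borel_integral_eq_integral(2)[OF m] by auto
qed

lemma AC_continuous: assumes "AC F f" shows "continuous_on UNIV F"
proof -
 have "isCont F x" for x
 proof -
  have "continuous_on {x-1..x+1} (\<lambda>t. F (x-1) + integral {x-1..t} f)"
   using AC_HK(4)[OF assms] by (intro continuous_intros indefinite_integral_continuous_1)
  then have "continuous_on {x-1..x+1} F"
  proof (rule continuous_on_eq)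
   fix t assume "t \<in> {x-1..x+1}"
   then have "F t - F (x-1) = integral {x-1..t} f" by (intro AC_HK(2)[OF assms]) auto
   then show "F (x-1) + integral {x-1..t} f = F t" by (metis add.commute diff_add_cancel)
  qed
  then have "continuous_on {x-1<..<x+1} F" by (rule continuous_on_subset) auto
  then show ?thesis by (subst (asm) continuous_on_eq_continuous_at) auto
 qed
 then show ?thesis by (simp add: continuous_at_imp_continuous_on)
qed

lemma AC_meas [measurable_dest]: "AC F f ==> F \<in> bor"
 using AC_continuous borel_measurable_continuous_onI by blast

lemma AC_isCont: "AC F f ==> isCont F x"
 using AC_continuous continuous_on_eq_continuous_at by blast

lemma AC_cong_AE:
 assumes "AC F f" "AE x in lborel. f x = g x" and [measurable]: "g \<in> bor"
 shows "AC F g"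
proof -
 have [measurable]: "f \<in> bor" using assms(1) by (rule AC_borel)
 have 1: "set_integrable lborel {a..b} g" for a b
  using AC_integrable[OF assms(1), of a b] unfolding set_integrable_def
  by (rule integrable_cong_AE_imp) (use assms(2) in auto)
 have 2: "(LINT x:{a..b}|lborel. f x) = (LINT x:{a..b}|lborel. g x)" for a b
  unfolding set_lebesgue_integral_def by (rule integral_cong_AE) (use assms(2) in auto)
 show ?thesis using assms(1) 1 2 unfolding AC_def by auto
qed

lemma AC_cong:
 assumes "AC F f" "\<And>x. F x = G x" "\<And>x. f x = g x"
 shows "AC G g"
proof -
 have "F = G" "f = g" using assms(2,3) by auto
 then show ?thesis using assms(1) by simp
qed

lemma AC_add: assumes "AC F f" "AC G g" shows "AC (\<lambda>x. F x + G x) (\<lambda>x. f x + g x)"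
proof -
 have "F b + G b - (F a + G a) = (LINT x:{a..b}|lborel. f x + g x)" if "a <= b" for a b
  using AC_eq[OF assms(1) that] AC_eq[OF assms(2) that]
  by (simp add: set_integral_add AC_integrable[OF assms(1)] AC_integrable[OF assms(2)] add_diff_add)
 then show ?thesis using assms unfolding AC_def by (auto intro: set_integral_add)
qed

lemma AC_cmult: assumes "AC F f" shows "AC (\<lambda>x. c * F x) (\<lambda>x. c * f x)"
 using assms unfolding AC_def by (auto simp: right_diff_distrib[symmetric])

lemma borel_measurable_cnj [measurable (raw)]:
 assumes "f \<in> borel_measurable M" shows "(\<lambda>x. cnj (f x)) \<in> borel_measurable M"
 using assms by (auto simp: borel_measurable_complex_iff)

lemma AC_cnj: assumes "AC F f" shows "AC (\<lambda>x. cnj (F x)) (\<lambda>x. cnj (f x))"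
proof -
 have 1: "set_integrable lborel {a..b} (\<lambda>x. cnj (f x))" for a b
  using AC_integrable[OF assms, of a b] unfolding set_integrable_def
  by (subst (asm) complex_integrable_cnj[symmetric]) simp
 have 2: "(LINT x:{a..b}|lborel. cnj (f x)) = cnj (LINT x:{a..b}|lborel. f x)" for a b
  unfolding set_lebesgue_integral_def using Bochner_Integration.integral_cnj[of lborel "\<lambda>x. indicat_real {a..b} x *\<^sub>R f x"] by simp
 show ?thesis unfolding AC_def
  using 1 2 AC_eq[OF assms] AC_borel[OF assms] by (auto simp: complex_cnj_diff[symmetric])
qed

lemma AC_const: "AC (\<lambda>x. c) (\<lambda>x. 0)"
 by (auto simp: AC_def set_integrable_def set_lebesgue_integral_def)

lemma AC_minus: "AC F f ==> AC (\<lambda>x. - F x) (\<lambda>x. - f x)"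
 using AC_cmult[of F f "-1"] by simp

lemma AC_diff: assumes "AC F f" "AC G g" shows "AC (\<lambda>x. F x - G x) (\<lambda>x. f x - g x)"
 using AC_add[OF assms(1) AC_minus[OF assms(2)]] by simp

lemma AC_sum: assumes "\<And>i. i \<in> I ==> AC (F i) (f i)"
 shows "AC (\<lambda>x. \<Sum>i\<in>I. F i x) (\<lambda>x. \<Sum>i\<in>I. f i x)"
 using assms by (induction I rule: infinite_finite_induct) (auto intro: AC_const AC_add)

lemma AC_zero_const:
 assumes "AC F (\<lambda>x. 0)" shows "F x = F y"
proof -
 have "F b - F a = 0" if "a <= b" for a b
  using AC_eq[OF assms that] by (simp add: set_lebesgue_integral_def)
 from this[of x y] this[of y x] show ?thesis by (cases "x <= y") auto
qed

lemma AC_of_deriv: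
 assumes "\<And>x. (F has_vector_derivative f x) (at x)" "continuous_on UNIV f"
 shows "AC F f"
proof (rule ACI_HK)
 show "f \<in> bor" using assms(2) by (rule borel_measurable_continuous_onI)
 show "f absolutely_integrable_on {a..b}" for a b
  using absolutely_integrable_continuous_real assms(2) continuous_on_subset by blast
 show "F b - F a = integral {a..b} f" if "a <= b" for a b
  using fundamental_theorem_of_calculus[OF that, of F f] assms(1)
  by (metis has_vector_derivative_at_within integral_unique)
qed

text \<open>The error of the chain rule on \<open>[a, b]\<close> is additive over adjacent intervals and locally at
 most \<open>e\<close> times the variation, so it vanishes.\<close>

lemma AC_chain:
 assumes F: "AC F f" and S: "open S" "\<And>x. F x \<in> S"
  and d: "\<And>z. z \<in> S ==> (\<Phi> has_field_derivative \<Phi>' z) (at z)" and c: "continuous_on S \<Phi>'"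
 shows "AC (\<lambda>x. \<Phi> (F x)) (\<lambda>x. \<Phi>' (F x) * f x)"
proof (rule ACI_HK)
 define C where "C = (\<lambda>x. \<Phi>' (F x))"
 have cF: "continuous_on UNIV F" using F by (rule AC_continuous)
 have cC: "continuous_on UNIV C"
  unfolding C_def by (rule continuous_on_compose2[OF c cF]) (use S in auto)
 have [measurable]: "C \<in> bor" "f \<in> bor"
  using cC borel_measurable_continuous_onI AC_borel[OF F] by auto
 show "(\<lambda>x. \<Phi>' (F x) * f x) \<in> bor"
  unfolding C_def[symmetric, THEN fun_cong, simplified] using \<open>C \<in> borel_measurable borel\<close> by measurable
 show abs: "(\<lambda>x. \<Phi>' (F x) * f x) absolutely_integrable_on {a..b}" for a b
 proof -
  have "bounded (C ` {a..b})"
   by (intro compact_imp_bounded compact_continuous_image continuous_on_subset[OF cC]) auto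
  moreover have "C \<in> borel_measurable (lebesgue_on {a..b})"
   using \<open>C \<in> borel_measurable borel\<close> by (simp add: borel_measurable_if_D measurable_completion)
  ultimately show ?thesis
   using absolutely_integrable_bounded_measurable_product[OF bilinear_times, of C "{a..b}" f] AC_HK(1)[OF F]
   unfolding C_def by auto
 qed
 fix a b :: real assume ab: "a <= b"
 let ?G = "\<lambda>x. \<Phi>' (F x) * f x"
 have iG: "?G integrable_on {s..t}" for s t using abs by (auto simp: absolutely_integrable_on_def)
 have comb: "integral {s..u} g = integral {s..t} g + integral {t..u} g"
  if "\<And>s t. g integrable_on {s..t}" "s <= t" "t <= u" for s t u and g :: "real => 'x::banach"
  using Henstock_Kurzweil_Integration.integral_combine[of s t u g] that by auto
 have est: "cmod (\<Phi> (F b) - \<Phi> (F a) - integral {a..b} ?G) <= e * integral {a..b} (\<lambda>x. cmod (f x))"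
  if e: "e > 0" for e :: real
  using ab
 proof (induction rule: Bolzano)
  case (trans a b c)
  have "\<Phi> (F c) - \<Phi> (F a) - integral {a..c} ?G =
   (\<Phi> (F b) - \<Phi> (F a) - integral {a..b} ?G) + (\<Phi> (F c) - \<Phi> (F b) - integral {b..c} ?G)"
   using comb[OF iG trans(3,4)] by simp
  also have "cmod \<dots> <= e * integral {a..b} (\<lambda>x. cmod (f x)) + e * integral {b..c} (\<lambda>x. cmod (f x))"
   by (rule norm_triangle_le[OF add_mono[OF trans(1,2)]])
  also have "\<dots> = e * integral {a..c} (\<lambda>x. cmod (f x))"
   using comb[OF AC_HK(3)[OF F] trans(3,4)] by (simp add: algebra_simps)
  finally show ?case .
 next
  case (local x)
  have "isCont \<Phi>' (F x)" using c S continuous_on_eq_continuous_at by blast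
  then obtain r1 where r1: "r1 > 0" "\<And>z. dist z (F x) < r1 ==> dist (\<Phi>' z) (\<Phi>' (F x)) < e/2"
   using e unfolding continuous_at_eps_delta by (metis half_gt_zero)
  obtain r2 where r2: "r2 > 0" "ball (F x) r2 \<subseteq> S" using S openE by metis
  define r where "r = min r1 r2"
  have r: "r > 0" using r1 r2 by (auto simp: r_def)
  have "isCont F x" using F by (rule AC_isCont)
  then obtain d where d0: "d > 0" "\<And>t. dist t x < d ==> dist (F t) (F x) < r"
   using r unfolding continuous_at_eps_delta by metis
  show ?case
  proof (intro exI[of _ d] conjI allI impI \<open>d > 0\<close>)
   fix s t assume st: "s <= x \<and> x <= t \<and> t - s < d"
   have inb: "F y \<in> ball (F x) r" if "y \<in> {s..t}" for y
    using d0(2)[of y] that st by (auto simp: dist_commute dist_real_def)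
   have p: "cmod (\<Phi>' z - \<Phi>' (F x)) <= e/2" "z \<in> S" if "z \<in> ball (F x) r" for z
    using r1(2)[of z] r2 that by (auto simp: r_def dist_norm norm_minus_commute)
   \<comment> \<open>Freeze the slope at \<open>F x\<close>: after subtracting the linear part, the
     remainder has derivative at most \<open>e/2\<close> on the ball and is
     \<open>e/2\<close>-Lipschitz there.\<close>
   have "cmod ((\<Phi> (F t) - \<Phi>' (F x) * F t) - (\<Phi> (F s) - \<Phi>' (F x) * F s)) <= e/2 * cmod (F t - F s)"
    by (rule field_differentiable_bound[of "ball (F x) r" _ "\<lambda>z. \<Phi>' z - \<Phi>' (F x)"])
     (use p inb st in \<open>auto intro!: derivative_eq_intros has_field_derivative_at_within[OF d]\<close>)
   moreover have Fd: "cmod (F t - F s) <= integral {s..t} (\<lambda>x. cmod (f x))"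
    using AC_HK(2)[OF F, of s t] integral_norm_bound_integral[OF AC_HK(4)[OF F] AC_HK(3)[OF F]] st by auto
   moreover have E1: "\<Phi>' (F x) * (F t - F s) - integral {s..t} ?G = integral {s..t} (\<lambda>y. (\<Phi>' (F x) - \<Phi>' (F y)) * f y)"
   proof -
    have i1: "(\<lambda>y. \<Phi>' (F x) * f y) integrable_on {s..t}" by (intro integrable_on_mult_right AC_HK(4)[OF F])
    have "integral {s..t} (\<lambda>y. (\<Phi>' (F x) - \<Phi>' (F y)) * f y) = integral {s..t} (\<lambda>y. \<Phi>' (F x) * f y) - integral {s..t} ?G"
     unfolding left_diff_distrib by (rule Henstock_Kurzweil_Integration.integral_diff[OF i1 iG])
    also have "integral {s..t} (\<lambda>y. \<Phi>' (F x) * f y) = \<Phi>' (F x) * integral {s..t} f"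
     by (rule Henstock_Kurzweil_Integration.integral_mult_right)
    also have "integral {s..t} f = F t - F s" using AC_HK(2)[OF F, of s t] st by simp
    finally show ?thesis by simp
   qed
   moreover have E2: "cmod (integral {s..t} (\<lambda>y. (\<Phi>' (F x) - \<Phi>' (F y)) * f y)) <= integral {s..t} (\<lambda>y. e/2 * cmod (f y))"
   proof (rule integral_norm_bound_integral)
    show "(\<lambda>y. (\<Phi>' (F x) - \<Phi>' (F y)) * f y) integrable_on {s..t}"
     unfolding left_diff_distrib
     by (intro Henstock_Kurzweil_Integration.integrable_diff iG integrable_on_mult_right AC_HK(4)[OF F])
    show "(\<lambda>y. e/2 * cmod (f y)) integrable_on {s..t}"
     using AC_HK(3)[OF F, of s t] by (rule integrable_on_mult_right)
    show "cmod ((\<Phi>' (F x) - \<Phi>' (F y)) * f y) <= e/2 * cmod (f y)" if "y \<in> {s..t}" for y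
     using mult_right_mono[OF p(1)[OF inb[OF that]], of "cmod (f y)"]
     unfolding norm_mult norm_minus_commute[of "\<Phi>' (F x)"] by simp
   qed
   moreover have E3: "integral {s..t} (\<lambda>y. e/2 * cmod (f y)) = e/2 * integral {s..t} (\<lambda>y. cmod (f y))"
    by (rule Henstock_Kurzweil_Integration.integral_mult_right)
   moreover have "e/2 * cmod (F t - F s) <= e/2 * integral {s..t} (\<lambda>x. cmod (f x))"
    using e by (intro mult_left_mono Fd) auto
   ultimately have 1: "cmod ((\<Phi> (F t) - \<Phi>' (F x) * F t) - (\<Phi> (F s) - \<Phi>' (F x) * F s)) <= e/2 * integral {s..t} (\<lambda>x. cmod (f x))"
    by linarith
   have 2: "cmod (\<Phi>' (F x) * (F t - F s) - integral {s..t} ?G) <= e/2 * integral {s..t} (\<lambda>x. cmod (f x))"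
    unfolding E1 using E2 E3 by linarith
   have "\<Phi> (F t) - \<Phi> (F s) - integral {s..t} ?G =
    ((\<Phi> (F t) - \<Phi>' (F x) * F t) - (\<Phi> (F s) - \<Phi>' (F x) * F s)) + (\<Phi>' (F x) * (F t - F s) - integral {s..t} ?G)"
    by (simp add: algebra_simps)
   also have "cmod \<dots> <= e/2 * integral {s..t} (\<lambda>x. cmod (f x)) + e/2 * integral {s..t} (\<lambda>x. cmod (f x))"
    by (rule norm_triangle_le[OF add_mono[OF 1 2]])
   finally show "cmod (\<Phi> (F t) - \<Phi> (F s) - integral {s..t} ?G) <= e * integral {s..t} (\<lambda>x. cmod (f x))"
    by (simp add: field_simps)
  qed
 qed
 let ?I = "integral {a..b} (\<lambda>x. cmod (f x))"
 have I0: "?I >= 0" by (intro integral_nonneg AC_HK(3)[OF F]) auto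
 have "cmod (\<Phi> (F b) - \<Phi> (F a) - integral {a..b} ?G) <= 0"
 proof (rule field_le_epsilon)
  fix e :: real assume "e > 0"
  have "e / (1 + ?I) > 0" using I0 \<open>e>0\<close> by simp
  from est[OF this] have "cmod (\<Phi> (F b) - \<Phi> (F a) - integral {a..b} ?G) <= e / (1 + ?I) * ?I" .
  also have "\<dots> <= e" using I0 \<open>e>0\<close> by (simp add: field_simps)
  finally show "cmod (\<Phi> (F b) - \<Phi> (F a) - integral {a..b} ?G) <= 0 + e" by simp
 qed
 then show "\<Phi> (F b) - \<Phi> (F a) = integral {a..b} ?G" by simp
qed

text \<open>Polarization: four times the product is the difference of the squares of sum and
  difference, and squares are covered by \<open>AC_chain\<close>.\<close>

lemma AC_mult:
 assumes "AC F f" "AC G g" shows "AC (\<lambda>x. F x * G x) (\<lambda>x. f x * G x + F x * g x)"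
proof -
 have sq: "AC (\<lambda>x. (H x)^2) (\<lambda>x. 2 * H x * h x)" if "AC H h" for H h
  by (rule AC_chain[OF that open_UNIV, where \<Phi>="\<lambda>z. z^2" and \<Phi>'="\<lambda>z. 2 * z"])
   (auto intro!: derivative_eq_intros continuous_intros)
 from AC_cmult[OF AC_diff[OF sq[OF AC_add[OF assms]] sq[OF AC_diff[OF assms]]], of "1/4"]
 have "AC (\<lambda>x. 1/4 * ((F x + G x)^2 - (F x - G x)^2))
  (\<lambda>x. 1/4 * (2 * (F x + G x) * (f x + g x) - 2 * (F x - G x) * (f x - g x)))" .
 then show ?thesis by (rule AC_cong) (auto simp: power2_eq_square algebra_simps)
qed

lemma AC_exp: assumes "AC F f" shows "AC (\<lambda>x. exp (F x)) (\<lambda>x. exp (F x) * f x)"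
 by (rule AC_chain[OF assms open_UNIV]) (auto intro!: derivative_eq_intros continuous_intros)

lemma AC_inverse:
 assumes "AC F f" "\<And>x. F x \<noteq> 0" shows "AC (\<lambda>x. inverse (F x)) (\<lambda>x. - f x / (F x)^2)"
proof -
 have "AC (\<lambda>x. inverse (F x)) (\<lambda>x. - inverse ((F x)^2) * f x)"
  by (rule AC_chain[OF assms(1), of "-{0}"])
   (use assms(2) in \<open>auto intro!: derivative_eq_intros continuous_intros simp: power2_eq_square\<close>)
 then show ?thesis by (simp add: field_simps)
qed

lemma AC_to_limit:
 assumes "AC F f" "set_integrable lborel {a..} f" "(F \<longlongrightarrow> L) at_top"
 shows "L - F a = (LINT x:{a..}|lborel. f x)"
proof -
 have A: "((\<lambda>b. LINT x:{a..b}|lborel. f x) \<longlongrightarrow> (LINT x:{a..}|lborel. f x)) at_top"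
  by (rule tendsto_set_lebesgue_integral_at_top) (use assms in auto)
 have B: "((\<lambda>b. F b - F a) \<longlongrightarrow> L - F a) at_top" by (intro tendsto_intros assms)
 have C: "\<forall>\<^sub>F b in at_top. F b - F a = (LINT x:{a..b}|lborel. f x)"
  using eventually_ge_at_top[of a] by eventually_elim (rule AC_eq[OF assms(1)])
 show ?thesis
  by (rule tendsto_unique[OF trivial_limit_at_top_linorder B]) (rule Lim_transform_eventually[OF A], use C in \<open>auto elim: eventually_mono\<close>)
qed

lemma AC_from_limit:
 assumes "AC F f" "set_integrable lborel {..a} f" "(F \<longlongrightarrow> L) at_bot"
 shows "F a - L = (LINT x:{..a}|lborel. f x)"
proof -
 have A: "((\<lambda>b. LINT x:{b..a}|lborel. f x) \<longlongrightarrow> (LINT x:{..a}|lborel. f x)) at_bot"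
  by (rule tendsto_set_lebesgue_integral_at_bot) (use assms in auto)
 have B: "((\<lambda>b. F a - F b) \<longlongrightarrow> F a - L) at_bot" by (intro tendsto_intros assms)
 have C: "\<forall>\<^sub>F b in at_bot. F a - F b = (LINT x:{b..a}|lborel. f x)"
  using eventually_le_at_bot[of a] by eventually_elim (rule AC_eq[OF assms(1)])
 show ?thesis
  by (rule tendsto_unique[OF trivial_limit_at_bot_linorder B]) (rule Lim_transform_eventually[OF A], use C in \<open>auto elim: eventually_mono\<close>)
qed

lemma AC_limits:
 assumes "AC F f" "integrable lborel f"
 shows "\<exists>L. (F \<longlongrightarrow> L) at_top" "\<exists>L. (F \<longlongrightarrow> L) at_bot"
proof -
 have si: "set_integrable lborel A f" if "A \<in> sets borel" for A
  using assms(2) integrable_mult_indicator[of A lborel f] that by (simp add: set_integrable_def)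
 have "((\<lambda>b. LINT x:{0..b}|lborel. f x) \<longlongrightarrow> (LINT x:{0..}|lborel. f x)) at_top"
  by (rule tendsto_set_lebesgue_integral_at_top) (use si in auto)
 then have "((\<lambda>b. F 0 + (LINT x:{0..b}|lborel. f x)) \<longlongrightarrow> F 0 + (LINT x:{0..}|lborel. f x)) at_top"
  by (intro tendsto_intros)
 moreover have "\<forall>\<^sub>F b in at_top. F 0 + (LINT x:{0..b}|lborel. f x) = F b"
  using eventually_ge_at_top[of 0] by eventually_elim (simp add: AC_eq[OF assms(1), symmetric])
 ultimately show "\<exists>L. (F \<longlongrightarrow> L) at_top" using Lim_transform_eventually by blast
 have "((\<lambda>b. LINT x:{b..0}|lborel. f x) \<longlongrightarrow> (LINT x:{..0}|lborel. f x)) at_bot"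
  by (rule tendsto_set_lebesgue_integral_at_bot) (use si in auto)
 then have "((\<lambda>b. F 0 - (LINT x:{b..0}|lborel. f x)) \<longlongrightarrow> F 0 - (LINT x:{..0}|lborel. f x)) at_bot"
  by (intro tendsto_intros)
 moreover have "\<forall>\<^sub>F b in at_bot. F 0 - (LINT x:{b..0}|lborel. f x) = F b"
  using eventually_le_at_bot[of 0] by eventually_elim (simp add: AC_eq[OF assms(1), symmetric])
 ultimately show "\<exists>L. (F \<longlongrightarrow> L) at_bot" using Lim_transform_eventually by blast
qed

lemma set_integral_split:
 fixes f :: "real => complex"
 assumes "set_integrable lborel (A \<union> B) f" "A \<in> sets borel" "B \<in> sets borel" "emeasure lborel (A \<inter> B) = 0"
 shows "(LINT x:A \<union> B|lborel. f x) = (LINT x:A|lborel. f x) + (LINT x:B|lborel. f x)"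
proof (rule set_integral_Un_AE)
 have "AE x in lborel. x \<notin> A \<inter> B"
  using assms by (intro AE_not_in) (auto simp: null_sets_def)
 then show "AE x in lborel. \<not> (x \<in> A \<and> x \<in> B)" by auto
qed (use assms set_integrable_subset[OF assms(1)] in auto)

lemma AC_upper_integral:
 assumes "f \<in> bor" "\<And>a. set_integrable lborel {a..} f"
 shows "AC (\<lambda>x. - (LINT y:{x..}|lborel. f y)) f"
 unfolding AC_def
proof (intro conjI allI impI)
 show "set_integrable lborel {a..b} f" for a b
  by (rule set_integrable_subset[OF assms(2)[of a]]) auto
 fix a b :: real assume "a <= b"
 then have e: "{a..} = {a..b} \<union> {b..}" by auto
 have "(LINT y:{a..}|lborel. f y) = (LINT y:{a..b}|lborel. f y) + (LINT y:{b..}|lborel. f y)"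
 proof (subst e, rule set_integral_split)
  have "{a..b} \<inter> {b..} = {b}" using \<open>a <= b\<close> by auto
  then show "emeasure lborel ({a..b} \<inter> {b..}) = 0" by simp
 qed (use assms(1) assms(2)[folded e] assms(2) in \<open>auto simp: e[symmetric]\<close>)
 then show "- (LINT y:{b..}|lborel. f y) - - (LINT y:{a..}|lborel. f y) = (LINT x:{a..b}|lborel. f x)" by simp
qed (use assms in auto)

lemma AC_lower_integral:
 assumes "f \<in> bor" "\<And>a. set_integrable lborel {..a} f"
 shows "AC (\<lambda>x. (LINT y:{..x}|lborel. f y)) f"
 unfolding AC_def
proof (intro conjI allI impI)
 show "set_integrable lborel {a..b} f" for a b
  by (rule set_integrable_subset[OF assms(2)[of b]]) auto
 fix a b :: real assume "a <= b"
 then have e: "{..b} = {..a} \<union> {a..b}" by auto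
 have "(LINT y:{..b}|lborel. f y) = (LINT y:{..a}|lborel. f y) + (LINT y:{a..b}|lborel. f y)"
 proof (subst e, rule set_integral_split)
  have "{..a} \<inter> {a..b} = {a}" using \<open>a <= b\<close> by auto
  then show "emeasure lborel ({..a} \<inter> {a..b}) = 0" by simp
 qed (use assms(1) assms(2)[folded e] assms(2) in \<open>auto simp: e[symmetric]\<close>)
 then show "(LINT y:{..b}|lborel. f y) - (LINT y:{..a}|lborel. f y) = (LINT x:{a..b}|lborel. f x)" by simp
qed (use assms in auto)

lemma lower_integral_at_bot:
 fixes f :: "real => complex"
 assumes "set_integrable lborel {..a} f"
 shows "((\<lambda>x. LINT y:{..x}|lborel. f y) \<longlongrightarrow> 0) at_bot"
proof -
 have "((\<lambda>x. (LINT y:{..a}|lborel. f y) - (LINT y:{x..a}|lborel. f y)) \<longlongrightarrow> (LINT y:{..a}|lborel. f y) - (LINT y:{..a}|lborel. f y)) at_bot"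
  by (intro tendsto_intros tendsto_set_lebesgue_integral_at_bot) (use assms in auto)
 moreover have "\<forall>\<^sub>F x in at_bot. (LINT y:{..a}|lborel. f y) - (LINT y:{x..a}|lborel. f y) = (LINT y:{..x}|lborel. f y)"
  using eventually_le_at_bot[of a]
 proof eventually_elim
  case (elim x)
  then have e: "{..a} = {..x} \<union> {x..a}" by auto
  have "(LINT y:{..a}|lborel. f y) = (LINT y:{..x}|lborel. f y) + (LINT y:{x..a}|lborel. f y)"
  proof (subst e, rule set_integral_split)
   have "{..x} \<inter> {x..a} = {x}" using elim by auto
   then show "emeasure lborel ({..x} \<inter> {x..a}) = 0" by simp
  qed (use assms(1) in \<open>auto simp: e[symmetric]\<close>)
  then show ?case by simp
 qed
 ultimately show ?thesis using Lim_transform_eventually by fastforce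
qed

lemma upper_integral_at_top:
 fixes f :: "real => complex"
 assumes "set_integrable lborel {a..} f"
 shows "((\<lambda>x. LINT y:{x..}|lborel. f y) \<longlongrightarrow> 0) at_top"
proof -
 have "((\<lambda>x. (LINT y:{a..}|lborel. f y) - (LINT y:{a..x}|lborel. f y)) \<longlongrightarrow> (LINT y:{a..}|lborel. f y) - (LINT y:{a..}|lborel. f y)) at_top"
  by (intro tendsto_intros tendsto_set_lebesgue_integral_at_top) (use assms in auto)
 moreover have "\<forall>\<^sub>F x in at_top. (LINT y:{a..}|lborel. f y) - (LINT y:{a..x}|lborel. f y) = (LINT y:{x..}|lborel. f y)"
  using eventually_ge_at_top[of a]
 proof eventually_elim
  case (elim x)
  then have e: "{a..} = {a..x} \<union> {x..}" by auto
  have "(LINT y:{a..}|lborel. f y) = (LINT y:{a..x}|lborel. f y) + (LINT y:{x..}|lborel. f y)"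
  proof (subst e, rule set_integral_split)
   have "{a..x} \<inter> {x..} = {x}" using elim by auto
   then show "emeasure lborel ({a..x} \<inter> {x..}) = 0" by simp
  qed (use assms(1) in \<open>auto simp: e[symmetric]\<close>)
  then show ?case by simp
 qed
 ultimately show ?thesis using Lim_transform_eventually by fastforce
qed

section \<open>Smooth functions, flat functions and test functions\<close>

definition smooth :: "(real => real) => bool" where
 "smooth f \<longleftrightarrow> (\<forall>k x. (deriv ^^ k) f differentiable (at x))"

text \<open>Smoothness is a greatest fixed point: exhibiting a class of differentiable functions
  closed under \<open>deriv\<close> replaces formulas for the k-th derivative. Products, affine
  substitutions and \<open>flat\<close> all go through this principle.\<close>

lemma smooth_coinduct:
 assumes "\<And>f x. f \<in> A ==> f differentiable (at x)" "\<And>f. f \<in> A ==> deriv f \<in> A" "f \<in> A"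
 shows "smooth f"
proof -
 have "(deriv ^^ k) f \<in> A" for k by (induction k) (use assms in auto)
 then show ?thesis unfolding smooth_def using assms(1) by blast
qed

lemma smooth_differentiable: "smooth f ==> f differentiable (at x)"
 unfolding smooth_def by (metis funpow_0)

lemma smooth_deriv: "smooth f ==> smooth (deriv f)"
 unfolding smooth_def by (metis comp_apply funpow_Suc_right)

lemma smooth_has_deriv: "smooth f ==> (f has_real_derivative deriv f x) (at x)"
 using smooth_differentiable DERIV_deriv_iff_real_differentiable by blast

lemma smooth_antideriv:
 assumes "smooth g" "\<And>x. (f has_real_derivative g x) (at x)" shows "smooth f"
proof -
 have "deriv f = g" using assms(2) DERIV_imp_deriv by blast
 then show ?thesis
  unfolding smooth_def
 proof (intro allI)
  fix k x show "(deriv ^^ k) f differentiable (at x)"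
  proof (cases k)
   case 0
   then show ?thesis using assms(2) real_differentiable_def by auto
  next
   case (Suc m)
   then show ?thesis using assms(1) \<open>deriv f = g\<close> by (simp add: funpow_Suc_right smooth_def del: funpow.simps)
  qed
 qed
qed

lemma smooth_continuous: "smooth f ==> continuous_on UNIV f"
 by (meson DERIV_isCont continuous_at_imp_continuous_on smooth_has_deriv)

text \<open>Closed under differentiation by construction: the product rule turns one product into a
  sum of two, and sums pass through. This avoids Leibniz's formula for higher derivatives.\<close>

inductive_set prods :: "(real => real) set" where
 prod: "smooth f ==> smooth g ==> (\<lambda>x. f x * g x) \<in> prods"
| add: "f \<in> prods ==> g \<in> prods ==> (\<lambda>x. f x + g x) \<in> prods"

lemma prods_deriv: "f \<in> prods ==> \<exists>g\<in>prods. \<forall>x. (f has_real_derivative g x) (at x)"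
proof (induction rule: prods.induct)
 case (prod f g)
 have "(\<lambda>x. (\<lambda>x. f x * deriv g x) x + (\<lambda>x. deriv f x * g x) x) \<in> prods"
  by (intro prods.intros smooth_deriv prod)
 then show ?case
  by (rule rev_bexI) (use prod in \<open>auto intro!: derivative_eq_intros smooth_has_deriv\<close>)
next
 case (add f g)
 then obtain f' g' where "f' \<in> prods" "g' \<in> prods" "\<And>x. (f has_real_derivative f' x) (at x)"
  "\<And>x. (g has_real_derivative g' x) (at x)" by blast
 then show ?case
  by (intro bexI[of _ "\<lambda>x. f' x + g' x"] prods.add) (auto intro!: derivative_intros)
qed

lemma prods_smooth: "f \<in> prods ==> smooth f"
proof (rule smooth_coinduct[of prods])
 show "f differentiable (at x)" if "f \<in> prods" for f x
  using prods_deriv[OF that] real_differentiable_def by blast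
 show "deriv f \<in> prods" if f: "f \<in> prods" for f
 proof -
  obtain g where g: "g \<in> prods" "\<And>x. (f has_real_derivative g x) (at x)" using prods_deriv[OF f] by blast
  then have "deriv f = g" by (auto intro!: ext DERIV_imp_deriv)
  then show ?thesis using g by simp
 qed
qed

lemma smooth_mult: "smooth f ==> smooth g ==> smooth (\<lambda>x. f x * g x)"
 by (rule prods_smooth[OF prods.prod])

lemma smooth_const: "smooth (\<lambda>x. c)"
 by (rule smooth_coinduct[of "range (\<lambda>c x. c)"]) auto

lemma smooth_add: assumes "smooth f" "smooth g" shows "smooth (\<lambda>x. f x + g x)"
 using prods_smooth[OF prods.add[OF prods.prod[OF smooth_const[of 1] assms(1)] prods.prod[OF smooth_const[of 1] assms(2)]]]
 by simp

lemma smooth_cmult: "smooth f ==> smooth (\<lambda>x. c * f x)"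
 by (intro smooth_mult smooth_const)

lemma smooth_affine: assumes "smooth f" shows "smooth (\<lambda>x. f (c * x + d))"
proof (rule smooth_coinduct[of "{g. \<exists>K f. smooth f \<and> g = (\<lambda>x. K * f (c * x + d))}"])
 have D: "((\<lambda>x. K * f (c * x + d)) has_real_derivative K * c * deriv f (c * x + d)) (at x)"
  if "smooth f" for K f x
 proof -
  have "((\<lambda>x. f (c * x + d)) has_real_derivative deriv f (c * x + d) * c) (at x)"
   by (rule DERIV_chain2[OF smooth_has_deriv[OF that]]) (auto intro!: derivative_eq_intros)
  from DERIV_cmult[OF this, of K] show ?thesis by (simp add: mult_ac)
 qed
 show "g differentiable (at x)" if "g \<in> {g. \<exists>K f. smooth f \<and> g = (\<lambda>x. K * f (c * x + d))}" for g x
  using that D real_differentiable_def by blast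
 show "deriv g \<in> {g. \<exists>K f. smooth f \<and> g = (\<lambda>x. K * f (c * x + d))}"
  if g: "g \<in> {g. \<exists>K f. smooth f \<and> g = (\<lambda>x. K * f (c * x + d))}" for g
 proof -
  obtain K f where f: "smooth f" "g = (\<lambda>x. K * f (c * x + d))" using g by blast
  have "deriv g = (\<lambda>x. K * c * deriv f (c * x + d))"
   unfolding f using D[OF f(1)] by (intro ext DERIV_imp_deriv)
  then show ?thesis using smooth_deriv[OF f(1)] by blast
 qed
 show "(\<lambda>x. f (c * x + d)) \<in> {g. \<exists>K f. smooth f \<and> g = (\<lambda>x. K * f (c * x + d))}"
  using assms by (auto intro!: exI[of _ 1] exI[of _ f])
qed

text \<open>The polynomial parameter makes the family closed under differentiation;
  \<open>flat 1\<close> is the classical function \<open>exp (-1/x)\<close> extended by 0.\<close>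

definition flat :: "real poly => real => real" where
 "flat P x = (if x > 0 then poly P (1 / x) * exp (- (1 / x)) else 0)"

lemma poly_times_exp_minus: "((\<lambda>t::real. t ^ n * (poly P t * exp (- t))) \<longlongrightarrow> 0) at_top"
proof (induction P arbitrary: n)
 case 0
 then show ?case by simp
next
 case (pCons a P)
 have "((\<lambda>t::real. a * (t ^ n / exp t) + t ^ Suc n * (poly P t * exp (- t))) \<longlongrightarrow> a * 0 + 0) at_top"
  by (intro tendsto_intros tendsto_power_div_exp_0 pCons)
 then show ?case by (simp add: algebra_simps exp_minus divide_inverse)
qed

text \<open>In terms of \<open>t = 1/x\<close> the derivative is
  \<open>t^2 (P(t) - P'(t)) exp (-t)\<close>, and \<open>[:0,0,1:]\<close> is the polynomial
  \<open>t^2\<close>. At 0 the right-hand difference quotient is \<open>t P(t) exp (-t)\<close> with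
  t going to infinity, which vanishes by \<open>poly_times_exp_minus\<close>.\<close>

lemma flat_deriv: "(flat P has_real_derivative flat ((P - pderiv P) * [:0,0,1:]) x) (at x)"
proof -
 consider "x > 0" | "x < 0" | "x = 0" by linarith
 then show ?thesis
 proof cases
  case 1
  have "((\<lambda>x. poly P (1 / x) * exp (- (1 / x))) has_real_derivative
    poly (pderiv P) (1/x) * (- 1 / (x * x)) * exp (- (1/x)) + poly P (1/x) * (exp (- (1/x)) * (1 / (x * x)))) (at x)"
   using 1 by (auto intro!: derivative_eq_intros DERIV_chain2[of "poly P"] poly_DERIV simp: power2_eq_square)
  also have "poly (pderiv P) (1/x) * (- 1 / (x * x)) * exp (- (1/x)) + poly P (1/x) * (exp (- (1/x)) * (1 / (x * x)))
   = flat ((P - pderiv P) * [:0,0,1:]) x"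
  proof -
   define y where "y = 1 / x"
   have y: "- 1 / (x * x) = - (y * y)" "1 / (x * x) = y * y" "1 / x = y" by (simp_all add: y_def)
   have q: "poly ((P - pderiv P) * [:0,0,1:]) y = (poly P y - poly (pderiv P) y) * (y * y)" by simp
   have alg: "b * (- (y * y)) * e + a * (e * (y * y)) = (a - b) * (y * y) * e" for a b e :: real by algebra
   show ?thesis unfolding flat_def if_P[OF 1] y q by (rule alg)
  qed
  finally show ?thesis
   by (rule has_field_derivative_transform_within_open[of _ _ _ "{0<..}"]) (use 1 in \<open>auto simp: flat_def\<close>)
 next
  case 2
  have "flat ((P - pderiv P) * [:0,0,1:]) x = 0" using 2 by (simp add: flat_def)
  moreover have "(flat P has_real_derivative 0) (at x)"
   by (rule has_field_derivative_transform_within_open[of "\<lambda>_. 0" 0 x "{..<0}"]) (use 2 in \<open>auto simp: flat_def\<close>)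
  ultimately show ?thesis by simp
 next
  case 3
  have "((\<lambda>h. flat P h / h) \<longlongrightarrow> 0) (at_right 0)"
  proof -
   have "((\<lambda>h. (1/h) ^ 1 * (poly P (1/h) * exp (- (1/h)))) \<longlongrightarrow> 0) (at_right (0::real))"
    using filterlim_compose[OF poly_times_exp_minus[of 1 P] filterlim_inverse_at_top_right]
    by (simp add: inverse_eq_divide)
   then show ?thesis
    by (rule Lim_transform_eventually)
     (auto simp: eventually_at_filter flat_def intro!: always_eventually)
  qed
  moreover have "((\<lambda>h. flat P h / h) \<longlongrightarrow> 0) (at_left 0)"
   by (rule Lim_transform_eventually[OF tendsto_const]) (auto simp: eventually_at_filter flat_def intro!: always_eventually)
  ultimately have "((\<lambda>h. flat P h / h) \<longlongrightarrow> 0) (at 0)"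
   by (simp add: filterlim_split_at)
  then show ?thesis using 3 by (simp add: DERIV_def flat_def)
 qed
qed

lemma flat_smooth: "smooth (flat P)"
proof (rule smooth_coinduct[of "range flat"])
 show "f differentiable (at x)" if "f \<in> range flat" for f x
  using that flat_deriv real_differentiable_def by blast
 show "deriv f \<in> range flat" if f: "f \<in> range flat" for f
 proof -
  obtain P where "f = flat P" using f by blast
  then have "deriv f = flat ((P - pderiv P) * [:0,0,1:])" using flat_deriv by (auto intro!: DERIV_imp_deriv)
  then show ?thesis by blast
 qed
qed auto

lemma test_function_iff:
 "test_function \<phi> \<longleftrightarrow> smooth \<phi> \<and> (\<exists>R>0. \<forall>x. \<bar>x\<bar> > R \<longrightarrow> \<phi> x = 0)"
proof
 assume t: "test_function \<phi>"
 then have "bounded (closure {x. \<phi> x \<noteq> 0})" by (auto simp: test_function_def compact_imp_bounded)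
 then obtain R where "R > 0" "\<And>x. x \<in> closure {x. \<phi> x \<noteq> 0} ==> norm x <= R" by (auto simp: bounded_pos)
 then have "\<forall>x. \<bar>x\<bar> > R \<longrightarrow> \<phi> x = 0"
  by (metis (mono_tags, lifting) closure_subset linorder_not_le mem_Collect_eq real_norm_def subset_iff)
 with \<open>R > 0\<close> t show "smooth \<phi> \<and> (\<exists>R>0. \<forall>x. \<bar>x\<bar> > R \<longrightarrow> \<phi> x = 0)"
  by (auto simp: test_function_def smooth_def)
next
 assume "smooth \<phi> \<and> (\<exists>R>0. \<forall>x. \<bar>x\<bar> > R \<longrightarrow> \<phi> x = 0)"
 then obtain R where R: "smooth \<phi>" "\<forall>x. \<bar>x\<bar> > R \<longrightarrow> \<phi> x = 0" by blast
 then have "{x. \<phi> x \<noteq> 0} \<subseteq> cball 0 R" by (auto simp: not_less[symmetric])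
 then have "bounded {x. \<phi> x \<noteq> 0}" using bounded_subset bounded_cball by blast
 then show "test_function \<phi>"
  using R(1) by (auto simp: test_function_def smooth_def compact_closure)
qed

lemma test_functionE:
 assumes "test_function \<phi>"
 obtains R where "R > 0" "smooth \<phi>" "\<And>x. \<bar>x\<bar> > R ==> \<phi> x = 0" "\<And>x. \<bar>x\<bar> > R ==> deriv \<phi> x = 0"
proof -
 obtain R where R: "R > 0" "smooth \<phi>" "\<forall>x. \<bar>x\<bar> > R \<longrightarrow> \<phi> x = 0"
  using assms test_function_iff by blast
 have "deriv \<phi> x = 0" if "\<bar>x\<bar> > R" for x
 proof (rule DERIV_imp_deriv)
  have "((\<lambda>x. 0) has_real_derivative 0) (at x)" by simp
  moreover have "open (- {-R..R})" "x \<in> - {-R..R}" using that by auto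
  ultimately show "(\<phi> has_real_derivative 0) (at x)"
   by (rule has_field_derivative_transform_within_open) (use R(3) in \<open>auto simp: abs_if\<close>)
 qed
 then show thesis using that R by blast
qed

lemma test_deriv: "test_function \<phi> ==> test_function (deriv \<phi>)"
 by (elim test_functionE) (auto simp: test_function_iff smooth_deriv)

lemma test_bounded:
 assumes "test_function \<phi>"
 obtains M where "M > 0" "\<And>x. \<bar>\<phi> x\<bar> <= M"
proof -
 obtain R where R: "R > 0" "smooth \<phi>" "\<And>x. \<bar>x\<bar> > R ==> \<phi> x = 0" using assms by (elim test_functionE) blast
 have "bounded (\<phi> ` {-R..R})"
  by (intro compact_imp_bounded compact_continuous_image continuous_on_subset[OF smooth_continuous[OF R(2)]]) auto
 then obtain M where M: "M > 0" "\<And>x. x \<in> {-R..R} ==> \<bar>\<phi> x\<bar> <= M" by (auto simp: bounded_pos)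
 have "\<bar>\<phi> x\<bar> <= M" for x
 proof (cases "\<bar>x\<bar> > R")
  case False
  then have "x \<in> {-R..R}" by auto
  then show ?thesis by (rule M(2))
 qed (use M R(3)[of x] in auto)
 then show thesis using that M(1) by blast
qed

lemma test_add: "test_function f ==> test_function g ==> test_function (\<lambda>x. f x + g x)"
proof -
 assume "test_function f" "test_function g"
 then obtain R S where "smooth f" "smooth g" "R > 0" "\<And>x. \<bar>x\<bar> > R ==> f x = 0" "\<And>x. \<bar>x\<bar> > S ==> g x = 0"
  unfolding test_function_iff by blast
 then show ?thesis
  unfolding test_function_iff by (auto intro!: smooth_add exI[of _ "max R S"])
qed

lemma test_cmult: "test_function f ==> test_function (\<lambda>x. c * f x)"
 unfolding test_function_iff by (auto intro!: smooth_cmult)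

text \<open>Smooth bumps on \<open>(a, b)\<close> whose flanks steepen with \<open>k\<close>: since
  \<open>exp (-1/(c (k+1)))\<close> tends to 1 for \<open>c > 0\<close>, they converge to the
  indicator of the open interval while staying between 0 and 1.\<close>

definition plateau :: "real => real => nat => real => real" where
 "plateau a b k x = flat 1 (real (Suc k) * (x - a)) * flat 1 (real (Suc k) * (b - x))"

lemma plateau_test: "test_function (plateau a b k)"
proof -
 have "smooth (\<lambda>x. flat 1 (real (Suc k) * x + - real (Suc k) * a) * flat 1 (- real (Suc k) * x + real (Suc k) * b))"
  by (intro smooth_mult smooth_affine flat_smooth)
 then have s: "smooth (plateau a b k)"
  by (rule back_subst[of smooth]) (auto simp: plateau_def algebra_simps fun_eq_iff simp del: of_nat_Suc)
 have "plateau a b k x = 0" if "\<bar>x\<bar> > \<bar>a\<bar> + \<bar>b\<bar> + 1" for x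
 proof -
  have "x < a \<or> x > b" using that by linarith
  then have "\<not> 0 < real (Suc k) * (x - a) \<or> \<not> 0 < real (Suc k) * (b - x)"
   by (auto simp: zero_less_mult_iff simp del: of_nat_Suc)
  then show ?thesis by (auto simp: plateau_def flat_def simp del: of_nat_Suc)
 qed
 then show ?thesis using s unfolding test_function_iff by (auto intro!: exI[of _ "\<bar>a\<bar> + \<bar>b\<bar> + 1"])
qed

lemma flat_1_bounds: "0 <= flat 1 x" "flat 1 x <= 1"
 by (auto simp: flat_def)

lemma plateau_bounds: "0 <= plateau a b k x" "plateau a b k x <= 1"
 "x \<notin> {a<..<b} ==> plateau a b k x = 0"
proof -
 show "0 <= plateau a b k x" "plateau a b k x <= 1"
  using flat_1_bounds by (auto simp: plateau_def mult_le_one)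
 assume "x \<notin> {a<..<b}"
 then have "\<not> 0 < real (Suc k) * (x - a) \<or> \<not> 0 < real (Suc k) * (b - x)"
  by (auto simp: zero_less_mult_iff simp del: of_nat_Suc)
 then show "plateau a b k x = 0" by (auto simp: plateau_def flat_def simp del: of_nat_Suc)
qed

lemma plateau_tendsto: "(\<lambda>k. plateau a b k x) \<longlonglongrightarrow> indicator {a<..<b} x"
proof (cases "x \<in> {a<..<b}")
 case True
 have f: "(\<lambda>k. flat 1 (real (Suc k) * c)) \<longlonglongrightarrow> 1" if "c > 0" for c
 proof -
  have "(\<lambda>k. exp (- (1 / c * (1 / real (Suc k))))) \<longlonglongrightarrow> exp (- (1 / c * 0))"
   by (intro tendsto_intros) (use LIMSEQ_inverse_real_of_nat in \<open>simp add: inverse_eq_divide\<close>)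
  then show ?thesis using that by (simp add: flat_def mult.commute zero_less_mult_iff del: of_nat_Suc)
 qed
 have "(\<lambda>k. plateau a b k x) \<longlonglongrightarrow> 1 * 1"
  unfolding plateau_def by (intro tendsto_mult f) (use True in auto)
 then show ?thesis using True by simp
next
 case False
 then show ?thesis by (simp add: plateau_bounds(3))
qed

section \<open>Weak derivatives and absolutely continuous representatives\<close>

lemma locally_integrable_measurable:
 assumes "locally_integrable f" shows "f \<in> borel_measurable lebesgue"
proof (rule borel_measurable_LIMSEQ_metric)
 show "(\<lambda>x. indicator {-real n..real n} x *\<^sub>R f x) \<in> borel_measurable lebesgue" for n
  using assms[unfolded locally_integrable_def, rule_format, of "{-real n..real n}"]
  by (auto simp: set_integrable_def intro: borel_measurable_integrable)
 show "(\<lambda>n. indicator {-real n..real n} x *\<^sub>R f x) \<longlonglongrightarrow> f x" for x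
 proof (rule tendsto_eventually)
  obtain N where "real N >= \<bar>x\<bar>" using real_arch_simple by blast
  then show "\<forall>\<^sub>F n in sequentially. indicator {-real n..real n} x *\<^sub>R f x = f x"
   by (intro eventually_sequentiallyI[of N]) (auto simp: indicator_def)
 qed
qed

lemma test_times_integrable:
 assumes "test_function \<phi>" "locally_integrable f"
 shows "integrable lebesgue (\<lambda>x. cor (\<phi> x) * f x)"
proof -
 obtain R where R: "R > 0" "smooth \<phi>" "\<And>x. \<bar>x\<bar> > R ==> \<phi> x = 0" using assms by (elim test_functionE) blast
 obtain M where M: "M > 0" "\<And>x. \<bar>\<phi> x\<bar> <= M" using assms test_bounded by blast
 have "\<phi> \<in> bor" by (rule borel_measurable_continuous_onI[OF smooth_continuous[OF R(2)]])
 then have [measurable]: "\<phi> \<in> borel_measurable lebesgue" by (intro measurable_completion) simp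
 note [measurable] = locally_integrable_measurable[OF assms(2)]
 have i: "integrable lebesgue (\<lambda>x. indicator {-R..R} x *\<^sub>R f x)"
  using assms(2) by (auto simp: locally_integrable_def set_integrable_def)
 show ?thesis
 proof (rule Bochner_Integration.integrable_bound[OF integrable_scaleR_right[OF i, of M]])
  show "AE x in lebesgue. norm (cor (\<phi> x) * f x) <= norm (M *\<^sub>R indicator {-R..R} x *\<^sub>R f x)"
  proof (rule AE_I2)
   fix x show "norm (cor (\<phi> x) * f x) <= norm (M *\<^sub>R indicator {-R..R} x *\<^sub>R f x)"
   proof (cases "\<bar>x\<bar> > R")
    case True then show ?thesis using R(3) by simp
   next
    case False
    then have "x \<in> {-R..R}" by auto
    then show ?thesis using M mult_right_mono[OF M(2)[of x], of "cmod (f x)"] by (simp add: norm_mult)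
   qed
  qed
 qed measurable
qed

lemma locally_integrable_HK:
 assumes "locally_integrable f" shows "f absolutely_integrable_on {a..b}"
 using assms by (auto simp: locally_integrable_def)

text \<open>The fundamental lemma of the calculus of variations: plateaus approximate indicators of
 intervals, and Lebesgue's differentiation theorem does the rest.\<close>

lemma ae_zero_of_test:
 assumes g: "locally_integrable g"
  and t: "\<And>\<phi>. test_function \<phi> ==> (\<integral>x. cor (\<phi> x) * g x \<partial>lebesgue) = 0"
 shows "AE x in lebesgue. g x = 0"
proof -
 have [measurable]: "g \<in> borel_measurable lebesgue" using g by (rule locally_integrable_measurable)
 have z: "integral {a..b} g = 0" for a b
 proof -
  have i: "set_integrable lebesgue {a..b} g" using g by (auto simp: locally_integrable_def)
  have "(\<lambda>k. \<integral>x. cor (plateau a b k x) * g x \<partial>lebesgue)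
    \<longlonglongrightarrow> (\<integral>x. cor (indicator {a<..<b} x) * g x \<partial>lebesgue)"
  proof (rule integral_dominated_convergence[where w="\<lambda>x. cmod (indicator {a..b} x *\<^sub>R g x)"])
   show "(\<lambda>x. cor (plateau a b k x) * g x) \<in> borel_measurable lebesgue" for k
    using test_times_integrable[OF plateau_test g] by (rule borel_measurable_integrable)
   show "integrable lebesgue (\<lambda>x. cmod (indicator {a..b} x *\<^sub>R g x))"
    using i unfolding set_integrable_def by (rule integrable_norm)
   show "AE x in lebesgue. (\<lambda>k. cor (plateau a b k x) * g x) \<longlonglongrightarrow> cor (indicator {a<..<b} x) * g x"
    by (intro AE_I2 tendsto_intros plateau_tendsto)
   show "AE x in lebesgue. cmod (cor (plateau a b k x) * g x) <= cmod (indicator {a..b} x *\<^sub>R g x)" for k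
   proof (rule AE_I2)
    fix x show "cmod (cor (plateau a b k x) * g x) <= cmod (indicator {a..b} x *\<^sub>R g x)"
    proof (cases "x \<in> {a<..<b}")
     case True
     then show ?thesis using plateau_bounds(1,2)[of a b k x] by (simp add: norm_mult mult_left_le_one_le)
    qed (simp add: plateau_bounds(3))
   qed
  next
   have "(\<lambda>x. cor (indicat_real {a<..<b} x)) \<in> bor" by measurable
   then have [measurable]: "(\<lambda>x. cor (indicat_real {a<..<b} x)) \<in> borel_measurable lebesgue"
    by (intro measurable_completion) simp
   show "(\<lambda>x. cor (indicat_real {a<..<b} x) * g x) \<in> borel_measurable lebesgue"
    by (rule borel_measurable_times) fact+
  qed
  then have "(\<integral>x. cor (indicator {a<..<b} x) * g x \<partial>lebesgue) = 0"
   using t[OF plateau_test] by (simp add: LIMSEQ_const_iff)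
  then have "(LINT x:{a<..<b}|lebesgue. g x) = 0"
   by (simp add: set_lebesgue_integral_def scaleR_conv_of_real)
  moreover have "set_integrable lebesgue {a<..<b} g" by (rule set_integrable_subset[OF i]) auto
  ultimately have "integral {a<..<b} g = 0" by (simp add: set_lebesgue_integral_eq_integral(2))
  then show ?thesis by (simp add: integral_open_interval_real)
 qed
 have "\<And>a b. g integrable_on cbox a b"
  using locally_integrable_HK[OF g] by (auto simp: absolutely_integrable_on_def)
 from integrable_ccontinuous_explicit[OF this] obtain N where N: "negligible N"
  "\<And>x e. \<lbrakk>x \<notin> N; 0 < e\<rbrakk> \<Longrightarrow> \<exists>d>0. \<forall>h. 0 < h \<and> h < d \<longrightarrow>
    norm(integral (cbox x (x + h *\<^sub>R One)) g /\<^sub>R h ^ DIM(real) - g x) < e" by blast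
 have "g x = 0" if "x \<notin> N" for x
 proof (rule ccontr)
  assume "g x \<noteq> 0"
  from N(2)[OF that, of "cmod (g x)"] this obtain d where
   "d > 0" "\<And>h. 0 < h \<and> h < d ==> norm (integral (cbox x (x + h *\<^sub>R One)) g /\<^sub>R h ^ DIM(real) - g x) < cmod (g x)"
   by (metis zero_less_norm_iff)
  from this(2)[of "d/2"] this(1) show False by (simp add: z)
 qed
 then have "{x \<in> space lebesgue. \<not> g x = 0} \<subseteq> N" by auto
 then show ?thesis using N(1) by (auto simp: negligible_iff_null_sets intro: AE_I')
qed

lemma borel_version:
 fixes f :: "real => complex"
 assumes "f \<in> borel_measurable lebesgue"
 obtains g where "g \<in> bor" "AE x in lborel. f x = g x"
proof -
 have "(\<lambda>x. Re (f x)) \<in> borel_measurable lebesgue" "(\<lambda>x. Im (f x)) \<in> borel_measurable lebesgue"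
  using assms by auto
 then obtain r i where [measurable]: "r \<in> borel_measurable lborel" "i \<in> borel_measurable lborel"
  and *: "AE x in lborel. Re (f x) = r x" "AE x in lborel. Im (f x) = i x"
  using completion_ex_borel_measurable_real by metis
 have "(\<lambda>x. Complex (r x) (i x)) \<in> bor"
  by (simp add: borel_measurable_complex_iff)
 moreover have "AE x in lborel. f x = Complex (r x) (i x)"
  using * by eventually_elim (simp add: complex_eq_iff)
 ultimately show thesis using that by blast
qed

lemma AC_primitive:
 fixes g :: "real => complex"
 assumes [measurable]: "g \<in> bor" and g: "\<And>a b. g absolutely_integrable_on {a..b}"
 obtains G where "AC G g" "G 0 = 0"
proof
 \<comment> \<open>One of the two integrals runs over an empty or one-point interval, so the
   difference covers both signs of \<open>x\<close>.\<close>
 define G where "G x = integral {0..x} g - integral {x..0} g" for x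
 have i: "g integrable_on {s..t}" for s t using g by (auto simp: absolutely_integrable_on_def)
 have c: "integral {s..t} g + integral {t..u} g = integral {s..u} g" if "s <= t" "t <= u" for s t u
  using Henstock_Kurzweil_Integration.integral_combine[OF that i] .
 show "AC G g"
 proof (rule ACI_HK[OF assms])
  fix a b :: real assume "a <= b"
  then consider "0 <= a" "a <= b" | "a <= 0" "0 <= b" | "a <= b" "b <= 0" by linarith
  then show "G b - G a = integral {a..b} g"
  proof cases
   case 1
   have "integral {a..0} g = 0" "integral {b..0} g = 0"
    using 1 by (cases "a = 0"; cases "b = 0"; simp)+
   then show ?thesis using c[OF 1] by (simp add: G_def algebra_simps)
  next
   case 2
   have "integral {0..a} g = 0" "integral {b..0} g = 0"
    using 2 by (cases "a = 0"; cases "b = 0"; simp)+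
   then show ?thesis using c[OF 2] by (simp add: G_def algebra_simps)
  next
   case 3
   have "integral {0..a} g = 0" "integral {0..b} g = 0"
    using 3 by (cases "a = 0"; cases "b = 0"; simp)+
   then show ?thesis using c[OF 3] by (simp add: G_def algebra_simps)
  qed
 qed
 show "G 0 = 0" by (simp add: G_def)
qed

lemma AC_deriv:
 assumes "AC F f" "continuous_on UNIV f" shows "(F has_vector_derivative f x) (at x)"
proof -
 have "((\<lambda>t. F (x-1) + integral {x-1..t} f) has_vector_derivative 0 + f x) (at x within {x-1..x+1})"
  by (intro has_vector_derivative_add has_vector_derivative_const integral_has_vector_derivative
    continuous_on_subset[OF assms(2)]) auto
 then have "((\<lambda>t. F (x-1) + integral {x-1..t} f) has_vector_derivative f x) (at x)"
  by (subst (asm) at_within_interior) auto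
 then show ?thesis
 proof (rule has_vector_derivative_transform_within_open[of _ _ _ "{x-1<..<x+1}"])
  fix t assume "t \<in> {x-1<..<x+1}"
  then have "F t - F (x-1) = integral {x-1..t} f" by (intro AC_HK(2)[OF assms(1)]) auto
  then show "F (x-1) + integral {x-1..t} f = F t" by (metis add.commute diff_add_cancel)
 qed auto
qed

lemma AC_locally_integrable: assumes "AC F f" shows "locally_integrable F" "locally_integrable f"
proof -
 have bor: "locally_integrable g" if g: "\<And>a b. g absolutely_integrable_on {a..b}" for g
  unfolding locally_integrable_def
 proof (intro allI impI)
  fix K :: "real set" assume "compact K"
  then obtain R where "\<And>x. x \<in> K ==> norm x <= R" by (meson bounded_iff compact_imp_bounded)
  then have "K \<subseteq> {-R..R}" by (auto simp: abs_le_iff minus_le_iff)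
  then show "set_integrable lebesgue K g"
   using set_integrable_subset[OF g[of "-R" R], of K] \<open>compact K\<close> by (simp add: borel_compact)
 qed
 show "locally_integrable f" using AC_HK(1)[OF assms] by (rule bor)
 show "locally_integrable F"
  using absolutely_integrable_continuous_real continuous_on_subset[OF AC_continuous[OF assms]]
  by (intro bor) blast
qed

lemma locally_integrable_diff:
 "locally_integrable f ==> locally_integrable g ==> locally_integrable (\<lambda>x. f x - g x)"
 unfolding locally_integrable_def by auto

lemma locally_integrable_cong_AE:
 assumes "locally_integrable f" "AE x in lebesgue. f x = g x" "g \<in> borel_measurable lebesgue"
 shows "locally_integrable g"
 unfolding locally_integrable_def
proof (intro allI impI)
 fix K :: "real set" assume K: "compact K"
 have [measurable]: "K \<in> sets lebesgue" using borel_compact[OF K] by simp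
 note [measurable] = assms(3)
 have i: "integrable lebesgue (\<lambda>x. indicator K x *\<^sub>R f x)"
  using assms(1) K by (auto simp: locally_integrable_def set_integrable_def)
 show "set_integrable lebesgue K g"
  unfolding set_integrable_def by (rule integrable_cong_AE_imp[OF i]) (use assms(2) in auto)
qed

lemma AC_integration_by_parts:
 assumes G: "AC G g" and \<phi>: "test_function \<phi>"
 shows "(\<integral>x. cor (deriv \<phi> x) * G x \<partial>lebesgue) = - (\<integral>x. cor (\<phi> x) * g x \<partial>lebesgue)"
proof -
 obtain R where R: "R > 0" "smooth \<phi>" "\<And>x. \<bar>x\<bar> > R ==> \<phi> x = 0" "\<And>x. \<bar>x\<bar> > R ==> deriv \<phi> x = 0"
  using \<phi> by (elim test_functionE) blast
 have "AC (\<lambda>x. cor (\<phi> x)) (\<lambda>x. cor (deriv \<phi> x))"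
 proof (rule AC_of_deriv)
  show "((\<lambda>x. cor (\<phi> x)) has_vector_derivative cor (deriv \<phi> x)) (at x)" for x
   using smooth_has_deriv[OF R(2), of x]
   by (intro has_vector_derivative_of_real) (simp add: has_real_derivative_iff_has_vector_derivative)
  show "continuous_on UNIV (\<lambda>x. cor (deriv \<phi> x))"
   by (intro continuous_intros smooth_continuous smooth_deriv R)
 qed
 note P = AC_mult[OF this G]
 let ?h = "\<lambda>x. cor (deriv \<phi> x) * G x + cor (\<phi> x) * g x"
 have i1: "integrable lebesgue (\<lambda>x. cor (deriv \<phi> x) * G x)"
  and i2: "integrable lebesgue (\<lambda>x. cor (\<phi> x) * g x)"
  using test_times_integrable test_deriv \<phi> AC_locally_integrable[OF G] by auto
 \<comment> \<open>\<open>\<phi>\<close> is known to vanish only for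
   \<open>\<bar>x\<bar> > R\<close>; enlarging the interval by 1 makes the boundary terms
   zero.\<close>
 have "(\<integral>x. ?h x \<partial>lebesgue) = integral {-(R+1)..R+1} ?h"
 proof -
  have "(\<integral>x. ?h x \<partial>lebesgue) = (LINT x:{-(R+1)..R+1}|lebesgue. ?h x)"
   unfolding set_lebesgue_integral_def
  proof (rule Bochner_Integration.integral_cong[OF refl])
   fix x show "?h x = indicat_real {- (R + 1)..R + 1} x *\<^sub>R ?h x"
    using R(3,4)[of x] by (cases "\<bar>x\<bar> > R") (auto simp: indicator_def)
  qed
  also have "\<dots> = integral {-(R+1)..R+1} ?h"
   using AC_HK(1)[OF P] by (rule set_lebesgue_integral_eq_integral(2))
  finally show ?thesis .
 qed
 also have "\<dots> = cor (\<phi> (R+1)) * G (R+1) - cor (\<phi> (-(R+1))) * G (-(R+1))"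
  using AC_HK(2)[OF P, of "-(R+1)" "R+1"] R(1) by simp
 also have "\<dots> = 0" using R(3)[of "R+1"] R(3)[of "-(R+1)"] R(1) by simp
 finally show ?thesis
  using Bochner_Integration.integral_add[OF i1 i2] by (simp add: eq_neg_iff_add_eq_0)
qed

text \<open>To the left of the support the primitive vanishes by normalisation, to the right because
  the total integral is zero. Mean zero is thus the only obstruction to being the derivative of a
  test function.\<close>

lemma test_primitive:
 assumes \<psi>: "test_function \<psi>" and z: "(\<integral>x. \<psi> x \<partial>lebesgue) = 0"
 obtains \<phi> where "test_function \<phi>" "deriv \<phi> = \<psi>"
proof -
 obtain R where R: "R > 0" "smooth \<psi>" "\<And>x. \<bar>x\<bar> > R ==> \<psi> x = 0"
  using \<psi> by (elim test_functionE) blast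
 let ?p = "\<lambda>x. cor (\<psi> x)"
 have cp: "continuous_on UNIV ?p" by (intro continuous_intros smooth_continuous R)
 obtain G where G: "AC G ?p"
  using AC_primitive[of ?p] borel_measurable_continuous_onI[OF cp]
   absolutely_integrable_continuous_real continuous_on_subset[OF cp] by (metis top_greatest)
 define \<phi> where "\<phi> x = Re (G x - G (-(R+1)))" for x
 have d: "(\<phi> has_real_derivative \<psi> x) (at x)" for x
 proof -
  have "(G has_vector_derivative ?p x) (at x)" by (rule AC_deriv[OF G cp])
  then have "((\<lambda>x. G x - G (-(R+1))) has_vector_derivative ?p x - 0) (at x)"
   by (intro has_vector_derivative_diff has_vector_derivative_const)
  from bounded_linear.has_vector_derivative[OF bounded_linear_Re this]
  show ?thesis unfolding \<phi>_def by (simp add: has_real_derivative_iff_has_vector_derivative)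
 qed
 have out: "integral {s..t} ?p = 0" if "\<And>x. x \<in> {s..t} ==> \<bar>x\<bar> > R" for s t
  using that R(3) Henstock_Kurzweil_Integration.integral_cong[of "{s..t}" ?p "\<lambda>_. 0"] by simp
 have "G (R+1) - G (-(R+1)) = integral {-(R+1)..R+1} ?p" by (rule AC_HK(2)[OF G]) (use R in auto)
 also have "\<dots> = (LINT x:{-(R+1)..R+1}|lebesgue. ?p x)"
  using AC_HK(1)[OF G] by (rule set_lebesgue_integral_eq_integral(2)[symmetric])
 also have "\<dots> = (\<integral>x. ?p x \<partial>lebesgue)"
  unfolding set_lebesgue_integral_def
 proof (rule Bochner_Integration.integral_cong[OF refl])
  fix x show "indicat_real {- (R + 1)..R + 1} x *\<^sub>R ?p x = ?p x"
   using R(3)[of x] by (cases "\<bar>x\<bar> > R") (auto simp: indicator_def)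
 qed
 also have "\<dots> = 0" using z by simp
 finally have tot: "G (R+1) = G (-(R+1))" by simp
 have "\<phi> x = 0" if "\<bar>x\<bar> > R+1" for x
 proof (cases "x > R+1")
  case True
  have "G x - G (R+1) = integral {R+1..x} ?p" by (rule AC_HK(2)[OF G]) (use True in auto)
  also have "\<dots> = 0" by (rule out) (use R in auto)
  finally show ?thesis using tot by (simp add: \<phi>_def)
 next
  case False
  then have "x < -(R+1)" using that by linarith
  then have "G (-(R+1)) - G x = integral {x..-(R+1)} ?p" by (intro AC_HK(2)[OF G]) auto
  also have "\<dots> = 0" by (rule out) (use R in auto)
  finally show ?thesis by (simp add: \<phi>_def)
 qed
 then have "test_function \<phi>"
  unfolding test_function_iff using smooth_antideriv[OF R(2) d] R(1) by (auto intro!: exI[of _ "R+1"])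
 moreover have "deriv \<phi> = \<psi>" using d DERIV_imp_deriv by blast
 ultimately show thesis using that by blast
qed

lemma test_integrable:
 assumes "test_function \<phi>" shows "integrable lebesgue \<phi>"
proof -
 have "integrable lebesgue (\<lambda>x. cor (\<phi> x) * 1)"
  by (rule test_times_integrable[OF assms AC_locally_integrable(1)[OF AC_const]])
 then show ?thesis by (simp add: complex_of_real_integrable_eq)
qed

lemma ex_unit_test: "\<exists>\<psi>. test_function \<psi> \<and> (\<integral>x. \<psi> x \<partial>lebesgue) = 1"
proof -
 let ?p = "plateau 0 1 0"
 have i: "integrable lebesgue ?p" by (rule test_integrable[OF plateau_test])
 have "(\<integral>x. ?p x \<partial>lebesgue) \<noteq> 0"
 proof
  assume "(\<integral>x. ?p x \<partial>lebesgue) = 0"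
  then have "AE x in lebesgue. ?p x = 0"
   using integral_nonneg_eq_0_iff_AE[OF i] plateau_bounds by auto
  moreover have "?p x \<noteq> 0" if "x \<in> {0<..<1}" for x using that by (simp add: plateau_def flat_def)
  ultimately have "AE x in lebesgue. x \<notin> {0<..<1::real}" by (auto elim!: eventually_mono)
  then have "{0<..<1::real} \<in> null_sets lebesgue"
   by (subst AE_iff_null_sets) auto
  then show False by (auto dest: null_setsD1)
 qed
 then show ?thesis
  using test_cmult[OF plateau_test[of 0 1 0], of "inverse (\<integral>x. ?p x \<partial>lebesgue)"] i
  by (intro exI[of _ "\<lambda>x. inverse (\<integral>x. ?p x \<partial>lebesgue) * ?p x"]) auto
qed

text \<open>The lemma of du Bois-Reymond. The difference of \<open>f\<close> and a primitive of
  \<open>g'\<close> annihilates all test functions of mean zero, as these are derivatives of test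
  functions. Subtracting a multiple of one test function of unit mass makes any test function mean
  zero, so the difference is almost everywhere constant.\<close>

lemma weak_derivative_AC:
 assumes w: "has_weak_derivative 1 f g" and [measurable]: "g' \<in> bor"
  and ae: "AE x in lborel. g x = g' x"
 obtains F where "AC F g'" "AE x in lborel. f x = F x"
proof -
 have lf: "locally_integrable f" and lg: "locally_integrable g"
  and wd: "\<And>\<phi>. test_function \<phi> ==> (\<integral>x. cor (deriv \<phi> x) * f x \<partial>lebesgue)
   = - (\<integral>x. cor (\<phi> x) * g x \<partial>lebesgue)"
  using w by (auto simp: has_weak_derivative_def)
 have ae': "AE x in lebesgue. g x = g' x" using ae by (rule AE_completion)
 have mg[measurable]: "g' \<in> borel_measurable lebesgue" by (rule measurable_completion) simp
 have lg': "locally_integrable g'" by (rule locally_integrable_cong_AE[OF lg ae' mg])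
 obtain G where G: "AC G g'" using AC_primitive[of g'] locally_integrable_HK[OF lg'] assms(2) by blast
 have gg: "(\<integral>x. cor (\<phi> x) * g x \<partial>lebesgue) = (\<integral>x. cor (\<phi> x) * g' x \<partial>lebesgue)"
  if "test_function \<phi>" for \<phi>
  by (rule integral_cong_AE)
   (use ae' test_times_integrable[OF that] lg lg' borel_measurable_integrable in auto)
 define h where "h x = f x - G x" for x
 have lh: "locally_integrable h"
  unfolding h_def by (rule locally_integrable_diff[OF lf AC_locally_integrable(1)[OF G]])
 have h0: "(\<integral>x. cor (\<psi> x) * h x \<partial>lebesgue) = 0"
  if \<psi>: "test_function \<psi>" "(\<integral>x. \<psi> x \<partial>lebesgue) = 0" for \<psi>
 proof -
  obtain \<phi> where \<phi>: "test_function \<phi>" "deriv \<phi> = \<psi>" using test_primitive[OF \<psi>] .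
  have "(\<integral>x. cor (\<psi> x) * h x \<partial>lebesgue) =
   (\<integral>x. cor (\<psi> x) * f x \<partial>lebesgue) - (\<integral>x. cor (\<psi> x) * G x \<partial>lebesgue)"
   unfolding h_def right_diff_distrib
   by (rule Bochner_Integration.integral_diff) (intro test_times_integrable \<psi> lf AC_locally_integrable(1)[OF G])+
  also have "\<dots> = 0"
   using wd[OF \<phi>(1)] AC_integration_by_parts[OF G \<phi>(1)] gg[OF \<phi>(1)] by (simp add: \<phi>(2))
  finally show ?thesis .
 qed
 obtain \<psi>0 where p0: "test_function \<psi>0" "(\<integral>x. \<psi>0 x \<partial>lebesgue) = 1" using ex_unit_test by blast
 define c where "c = (\<integral>x. cor (\<psi>0 x) * h x \<partial>lebesgue)"
 have lc: "locally_integrable (\<lambda>x. c)" by (rule AC_locally_integrable(1)[OF AC_const])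
 have "AE x in lebesgue. h x - c = 0"
 proof (rule ae_zero_of_test[OF locally_integrable_diff[OF lh lc]])
  fix \<psi> assume \<psi>: "test_function \<psi>"
  define s where "s = (\<integral>x. \<psi> x \<partial>lebesgue)"
  have t: "test_function (\<lambda>x. \<psi> x + (- s) * \<psi>0 x)" by (intro test_add test_cmult \<psi> p0)
  have "(\<integral>x. \<psi> x + (- s) * \<psi>0 x \<partial>lebesgue) = 0"
   using test_integrable[OF \<psi>] test_integrable[OF p0(1)] p0(2) by (simp add: s_def)
  from h0[OF t this] have "(\<integral>x. cor (\<psi> x) * h x \<partial>lebesgue) = of_real s * c"
   using test_times_integrable[OF \<psi> lh] test_times_integrable[OF p0(1) lh]
   by (simp add: c_def algebra_simps)
  moreover have "(\<integral>x. cor (\<psi> x) * c \<partial>lebesgue) = of_real s * c"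
   unfolding s_def using test_integrable[OF \<psi>] by simp
  moreover have "(\<integral>x. cor (\<psi> x) * (h x - c) \<partial>lebesgue)
   = (\<integral>x. cor (\<psi> x) * h x \<partial>lebesgue) - (\<integral>x. cor (\<psi> x) * c \<partial>lebesgue)"
   unfolding right_diff_distrib
   by (rule Bochner_Integration.integral_diff[OF test_times_integrable[OF \<psi> lh] test_times_integrable[OF \<psi> lc]])
  ultimately show "(\<integral>x. cor (\<psi> x) * (h x - c) \<partial>lebesgue) = 0"
   by (simp only: diff_self)
 qed
 then have "AE x in lborel. f x = G x + c"
  unfolding AE_completion_iff by eventually_elim (auto simp: h_def algebra_simps)
 moreover have "AC (\<lambda>x. G x + c) g'" using AC_add[OF G AC_const[of c]] by simp
 ultimately show thesis using that by blast
qed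

text \<open>Links independent choices: \<open>X1_norm\<close> measures a derivative picked by
  \<open>SOME\<close>, whereas \<open>X_space\<close> supplies another one for each order.\<close>

lemma weak_derivative_unique:
 assumes "has_weak_derivative j f g" "has_weak_derivative j f h"
 shows "AE x in lebesgue. g x = h x"
proof -
 have "AE x in lebesgue. g x - h x = 0"
 proof (rule ae_zero_of_test)
  show "locally_integrable (\<lambda>x. g x - h x)"
   using assms by (intro locally_integrable_diff) (auto simp: has_weak_derivative_def)
  fix \<phi> assume \<phi>: "test_function \<phi>"
  have "(-1)^j * (\<integral>x. cor (\<phi> x) * g x \<partial>lebesgue) = (-1)^j * (\<integral>x. cor (\<phi> x) * h x \<partial>lebesgue)"
   using assms[unfolded has_weak_derivative_def, THEN conjunct2, THEN conjunct2, rule_format, OF \<phi>]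
   by (rule trans[OF sym])
  then have "(\<integral>x. cor (\<phi> x) * g x \<partial>lebesgue) = (\<integral>x. cor (\<phi> x) * h x \<partial>lebesgue)"
   by simp
  then show "(\<integral>x. cor (\<phi> x) * (g x - h x) \<partial>lebesgue) = 0"
   using test_times_integrable[OF \<phi>, of g] test_times_integrable[OF \<phi>, of h] assms
   unfolding has_weak_derivative_def right_diff_distrib by (simp add: Bochner_Integration.integral_diff)
 qed
 then show ?thesis by eventually_elim simp
qed

section \<open>Square integrable functions\<close>

text \<open>Stated with nonnegative integrals, both sides possibly infinite, so that it can be
  applied before anything is known to be square integrable.\<close>

lemma nn_Cauchy_Schwarz:
 fixes f g :: "'a => real"
 assumes [measurable]: "f \<in> borel_measurable M" "g \<in> borel_measurable M"
 shows "(\<integral>\<^sup>+x. ennreal \<bar>f x * g x\<bar> \<partial>M)\<^sup>2 <= (\<integral>\<^sup>+x. ennreal ((f x)\<^sup>2) \<partial>M) * (\<integral>\<^sup>+x. ennreal ((g x)\<^sup>2) \<partial>M)"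
  (is "?L\<^sup>2 <= ?A * ?B")
proof -
 consider "?A = 0 \<or> ?B = 0" | "?A \<noteq> 0" "?B \<noteq> 0" "?A = \<infinity> \<or> ?B = \<infinity>" | "?A \<noteq> 0" "?B \<noteq> 0" "?A \<noteq> \<infinity>" "?B \<noteq> \<infinity>"
  by blast
 then show ?thesis
 proof cases
  case 1
  have "AE x in M. ennreal \<bar>f x * g x\<bar> = 0"
   using 1
  proof
   assume "?A = 0"
   then have "AE x in M. ennreal ((f x)\<^sup>2) = 0" by (subst (asm) nn_integral_0_iff_AE) auto
   then show ?thesis by eventually_elim (simp add: ennreal_eq_0_iff)
  next
   assume "?B = 0"
   then have "AE x in M. ennreal ((g x)\<^sup>2) = 0" by (subst (asm) nn_integral_0_iff_AE) auto
   then show ?thesis by eventually_elim (simp add: ennreal_eq_0_iff)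
  qed
  then have "?L = 0" by (subst nn_integral_0_iff_AE) auto
  then show ?thesis by simp
 next
  case 2
  then have "?A * ?B = \<infinity>" by (auto simp: ennreal_mult_eq_top_iff)
  then show ?thesis by simp
 next
  case 3
  define a b where "a = enn2real ?A" and "b = enn2real ?B"
  have ab: "?A = ennreal a" "?B = ennreal b" "a > 0" "b > 0"
   using 3 by (auto simp: a_def b_def enn2real_positive_iff less_top[symmetric] zero_less_iff_neq_zero)
  \<comment> \<open>The weight that balances Young's inequality: with this \<open>t\<close> both
    terms on the right equal half of \<open>sqrt (a * b)\<close>.\<close>
  define t where "t = sqrt (b / a)"
  have t: "t > 0" using ab by (simp add: t_def)
  have "?L <= (\<integral>\<^sup>+x. ennreal (t/2) * ennreal ((f x)\<^sup>2) + ennreal (1/(2*t)) * ennreal ((g x)\<^sup>2) \<partial>M)"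
  proof (rule nn_integral_mono)
   fix x
   have "0 <= (t * \<bar>f x\<bar> - \<bar>g x\<bar>)\<^sup>2 / (2 * t)" using t by simp
   also have "\<dots> = t/2 * (f x)\<^sup>2 + 1/(2*t) * (g x)\<^sup>2 - \<bar>f x * g x\<bar>"
    using t by (simp add: field_simps power2_eq_square abs_mult)
   finally show "ennreal \<bar>f x * g x\<bar> <= ennreal (t/2) * ennreal ((f x)\<^sup>2) + ennreal (1/(2*t)) * ennreal ((g x)\<^sup>2)"
    using t by (simp add: ennreal_mult[symmetric] ennreal_plus[symmetric] del: ennreal_plus)
  qed
  also have "\<dots> = ennreal (t/2) * ?A + ennreal (1/(2*t)) * ?B"
   by (simp add: nn_integral_add nn_integral_cmult)
  also have "\<dots> = ennreal (t/2 * a + 1/(2*t) * b)"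
   using t ab by (simp add: ennreal_mult[symmetric] ennreal_plus[symmetric] del: ennreal_plus)
  also have "t/2 * a + 1/(2*t) * b = sqrt (a * b)"
  proof -
   have "t * a = sqrt (a * b)" "b / t = sqrt (a * b)"
    using ab by (simp_all add: t_def real_sqrt_divide real_sqrt_mult field_simps)
   then show ?thesis by (simp add: field_simps)
  qed
  finally have "?L\<^sup>2 <= (ennreal (sqrt (a * b)))\<^sup>2" by (rule power_mono) simp
  also have "\<dots> = ?A * ?B" using ab by (simp add: ennreal_power ennreal_mult[symmetric])
  finally show ?thesis .
 qed
qed

text \<open>The squared L2 norm with infinity allowed as a value: finiteness can then be a
  conclusion of an estimate instead of a side condition.\<close>

definition N2 :: "(real => complex) => ennreal" where
 "N2 f = (NN x. ennreal ((cmod (f x))\<^sup>2))"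

lemma N2_integrable:
 assumes [measurable]: "f \<in> bor"
 shows "N2 f < \<infinity> \<longleftrightarrow> integrable lborel (\<lambda>x. (cmod (f x))\<^sup>2)"
 by (subst integrable_iff_bounded) (simp add: N2_def)

lemma cmod_add_square_le: "(cmod (a + b))\<^sup>2 <= 2 * (cmod a)\<^sup>2 + 2 * (cmod b)\<^sup>2"
proof -
 have "(cmod (a + b))\<^sup>2 <= (cmod a + cmod b)\<^sup>2" by (intro power_mono norm_triangle_ineq) simp
 also have "\<dots> <= 2 * (cmod a)\<^sup>2 + 2 * (cmod b)\<^sup>2"
  using sum_squares_bound[of "cmod a" "cmod b"] by (simp add: power2_sum)
 finally show ?thesis .
qed

lemma N2_add:
 assumes [measurable]: "f \<in> bor" "g \<in> bor"
 shows "N2 (\<lambda>x. f x + g x) <= 2 * N2 f + 2 * N2 g"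
proof -
 have "N2 (\<lambda>x. f x + g x) <= (NN x. 2 * ennreal ((cmod (f x))\<^sup>2) + 2 * ennreal ((cmod (g x))\<^sup>2))"
  unfolding N2_def
 proof (rule nn_integral_mono)
  fix x
  have "ennreal ((cmod (f x + g x))\<^sup>2) <= ennreal (2 * (cmod (f x))\<^sup>2 + 2 * (cmod (g x))\<^sup>2)"
   by (intro ennreal_leI cmod_add_square_le)
  then show "ennreal ((cmod (f x + g x))\<^sup>2) <= 2 * ennreal ((cmod (f x))\<^sup>2) + 2 * ennreal ((cmod (g x))\<^sup>2)"
   by (simp add: ennreal_mult)
 qed
 also have "\<dots> = 2 * N2 f + 2 * N2 g" unfolding N2_def by (simp add: nn_integral_add nn_integral_cmult)
 finally show ?thesis .
qed

lemma N2_parallelogram: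
 assumes [measurable]: "f \<in> bor" "g \<in> bor"
 shows "N2 (\<lambda>x. f x - g x) + 4 * N2 (\<lambda>x. (f x + g x) / 2) = 2 * N2 f + 2 * N2 g"
proof -
 have "(NN x. ennreal ((cmod (f x - g x))\<^sup>2) + 4 * ennreal ((cmod ((f x + g x)/2))\<^sup>2)) =
  (NN x. 2 * ennreal ((cmod (f x))\<^sup>2) + 2 * ennreal ((cmod (g x))\<^sup>2))"
 proof (rule nn_integral_cong)
  fix x
  have e: "(cmod (f x - g x))\<^sup>2 + 4 * (cmod ((f x + g x)/2))\<^sup>2 = 2 * (cmod (f x))\<^sup>2 + 2 * (cmod (g x))\<^sup>2"
  proof -
   have "4 * (cmod ((f x + g x)/2))\<^sup>2 = (cmod (f x + g x))\<^sup>2" by (simp add: norm_divide power_divide)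
   then show ?thesis by (simp only: cmod_power2) (simp add: power2_eq_square algebra_simps)
  qed
  show "ennreal ((cmod (f x - g x))\<^sup>2) + 4 * ennreal ((cmod ((f x + g x)/2))\<^sup>2) =
   2 * ennreal ((cmod (f x))\<^sup>2) + 2 * ennreal ((cmod (g x))\<^sup>2)"
   using arg_cong[OF e, of ennreal] by (simp add: ennreal_mult)
 qed
 then show ?thesis unfolding N2_def by (simp add: nn_integral_add nn_integral_cmult)
qed

text \<open>The rate \<open>(1/4)^k\<close> is split in two: after multiplication by
  \<open>2^k\<close> the squared increments still have a summable integral, and finiteness of that
  sum at a point forces the increments there to decay like \<open>2^(-k/2)\<close>. The limit exists
  almost everywhere, and Fatou's lemma transfers the rate.\<close>

lemma riesz_fischer:
 fixes u :: "nat => real => complex"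
 assumes [measurable]: "\<And>k. u k \<in> bor"
  and C: "\<And>k m. k <= m ==> N2 (\<lambda>x. u m x - u k x) <= ennreal ((1/4)^k)"
 obtains v where "v \<in> bor" "\<And>k. N2 (\<lambda>x. v x - u k x) <= ennreal ((1/4)^k)"
proof -
 define w where "w k x = ennreal (2^k * (cmod (u (Suc k) x - u k x))\<^sup>2)" for k x
 have [measurable]: "w k \<in> bor" for k unfolding w_def by measurable
 have "(NN x. (\<Sum>k. w k x)) = (\<Sum>k. NN x. w k x)" by (rule nn_integral_suminf) simp
 also have "\<dots> <= (\<Sum>k. ennreal ((1/2)^k))"
 proof (rule suminf_le)
  fix k
  have "(NN x. w k x) = ennreal (2^k) * N2 (\<lambda>x. u (Suc k) x - u k x)"
   unfolding w_def N2_def by (simp add: ennreal_mult nn_integral_cmult)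
  also have "\<dots> <= ennreal (2^k) * ennreal ((1/4)^k)" by (intro mult_left_mono C) auto
  also have "\<dots> = ennreal ((1/2)^k)" by (simp add: ennreal_mult[symmetric] power_mult_distrib[symmetric])
  finally show "(NN x. w k x) <= ennreal ((1/2)^k)" .
 qed auto
 also have "\<dots> < \<infinity>" by (subst suminf_ennreal2) (auto intro: summable_geometric)
 finally have "AE x in lborel. (\<Sum>k. w k x) \<noteq> \<infinity>" by (intro nn_integral_PInf_AE) auto
 then have ae: "AE x in lborel. convergent (\<lambda>k. u k x)"
 proof eventually_elim
  case (elim x)
  define S where "S = enn2real (\<Sum>k. w k x)"
  have S: "2^k * (cmod (u (Suc k) x - u k x))\<^sup>2 <= S" for k
  proof -
   have "w k x <= (\<Sum>k. w k x)" using sum_le_suminf[of "\<lambda>k. w k x" "{k}"] by simp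
   then have "enn2real (w k x) <= S" unfolding S_def using elim by (intro enn2real_mono) (auto simp: less_top)
   then show ?thesis by (simp add: w_def)
  qed
  have S0: "S >= 0" by (simp add: S_def)
  have b: "cmod (u (Suc k) x - u k x) <= sqrt S * (sqrt (1/2))^k" for k
  proof (rule power2_le_imp_le)
   have "(sqrt S * (sqrt (1/2))^k)\<^sup>2 = S * (1/2)^k"
   proof -
    have "((sqrt (1/2))^k)\<^sup>2 = ((sqrt (1/2))\<^sup>2)^k" by (simp only: power_mult[symmetric] mult.commute)
    then have "((sqrt (1/2))^k)\<^sup>2 = (1/2 :: real)^k" by simp
    then show ?thesis using S0 by (simp only: power_mult_distrib) simp
   qed
   then show "(cmod (u (Suc k) x - u k x))\<^sup>2 <= (sqrt S * (sqrt (1/2))^k)\<^sup>2"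
   proof -
    have "(1/2)^k * (2^k * (cmod (u (Suc k) x - u k x))\<^sup>2) <= (1/2)^k * S" by (intro mult_left_mono S) auto
    moreover have "(1/2::real)^k * 2^k = 1" by (simp add: power_mult_distrib[symmetric])
    ultimately have "(cmod (u (Suc k) x - u k x))\<^sup>2 <= (1/2)^k * S" by (simp add: mult.assoc[symmetric])
    also have "\<dots> = (sqrt S * (sqrt (1/2))^k)\<^sup>2"
     unfolding \<open>(sqrt S * (sqrt (1/2))^k)\<^sup>2 = S * (1/2)^k\<close> by simp
    finally show ?thesis .
   qed
  qed (use S0 in simp)
  have "summable (\<lambda>k. sqrt S * (sqrt (1/2))^k)"
   by (intro summable_mult summable_geometric) (simp add: real_sqrt_divide)
  then have "summable (\<lambda>k. u (Suc k) x - u k x)"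
   by (rule summable_comparison_test'[where N=0]) (use b in auto)
  then have "convergent (\<lambda>n. \<Sum>k<n. u (Suc k) x - u k x)" by (simp add: summable_iff_convergent)
  moreover have "(\<lambda>n. \<Sum>k<n. u (Suc k) x - u k x) = (\<lambda>n. u n x - u 0 x)"
   using sum_lessThan_telescope[of "\<lambda>k. u k x"] by auto
  ultimately have "convergent (\<lambda>n. (u n x - u 0 x) + u 0 x)"
   by (intro convergent_add convergent_const) simp
  then show ?case by simp
 qed
 define v where "v x = lim (\<lambda>k. u k x)" for x
 have [measurable]: "v \<in> bor"
  unfolding v_def by (rule borel_measurable_lim_metric) simp
 have "N2 (\<lambda>x. v x - u k x) <= ennreal ((1/4)^k)" for k
 proof -
  have "N2 (\<lambda>x. v x - u k x) = (NN x. liminf (\<lambda>m. ennreal ((cmod (u m x - u k x))\<^sup>2)))"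
   unfolding N2_def
  proof (rule nn_integral_cong_AE, use ae in eventually_elim)
   case (elim x)
   then have "(\<lambda>m. u m x) \<longlonglongrightarrow> v x" by (simp add: v_def convergent_LIMSEQ_iff)
   then have "(\<lambda>m. ennreal ((cmod (u m x - u k x))\<^sup>2)) \<longlonglongrightarrow> ennreal ((cmod (v x - u k x))\<^sup>2)"
    by (intro tendsto_intros)
   then show ?case by (intro lim_imp_Liminf[symmetric]) auto
  qed
  also have "\<dots> <= liminf (\<lambda>m. NN x. ennreal ((cmod (u m x - u k x))\<^sup>2))"
   by (rule nn_integral_liminf) simp
  also have "\<dots> <= liminf (\<lambda>m. ennreal ((1/4)^k))"
   by (rule Liminf_mono) (use C in \<open>auto simp: N2_def intro!: eventually_sequentiallyI[of k]\<close>)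
  also have "\<dots> = ennreal ((1/4)^k)" by (simp add: Liminf_const)
  finally show ?thesis .
 qed
 then show thesis using that \<open>v \<in> borel_measurable borel\<close> by blast
qed

lemma lebesgue_integral_borel:
 fixes f :: "real => complex"
 assumes "f \<in> bor"
 shows "(\<integral>x. f x \<partial>lebesgue) = (\<integral>x. f x \<partial>lborel)" "integrable lebesgue f \<longleftrightarrow> integrable lborel f"
 using assms by (auto simp: integral_completion integrable_completion)

lemma N2_L2:
 assumes [measurable]: "f \<in> bor" and f: "N2 f < \<infinity>"
 shows "f \<in> L2" "locally_integrable f"
proof -
 have i: "integrable lborel (\<lambda>x. (cmod (f x))\<^sup>2)" using f N2_integrable by simp
 then show "f \<in> L2"
  by (auto simp: L2_def integrable_completion intro: measurable_completion)
 show "locally_integrable f"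
  unfolding locally_integrable_def
 proof (intro allI impI)
  fix K :: "real set" assume K: "compact K"
  have [measurable]: "K \<in> sets borel" using K by (rule borel_compact)
  have "integrable lborel (\<lambda>x. indicator K x *\<^sub>R (1 :: real))"
   using emeasure_compact_finite[OF K] by (simp add: less_top[symmetric])
  then have "integrable lborel (\<lambda>x. indicator K x *\<^sub>R (1 :: real) + (cmod (f x))\<^sup>2)" using i by simp
  then have "integrable lborel (\<lambda>x. indicator K x *\<^sub>R f x)"
  proof (rule Bochner_Integration.integrable_bound)
   have "cmod (f x) <= 1 + (cmod (f x))\<^sup>2" for x
    using sum_squares_bound[of 1 "cmod (f x)"] by (simp add: power2_eq_square) (smt (verit) norm_ge_zero mult_nonneg_nonneg)
   then show "AE x in lborel. norm (indicator K x *\<^sub>R f x) <= norm (indicator K x *\<^sub>R (1 :: real) + (cmod (f x))\<^sup>2)"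
    by (auto simp: indicator_def)
  qed measurable
  then show "set_integrable lebesgue K f"
   unfolding set_integrable_def by (subst integrable_completion) auto
 qed
qed

lemma le_ennreal_finite: "x <= ennreal c ==> x < \<infinity>"
 by (rule le_less_trans) auto

text \<open>Weak compactness in \<open>L\<^sup>2\<close> without a Hilbert space: among all functions with
 the same pairings as a tail of the difference quotients choose almost norm-minimal ones; by the
 parallelogram law they form a Cauchy sequence.\<close>

lemma H1_criterion:
 assumes r[measurable]: "r \<in> bor" and N: "N2 r < \<infinity>" and C0: "C >= 0"
  and C: "\<And>h. N2 (\<lambda>x. r (x + h) - r x) <= ennreal (C * h\<^sup>2)"
 shows "r \<in> H1_space"
proof -
 define I where "I \<phi> h = (\<integral>x. cor (\<phi> x) * h x \<partial>lborel)" for \<phi> and h :: "real => complex"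
 have tb: "\<phi> \<in> bor" if "test_function \<phi>" for \<phi>
  using that by (auto elim!: test_functionE intro!: borel_measurable_continuous_onI smooth_continuous)
 have ti: "integrable lborel (\<lambda>x. cor (\<phi> x) * h x)"
  if "test_function \<phi>" "h \<in> bor" "N2 h < \<infinity>" for \<phi> h
  using test_times_integrable[OF that(1) N2_L2(2)[OF that(2,3)]] tb[OF that(1)] that(2)
  by (subst (asm) lebesgue_integral_borel(2)) auto
 have Icont: "(cmod (I \<phi> h))\<^sup>2 <= K * c"
  if \<phi>: "test_function \<phi>" and h[measurable]: "h \<in> bor" and "N2 h <= ennreal c" "c >= 0"
   and K: "N2 (\<lambda>x. cor (\<phi> x)) = ennreal K" "K >= 0" for \<phi> h c K
 proof -
  note [measurable] = tb[OF \<phi>]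
  have "ennreal (cmod (I \<phi> h)) <= (NN x. ennreal (cmod (cor (\<phi> x) * h x)))"
   unfolding I_def
   by (intro integral_norm_bound_ennreal ti \<phi> h le_ennreal_finite[OF that(3)])
  also have "\<dots> = (NN x. ennreal \<bar>\<bar>\<phi> x\<bar> * cmod (h x)\<bar>)" by (simp add: norm_mult abs_mult)
  finally have "(ennreal (cmod (I \<phi> h)))\<^sup>2 <= (NN x. ennreal \<bar>\<bar>\<phi> x\<bar> * cmod (h x)\<bar>)\<^sup>2"
   by (rule power_mono) simp
  also have "\<dots> <= (NN x. ennreal (\<bar>\<phi> x\<bar>\<^sup>2)) * (NN x. ennreal ((cmod (h x))\<^sup>2))"
   by (rule nn_Cauchy_Schwarz) measurable
  also have "\<dots> = ennreal K * N2 h" using K by (simp add: N2_def)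
  also have "\<dots> <= ennreal K * ennreal c" by (intro mult_left_mono that) simp
  finally show ?thesis using that by (simp add: ennreal_power ennreal_mult[symmetric] ennreal_le_iff)
 qed
 \<comment> \<open>Dyadic steps suffice: the bound on increments makes all these quotients bounded
   by \<open>C\<close>, and only weak convergence along the sequence is used.\<close>
 define d where "d m x = (r (x + (1/2)^m) - r x) / cor ((1/2)^m)" for m :: nat and x
 have [measurable]: "d m \<in> bor" for m unfolding d_def by measurable
 have dC: "N2 (d m) <= ennreal C" for m
 proof -
  have "N2 (d m) = ennreal (4^m) * N2 (\<lambda>x. r (x + (1/2)^m) - r x)"
  proof -
   have four: "(2^m)\<^sup>2 = (4::real)^m"
   proof -
    have "(4::real)^m = (2^2)^m" by simp
    also have "\<dots> = (2^m)^2" by (simp only: power_mult[symmetric] mult.commute)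
    finally show ?thesis by simp
   qed
   have "(cmod (d m x))\<^sup>2 = 4^m * (cmod (r (x + (1/2)^m) - r x))\<^sup>2" for x
    unfolding d_def norm_divide norm_of_real power_divide by (simp add: four[symmetric] power_divide)
   then show ?thesis unfolding N2_def by (simp add: ennreal_mult nn_integral_cmult)
  qed
  also have "\<dots> <= ennreal (4^m) * ennreal (C * ((1/2)^m)\<^sup>2)" by (intro mult_left_mono C) simp
  also have "\<dots> = ennreal (4^m * (C * ((1/2)^m)\<^sup>2))" using C0 by (simp add: ennreal_mult[symmetric])
  also have "4^m * (C * ((1/2)^m)\<^sup>2) = C"
   by (simp add: power_divide power_mult[symmetric] mult.commute[of m 2] power_mult[of _ 2 m])
  finally show ?thesis .
 qed
 \<comment> \<open>A translation moves the difference quotient to the test function, where the mean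
   value theorem bounds it by \<open>M\<close>. Since the steps are at most 1, everything happens in
   \<open>[-(R+1), R+1]\<close>, and dominated convergence applies.\<close>
 have dlim: "(\<lambda>m. I \<phi> (d m)) \<longlonglongrightarrow> - I (deriv \<phi>) r" if \<phi>: "test_function \<phi>" for \<phi>
 proof -
  obtain R where R: "R > 0" "smooth \<phi>" "\<And>x. \<bar>x\<bar> > R ==> \<phi> x = 0" using \<phi> by (elim test_functionE) blast
  obtain M where M: "M > 0" "\<And>x. \<bar>deriv \<phi> x\<bar> <= M" using test_bounded[OF test_deriv[OF \<phi>]] by blast
  note [measurable] = tb[OF \<phi>] tb[OF test_deriv[OF \<phi>]]
  define e where "e m = (1/2 :: real)^m" for m
  have e: "e m > 0" "e m <= 1" "e \<longlonglongrightarrow> 0" for m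
   unfolding e_def by (auto simp: power_le_one intro!: LIMSEQ_power_zero)
  have eq: "I \<phi> (d m) = (\<integral>x. cor ((\<phi> (x - e m) - \<phi> x) / e m) * r x \<partial>lborel)" for m
  proof -
   have s: "(\<lambda>x. cor (\<phi> x) * r (x + e m)) = (\<lambda>x. (\<lambda>y. cor (\<phi> (y - e m)) * r y) (e m + 1 * x))"
    by (auto simp: add.commute)
   have tr: "test_function (\<lambda>y. \<phi> (y - e m))"
    unfolding test_function_iff
    using smooth_affine[OF R(2), of 1 "- e m"] R(1,3) e(1,2)[of m]
    by (auto intro!: exI[of _ "R + 1"])
   have i1: "integrable lborel (\<lambda>y. cor (\<phi> (y - e m)) * r y)" by (rule ti[OF tr r N])
   have i2: "integrable lborel (\<lambda>y. cor (\<phi> y) * r y)" by (rule ti[OF \<phi> r N])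
   have i3: "integrable lborel (\<lambda>x. cor (\<phi> x) * r (x + e m))"
    unfolding s by (rule lborel_integrable_real_affine[OF i1]) simp
   have t: "(\<integral>x. cor (\<phi> x) * r (x + e m) \<partial>lborel) = (\<integral>y. cor (\<phi> (y - e m)) * r y \<partial>lborel)"
    unfolding s using lborel_integral_real_affine[of 1 "\<lambda>y. cor (\<phi> (y - e m)) * r y" "e m"] by simp
   have "I \<phi> (d m) = (\<integral>x. (cor (\<phi> x) * r (x + e m) - cor (\<phi> x) * r x) / cor (e m) \<partial>lborel)"
    unfolding I_def d_def e_def by (simp add: algebra_simps diff_divide_distrib)
   also have "\<dots> = ((\<integral>y. cor (\<phi> (y - e m)) * r y \<partial>lborel) - (\<integral>x. cor (\<phi> x) * r x \<partial>lborel)) / cor (e m)"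
    using i3 i2 t by simp
   also have "\<dots> = (\<integral>x. (cor (\<phi> (x - e m)) * r x - cor (\<phi> x) * r x) / cor (e m) \<partial>lborel)"
    using i1 i2 by simp
   finally show ?thesis by (simp add: algebra_simps diff_divide_distrib)
  qed
  have "(\<lambda>m. \<integral>x. cor ((\<phi> (x - e m) - \<phi> x) / e m) * r x \<partial>lborel)
   \<longlonglongrightarrow> (\<integral>x. cor (- deriv \<phi> x) * r x \<partial>lborel)"
  proof (rule integral_dominated_convergence[where w="\<lambda>x. M * cmod (indicator {-(R+1)..R+1} x *\<^sub>R r x)"])
   have "set_integrable lebesgue {-(R+1)..R+1} r"
    using N2_L2(2)[OF r N] by (auto simp: locally_integrable_def)
   then have "integrable lborel (\<lambda>x. indicator {-(R+1)..R+1} x *\<^sub>R r x)"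
    unfolding set_integrable_def by (subst (asm) integrable_completion) auto
   then show "integrable lborel (\<lambda>x. M * cmod (indicator {-(R+1)..R+1} x *\<^sub>R r x))"
    by (intro integrable_mult_right integrable_norm)
   show "AE x in lborel. (\<lambda>m. cor ((\<phi> (x - e m) - \<phi> x) / e m) * r x) \<longlonglongrightarrow> cor (- deriv \<phi> x) * r x"
   proof (intro AE_I2 tendsto_intros)
    fix x
    have "((\<lambda>h. (\<phi> (x + h) - \<phi> x) / h) \<longlongrightarrow> deriv \<phi> x) (at 0)"
     using smooth_has_deriv[OF R(2)] by (simp add: DERIV_def)
    moreover have "filterlim (\<lambda>m. - e m) (at 0) sequentially"
     unfolding filterlim_at using tendsto_minus[OF e(3)] e(1) by (auto intro!: always_eventually simp: less_imp_neq[symmetric] less_imp_neq)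
    ultimately have "(\<lambda>m. (\<phi> (x + - e m) - \<phi> x) / (- e m)) \<longlonglongrightarrow> deriv \<phi> x"
     by (rule filterlim_compose)
    from tendsto_minus[OF this] show "(\<lambda>m. (\<phi> (x - e m) - \<phi> x) / e m) \<longlonglongrightarrow> - deriv \<phi> x" by simp
   qed
   show "AE x in lborel. norm (cor ((\<phi> (x - e m) - \<phi> x) / e m) * r x) <= M * cmod (indicator {-(R+1)..R+1} x *\<^sub>R r x)" for m
   proof (rule AE_I2)
    fix x
    show "norm (cor ((\<phi> (x - e m) - \<phi> x) / e m) * r x) <= M * cmod (indicator {-(R+1)..R+1} x *\<^sub>R r x)"
    proof (cases "x \<in> {-(R+1)..R+1}")
     case True
     have "norm (\<phi> (x - e m) - \<phi> x) <= M * norm ((x - e m) - x)"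
      by (rule field_differentiable_bound[of UNIV \<phi> "deriv \<phi>"])
       (use smooth_has_deriv[OF R(2)] M in \<open>auto intro: has_field_derivative_at_within\<close>)
     then have "\<bar>(\<phi> (x - e m) - \<phi> x) / e m\<bar> <= M" using e(1)[of m] by (simp add: field_simps)
     then have "\<bar>(\<phi> (x - e m) - \<phi> x) / e m\<bar> * cmod (r x) <= M * cmod (r x)"
      by (rule mult_right_mono) simp
     moreover have "norm (cor ((\<phi> (x - e m) - \<phi> x) / e m) * r x) = \<bar>(\<phi> (x - e m) - \<phi> x) / e m\<bar> * cmod (r x)"
      by (simp only: norm_mult norm_of_real)
     moreover have "indicator {-(R+1)..R+1} x *\<^sub>R r x = r x" using True by simp
     ultimately show ?thesis by (simp only:)
    next
     case False
     then have "\<phi> (x - e m) = 0" "\<phi> x = 0" using e(1,2)[of m] by (auto intro!: R(3))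
     then show ?thesis using M by simp
    qed
   qed
  qed measurable
  also have "(\<integral>x. cor (- deriv \<phi> x) * r x \<partial>lborel) = - I (deriv \<phi>) r" by (simp add: I_def)
  finally show ?thesis unfolding eq .
 qed
 \<comment> \<open>Having the same pairings as the tail is encoded without limits: every error bound
   \<open>e\<close> shared by the pairings of all \<open>d m\<close> with \<open>m >= n\<close> must
   also hold for \<open>h\<close>. The sets are convex, shrink with \<open>n\<close>, and contain
   \<open>d n\<close>.\<close>
 define Cs where "Cs n = {h. h \<in> bor \<and> N2 h < \<infinity> \<and>
  (\<forall>\<phi> e. test_function \<phi> \<longrightarrow> (\<forall>m\<ge>n. cmod (I \<phi> (d m) + I (deriv \<phi>) r) <= e) \<longrightarrow> cmod (I \<phi> h + I (deriv \<phi>) r) <= e)}" for n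
 define D where "D n = Inf (N2 ` Cs n)" for n
 have dCs: "d n \<in> Cs n" for n
  unfolding Cs_def using le_ennreal_finite[OF dC[of n]] by auto
 have Csmono: "Cs m \<subseteq> Cs n" if "n <= m" for n m
  unfolding Cs_def using that by auto
 have DC: "D n <= ennreal C" for n
  unfolding D_def by (rule order_trans[OF Inf_lower dC[of n]]) (use dCs in auto)
 have Dmono: "D n <= D m" if "n <= m" for n m
  unfolding D_def using Csmono[OF that] by (intro Inf_superset_mono) auto
 define D' where "D' n = enn2real (D n)" for n
 have D': "D n = ennreal (D' n)" "D' n >= 0" "D' n <= C" for n
  using DC[of n] C0 le_ennreal_finite[OF DC[of n]] by (auto simp: D'_def enn2real_leI)
 have D'mono: "D' n <= D' m" if "n <= m" for n m
  using Dmono[OF that] D'(2)[of m] unfolding D'(1) by (simp add: ennreal_le_iff)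
 have "\<exists>h\<in>Cs n. N2 h <= D n + ennreal ((1/4)^n)" for n
 proof -
  have "D n < D n + ennreal ((1/4)^n)" unfolding D'(1) using D'(2)[of n]
   by (simp add: ennreal_plus[symmetric] ennreal_less_iff del: ennreal_plus)
  then show ?thesis unfolding D_def by (subst (asm) Inf_less_iff) (auto intro: less_imp_le)
 qed
 then obtain h where h: "\<And>n. h n \<in> Cs n" "\<And>n. N2 (h n) <= D n + ennreal ((1/4)^n)" by metis
 have hb[measurable]: "h n \<in> bor" and hN: "N2 (h n) < \<infinity>" for n using h(1)[of n] by (auto simp: Cs_def)
 have hdiff: "N2 (\<lambda>x. h m x - h n x) <= ennreal (2 * (D' m - D' n) + 4 * (1/4)^n)" if "n <= m" for n m
 proof -
  \<comment> \<open>By convexity the midpoint competes for the infimum \<open>D n\<close>; an almost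
    minimal pair therefore cannot be far apart.\<close>
  have "(\<lambda>x. (h m x + h n x) / 2) \<in> Cs n"
   unfolding Cs_def
  proof (intro CollectI conjI allI impI)
   have "N2 (\<lambda>x. h m x / 2 + h n x / 2) <= 2 * N2 (\<lambda>x. h m x / 2) + 2 * N2 (\<lambda>x. h n x / 2)" by (rule N2_add) auto
   also have "\<dots> <= 2 * N2 (h m) + 2 * N2 (h n)"
    unfolding N2_def by (intro add_mono mult_left_mono nn_integral_mono ennreal_leI power_mono) (auto simp: norm_divide)
   also have "\<dots> < \<infinity>" using hN by (simp add: ennreal_mult_less_top)
   finally show "N2 (\<lambda>x. (h m x + h n x) / 2) < \<infinity>" by (simp add: add_divide_distrib)
   fix \<phi> e assume \<phi>: "test_function \<phi>" and e: "\<forall>m\<ge>n. cmod (I \<phi> (d m) + I (deriv \<phi>) r) <= e"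
   have 1: "cmod (I \<phi> (h n) + I (deriv \<phi>) r) <= e" using h(1)[of n] \<phi> e by (auto simp: Cs_def)
   have "h m \<in> Cs n" using h(1)[of m] Csmono[OF that] by blast
   then have 2: "cmod (I \<phi> (h m) + I (deriv \<phi>) r) <= e" using \<phi> e by (auto simp: Cs_def)
   have "I \<phi> (\<lambda>x. (h m x + h n x) / 2) = (I \<phi> (h m) + I \<phi> (h n)) / 2"
    unfolding I_def using ti[OF \<phi> hb hN] by (simp add: distrib_left add_divide_distrib)
   then have "I \<phi> (\<lambda>x. (h m x + h n x) / 2) + I (deriv \<phi>) r =
    ((I \<phi> (h n) + I (deriv \<phi>) r) + (I \<phi> (h m) + I (deriv \<phi>) r)) / 2" by (simp add: field_simps)
   also have "cmod \<dots> <= (e + e) / 2"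
    unfolding norm_divide using norm_triangle_le[OF add_mono[OF 1 2]] by simp
   finally show "cmod (I \<phi> (\<lambda>x. (h m x + h n x) / 2) + I (deriv \<phi>) r) <= e" by simp
  qed measurable
  then have Dle: "D n <= N2 (\<lambda>x. (h m x + h n x) / 2)" unfolding D_def by (intro Inf_lower) auto
  have "N2 (\<lambda>x. h m x - h n x) + 4 * D n <= N2 (\<lambda>x. h m x - h n x) + 4 * N2 (\<lambda>x. (h m x + h n x) / 2)"
   by (intro add_left_mono mult_left_mono Dle) simp
  also have "\<dots> = 2 * N2 (h m) + 2 * N2 (h n)" by (rule N2_parallelogram) auto
  also have "\<dots> <= 2 * (D m + ennreal ((1/4)^m)) + 2 * (D n + ennreal ((1/4)^n))"
   by (intro add_mono mult_left_mono h) auto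
  also have "\<dots> <= 2 * (D m + ennreal ((1/4)^n)) + 2 * (D n + ennreal ((1/4)^n))"
   using that by (intro add_mono mult_left_mono order_refl ennreal_leI power_decreasing) auto
  finally have fin: "N2 (\<lambda>x. h m x - h n x) + 4 * D n <= 2 * (D m + ennreal ((1/4)^n)) + 2 * (D n + ennreal ((1/4)^n))" .
  have n4: "4 = ennreal 4" "2 = ennreal 2" by simp_all
  have fin': "N2 (\<lambda>x. h m x - h n x) + ennreal (4 * D' n) <= ennreal (2 * (D' m + (1/4)^n) + 2 * (D' n + (1/4)^n))"
   using fin D'(2)[of n] D'(2)[of m] unfolding D'(1) n4
   by (simp add: ennreal_mult[symmetric] ennreal_plus[symmetric] del: ennreal_plus ennreal_numeral)
  then have ft: "N2 (\<lambda>x. h m x - h n x) \<noteq> \<infinity>"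
   by (metis ennreal_add_eq_top ennreal_less_top infinity_ennreal_def leD)
  then obtain z where z: "N2 (\<lambda>x. h m x - h n x) = ennreal z" "z >= 0" by (cases "N2 (\<lambda>x. h m x - h n x)") auto
  have "z + 4 * D' n <= 2 * (D' m + (1/4)^n) + 2 * (D' n + (1/4)^n)"
   using fin' z D'(2)[of n] D'(2)[of m] by (simp add: ennreal_plus[symmetric] ennreal_le_iff del: ennreal_plus)
  then show ?thesis unfolding z by (intro ennreal_leI) simp
 qed
 have conv: "convergent D'"
  by (rule Bseq_mono_convergent[OF BseqI'[where K=C]]) (use D' D'mono in auto)
 have "\<exists>N. \<forall>n\<ge>N. \<forall>m\<ge>n. 2 * (D' m - D' n) + 4 * (1/4)^n <= (1/4)^k" for k :: nat
 proof -
  obtain L where L: "D' \<longlonglongrightarrow> L" using conv by (auto simp: convergent_def)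
  have DL: "D' m <= L" for m by (rule LIMSEQ_le_const[OF L]) (use D'mono in blast)
  have "(\<lambda>n. 2 * (L - D' n) + 4 * (1/4)^n) \<longlonglongrightarrow> 2 * (L - L) + 4 * 0"
   by (intro tendsto_intros L LIMSEQ_realpow_zero) auto
  then have "\<forall>\<^sub>F n in sequentially. 2 * (L - D' n) + 4 * (1/4)^n < (1/4)^k"
   by (rule order_tendstoD) simp
  then obtain N where "\<forall>n\<ge>N. 2 * (L - D' n) + 4 * (1/4)^n < (1/4)^k" by (auto simp: eventually_sequentially)
  then show ?thesis using DL by (intro exI[of _ N]) (smt (verit))
 qed
 then obtain Nf where Nf: "\<And>k n m. n >= Nf k ==> m >= n ==> 2 * (D' m - D' n) + 4 * (1/4)^n <= (1/4)^k" by metis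
 \<comment> \<open>Adding up all earlier thresholds makes the index sequence increasing; it
   dominates both \<open>Nf k\<close> and \<open>k\<close>.\<close>
 define s where "s k = k + (\<Sum>i\<le>k. Nf i)" for k
 have s: "s k >= Nf k" "s k >= k" for k unfolding s_def by (auto intro!: trans_le_add2 member_le_sum)
 have smono: "s k <= s m" if "k <= m" for k m unfolding s_def using that by (intro add_mono sum_mono2) auto
 obtain v where v[measurable]: "v \<in> bor" and vN: "\<And>k. N2 (\<lambda>x. v x - h (s k) x) <= ennreal ((1/4)^k)"
 proof (rule riesz_fischer[of "\<lambda>k. h (s k)"])
  show "N2 (\<lambda>x. h (s m) x - h (s k) x) <= ennreal ((1/4)^k)" if "k <= m" for k m
   by (rule order_trans[OF hdiff[OF smono[OF that]] ennreal_leI[OF Nf[OF s(1) smono[OF that]]]])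
 qed auto
 have vfin: "N2 v < \<infinity>"
 proof -
  have "N2 (\<lambda>x. (v x - h (s 0) x) + h (s 0) x) <= 2 * N2 (\<lambda>x. v x - h (s 0) x) + 2 * N2 (h (s 0))" by (rule N2_add) auto
  also have "\<dots> <= 2 * ennreal ((1/4)^0) + 2 * N2 (h (s 0))" by (intro add_mono mult_left_mono vN) auto
  also have "\<dots> < \<infinity>" using hN by (simp add: ennreal_mult_less_top)
  finally show ?thesis by simp
 qed
 have Iv: "I (deriv \<phi>) r = - I \<phi> v" if \<phi>: "test_function \<phi>" for \<phi>
 proof -
  note [measurable] = tb[OF \<phi>]
  obtain M where M: "M > 0" "\<And>x. \<bar>\<phi> x\<bar> <= M" using test_bounded[OF \<phi>] by blast
  have "integrable lborel (\<lambda>x. cor (\<phi> x) * cor (\<phi> x))"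
  proof -
   have "AC (\<lambda>x. cor (\<phi> x)) (\<lambda>x. cor (deriv \<phi> x))"
   proof (rule AC_of_deriv)
    show "((\<lambda>x. cor (\<phi> x)) has_vector_derivative cor (deriv \<phi> x)) (at x)" for x
     using smooth_has_deriv[of \<phi> x] \<phi>
     by (intro has_vector_derivative_of_real) (auto simp: has_real_derivative_iff_has_vector_derivative test_function_iff)
    show "continuous_on UNIV (\<lambda>x. cor (deriv \<phi> x))"
     using \<phi> by (intro continuous_intros smooth_continuous smooth_deriv) (auto simp: test_function_iff)
   qed
   from test_times_integrable[OF \<phi> AC_locally_integrable(1)[OF this]] show ?thesis
    by (subst (asm) lebesgue_integral_borel(2)) auto
  qed
  from integrable_norm[OF this] have "integrable lborel (\<lambda>x. (cmod (cor (\<phi> x)))\<^sup>2)"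
   by (simp only: norm_mult power2_eq_square)
  then have "N2 (\<lambda>x. cor (\<phi> x)) < \<infinity>" by (subst N2_integrable) auto
  then obtain K where K: "N2 (\<lambda>x. cor (\<phi> x)) = ennreal K" "K >= 0"
   by (cases "N2 (\<lambda>x. cor (\<phi> x))") auto
  have "(\<lambda>k. I \<phi> (\<lambda>x. v x - h (s k) x)) \<longlonglongrightarrow> 0"
  proof (rule tendsto_norm_zero_cancel, rule power_tendsto_0_iff[of 2, THEN iffD1])
   show "(\<lambda>k. (cmod (I \<phi> (\<lambda>x. v x - h (s k) x)))\<^sup>2) \<longlonglongrightarrow> 0"
   proof (rule tendsto_sandwich[of "\<lambda>k. 0"])
    show "(\<lambda>k. K * (1/4)^k) \<longlonglongrightarrow> 0"
     using tendsto_mult[OF tendsto_const[of K] LIMSEQ_realpow_zero[of "1/4"]] by simp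
    show "\<forall>\<^sub>F k in sequentially. (cmod (I \<phi> (\<lambda>x. v x - h (s k) x)))\<^sup>2 <= K * (1/4)^k"
     by (intro always_eventually allI Icont[OF \<phi> _ vN _ K]) auto
   qed auto
  qed simp
  moreover have "(\<lambda>k. I \<phi> (h (s k))) \<longlonglongrightarrow> - I (deriv \<phi>) r"
  proof (rule LIMSEQ_I)
   fix e :: real assume "e > 0"
   then obtain n where n: "\<And>m. m >= n ==> cmod (I \<phi> (d m) - - I (deriv \<phi>) r) < e/2"
    using LIMSEQ_D[OF dlim[OF \<phi>], of "e/2"] by auto
   have "cmod (I \<phi> (h (s k)) - - I (deriv \<phi>) r) < e" if "k >= n" for k
   proof -
    have "h (s k) \<in> Cs n" using h(1)[of "s k"] Csmono[of n "s k"] s(2)[of k] that le_trans by blast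
    moreover have "\<forall>m\<ge>n. cmod (I \<phi> (d m) + I (deriv \<phi>) r) <= e/2"
    proof (intro allI impI)
     fix m assume "m >= n"
     from n[OF this] show "cmod (I \<phi> (d m) + I (deriv \<phi>) r) <= e/2" unfolding diff_minus_eq_add by (rule less_imp_le)
    qed
    ultimately have "cmod (I \<phi> (h (s k)) + I (deriv \<phi>) r) <= e/2"
     using \<phi> unfolding Cs_def by blast
    then show ?thesis using \<open>e > 0\<close> by simp
   qed
   then show "\<exists>no. \<forall>k\<ge>no. cmod (I \<phi> (h (s k)) - - I (deriv \<phi>) r) < e" by blast
  qed
  ultimately have "(\<lambda>k. I \<phi> (\<lambda>x. v x - h (s k) x) + I \<phi> (h (s k))) \<longlonglongrightarrow> 0 + - I (deriv \<phi>) r"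
   by (rule tendsto_add)
  moreover have "I \<phi> (\<lambda>x. v x - h (s k) x) + I \<phi> (h (s k)) = I \<phi> v" for k
   unfolding I_def using ti[OF \<phi> hb hN] ti[OF \<phi> v vfin] by (simp add: right_diff_distrib)
  ultimately have "I \<phi> v = - I (deriv \<phi>) r" by (simp add: LIMSEQ_const_iff)
  then show ?thesis by simp
 qed
 have "has_weak_derivative 1 r v"
  unfolding has_weak_derivative_def
 proof (intro conjI allI impI)
  show "locally_integrable r" "locally_integrable v" using N2_L2(2) N vfin by auto
  fix \<phi> assume \<phi>: "test_function \<phi>"
  note [measurable] = tb[OF \<phi>] tb[OF test_deriv[OF \<phi>]]
  show "(\<integral>x. cor ((deriv ^^ 1) \<phi> x) * r x \<partial>lebesgue) = (- 1) ^ 1 * (\<integral>x. cor (\<phi> x) * v x \<partial>lebesgue)"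
   using Iv[OF \<phi>] by (simp add: lebesgue_integral_borel(1) I_def)
 qed
 then show ?thesis unfolding H1_space_def using N2_L2(1) N vfin by auto
qed

section \<open>Gaussians and Bessel's inequality for oscillatory integrals\<close>

lemma borel_measurable_cis [measurable (raw)]:
 assumes "f \<in> borel_measurable M" shows "(\<lambda>x. cis (f x)) \<in> borel_measurable M"
 using assms by (auto simp: borel_measurable_complex_iff)

text \<open>Scaling by \<open>s\<close> reduces the transform to the characteristic function of the
  standard normal distribution.\<close>

lemma gaussian_fourier:
 assumes s: "s > 0"
 shows "(\<integral>l. cis (t * l) * cor (exp (- l\<^sup>2 / (2 * s\<^sup>2))) \<partial>lborel)
  = cor (s * sqrt (2 * pi) * exp (- (s * t)\<^sup>2 / 2))"
  and "integrable lborel (\<lambda>l. exp (- l\<^sup>2 / (2 * s\<^sup>2)))"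
proof -
 have n: "exp (- l\<^sup>2 / (2 * s\<^sup>2)) = s * sqrt (2 * pi) * normal_density 0 s l" for l
  using s by (simp add: normal_density_def real_sqrt_mult)
 show "integrable lborel (\<lambda>l. exp (- l\<^sup>2 / (2 * s\<^sup>2)))"
  unfolding n using s by (intro integrable_mult_right integrable_normal_density)
 have "(\<integral>l. cis (t * l) * cor (exp (- l\<^sup>2 / (2 * s\<^sup>2))) \<partial>lborel)
  = s *\<^sub>R (\<integral>l. cis (t * (0 + s * l)) * cor (exp (- (0 + s * l)\<^sup>2 / (2 * s\<^sup>2))) \<partial>lborel)"
  using lborel_integral_real_affine[of s "\<lambda>l. cis (t * l) * cor (exp (- l\<^sup>2 / (2 * s\<^sup>2)))" 0] s by simp
 also have "(\<lambda>l. cis (t * (0 + s * l)) * cor (exp (- (0 + s * l)\<^sup>2 / (2 * s\<^sup>2))))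
  = (\<lambda>l. cor (sqrt (2 * pi)) * (std_normal_density l *\<^sub>R iexp ((s * t) * l)))"
  using s by (auto simp: fun_eq_iff std_normal_density_def cis_conv_exp scaleR_conv_of_real power_mult_distrib mult_ac)
 also have "(\<integral>l. cor (sqrt (2 * pi)) * (std_normal_density l *\<^sub>R iexp ((s * t) * l)) \<partial>lborel)
  = cor (sqrt (2 * pi)) * (\<integral>l. std_normal_density l *\<^sub>R iexp ((s * t) * l) \<partial>lborel)"
  by (rule integral_mult_right_zero)
 also have "(\<integral>l. std_normal_density l *\<^sub>R iexp ((s * t) * l) \<partial>lborel) = char std_normal_distribution (s * t)"
  unfolding char_def by (subst integral_density) auto
 also have "\<dots> = cor (exp (- (s * t)\<^sup>2 / 2))" by (simp add: char_std_normal_distribution)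
 finally show "(\<integral>l. cis (t * l) * cor (exp (- l\<^sup>2 / (2 * s\<^sup>2))) \<partial>lborel)
  = cor (s * sqrt (2 * pi) * exp (- (s * t)\<^sup>2 / 2))" by (simp add: scaleR_conv_of_real)
qed

text \<open>The kernel is pi times the normal density of standard deviation \<open>1/(2 s)\<close>.
  Its mass does not depend on \<open>s\<close>, which is why the cut-off in \<open>bessel\<close>
  can be removed; pi survives as the constant there.\<close>

lemma gaussian_mass:
 assumes s: "s > 0"
 shows "(NN u. ennreal (s * sqrt (2 * pi) * exp (- 2 * s\<^sup>2 * (u - a)\<^sup>2))) = ennreal pi"
proof -
 have "s * sqrt (2 * pi) * exp (- 2 * s\<^sup>2 * (u - a)\<^sup>2) = pi * normal_density a (1 / (2 * s)) u" for u
 proof -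
  have "sqrt (2 * pi * (1 / (2 * s))\<^sup>2) = sqrt (2 * pi) / (2 * s)"
   using s by (simp only: real_sqrt_mult real_sqrt_abs) simp
  moreover have "- (u - a)\<^sup>2 / (2 * (1 / (2 * s))\<^sup>2) = - 2 * s\<^sup>2 * (u - a)\<^sup>2"
   using s by (simp add: power_divide field_simps power2_eq_square)
  moreover have "s * sqrt (2 * pi) = pi * (1 / (sqrt (2 * pi) / (2 * s)))"
  proof -
   have "sqrt (2 * pi) * sqrt (2 * pi) = 2 * pi" by simp
   then show ?thesis using s by (simp add: field_simps)
  qed
  ultimately show ?thesis by (simp add: normal_density_def)
 qed
 then have "(NN u. ennreal (s * sqrt (2 * pi) * exp (- 2 * s\<^sup>2 * (u - a)\<^sup>2)))
  = (NN u. ennreal pi * ennreal (normal_density a (1 / (2 * s)) u))"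
  by (simp add: ennreal_mult)
 also have "\<dots> = ennreal pi * (NN u. ennreal (normal_density a (1 / (2 * s)) u))"
  by (rule nn_integral_cmult) simp
 also have "(NN u. ennreal (normal_density a (1 / (2 * s)) u)) = 1"
 proof -
  have "(NN u. ennreal (normal_density a (1 / (2 * s)) u)) = ennreal (\<integral>u. normal_density a (1 / (2 * s)) u \<partial>lborel)"
   by (rule nn_integral_eq_integral) (use s in simp_all)
  then show ?thesis using s by simp
 qed
 finally show ?thesis by simp
qed

lemma integrable_pair_mult:
 fixes f :: "'a => complex" and g :: "'b => complex"
 assumes "sigma_finite_measure M" "sigma_finite_measure N" and f: "integrable M f" and g: "integrable N g"
 shows "integrable (M \<Otimes>\<^sub>M N) (\<lambda>(x, y). f x * g y)"
proof -
 interpret pair_sigma_finite M N using assms(1,2) by (simp add: pair_sigma_finite_def)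
 have [measurable]: "f \<in> borel_measurable M" "g \<in> borel_measurable N" using f g by auto
 show ?thesis
 proof (rule Fubini_integrable)
  show "integrable M (\<lambda>x. \<integral>y. norm (case (x, y) of (x, y) => f x * g y) \<partial>N)"
   using integrable_mult_left[OF integrable_norm[OF f], of "\<integral>y. norm (g y) \<partial>N"] by (simp add: norm_mult)
  show "AE x in M. integrable N (\<lambda>y. case (x, y) of (x, y) => f x * g y)" using g by simp
 qed measurable
qed

text \<open>A Gaussian cut-off in \<open>l\<close> turns the left-hand side into a double integral against a
 Gaussian in \<open>E x - E y\<close>, which is dominated by the same Gaussian in \<open>x - y\<close>; Schur's test applies.\<close>

lemma bessel:
 fixes g :: "real => complex" and E :: "real => real"
 assumes g: "integrable lborel g" and E[measurable]: "E \<in> bor"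
  and mono: "\<And>x y. \<bar>x - y\<bar> <= \<bar>E x - E y\<bar>"
 shows "(NN l. ennreal ((cmod (\<integral>z. cis (2 * l * E z) * g z \<partial>lborel))\<^sup>2))
  <= ennreal pi * (NN z. ennreal ((cmod (g z))\<^sup>2))"
proof -
 have [measurable]: "g \<in> bor" using g by auto
 define G where "G l = (\<integral>z. cis (2 * l * E z) * g z \<partial>lborel)" for l
 let ?P = "lborel \<Otimes>\<^sub>M lborel :: (real \<times> real) measure"
 have ig: "integrable lborel (\<lambda>z. cis (2 * l * E z) * g z)" for l
  by (rule Bochner_Integration.integrable_bound[OF g]) (auto simp: norm_mult)
 have Gm[measurable]: "G \<in> bor"
  unfolding G_def by measurable
 interpret Q: pair_sigma_finite lborel ?P
  by (intro pair_sigma_finite.intro) (auto intro: lborel.sigma_finite_measure_axioms lborel_pair.sigma_finite_measure_axioms)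
 have main: "(NN l. ennreal (exp (- l\<^sup>2 / (2 * s\<^sup>2)) * (cmod (G l))\<^sup>2)) <= ennreal pi * (NN z. ennreal ((cmod (g z))\<^sup>2))"
  if s: "s > 0" for s
 proof -
  let ?w = "\<lambda>l. exp (- l\<^sup>2 / (2 * s\<^sup>2))"
  define H where "H l p = cor (?w l) * (cis (2 * l * E (fst p)) * g (fst p) * cnj (cis (2 * l * E (snd p)) * g (snd p)))" for l and p :: "real \<times> real"
  have sq: "cor (?w l * (cmod (G l))\<^sup>2) = (\<integral>p. H l p \<partial>?P)" for l
  proof -
   have ip: "integrable ?P (\<lambda>(x, y). (cis (2 * l * E x) * g x) * cnj (cis (2 * l * E y) * g y))"
    using integrable_pair_mult[OF lborel.sigma_finite_measure_axioms lborel.sigma_finite_measure_axioms ig integrable_cnj[OF ig]] .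
   have "(\<integral>p. H l p \<partial>?P) = cor (?w l) * (\<integral>p. (case p of (x, y) => (cis (2 * l * E x) * g x) * cnj (cis (2 * l * E y) * g y)) \<partial>?P)"
    unfolding H_def by (simp add: case_prod_beta)
   also have "(\<integral>p. (case p of (x, y) => (cis (2 * l * E x) * g x) * cnj (cis (2 * l * E y) * g y)) \<partial>?P)
    = (\<integral>x. (\<integral>y. (cis (2 * l * E x) * g x) * cnj (cis (2 * l * E y) * g y) \<partial>lborel) \<partial>lborel)"
    by (subst lborel_pair.integral_fst'[OF ip, symmetric]) simp
   also have "\<dots> = (\<integral>x. (cis (2 * l * E x) * g x) * cnj (G l) \<partial>lborel)"
    unfolding G_def integral_mult_right_zero Bochner_Integration.integral_cnj ..
   also have "\<dots> = G l * cnj (G l)" unfolding G_def by simp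
   also have "\<dots> = cor ((cmod (G l))\<^sup>2)" by (simp add: complex_norm_square[symmetric])
   finally show ?thesis by simp
  qed
  have iH: "integrable (lborel \<Otimes>\<^sub>M ?P) (\<lambda>(l, p). H l p)"
  proof -
   have a: "integrable ?P (\<lambda>(x, y). g x * g y)"
    by (rule integrable_pair_mult[OF lborel.sigma_finite_measure_axioms lborel.sigma_finite_measure_axioms g g])
   have b: "integrable lborel (\<lambda>l. cor (?w l))"
    using gaussian_fourier(2)[OF s] by (rule integrable_of_real)
   have "integrable (lborel \<Otimes>\<^sub>M ?P) (\<lambda>(l, p). cor (?w l) * (case p of (x, y) => g x * g y))"
    by (rule integrable_pair_mult[OF lborel.sigma_finite_measure_axioms lborel_pair.sigma_finite_measure_axioms b a])
   then show ?thesis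
    by (rule Bochner_Integration.integrable_bound)
     (auto simp: H_def norm_mult case_prod_beta intro!: AE_I2)
  qed
  have Hint: "(\<integral>l. H l (x, y) \<partial>lborel) = g x * cnj (g y) * cor (s * sqrt (2 * pi) * exp (- (s * (2 * (E x - E y)))\<^sup>2 / 2))" for x y
  proof -
   have "H l (x, y) = g x * cnj (g y) * (cis (2 * (E x - E y) * l) * cor (?w l))" for l
   proof -
    have c: "cis (2 * (E x - E y) * l) = cis (2 * l * E x) * cnj (cis (2 * l * E y))"
     by (simp add: cis_cnj cis_mult algebra_simps)
    show ?thesis unfolding c H_def by (simp add: mult_ac)
   qed
   then show ?thesis using gaussian_fourier(1)[OF s, of "2 * (E x - E y)"] by simp
  qed
  have "cor (\<integral>l. ?w l * (cmod (G l))\<^sup>2 \<partial>lborel) = (\<integral>l. (\<integral>p. H l p \<partial>?P) \<partial>lborel)"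
   unfolding sq[symmetric] by (rule integral_complex_of_real[symmetric])
  also have "\<dots> = (\<integral>p. (\<integral>l. H l p \<partial>lborel) \<partial>?P)"
   using Q.Fubini_integral[OF iH] by simp
  finally have eq: "cor (\<integral>l. ?w l * (cmod (G l))\<^sup>2 \<partial>lborel) = (\<integral>p. (\<integral>l. H l p \<partial>lborel) \<partial>?P)" .
  have iw: "integrable lborel (\<lambda>l. ?w l * (cmod (G l))\<^sup>2)"
  proof -
   have "integrable lborel (\<lambda>l. \<integral>p. H l p \<partial>?P)" using Q.integrable_fst'[OF iH] by simp
   then show ?thesis unfolding sq[symmetric] complex_of_real_integrable_eq .
  qed
  let ?k = "\<lambda>x y. s * sqrt (2 * pi) * exp (- 2 * s\<^sup>2 * (x - y)\<^sup>2)"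
  have k0: "0 <= ?k x y" for x y using s by simp
  have "ennreal (\<integral>l. ?w l * (cmod (G l))\<^sup>2 \<partial>lborel) = ennreal (cmod (\<integral>p. (\<integral>l. H l p \<partial>lborel) \<partial>?P))"
   unfolding eq[symmetric] by (simp add: integral_nonneg_AE)
  also have "\<dots> <= (\<integral>\<^sup>+p. ennreal (cmod (\<integral>l. H l p \<partial>lborel)) \<partial>?P)"
   by (rule integral_norm_bound_ennreal) (use Q.integrable_snd[OF iH] in simp)
  also have "\<dots> <= (\<integral>\<^sup>+p. ennreal (?k (fst p) (snd p) * ((cmod (g (fst p)))\<^sup>2 / 2)) + ennreal (?k (fst p) (snd p) * ((cmod (g (snd p)))\<^sup>2 / 2)) \<partial>?P)"
  proof (rule nn_integral_mono)
   fix p :: "real \<times> real"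
   obtain x y where p: "p = (x, y)" by (cases p)
   have "cmod (\<integral>l. H l p \<partial>lborel) = cmod (g x) * cmod (g y) * (s * sqrt (2 * pi) * exp (- (s * (2 * (E x - E y)))\<^sup>2 / 2))"
    unfolding p Hint using s by (simp add: norm_mult)
   \<comment> \<open>The only place where the expansion of \<open>E\<close> enters: a larger phase
     difference only makes the Gaussian smaller.\<close>
   also have "exp (- (s * (2 * (E x - E y)))\<^sup>2 / 2) <= exp (- 2 * s\<^sup>2 * (x - y)\<^sup>2)"
   proof -
    have "(x - y)\<^sup>2 <= (E x - E y)\<^sup>2" using mono[of x y] by (simp add: abs_le_square_iff)
    then have "2 * s\<^sup>2 * (x - y)\<^sup>2 <= 2 * s\<^sup>2 * (E x - E y)\<^sup>2" by (intro mult_left_mono) auto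
    moreover have "- (s * (2 * (E x - E y)))\<^sup>2 / 2 = - (2 * s\<^sup>2 * (E x - E y)\<^sup>2)"
     by (simp only: power_mult_distrib) simp
    ultimately show ?thesis unfolding exp_le_cancel_iff by linarith
   qed
   then have "cmod (g x) * cmod (g y) * (s * sqrt (2 * pi) * exp (- (s * (2 * (E x - E y)))\<^sup>2 / 2))
    <= cmod (g x) * cmod (g y) * ?k x y" using s by (intro mult_left_mono) auto
   \<comment> \<open>The kernel is symmetric with known mass in either variable, so splitting the
     product into two halves leaves a single integral in each.\<close>
   also have "\<dots> <= ((cmod (g x))\<^sup>2 / 2 + (cmod (g y))\<^sup>2 / 2) * ?k x y"
    using sum_squares_bound[of "cmod (g x)" "cmod (g y)"] by (intro mult_right_mono k0) simp
   finally have *: "cmod (\<integral>l. H l p \<partial>lborel) <= ?k x y * ((cmod (g x))\<^sup>2 / 2) + ?k x y * ((cmod (g y))\<^sup>2 / 2)"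
    by (simp add: algebra_simps)
   show "ennreal (cmod (\<integral>l. H l p \<partial>lborel)) <= ennreal (?k (fst p) (snd p) * ((cmod (g (fst p)))\<^sup>2 / 2)) + ennreal (?k (fst p) (snd p) * ((cmod (g (snd p)))\<^sup>2 / 2))"
    using ennreal_leI[OF *] k0[of x y] unfolding p by (subst (asm) ennreal_plus) auto
  qed
  also have "\<dots> = (\<integral>\<^sup>+p. ennreal (?k (fst p) (snd p) * ((cmod (g (fst p)))\<^sup>2 / 2)) \<partial>?P) + (\<integral>\<^sup>+p. ennreal (?k (fst p) (snd p) * ((cmod (g (snd p)))\<^sup>2 / 2)) \<partial>?P)"
   by (rule nn_integral_add) measurable
  also have "(\<integral>\<^sup>+p. ennreal (?k (fst p) (snd p) * ((cmod (g (snd p)))\<^sup>2 / 2)) \<partial>?P)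
   = (NN y. (NN x. ennreal (?k x y * ((cmod (g y))\<^sup>2 / 2))))"
   by (subst lborel_pair.nn_integral_snd[symmetric]) auto
  also have "(\<integral>\<^sup>+p. ennreal (?k (fst p) (snd p) * ((cmod (g (fst p)))\<^sup>2 / 2)) \<partial>?P)
   = (NN x. (NN y. ennreal (?k y x * ((cmod (g x))\<^sup>2 / 2))))"
   by (subst lborel.nn_integral_fst[symmetric]) (auto simp: power2_commute)
  also have "(NN y. (NN x. ennreal (?k x y * ((cmod (g y))\<^sup>2 / 2))))
   = (NN y. ennreal pi * ennreal ((cmod (g y))\<^sup>2 / 2))"
  proof (rule nn_integral_cong)
   fix y :: real
   have "(NN x. ennreal (?k x y * ((cmod (g y))\<^sup>2 / 2))) = (NN x. ennreal (?k x y) * ennreal ((cmod (g y))\<^sup>2 / 2))"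
    using k0 by (intro nn_integral_cong ennreal_mult) auto
   also have "\<dots> = (NN x. ennreal (?k x y)) * ennreal ((cmod (g y))\<^sup>2 / 2)" by (rule nn_integral_multc) measurable
   also have "(NN x. ennreal (?k x y)) = ennreal pi" by (rule gaussian_mass[OF s])
   finally show "(NN x. ennreal (?k x y * ((cmod (g y))\<^sup>2 / 2))) = ennreal pi * ennreal ((cmod (g y))\<^sup>2 / 2)" .
  qed
  also have "\<dots> + \<dots> = ennreal pi * (NN z. ennreal ((cmod (g z))\<^sup>2))"
  proof -
   have "(NN y. ennreal pi * ennreal ((cmod (g y))\<^sup>2 / 2)) + (NN y. ennreal pi * ennreal ((cmod (g y))\<^sup>2 / 2))
    = (NN y. ennreal pi * ennreal ((cmod (g y))\<^sup>2 / 2) + ennreal pi * ennreal ((cmod (g y))\<^sup>2 / 2))"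
    by (rule nn_integral_add[symmetric]) measurable
   also have "\<dots> = (NN y. ennreal pi * ennreal ((cmod (g y))\<^sup>2))"
    by (intro nn_integral_cong) (simp add: ennreal_mult[symmetric] ennreal_plus[symmetric] del: ennreal_plus)
   finally show ?thesis by (simp add: nn_integral_cmult)
  qed
  finally have "ennreal (\<integral>l. ?w l * (cmod (G l))\<^sup>2 \<partial>lborel) <= ennreal pi * (NN z. ennreal ((cmod (g z))\<^sup>2))" .
  then show ?thesis by (subst nn_integral_eq_integral[OF iw]) auto
 qed
 \<comment> \<open>The cut-off of width \<open>s = n + 1\<close> tends to 1 pointwise; Fatou's lemma
   suffices because the bound is uniform in \<open>s\<close>.\<close>
 have "(NN l. ennreal ((cmod (G l))\<^sup>2))
  = (NN l. liminf (\<lambda>n. ennreal (exp (- l\<^sup>2 / (2 * (real (Suc n))\<^sup>2)) * (cmod (G l))\<^sup>2)))"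
 proof (rule nn_integral_cong)
  fix l :: real
  have "(\<lambda>n. exp (- (l\<^sup>2 / 2 * (1 / real (Suc n))\<^sup>2)) * (cmod (G l))\<^sup>2) \<longlonglongrightarrow> exp (- (l\<^sup>2 / 2 * 0\<^sup>2)) * (cmod (G l))\<^sup>2"
   by (intro tendsto_intros) (use LIMSEQ_inverse_real_of_nat in \<open>simp add: inverse_eq_divide\<close>)
  then have "(\<lambda>n. exp (- l\<^sup>2 / (2 * (real (Suc n))\<^sup>2)) * (cmod (G l))\<^sup>2) \<longlonglongrightarrow> (cmod (G l))\<^sup>2"
   by (simp add: power_divide del: of_nat_Suc)
  then have "(\<lambda>n. ennreal (exp (- l\<^sup>2 / (2 * (real (Suc n))\<^sup>2)) * (cmod (G l))\<^sup>2)) \<longlonglongrightarrow> ennreal ((cmod (G l))\<^sup>2)"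
   by (rule tendsto_ennrealI)
  then show "ennreal ((cmod (G l))\<^sup>2) = liminf (\<lambda>n. ennreal (exp (- l\<^sup>2 / (2 * (real (Suc n))\<^sup>2)) * (cmod (G l))\<^sup>2))"
   by (intro lim_imp_Liminf[symmetric]) auto
 qed
 also have "\<dots> <= liminf (\<lambda>n. NN l. ennreal (exp (- l\<^sup>2 / (2 * (real (Suc n))\<^sup>2)) * (cmod (G l))\<^sup>2))"
  by (rule nn_integral_liminf) measurable
 also have "\<dots> <= liminf (\<lambda>n. ennreal pi * (NN z. ennreal ((cmod (g z))\<^sup>2)))"
  by (intro Liminf_mono always_eventually allI main) simp
 also have "\<dots> = ennreal pi * (NN z. ennreal ((cmod (g z))\<^sup>2))" by (simp add: Liminf_const)
 finally show ?thesis unfolding G_def .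
qed

section \<open>Weighted square integrable functions\<close>

lemma nn_integral_inverse_quadratic: "(NN x. ennreal (1 / (1 + x\<^sup>2))) <= ennreal pi"
proof -
 have h: "(NN x. ennreal (1 / (1 + x\<^sup>2)) * indicator {0..} x) = ennreal (pi/2 - arctan 0)"
 proof (rule nn_integral_FTC_atLeast)
  show "(arctan \<longlongrightarrow> pi/2) at_top" by (rule tendsto_arctan_at_top)
  show "DERIV arctan x :> 1 / (1 + x\<^sup>2)" for x using DERIV_arctan[of x] by (simp add: inverse_eq_divide)
 qed auto
 have "(NN x. ennreal (1 / (1 + x\<^sup>2)))
  <= (NN x. ennreal (1 / (1 + x\<^sup>2)) * indicator {0..} x + ennreal (1 / (1 + (-x)\<^sup>2)) * indicator {0..} (-x))"
  by (intro nn_integral_mono) (auto simp: indicator_def)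
 also have "\<dots> = (NN x. ennreal (1 / (1 + x\<^sup>2)) * indicator {0..} x)
  + (NN x. ennreal (1 / (1 + (-x)\<^sup>2)) * indicator {0..} (-x))"
  by (rule nn_integral_add) measurable
 also have "(NN x. ennreal (1 / (1 + (-x)\<^sup>2)) * indicator {0..} (-x))
  = (NN x. ennreal (1 / (1 + x\<^sup>2)) * indicator {0..} x)"
  using nn_integral_real_affine[of "\<lambda>x. ennreal (1 / (1 + x\<^sup>2)) * indicator {0..} x" "-1" 0] by simp
 finally show ?thesis unfolding h by (simp add: ennreal_plus[symmetric] del: ennreal_plus)
qed

definition WN :: "(real => complex) => ennreal" where
 "WN g = (NN x. ennreal ((1 + x\<^sup>2) * (cmod (g x))\<^sup>2))"

definition wL2 :: "(real => complex) => bool" where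
 "wL2 g \<longleftrightarrow> g \<in> bor \<and> WN g < \<infinity>"

lemma wL2_meas [measurable_dest]: "wL2 g ==> g \<in> bor"
 by (simp add: wL2_def)

lemma wL2_bound:
 assumes "wL2 g" obtains W where "W >= 0" "WN g <= ennreal W"
 using assms by (cases "WN g") (auto simp: wL2_def)

text \<open>Write \<open>g\<close> as \<open>1/<x>\<close> times \<open><x> g\<close>; the square of
  the first factor has integral at most pi.\<close>

lemma WN_L1:
 assumes [measurable]: "g \<in> bor"
 shows "(NN x. ennreal (cmod (g x)))\<^sup>2 <= ennreal pi * WN g"
proof -
 have "(NN x. ennreal (cmod (g x))) = (NN x. ennreal \<bar>(1 / sqrt (1 + x\<^sup>2)) * (sqrt (1 + x\<^sup>2) * cmod (g x))\<bar>)"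
 proof (rule nn_integral_cong)
  fix x :: real
  have "1 + x\<^sup>2 > 0" by (simp add: add_pos_nonneg)
  then have "sqrt (1 + x\<^sup>2) > 0" by (simp only: real_sqrt_gt_0_iff)
  then show "ennreal (cmod (g x)) = ennreal \<bar>(1 / sqrt (1 + x\<^sup>2)) * (sqrt (1 + x\<^sup>2) * cmod (g x))\<bar>" by simp
 qed
 then have "(NN x. ennreal (cmod (g x)))\<^sup>2 \<le>
  (NN x. ennreal ((1 / sqrt (1 + x\<^sup>2))\<^sup>2)) * (NN x. ennreal ((sqrt (1 + x\<^sup>2) * cmod (g x))\<^sup>2))"
  by (simp only:) (rule nn_Cauchy_Schwarz; measurable)
 also have "(NN x. ennreal ((1 / sqrt (1 + x\<^sup>2))\<^sup>2)) <= ennreal pi"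
  using nn_integral_inverse_quadratic by (simp add: power_divide)
 also have "(NN x. ennreal ((sqrt (1 + x\<^sup>2) * cmod (g x))\<^sup>2)) = WN g"
  by (simp add: WN_def power_mult_distrib)
 finally show ?thesis by (simp add: mult_right_mono)
qed

lemma wL2_integrable: assumes "wL2 g" shows "integrable lborel g"
proof -
 have [measurable]: "g \<in> bor" using assms by auto
 have "(NN x. ennreal (cmod (g x)))\<^sup>2 < \<infinity>"
  using WN_L1[of g] assms by (auto simp: wL2_def ennreal_mult_less_top intro: le_less_trans)
 then have "(NN x. ennreal (cmod (g x))) < \<infinity>"
  by (simp add: power_less_top_ennreal)
 then show ?thesis by (simp add: integrable_iff_bounded)
qed

text \<open>The origin of the rate \<open>1/(1 + x^2)\<close> in all later bounds: beyond
  \<open>x\<close> the weight is at least its value at \<open>x\<close>. This comparison needs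
  \<open>x >= 0\<close>, which confines the estimates to a half line.\<close>

lemma wL2_tail:
 assumes [measurable]: "g \<in> bor" and "x >= 0"
 shows "(NN z. ennreal ((cmod (g z))\<^sup>2) * indicator {x..} z) <= ennreal (1 / (1 + x\<^sup>2)) * WN g"
proof -
 have "(NN z. ennreal ((cmod (g z))\<^sup>2) * indicator {x..} z) <= (NN z. ennreal (1 / (1 + x\<^sup>2)) * ennreal ((1 + z\<^sup>2) * (cmod (g z))\<^sup>2))"
 proof (rule nn_integral_mono)
  fix z
  have "(cmod (g z))\<^sup>2 <= 1 / (1 + x\<^sup>2) * ((1 + z\<^sup>2) * (cmod (g z))\<^sup>2)" if "z >= x"
  proof -
   have "x\<^sup>2 <= z\<^sup>2" using that assms(2) by (intro power_mono) auto
   moreover have "1 + x\<^sup>2 > 0" by (simp add: add_pos_nonneg)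
   ultimately have "1 <= (1 + z\<^sup>2) / (1 + x\<^sup>2)" by simp
   from mult_right_mono[OF this, of "(cmod (g z))\<^sup>2"] show ?thesis by simp
  qed
  then show "ennreal ((cmod (g z))\<^sup>2) * indicator {x..} z <= ennreal (1 / (1 + x\<^sup>2)) * ennreal ((1 + z\<^sup>2) * (cmod (g z))\<^sup>2)"
   by (auto simp: indicator_def ennreal_mult[symmetric] intro!: ennreal_leI)
 qed
 also have "\<dots> = ennreal (1 / (1 + x\<^sup>2)) * WN g" unfolding WN_def by (rule nn_integral_cmult) simp
 finally show ?thesis .
qed

lemma wL2_mono:
 assumes "wL2 g" "f \<in> bor" "\<And>x. cmod (f x) <= c * cmod (g x)" "c >= 0"
 shows "wL2 f"
proof -
 have [measurable]: "g \<in> bor" "f \<in> bor" using assms by auto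
 have "WN f <= (NN x. ennreal (c\<^sup>2) * ennreal ((1 + x\<^sup>2) * (cmod (g x))\<^sup>2))"
  unfolding WN_def
 proof (rule nn_integral_mono)
  fix x
  have "(cmod (f x))\<^sup>2 <= (c * cmod (g x))\<^sup>2" by (intro power_mono assms(3)) auto
  then have "(1 + x\<^sup>2) * (cmod (f x))\<^sup>2 <= (1 + x\<^sup>2) * (c * cmod (g x))\<^sup>2" by (intro mult_left_mono) auto
  also have "\<dots> = c\<^sup>2 * ((1 + x\<^sup>2) * (cmod (g x))\<^sup>2)" by (simp only: power_mult_distrib mult_ac)
  finally show "ennreal ((1 + x\<^sup>2) * (cmod (f x))\<^sup>2) <= ennreal (c\<^sup>2) * ennreal ((1 + x\<^sup>2) * (cmod (g x))\<^sup>2)"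
   by (subst ennreal_mult[symmetric]) (auto intro!: ennreal_leI)
 qed
 also have "\<dots> = ennreal (c\<^sup>2) * WN g" unfolding WN_def by (rule nn_integral_cmult) simp
 also have "\<dots> < \<infinity>" using assms(1) by (simp add: wL2_def ennreal_mult_less_top)
 finally show ?thesis using assms(2) by (simp add: wL2_def)
qed

lemma wL2_cmult: "wL2 g ==> wL2 (\<lambda>x. c * g x)"
 by (rule wL2_mono[of g _ "cmod c"]) (auto simp: norm_mult)

lemma wL2_cnj: "wL2 g ==> wL2 (\<lambda>x. cnj (g x))"
 by (rule wL2_mono[of g _ 1]) auto

lemma wL2_abs: "wL2 g ==> wL2 (\<lambda>x. cor (cmod (g x)))"
 by (rule wL2_mono[of g _ 1]) auto

lemma wL2_mult_bounded:
 assumes "wL2 g" "c \<in> bor" "\<And>x. cmod (c x) <= M"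
 shows "wL2 (\<lambda>x. c x * g x)"
proof (rule wL2_mono[OF assms(1)])
 have [measurable]: "g \<in> bor" using assms by auto
 note [measurable] = assms(2)
 show "(\<lambda>x. c x * g x) \<in> bor" by measurable
 show "cmod (c x * g x) <= M * cmod (g x)" for x
  unfolding norm_mult by (intro mult_right_mono assms) simp
 show "M >= 0" using assms(3)[of 0] norm_ge_zero order_trans by blast
qed

lemma wL2_add:
 assumes "wL2 f" "wL2 g" shows "wL2 (\<lambda>x. f x + g x)"
proof -
 have [measurable]: "g \<in> bor" "f \<in> bor" using assms by auto
 have "WN (\<lambda>x. f x + g x) <= (NN x. 2 * ennreal ((1 + x\<^sup>2) * (cmod (f x))\<^sup>2) + 2 * ennreal ((1 + x\<^sup>2) * (cmod (g x))\<^sup>2))"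
  unfolding WN_def
 proof (rule nn_integral_mono)
  fix x
  have "(1 + x\<^sup>2) * (cmod (f x + g x))\<^sup>2 <= (1 + x\<^sup>2) * (2 * (cmod (f x))\<^sup>2 + 2 * (cmod (g x))\<^sup>2)"
   by (intro mult_left_mono cmod_add_square_le) auto
  then have "ennreal ((1 + x\<^sup>2) * (cmod (f x + g x))\<^sup>2) <= ennreal (2 * ((1 + x\<^sup>2) * (cmod (f x))\<^sup>2) + 2 * ((1 + x\<^sup>2) * (cmod (g x))\<^sup>2))"
   by (intro ennreal_leI) (simp add: algebra_simps)
  also have "\<dots> = 2 * ennreal ((1 + x\<^sup>2) * (cmod (f x))\<^sup>2) + 2 * ennreal ((1 + x\<^sup>2) * (cmod (g x))\<^sup>2)"
   by (subst ennreal_plus) (auto simp: ennreal_mult)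
  finally show "ennreal ((1 + x\<^sup>2) * (cmod (f x + g x))\<^sup>2) <= 2 * ennreal ((1 + x\<^sup>2) * (cmod (f x))\<^sup>2) + 2 * ennreal ((1 + x\<^sup>2) * (cmod (g x))\<^sup>2)" .
 qed
 also have "\<dots> = 2 * WN f + 2 * WN g" unfolding WN_def by (simp add: nn_integral_add nn_integral_cmult)
 also have "\<dots> < \<infinity>" using assms by (simp add: wL2_def ennreal_mult_less_top)
 finally show ?thesis by (simp add: wL2_def)
qed

lemma ennreal_square_sum: "((a::ennreal) + b)\<^sup>2 <= 2 * a\<^sup>2 + 2 * b\<^sup>2"
proof (cases "a = \<infinity> \<or> b = \<infinity>")
 case True
 then show ?thesis by (auto simp: ennreal_mult_eq_top_iff power2_eq_square ennreal_top_mult)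
next
 case False
 then obtain x y where xy: "a = ennreal x" "b = ennreal y" "x >= 0" "y >= 0" by (cases a; cases b) auto
 have "(x + y)\<^sup>2 <= 2 * x\<^sup>2 + 2 * y\<^sup>2" using sum_squares_bound[of x y] by (simp add: power2_sum)
 then have "ennreal ((x + y)\<^sup>2) <= ennreal (2 * x\<^sup>2 + 2 * y\<^sup>2)" by (rule ennreal_leI)
 moreover have "(a + b)\<^sup>2 = ennreal ((x + y)\<^sup>2)"
  using xy by (simp add: ennreal_plus[symmetric] ennreal_power del: ennreal_plus)
 moreover have "ennreal (2 * x\<^sup>2 + 2 * y\<^sup>2) = 2 * a\<^sup>2 + 2 * b\<^sup>2"
  using xy by (simp add: ennreal_power ennreal_mult)
 ultimately show ?thesis by simp
qed

text \<open>Infinity also satisfies the inequality, so finiteness of \<open>S\<close> has to be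
  secured first; each use below has its own argument for that.\<close>

lemma ennreal_absorb:
 assumes "S < \<infinity>" "S <= ennreal c + ennreal (1/2) * S" "c >= 0"
 shows "S <= ennreal (2 * c)"
proof -
 obtain s where s: "S = ennreal s" "s >= 0" using assms(1) by (cases S) auto
 have "ennreal s <= ennreal (c + 1/2 * s)"
  using assms(2,3) s ennreal_plus[of c "1/2 * s"] ennreal_mult[of "1/2" s] by simp
 then have "s <= c + 1/2 * s" using s assms(3) by (subst (asm) ennreal_le_iff) auto
 then show ?thesis unfolding s(1) by (intro ennreal_leI) simp
qed

section \<open>Functions of position and spectral parameter\<close>

definition pmeas :: "(real => real => complex) => bool" where
 "pmeas F \<longleftrightarrow> (\<lambda>q. F (fst q) (snd q)) \<in> borel_measurable (borel \<Otimes>\<^sub>M borel)"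

lemma pmeas_comp:
 assumes "pmeas F" "a \<in> borel_measurable M" "b \<in> borel_measurable M"
 shows "(\<lambda>x. F (a x) (b x)) \<in> borel_measurable M"
 using measurable_compose[OF measurable_Pair[OF assms(2,3)], of "\<lambda>q. F (fst q) (snd q)" borel] assms(1)
 by (simp add: pmeas_def)

lemma pmeasI: "(\<lambda>q. F (fst q) (snd q)) \<in> borel_measurable (borel \<Otimes>\<^sub>M borel) ==> pmeas F"
 by (simp add: pmeas_def)

lemma pmeas_continuous:
 assumes "continuous_on UNIV (\<lambda>(x, l). F x l)" shows "pmeas F"
proof -
 have "(\<lambda>(x, l). F x l) \<in> bor" using assms by (rule borel_measurable_continuous_onI)
 then show ?thesis by (simp add: pmeas_def borel_prod case_prod_beta')
qed

lemma N2_bounded_mult: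
 assumes [measurable]: "g \<in> bor" "f \<in> bor" and "\<And>x. cmod (f x) <= c * cmod (g x)"
 shows "N2 f <= ennreal (c\<^sup>2) * N2 g"
proof -
 have "N2 f <= (NN x. ennreal (c\<^sup>2) * ennreal ((cmod (g x))\<^sup>2))"
  unfolding N2_def
 proof (rule nn_integral_mono)
  fix x
  have "(cmod (f x))\<^sup>2 <= (c * cmod (g x))\<^sup>2" by (intro power_mono assms(3)) auto
  then show "ennreal ((cmod (f x))\<^sup>2) <= ennreal (c\<^sup>2) * ennreal ((cmod (g x))\<^sup>2)"
   by (auto simp: ennreal_mult[symmetric] power_mult_distrib intro!: ennreal_leI)
 qed
 also have "\<dots> = ennreal (c\<^sup>2) * N2 g" unfolding N2_def by (rule nn_integral_cmult) simp
 finally show ?thesis .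
qed

lemma N2_shift:
 assumes [measurable]: "V \<in> bor" shows "N2 (\<lambda>l. V (l + h)) = N2 V"
 using nn_integral_real_affine[of "\<lambda>l. ennreal ((cmod (V l))\<^sup>2)" 1 h] by (simp add: N2_def add.commute)

text \<open>Cauchy-Schwarz in \<open>z\<close> followed by Tonelli takes the place of Minkowski's
  integral inequality. It is used in two ways: an L1 coefficient is split evenly into square roots,
  or the whole coefficient goes into \<open>u\<close> and the decay of \<open>N2 (a z)\<close> makes
  the other factor integrable.\<close>

lemma nn_square_factor:
 fixes u w :: "real => real" and a :: "real => real => complex"
 assumes [measurable]: "u \<in> bor" "w \<in> bor" and a: "pmeas a"
 shows "(NN l. (NN z. ennreal (\<bar>u z * w z\<bar> * cmod (a z l)) * indicator {x..} z)\<^sup>2)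
  <= (NN z. ennreal ((u z)\<^sup>2) * indicator {x..} z) * (NN z. ennreal ((w z)\<^sup>2) * N2 (a z) * indicator {x..} z)"
proof -
 note [measurable (raw)] = pmeas_comp[OF a]
 let ?U = "NN z. ennreal ((u z)\<^sup>2) * indicator {x..} z"
 have "(NN l. (NN z. ennreal (\<bar>u z * w z\<bar> * cmod (a z l)) * indicator {x..} z)\<^sup>2)
  <= (NN l. ?U * (NN z. ennreal ((w z)\<^sup>2) * ennreal ((cmod (a z l))\<^sup>2) * indicator {x..} z))"
 proof (rule nn_integral_mono)
  fix l
  have "(NN z. ennreal (\<bar>u z * w z\<bar> * cmod (a z l)) * indicator {x..} z)
   = (NN z. ennreal \<bar>(u z * indicator {x..} z) * (w z * cmod (a z l) * indicator {x..} z)\<bar>)"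
   by (intro nn_integral_cong) (auto simp: indicator_def abs_mult)
  also have "\<dots>\<^sup>2 <= (NN z. ennreal ((u z * indicator {x..} z)\<^sup>2)) * (NN z. ennreal ((w z * cmod (a z l) * indicator {x..} z)\<^sup>2))"
   by (rule nn_Cauchy_Schwarz) measurable
  also have "(NN z. ennreal ((u z * indicator {x..} z)\<^sup>2)) = ?U"
   by (intro nn_integral_cong) (auto simp: indicator_def)
  also have "(NN z. ennreal ((w z * cmod (a z l) * indicator {x..} z)\<^sup>2))
   = (NN z. ennreal ((w z)\<^sup>2) * ennreal ((cmod (a z l))\<^sup>2) * indicator {x..} z)"
   by (intro nn_integral_cong) (auto simp: indicator_def power_mult_distrib ennreal_mult)
  finally show "(NN z. ennreal (\<bar>u z * w z\<bar> * cmod (a z l)) * indicator {x..} z)\<^sup>2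
   <= ?U * (NN z. ennreal ((w z)\<^sup>2) * ennreal ((cmod (a z l))\<^sup>2) * indicator {x..} z)" .
 qed
 also have "\<dots> = ?U * (NN l. (NN z. ennreal ((w z)\<^sup>2) * ennreal ((cmod (a z l))\<^sup>2) * indicator {x..} z))"
  by (rule nn_integral_cmult) measurable
 also have "(NN l. (NN z. ennreal ((w z)\<^sup>2) * ennreal ((cmod (a z l))\<^sup>2) * indicator {x..} z))
  = (NN z. (NN l. ennreal ((w z)\<^sup>2) * ennreal ((cmod (a z l))\<^sup>2) * indicator {x..} z))"
  using lborel_pair.Fubini[of "\<lambda>(z, l). ennreal ((w z)\<^sup>2) * ennreal ((cmod (a z l))\<^sup>2) * indicator {x..} z"]
  by simp
 also have "\<dots> = (NN z. ennreal ((w z)\<^sup>2) * N2 (a z) * indicator {x..} z)"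
  unfolding N2_def by (intro nn_integral_cong) (simp add: nn_integral_cmult nn_integral_multc)
 finally show ?thesis .
qed

lemma nn_square_L1:
 fixes w :: "real => real" and a :: "real => real => complex"
 assumes [measurable]: "w \<in> bor" and a: "pmeas a"
  and K: "(NN z. ennreal \<bar>w z\<bar>) <= ennreal K" and A: "\<And>z. z >= x ==> N2 (a z) <= A"
 shows "(NN l. (NN z. ennreal (\<bar>w z\<bar> * cmod (a z l)) * indicator {x..} z)\<^sup>2)
  <= ennreal K * (ennreal K * A)"
proof -
 let ?s = "\<lambda>z. sqrt \<bar>w z\<bar>"
 have "(NN l. (NN z. ennreal (\<bar>w z\<bar> * cmod (a z l)) * indicator {x..} z)\<^sup>2)
  <= (NN z. ennreal ((?s z)\<^sup>2) * indicator {x..} z) * (NN z. ennreal ((?s z)\<^sup>2) * N2 (a z) * indicator {x..} z)"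
  using nn_square_factor[of ?s ?s a x] a by simp
 also have "\<dots> <= ennreal K * (ennreal K * A)"
 proof (rule mult_mono)
  have "(NN z. ennreal ((?s z)\<^sup>2) * indicator {x..} z) <= (NN z. ennreal \<bar>w z\<bar>)"
   by (intro nn_integral_mono) (auto simp: indicator_def)
  then show "(NN z. ennreal ((?s z)\<^sup>2) * indicator {x..} z) <= ennreal K" using K by (rule order_trans)
  have "(NN z. ennreal ((?s z)\<^sup>2) * N2 (a z) * indicator {x..} z) <= (NN z. ennreal \<bar>w z\<bar> * A)"
   by (intro nn_integral_mono) (use A in \<open>auto simp: indicator_def intro!: mult_left_mono\<close>)
  also have "\<dots> = (NN z. ennreal \<bar>w z\<bar>) * A" by (rule nn_integral_multc) simp
  also have "\<dots> <= ennreal K * A" using K by (rule mult_right_mono) simp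
  finally show "(NN z. ennreal ((?s z)\<^sup>2) * N2 (a z) * indicator {x..} z) <= ennreal K * A" .
 qed auto
 finally show ?thesis .
qed

lemma nn_square_weight:
 fixes u :: "real => real" and a :: "real => real => complex"
 assumes [measurable]: "u \<in> bor" and a: "pmeas a" and x: "x >= 0"
  and W: "(NN z. ennreal ((u z)\<^sup>2)) <= ennreal W" and A: "\<And>z. z >= 0 ==> N2 (a z) <= ennreal (C / (1 + z\<^sup>2))" and C: "C >= 0"
 shows "(NN l. (NN z. ennreal (\<bar>u z\<bar> * cmod (a z l)) * indicator {x..} z)\<^sup>2)
  <= ennreal W * ennreal (C * pi)"
proof -
 have "(NN l. (NN z. ennreal (\<bar>u z\<bar> * cmod (a z l)) * indicator {x..} z)\<^sup>2)
  <= (NN z. ennreal ((u z)\<^sup>2) * indicator {x..} z) * (NN z. ennreal (1\<^sup>2) * N2 (a z) * indicator {x..} z)"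
  using nn_square_factor[of u "\<lambda>_. 1" a x] a by simp
 also have "\<dots> <= ennreal W * ennreal (C * pi)"
 proof (rule mult_mono)
  have "(NN z. ennreal ((u z)\<^sup>2) * indicator {x..} z) <= (NN z. ennreal ((u z)\<^sup>2))"
   by (intro nn_integral_mono) (auto simp: indicator_def)
  then show "(NN z. ennreal ((u z)\<^sup>2) * indicator {x..} z) <= ennreal W" using W by (rule order_trans)
  have "(NN z. ennreal (1\<^sup>2) * N2 (a z) * indicator {x..} z) <= (NN z. ennreal C * ennreal (1 / (1 + z\<^sup>2)))"
  proof (rule nn_integral_mono)
   fix z show "ennreal (1\<^sup>2) * N2 (a z) * indicator {x..} z <= ennreal C * ennreal (1 / (1 + z\<^sup>2))"
    using A[of z] x C by (auto simp: indicator_def ennreal_mult[symmetric])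
  qed
  also have "\<dots> = ennreal C * (NN z. ennreal (1 / (1 + z\<^sup>2)))" by (rule nn_integral_cmult) simp
  also have "\<dots> <= ennreal C * ennreal pi" by (intro mult_left_mono nn_integral_inverse_quadratic) simp
  also have "\<dots> = ennreal (C * pi)" using C by (simp add: ennreal_mult)
  finally show "(NN z. ennreal (1\<^sup>2) * N2 (a z) * indicator {x..} z) <= ennreal (C * pi)" .
 qed auto
 finally show ?thesis .
qed

text \<open>Bounds for \<open>x >= 0\<close> only. The supremum bound makes the class an algebra;
  the decay of \<open>N2\<close> is that of a weighted tail; the increments in \<open>l\<close> come
  without decay, because the weight is used up by differentiating the phase.\<close>

definition good :: "(real => real => complex) => bool" where
 "good V \<longleftrightarrow> continuous_on UNIV (\<lambda>(x, l). V x l) \<and>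
  (\<exists>C\<ge>0. \<forall>x\<ge>0. (\<forall>l. cmod (V x l) <= C) \<and> N2 (V x) <= ennreal (C / (1 + x\<^sup>2)) \<and>
   (\<forall>h. N2 (\<lambda>l. V x (l + h) - V x l) <= ennreal (C * h\<^sup>2)))"

lemma pair_cont_snd: "continuous_on UNIV (\<lambda>(x, l). V x l) ==> continuous_on UNIV (V x)"
proof -
 assume "continuous_on UNIV (\<lambda>(x, l). V x l)"
 moreover have "continuous_on UNIV (\<lambda>l. (x, l))" by (intro continuous_intros)
 ultimately have "continuous_on UNIV (\<lambda>l. case (x, l) of (x, l) => V x l)" by (rule continuous_on_compose2) simp
 then show ?thesis by simp
qed

lemma goodE:
 assumes "good V"
 obtains C where "C >= 0" "\<And>x l. x >= 0 ==> cmod (V x l) <= C" "\<And>x. x >= 0 ==> N2 (V x) <= ennreal (C / (1 + x\<^sup>2))"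
  "\<And>x h. x >= 0 ==> N2 (\<lambda>l. V x (l + h) - V x l) <= ennreal (C * h\<^sup>2)"
 using assms unfolding good_def by blast

definition good_bound :: "real => (real => real => complex) => bool" where
 "good_bound C V \<longleftrightarrow> C >= 0 \<and> (\<forall>x l. x >= 0 \<longrightarrow> cmod (V x l) <= C) \<and> (\<forall>x\<ge>0. N2 (V x) <= ennreal (C / (1 + x\<^sup>2))) \<and>
  (\<forall>x h. x >= 0 \<longrightarrow> N2 (\<lambda>l. V x (l + h) - V x l) <= ennreal (C * h\<^sup>2))"

lemma good_boundD:
 assumes "good_bound C V"
 shows "C >= 0" "x >= 0 ==> cmod (V x l) <= C" "x >= 0 ==> N2 (V x) <= ennreal (C / (1 + x\<^sup>2))"
  "x >= 0 ==> N2 (\<lambda>l. V x (l + h) - V x l) <= ennreal (C * h\<^sup>2)"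
 using assms unfolding good_bound_def by blast+

lemma good_boundE: assumes "good V" obtains C where "good_bound C V"
 using assms that unfolding good_def good_bound_def by blast

lemma good_cont: "good V ==> continuous_on UNIV (\<lambda>(x, l). V x l)"
 by (simp add: good_def)

lemma good_meas: "good V ==> V x \<in> bor"
 by (rule borel_measurable_continuous_onI[OF pair_cont_snd[OF good_cont]])

lemma goodI:
 assumes "continuous_on UNIV (\<lambda>(x, l). V x l)" "C1 >= 0" "C2 >= 0" "C3 >= 0"
 "\<And>x l. x >= 0 ==> cmod (V x l) <= C1" "\<And>x. x >= 0 ==> N2 (V x) <= ennreal (C2 / (1 + x\<^sup>2))"
  "\<And>x h. x >= 0 ==> N2 (\<lambda>l. V x (l + h) - V x l) <= ennreal (C3 * h\<^sup>2)"
 shows "good V"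
 unfolding good_def
proof (intro conjI exI[of _ "C1 + C2 + C3"] allI impI)
 show "cmod (V x l) <= C1 + C2 + C3" if "x >= 0" for x l using assms(5)[OF that, of l] assms(3,4) by simp
 show "N2 (V x) <= ennreal ((C1 + C2 + C3) / (1 + x\<^sup>2))" if "x >= 0" for x
  by (rule order_trans[OF assms(6)[OF that]]) (use assms(2,4) in \<open>auto intro!: ennreal_leI divide_right_mono\<close>)
 show "N2 (\<lambda>l. V x (l + h) - V x l) <= ennreal ((C1 + C2 + C3) * h\<^sup>2)" if "x >= 0" for x h
  by (rule order_trans[OF assms(7)[OF that]]) (use assms(2,3) in \<open>auto intro!: ennreal_leI mult_right_mono\<close>)
qed (use assms in auto)

lemma ennreal_lincomb:
 assumes "X <= ennreal a" "Y <= ennreal b" "a >= 0" "b >= 0" "s >= 0" "t >= 0"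
 shows "ennreal s * X + ennreal t * Y <= ennreal (s * a + t * b)"
proof -
 have "ennreal s * X + ennreal t * Y <= ennreal s * ennreal a + ennreal t * ennreal b"
  by (intro add_mono mult_left_mono assms) auto
 then show ?thesis using assms by (simp add: ennreal_mult)
qed

lemma N2_add':
 assumes "f \<in> bor" "g \<in> bor" "N2 f <= ennreal a" "N2 g <= ennreal b" "a >= 0" "b >= 0"
 shows "N2 (\<lambda>x. f x + g x) <= ennreal (2 * a + 2 * b)"
 using order_trans[OF N2_add[OF assms(1,2)]] ennreal_lincomb[OF assms(3-6), of 2 2] by simp

lemma good_add:
 assumes V: "good V" and W: "good W" shows "good (\<lambda>x l. V x l + W x l)"
proof -
 obtain A where "good_bound A V" using good_boundE[OF V] .
 note A = good_boundD[OF this]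
 obtain B where "good_bound B W" using good_boundE[OF W] .
 note B = good_boundD[OF this]
 note [measurable] = good_meas[OF V] good_meas[OF W]
 show ?thesis
 proof (rule goodI[of _ "A + B" "2*A + 2*B" "2*A + 2*B"])
  show "continuous_on UNIV (\<lambda>(x, l). V x l + W x l)"
   using continuous_on_add[OF good_cont[OF V] good_cont[OF W]] by (simp add: case_prod_beta')
  fix x :: real assume x: "x >= 0"
  show "cmod (V x l + W x l) <= A + B" for l by (rule norm_triangle_le[OF add_mono[OF A(2)[OF x] B(2)[OF x]]])
  show "N2 (\<lambda>l. V x l + W x l) <= ennreal ((2*A + 2*B) / (1 + x\<^sup>2))"
   using N2_add'[OF _ _ A(3)[OF x] B(3)[OF x]] A(1) B(1) by (simp add: add_divide_distrib)
  fix h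
  have "N2 (\<lambda>l. (V x (l + h) - V x l) + (W x (l + h) - W x l)) <= ennreal (2 * (A * h\<^sup>2) + 2 * (B * h\<^sup>2))"
   by (rule N2_add'[OF _ _ A(4)[OF x] B(4)[OF x]]) (use A(1) B(1) in auto)
  then show "N2 (\<lambda>l. V x (l + h) + W x (l + h) - (V x l + W x l)) <= ennreal ((2*A + 2*B) * h\<^sup>2)"
   by (simp add: algebra_simps)
 qed (use A(1) B(1) in auto)
qed

text \<open>The increment of the product has a part where the multiplier moves; it is controlled by
  the Lipschitz constant \<open>L\<close> and the L2 bound of \<open>V\<close> itself.\<close>

lemma good_cmult:
 assumes V: "good V" and \<mu>: "continuous_on UNIV \<mu>" "\<And>l. cmod (\<mu> l) <= K" "\<And>l h. cmod (\<mu> (l + h) - \<mu> l) <= L * \<bar>h\<bar>"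
 shows "good (\<lambda>x l. \<mu> l * V x l)"
proof -
 obtain A where "good_bound A V" using good_boundE[OF V] .
 note A = good_boundD[OF this]
 have K: "K >= 0" using \<mu>(2)[of 0] norm_ge_zero order_trans by blast
 note [measurable] = good_meas[OF V] borel_measurable_continuous_onI[OF \<mu>(1)]
 show ?thesis
 proof (rule goodI[of _ "K * A" "K\<^sup>2 * A" "2 * (K\<^sup>2 * A) + 2 * (L\<^sup>2 * A)"])
  show "continuous_on UNIV (\<lambda>(x, l). \<mu> l * V x l)"
  proof -
   have "continuous_on UNIV (\<lambda>q. \<mu> (snd q))"
    by (rule continuous_on_compose2[OF \<mu>(1)]) (auto intro!: continuous_intros)
   from continuous_on_mult[OF this good_cont[OF V]] show ?thesis by (simp add: case_prod_beta')
  qed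
  fix x :: real assume x: "x >= 0"
  show "cmod (\<mu> l * V x l) <= K * A" for l unfolding norm_mult by (intro mult_mono \<mu> A x K) auto
  have "N2 (\<lambda>l. \<mu> l * V x l) <= ennreal (K\<^sup>2) * N2 (V x)"
   by (rule N2_bounded_mult) (auto simp: norm_mult intro!: mult_right_mono \<mu>)
  also have "\<dots> <= ennreal (K\<^sup>2) * ennreal (A / (1 + x\<^sup>2))" by (intro mult_left_mono A x) auto
  finally show "N2 (\<lambda>l. \<mu> l * V x l) <= ennreal (K\<^sup>2 * A / (1 + x\<^sup>2))"
   using A(1) by (simp add: ennreal_mult[symmetric])
  fix h
  have 1: "N2 (\<lambda>l. \<mu> (l + h) * (V x (l + h) - V x l)) <= ennreal (K\<^sup>2 * (A * h\<^sup>2))"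
  proof -
   have "N2 (\<lambda>l. \<mu> (l + h) * (V x (l + h) - V x l)) <= ennreal (K\<^sup>2) * N2 (\<lambda>l. V x (l + h) - V x l)"
    by (rule N2_bounded_mult) (auto simp: norm_mult intro!: mult_right_mono \<mu>)
   also have "\<dots> <= ennreal (K\<^sup>2) * ennreal (A * h\<^sup>2)" by (intro mult_left_mono A x) auto
   finally show ?thesis using A(1) by (simp add: ennreal_mult[symmetric])
  qed
  have 2: "N2 (\<lambda>l. (\<mu> (l + h) - \<mu> l) * V x l) <= ennreal ((L * \<bar>h\<bar>)\<^sup>2 * (A / (1 + x\<^sup>2)))"
  proof -
   have "N2 (\<lambda>l. (\<mu> (l + h) - \<mu> l) * V x l) <= ennreal ((L * \<bar>h\<bar>)\<^sup>2) * N2 (V x)"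
    by (rule N2_bounded_mult) (auto simp: norm_mult intro!: mult_right_mono \<mu>)
   also have "\<dots> <= ennreal ((L * \<bar>h\<bar>)\<^sup>2) * ennreal (A / (1 + x\<^sup>2))" by (intro mult_left_mono A x) auto
   finally show ?thesis using A(1) by (simp add: ennreal_mult[symmetric])
  qed
  have "N2 (\<lambda>l. \<mu> (l + h) * (V x (l + h) - V x l) + (\<mu> (l + h) - \<mu> l) * V x l) <= ennreal (2 * (K\<^sup>2 * (A * h\<^sup>2)) + 2 * ((L * \<bar>h\<bar>)\<^sup>2 * (A / (1 + x\<^sup>2))))"
   by (rule N2_add'[OF _ _ 1 2]) (use A(1) in auto)
  also have "\<dots> <= ennreal ((2 * (K\<^sup>2 * A) + 2 * (L\<^sup>2 * A)) * h\<^sup>2)"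
  proof (rule ennreal_leI)
   have "A / (1 + x\<^sup>2) <= A" using A(1) by (simp add: divide_le_eq mult_le_cancel_left1 add_pos_nonneg)
   then have "(L * \<bar>h\<bar>)\<^sup>2 * (A / (1 + x\<^sup>2)) <= (L * \<bar>h\<bar>)\<^sup>2 * A" by (intro mult_left_mono) auto
   then have "2 * (K\<^sup>2 * (A * h\<^sup>2)) + 2 * ((L * \<bar>h\<bar>)\<^sup>2 * (A / (1 + x\<^sup>2))) <= 2 * (K\<^sup>2 * (A * h\<^sup>2)) + 2 * ((L * \<bar>h\<bar>)\<^sup>2 * A)"
    by linarith
   also have "\<dots> = (2 * (K\<^sup>2 * A) + 2 * (L\<^sup>2 * A)) * h\<^sup>2" by (simp add: power_mult_distrib algebra_simps)
   finally show "2 * (K\<^sup>2 * (A * h\<^sup>2)) + 2 * ((L * \<bar>h\<bar>)\<^sup>2 * (A / (1 + x\<^sup>2))) <= (2 * (K\<^sup>2 * A) + 2 * (L\<^sup>2 * A)) * h\<^sup>2" .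
  qed
  finally show "N2 (\<lambda>l. \<mu> (l + h) * V x (l + h) - \<mu> l * V x l) <= ennreal ((2 * (K\<^sup>2 * A) + 2 * (L\<^sup>2 * A)) * h\<^sup>2)"
   by (simp add: algebra_simps)
 qed (use A(1) K in auto)
qed

lemma good_scale: "good V ==> good (\<lambda>x l. c * V x l)"
 by (rule good_cmult[of V "\<lambda>_. c" "cmod c" 0]) auto

lemma good_zero: "good (\<lambda>x l. 0)"
 by (rule goodI[of _ 0 0 0]) (auto simp: N2_def)

lemma good_sum: "(\<And>i. i \<in> I ==> good (V i)) ==> good (\<lambda>x l. \<Sum>i\<in>I. V i x l)"
 by (induction I rule: infinite_finite_induct) (auto intro: good_add good_zero)

lemma good_mult:
 assumes V: "good V" and W: "good W" shows "good (\<lambda>x l. V x l * W x l)"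
proof -
 obtain A where "good_bound A V" using good_boundE[OF V] .
 note A = good_boundD[OF this]
 obtain B where "good_bound B W" using good_boundE[OF W] .
 note B = good_boundD[OF this]
 note [measurable] = good_meas[OF V] good_meas[OF W]
 show ?thesis
 proof (rule goodI[of _ "A * B" "A\<^sup>2 * B" "2 * (A\<^sup>2 * B) + 2 * (B\<^sup>2 * A)"])
  show "continuous_on UNIV (\<lambda>(x, l). V x l * W x l)"
   using continuous_on_mult[OF good_cont[OF V] good_cont[OF W]] by (simp add: case_prod_beta')
  fix x :: real assume x: "x >= 0"
  show "cmod (V x l * W x l) <= A * B" for l unfolding norm_mult by (intro mult_mono A B x) auto
  have "N2 (\<lambda>l. V x l * W x l) <= ennreal (A\<^sup>2) * N2 (W x)"
   by (rule N2_bounded_mult) (auto simp: norm_mult intro!: mult_right_mono A x)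
  also have "\<dots> <= ennreal (A\<^sup>2) * ennreal (B / (1 + x\<^sup>2))" by (intro mult_left_mono B x) auto
  finally show "N2 (\<lambda>l. V x l * W x l) <= ennreal (A\<^sup>2 * B / (1 + x\<^sup>2))"
   using B(1) by (simp add: ennreal_mult[symmetric])
  fix h
  have 1: "N2 (\<lambda>l. V x (l + h) * (W x (l + h) - W x l)) <= ennreal (A\<^sup>2 * (B * h\<^sup>2))"
  proof -
   have "N2 (\<lambda>l. V x (l + h) * (W x (l + h) - W x l)) <= ennreal (A\<^sup>2) * N2 (\<lambda>l. W x (l + h) - W x l)"
    by (rule N2_bounded_mult) (auto simp: norm_mult intro!: mult_right_mono A x)
   also have "\<dots> <= ennreal (A\<^sup>2) * ennreal (B * h\<^sup>2)" by (intro mult_left_mono B x) auto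
   finally show ?thesis using B(1) by (simp add: ennreal_mult[symmetric])
  qed
  have 2: "N2 (\<lambda>l. W x l * (V x (l + h) - V x l)) <= ennreal (B\<^sup>2 * (A * h\<^sup>2))"
  proof -
   have "N2 (\<lambda>l. W x l * (V x (l + h) - V x l)) <= ennreal (B\<^sup>2) * N2 (\<lambda>l. V x (l + h) - V x l)"
    by (rule N2_bounded_mult) (auto simp: norm_mult intro!: mult_right_mono B x)
   also have "\<dots> <= ennreal (B\<^sup>2) * ennreal (A * h\<^sup>2)" by (intro mult_left_mono A x) auto
   finally show ?thesis using A(1) by (simp add: ennreal_mult[symmetric])
  qed
  have "N2 (\<lambda>l. V x (l + h) * (W x (l + h) - W x l) + W x l * (V x (l + h) - V x l)) <= ennreal (2 * (A\<^sup>2 * (B * h\<^sup>2)) + 2 * (B\<^sup>2 * (A * h\<^sup>2)))"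
   by (rule N2_add'[OF _ _ 1 2]) (use A(1) B(1) in auto)
  then show "N2 (\<lambda>l. V x (l + h) * W x (l + h) - V x l * W x l) <= ennreal ((2 * (A\<^sup>2 * B) + 2 * (B\<^sup>2 * A)) * h\<^sup>2)"
   by (simp add: algebra_simps)
 qed (use A(1) B(1) in auto)
qed

text \<open>Source terms: products of a weighted \<open>L\<^sup>2\<close> function of \<open>z\<close> with a function that behaves like
 a good one; only the bounds needed in the Duhamel estimates are recorded.\<close>

definition src_bounds :: "(real => real => complex) => (real => complex) => (real => real => complex) => (real => real => real => complex) => real => bool" where
 "src_bounds R k A B C \<longleftrightarrow> wL2 k \<and> C >= 0 \<and> pmeas R \<and> pmeas A \<and> (\<forall>h. pmeas (B h)) \<and>
  (\<forall>z\<ge>0. (\<forall>l. cmod (R z l) <= cmod (k z) * cmod (A z l) \<and> cmod (A z l) <= C) \<and> N2 (A z) <= ennreal (C / (1 + z\<^sup>2)) \<and>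
   (\<forall>h. (\<forall>l. cmod (R z (l + h) - R z l) <= cmod (k z) * cmod (B h z l)) \<and> N2 (B h z) <= ennreal (C * h\<^sup>2)))"

definition src :: "(real => real => complex) => bool" where
 "src R \<longleftrightarrow> (\<exists>k A B C. src_bounds R k A B C)"

lemma pmeas_good: "good V ==> pmeas V"
 by (rule pmeas_continuous[OF good_cont])

lemma src_mult:
 assumes g: "wL2 g" and Z: "good Z" shows "src (\<lambda>z l. g z * Z z l)"
proof -
 obtain A where "good_bound A Z" using good_boundE[OF Z] .
 note A = good_boundD[OF this]
 note [measurable (raw)] = pmeas_comp[OF pmeas_good[OF Z]]
 have [measurable]: "g \<in> bor" using g by auto
 have "src_bounds (\<lambda>z l. g z * Z z l) g Z (\<lambda>h z l. Z z (l + h) - Z z l) A"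
  unfolding src_bounds_def
 proof (intro conjI allI impI)
  show "pmeas (\<lambda>z l. g z * Z z l)" "pmeas (\<lambda>z l. Z z (l + h) - Z z l)" "pmeas Z" for h by (rule pmeasI; measurable)+
  show "cmod (g z * Z z (l + h) - g z * Z z l) <= cmod (g z) * cmod (Z z (l + h) - Z z l)" for z l h
   by (simp add: norm_mult right_diff_distrib[symmetric])
 qed (use A g in \<open>auto simp: norm_mult\<close>)
 then show ?thesis unfolding src_def by blast
qed

lemma src_add:
 assumes "src R1" "src R2" shows "src (\<lambda>z l. R1 z l + R2 z l)"
proof -
 obtain k A B C where 1: "src_bounds R1 k A B C" using assms unfolding src_def by blast
 obtain k' A' B' C' where 2: "src_bounds R2 k' A' B' C'" using assms unfolding src_def by blast
 \<comment> \<open>Two products are bounded by one: \<open>a c + b d <= (a + b) (c + d)\<close> for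
   nonnegative numbers. Absolute values are summed so that nothing cancels in the new
   factors.\<close>
 define k2 where "k2 z = cor (cmod (k z)) + cor (cmod (k' z))" for z
 define A2 where "A2 z l = cor (cmod (A z l)) + cor (cmod (A' z l))" for z l
 define B2 where "B2 h z l = cor (cmod (B h z l)) + cor (cmod (B' h z l))" for h z l
 have c: "cmod (cor (cmod a) + cor (cmod b)) = cmod a + cmod b" for a b
  by (simp add: of_real_add[symmetric] del: of_real_add)
 have m[measurable (raw)]: "\<And>a b M. a \<in> borel_measurable M ==> b \<in> borel_measurable M ==> (\<lambda>x. R1 (a x) (b x)) \<in> borel_measurable M"
  "\<And>a b M. a \<in> borel_measurable M ==> b \<in> borel_measurable M ==> (\<lambda>x. R2 (a x) (b x)) \<in> borel_measurable M"
  "\<And>a b M. a \<in> borel_measurable M ==> b \<in> borel_measurable M ==> (\<lambda>x. A (a x) (b x)) \<in> borel_measurable M"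
  "\<And>a b M. a \<in> borel_measurable M ==> b \<in> borel_measurable M ==> (\<lambda>x. A' (a x) (b x)) \<in> borel_measurable M"
  "\<And>h a b M. a \<in> borel_measurable M ==> b \<in> borel_measurable M ==> (\<lambda>x. B h (a x) (b x)) \<in> borel_measurable M"
  "\<And>h a b M. a \<in> borel_measurable M ==> b \<in> borel_measurable M ==> (\<lambda>x. B' h (a x) (b x)) \<in> borel_measurable M"
  using 1 2 unfolding src_bounds_def by (auto intro: pmeas_comp)
 have comb: "cmod (x + y) <= (a + b) * (c + d)"
  if "cmod x <= a * c" "cmod y <= b * d" "a >= 0" "b >= 0" "c >= 0" "d >= 0" for x y and a b c d :: real
 proof -
  have "cmod (x + y) <= a * c + b * d" by (rule norm_triangle_le[OF add_mono[OF that(1,2)]])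
  also have "\<dots> <= (a + b) * (c + d)" using that(3-6) by (simp add: algebra_simps)
  finally show ?thesis .
 qed
 have "src_bounds (\<lambda>z l. R1 z l + R2 z l) k2 A2 B2 (2 * C + 2 * C')"
  unfolding src_bounds_def
 proof (intro conjI allI impI)
  have C: "C >= 0" "C' >= 0" using 1 2 by (auto simp: src_bounds_def)
  then show "0 <= 2 * C + 2 * C'" by simp
  show "wL2 k2" unfolding k2_def using 1 2 by (auto simp: src_bounds_def intro!: wL2_add wL2_abs)
  show "pmeas (\<lambda>z l. R1 z l + R2 z l)" "pmeas A2" "pmeas (B2 h)" for h
   unfolding A2_def B2_def by (rule pmeasI; measurable)+
  fix z :: real assume z: "z >= 0"
  show "cmod (R1 z l + R2 z l) <= cmod (k2 z) * cmod (A2 z l)" for l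
   unfolding k2_def A2_def c using 1 2 z by (intro comb) (auto simp: src_bounds_def)
  show "cmod (A2 z l) <= 2 * C + 2 * C'" for l
  proof -
   have "cmod (A z l) <= C" "cmod (A' z l) <= C'" using 1 2 z by (auto simp: src_bounds_def)
   then show ?thesis unfolding A2_def c using C by simp
  qed
  show "N2 (A2 z) <= ennreal ((2 * C + 2 * C') / (1 + z\<^sup>2))"
  proof -
   have "N2 (\<lambda>l. cor (cmod (A z l))) <= ennreal (C / (1 + z\<^sup>2))" "N2 (\<lambda>l. cor (cmod (A' z l))) <= ennreal (C' / (1 + z\<^sup>2))"
    using 1 2 z by (auto simp: src_bounds_def N2_def)
   from N2_add'[OF _ _ this] show ?thesis unfolding A2_def[abs_def] using C by (simp add: add_divide_distrib)
  qed
  fix h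
  show "cmod (R1 z (l + h) + R2 z (l + h) - (R1 z l + R2 z l)) <= cmod (k2 z) * cmod (B2 h z l)" for l
  proof -
   have "cmod ((R1 z (l + h) - R1 z l) + (R2 z (l + h) - R2 z l)) <= cmod (k2 z) * cmod (B2 h z l)"
    unfolding k2_def B2_def c using 1 2 z by (intro comb) (auto simp: src_bounds_def)
   then show ?thesis by (simp add: algebra_simps)
  qed
  show "N2 (B2 h z) <= ennreal ((2 * C + 2 * C') * h\<^sup>2)"
  proof -
   have "N2 (\<lambda>l. cor (cmod (B h z l))) <= ennreal (C * h\<^sup>2)" "N2 (\<lambda>l. cor (cmod (B' h z l))) <= ennreal (C' * h\<^sup>2)"
    using 1 2 z by (auto simp: src_bounds_def N2_def)
   from N2_add'[OF _ _ this] show ?thesis unfolding B2_def[abs_def] using C by (simp add: algebra_simps)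
  qed
 qed
 then show ?thesis unfolding src_def by blast
qed

lemma src_zero: "src (\<lambda>z l. 0)"
 using src_mult[OF _ good_zero, of "\<lambda>_. 0"] by (simp add: wL2_def WN_def)

lemma src_sum: "(\<And>i. i \<in> I ==> src (R i)) ==> src (\<lambda>z l. \<Sum>i\<in>I. R i z l)"
 by (induction I rule: infinite_finite_induct) (auto intro: src_add src_zero)

section \<open>The Riccati equation\<close>

lemma norm_cis_minus_one: "cmod (cis t - 1) <= \<bar>t\<bar>"
 using iexp_approx1[of t 0] by (simp add: cis_conv_exp)

lemma set_integral_norm_bound_ennreal:
 fixes h :: "real => complex"
 assumes "set_integrable lborel A h"
 shows "ennreal (cmod (LINT z:A|lborel. h z)) <= (NN z. ennreal (cmod (h z)) * indicator A z)"
proof -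
 have "ennreal (cmod (LINT z:A|lborel. h z)) <= (NN z. ennreal (cmod (indicator A z *\<^sub>R h z)))"
  unfolding set_lebesgue_integral_def
  by (rule integral_norm_bound_ennreal) (use assms in \<open>simp add: set_integrable_def\<close>)
 also have "\<dots> = (NN z. ennreal (cmod (h z)) * indicator A z)"
  by (intro nn_integral_cong) (auto simp: indicator_def)
 finally show ?thesis .
qed

lemma set_integrable_dominated:
 fixes h :: "real => complex"
 assumes "integrable lborel w" "A \<in> sets borel" "h \<in> bor" "\<And>z. z \<in> A ==> cmod (h z) <= c * cmod (w z)"
 shows "set_integrable lborel A h"
 unfolding set_integrable_def
proof (rule Bochner_Integration.integrable_bound)
 note [measurable] = assms(2,3)
 show "integrable lborel (\<lambda>z. cor c * w z)" using assms(1) by simp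
 show "(\<lambda>z. indicat_real A z *\<^sub>R h z) \<in> borel_measurable lborel" by measurable
 show "AE z in lborel. cmod (indicat_real A z *\<^sub>R h z) <= cmod (cor c * w z)"
 proof (rule AE_I2)
  fix z show "cmod (indicat_real A z *\<^sub>R h z) <= cmod (cor c * w z)"
  proof (cases "z \<in> A")
   case True
   have "c * cmod (w z) <= \<bar>c\<bar> * cmod (w z)" by (intro mult_right_mono) auto
   then show ?thesis using assms(4)[OF True] True by (simp add: norm_mult)
  qed simp
 qed
qed

text \<open>\<open>E\<close> is the stretched variable in which the phase is linear. The bound
  \<open>p >= 1\<close> makes \<open>E\<close> expanding, as \<open>bessel\<close> demands;
  \<open>p <= P\<close> makes it Lipschitz, as increments in \<open>l\<close> demand.\<close>

locale profile =
 fixes p E :: "real => real" and P :: real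
 assumes p_cont: "continuous_on UNIV p" and p_ge: "\<And>x. 1 <= p x" and p_le: "\<And>x. p x <= P"
  and E_deriv: "\<And>x. (E has_real_derivative p x) (at x)"
begin

lemma P_ge: "1 <= P" using p_ge p_le order_trans by blast

lemma p_pos: "0 < p x" "0 <= p x" using p_ge[of x] by auto

lemma E_cont: "continuous_on UNIV E"
 using E_deriv DERIV_isCont continuous_at_imp_continuous_on by blast

lemma E_mvt: "x < y ==> \<exists>z. E y - E x = (y - x) * p z"
 using MVT2[of x y E p] E_deriv by blast

lemma E_expanding: "\<bar>x - y\<bar> <= \<bar>E x - E y\<bar>"
proof -
 have *: "y - x <= E y - E x" if xy: "x < y" for x y
 proof -
  obtain z where "E y - E x = (y - x) * p z" using E_mvt[OF xy] by blast
  then show ?thesis using p_ge[of z] xy by (simp add: mult_le_cancel_left1)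
 qed
 from *[of x y] *[of y x] show ?thesis by (cases x y rule: linorder_cases) auto
qed

lemma E_lipschitz: "x <= y ==> \<bar>E y - E x\<bar> <= P * (y - x)"
proof (cases "x = y")
 case False
 assume "x <= y"
 with False obtain z where z: "E y - E x = (y - x) * p z" using E_mvt[of x y] by auto
 have "\<bar>E y - E x\<bar> = (y - x) * p z" unfolding z using \<open>x <= y\<close> p_pos[of z] by (simp add: abs_mult)
 also have "\<dots> <= (y - x) * P" using \<open>x <= y\<close> p_le[of z] by (intro mult_left_mono) auto
 finally show ?thesis by (simp add: mult.commute)
qed simp

lemma p_meas [measurable]: "p \<in> bor"
 by (rule borel_measurable_continuous_onI[OF p_cont])

lemma E_meas [measurable]: "E \<in> bor"
 by (rule borel_measurable_continuous_onI[OF E_cont])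

definition ph :: "real => real => real => complex" where
 "ph l x z = cis (2 * l * (E z - E x))"

lemma ph_meas [measurable (raw)]:
 "a \<in> borel_measurable M ==> b \<in> borel_measurable M ==> c \<in> borel_measurable M ==> (\<lambda>w. ph (a w) (b w) (c w)) \<in> borel_measurable M"
proof -
 assume [measurable]: "a \<in> borel_measurable M" "b \<in> borel_measurable M" "c \<in> borel_measurable M"
 show ?thesis unfolding ph_def by measurable
qed

lemma norm_ph [simp]: "cmod (ph l x z) = 1" by (simp add: ph_def)

lemma ph_add: "ph (l + h) x z = ph l x z * ph h x z"
 by (simp add: ph_def cis_mult algebra_simps)

text \<open>A derivative of the phase in \<open>l\<close> costs a factor \<open>z\<close>, just what
  the weight in \<open>wL2\<close> pays for. Replacing \<open>z - x\<close> by \<open>z\<close> uses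
  \<open>x >= 0\<close>.\<close>

lemma ph_minus_one: "0 <= x ==> x <= z ==> cmod (ph h x z - 1) <= 2 * \<bar>h\<bar> * P * z"
proof -
 assume x: "0 <= x" "x <= z"
 have "cmod (ph h x z - 1) <= \<bar>2 * h * (E z - E x)\<bar>" unfolding ph_def by (rule norm_cis_minus_one)
 also have "\<dots> = 2 * \<bar>h\<bar> * \<bar>E z - E x\<bar>" by (simp add: abs_mult)
 also have "\<dots> <= 2 * \<bar>h\<bar> * (P * (z - x))" by (intro mult_left_mono E_lipschitz x) auto
 also have "\<dots> <= 2 * \<bar>h\<bar> * (P * z)" using x P_ge by (intro mult_left_mono) auto
 finally show ?thesis by (simp add: mult_ac)
qed

lemma wL2_p: "wL2 g ==> wL2 (\<lambda>z. cor (p z) * g z)"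
 by (rule wL2_mult_bounded[where M=P]) (use p_le p_pos in \<open>auto simp: abs_of_pos\<close>)

text \<open>The part of the phase that depends on \<open>x\<close> has modulus 1, so
  \<open>bessel\<close> applies to \<open>g\<close> cut off at \<open>x\<close>. Only the tail of
  \<open>g\<close> remains on the right, and this is what decays in \<open>x\<close>.\<close>

lemma N2_oscillatory:
 fixes g :: "real => complex"
 assumes g: "integrable lborel g"
 shows "N2 (\<lambda>l. LINT z:{x..}|lborel. ph l x z * g z) <= ennreal pi * (NN z. ennreal ((cmod (g z))\<^sup>2) * indicator {x..} z)"
proof -
 let ?g = "\<lambda>z. indicator {x..} z *\<^sub>R g z"
 have [measurable]: "g \<in> bor" using g by auto
 have gi: "integrable lborel ?g" using g by (intro integrable_mult_indicator) auto
 have e: "(LINT z:{x..}|lborel. ph l x z * g z) = cis (- 2 * l * E x) * (\<integral>z. cis (2 * l * E z) * ?g z \<partial>lborel)" for l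
 proof -
  have c: "ph l x z = cis (- 2 * l * E x) * cis (2 * l * E z)" for z by (simp add: ph_def cis_mult algebra_simps)
  have "(LINT z:{x..}|lborel. ph l x z * g z) = (\<integral>z. cis (- 2 * l * E x) * (cis (2 * l * E z) * ?g z) \<partial>lborel)"
   unfolding set_lebesgue_integral_def
   by (rule Bochner_Integration.integral_cong[OF refl]) (simp add: c indicator_def)
  then show ?thesis by (simp only: integral_mult_right_zero)
 qed
 have "N2 (\<lambda>l. LINT z:{x..}|lborel. ph l x z * g z) = (NN l. ennreal ((cmod (\<integral>z. cis (2 * l * E z) * ?g z \<partial>lborel))\<^sup>2))"
  unfolding N2_def e by (simp add: norm_mult)
 also have "\<dots> <= ennreal pi * (NN z. ennreal ((cmod (?g z))\<^sup>2))"
  by (rule bessel[OF gi E_meas E_expanding])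
 also have "(NN z. ennreal ((cmod (?g z))\<^sup>2)) = (NN z. ennreal ((cmod (g z))\<^sup>2) * indicator {x..} z)"
  by (intro nn_integral_cong) (auto simp: indicator_def)
 finally show ?thesis .
qed

end

text \<open>One linear-type Volterra equation that fits \<open>v\<close> and each of its
  derivatives. The source is sorted by the way it is estimated: \<open>g0\<close> is free of
  \<open>l\<close> and needs Bessel's inequality, \<open>M1\<close> is dominated by the unknown with
  the small coefficient \<open>f\<close> and gets absorbed, \<open>R\<close> is built from functions
  already controlled.\<close>

locale duhamel = profile +
 fixes v M1 R :: "real => real => complex" and f g0 :: "real => complex" and M :: real
 assumes v_cont: "continuous_on UNIV (\<lambda>(x, l). v x l)"
  and v_bound: "\<And>x l. x >= 0 ==> cmod (v x l) <= M"
  and f: "wL2 f" and f_small: "(NN z. ennreal \<bar>p z * cmod (f z)\<bar>) <= ennreal (1/16)"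
  and g0: "wL2 g0" and R: "src R" and M1m: "pmeas M1"
  and M1b: "\<And>z l. z >= 0 ==> cmod (M1 z l) <= cmod (f z) * cmod (v z l)"
  and eq: "\<And>x l. x >= 0 ==> v x l = - (LINT z:{x..}|lborel. ph l x z * (p z * (g0 z + M1 z l + R z l)))"
begin

lemma M_nonneg: "M >= 0" using v_bound[of 0 0] norm_ge_zero order_trans by blast

lemmas [measurable] = wL2_meas[OF f] wL2_meas[OF g0]
lemmas [measurable (raw)] = pmeas_comp[OF pmeas_continuous[OF v_cont]] pmeas_comp[OF M1m]

lemma v_m: "v x \<in> bor" by measurable

lemma M1_integrable: "x >= 0 ==> set_integrable lborel {x..} (\<lambda>z. p z * M1 z l)"
proof (rule set_integrable_dominated[OF wL2_integrable[OF wL2_p[OF f]], where c=M])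
 fix z assume "x >= 0" "z \<in> {x..}"
 then have z: "z >= 0" by simp
 have "cmod (M1 z l) <= cmod (f z) * M" using M1b[OF z, of l] mult_left_mono[OF v_bound[OF z, of l], of "cmod (f z)"] by simp
 then have "p z * cmod (M1 z l) <= p z * (cmod (f z) * M)" by (intro mult_left_mono p_pos)
 then show "cmod (p z * M1 z l) <= M * cmod (cor (p z) * f z)"
  using p_pos[of z] by (simp add: norm_mult mult_ac)
qed auto

lemma R_integrable: "x >= 0 ==> set_integrable lborel {x..} (\<lambda>z. p z * R z l)"
proof -
 assume x: "x >= 0"
 obtain k A B C where R': "src_bounds R k A B C" using R unfolding src_def by blast
 then have k: "wL2 k" and Rm: "pmeas R" by (auto simp: src_bounds_def)
 note [measurable (raw)] = pmeas_comp[OF Rm]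
 show ?thesis
 proof (rule set_integrable_dominated[OF wL2_integrable[OF wL2_p[OF k]], where c=C])
  fix z assume "z \<in> {x..}"
  then have z: "z >= 0" using x by simp
  have "cmod (R z l) <= cmod (k z) * cmod (A z l)" "cmod (A z l) <= C" using R' z by (auto simp: src_bounds_def)
  then have "cmod (R z l) <= cmod (k z) * C" using mult_left_mono[of "cmod (A z l)" C "cmod (k z)"] by simp
  then have "p z * cmod (R z l) <= p z * (cmod (k z) * C)" by (intro mult_left_mono p_pos)
  then show "cmod (p z * R z l) <= C * cmod (cor (p z) * k z)"
   using p_pos[of z] by (simp add: norm_mult mult_ac)
 qed auto
qed

lemma g0_integrable: "set_integrable lborel {x..} (\<lambda>z. cor (p z) * g0 z)"
 using wL2_integrable[OF wL2_p[OF g0]] unfolding set_integrable_def by (intro integrable_mult_indicator) auto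

lemma set_integrable_ph:
 assumes "set_integrable lborel {x..} h" "h \<in> bor"
 shows "set_integrable lborel {x..} (\<lambda>z. ph l y z * h z)"
proof -
 note [measurable] = assms(2)
 show ?thesis
  using assms(1) unfolding set_integrable_def
  by (rule Bochner_Integration.integrable_bound) (auto simp: norm_mult indicator_def)
qed

text \<open>Bessel's inequality handles \<open>g0\<close>, the recorded decay handles
  \<open>R\<close>, and the term with \<open>M1\<close> is absorbed into the left-hand side by
  smallness of \<open>f\<close>.\<close>

lemma L2_bound: "\<exists>C\<ge>0. \<forall>x\<ge>0. N2 (v x) <= ennreal (C / (1 + x\<^sup>2))"
proof -
 obtain k A B C where R': "src_bounds R k A B C" using R unfolding src_def by blast
 then have k: "wL2 k" and Rm: "pmeas R" and Am: "pmeas A" and C: "C >= 0" by (auto simp: src_bounds_def)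
 note [measurable (raw)] = pmeas_comp[OF Rm] pmeas_comp[OF Am]
 note [measurable] = wL2_meas[OF k]
 obtain W where W: "W >= 0" "WN (\<lambda>z. cor (p z) * g0 z) <= ennreal W" using wL2_bound[OF wL2_p[OF g0]] by blast
 have "(NN z. ennreal (cmod (p z * k z))) < \<infinity>"
  using wL2_integrable[OF wL2_p[OF k]] by (simp add: integrable_iff_bounded)
 then obtain K where K: "K >= 0" "(NN z. ennreal \<bar>p z * cmod (k z)\<bar>) <= ennreal K"
  by (cases "NN z. ennreal (cmod (p z * k z))") (auto simp: norm_mult abs_mult)
 define J where "J x l = (LINT z:{x..}|lborel. ph l x z * (p z * g0 z))" for x l
 define T2 where "T2 x l = (NN z. ennreal (\<bar>p z * cmod (k z)\<bar> * cmod (A z l)) * indicator {x..} z)" for x l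
 \<comment> \<open>Absorption presupposes a finite supremum. Restricting \<open>l\<close> to a
   bounded interval provides it through the pointwise bound \<open>M\<close>; the resulting estimate
   is independent of \<open>n\<close>, and Fatou's lemma removes the restriction.\<close>
 define u where "u n z l = cor (indicator {- real n..real n} l) * v z l" for n z l
 have um: "pmeas (u n)" for n unfolding u_def by (rule pmeasI) measurable
 note [measurable (raw)] = pmeas_comp[OF um]
 define T1 where "T1 n x l = (NN z. ennreal (\<bar>p z * cmod (f z)\<bar> * cmod (u n z l)) * indicator {x..} z)" for n x l
 have Jm[measurable]: "J x \<in> bor" for x
  unfolding J_def set_lebesgue_integral_def by measurable
 have T2m[measurable]: "T2 x \<in> bor" for x unfolding T2_def by measurable
 have T1m[measurable]: "T1 n x \<in> bor" for n x unfolding T1_def by measurable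
 have pt: "ennreal (cmod (u n x l)) <= ennreal (cmod (J x l)) + (T2 x l + T1 n x l)" if x: "x >= 0" for n x l
 proof (cases "l \<in> {- real n..real n}")
  case False
  then show ?thesis by (simp add: u_def)
 next
  case True
  have i0: "set_integrable lborel {x..} (\<lambda>z. ph l x z * (p z * g0 z))"
   by (intro set_integrable_ph g0_integrable) measurable
  have i1: "set_integrable lborel {x..} (\<lambda>z. ph l x z * (p z * M1 z l))"
   by (intro set_integrable_ph M1_integrable x) measurable
  have i2: "set_integrable lborel {x..} (\<lambda>z. ph l x z * (p z * R z l))"
   by (intro set_integrable_ph R_integrable x) measurable
  have "(\<lambda>z. ph l x z * (p z * (g0 z + M1 z l + R z l))) = (\<lambda>z. ph l x z * (p z * g0 z) + (ph l x z * (p z * R z l) + ph l x z * (p z * M1 z l)))"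
   by (simp add: algebra_simps)
  then have "v x l = - (J x l + ((LINT z:{x..}|lborel. ph l x z * (p z * R z l)) + (LINT z:{x..}|lborel. ph l x z * (p z * M1 z l))))"
   unfolding eq[OF x] J_def
   by (simp only: set_integral_add(2)[OF i0 set_integral_add(1)[OF i2 i1]] set_integral_add(2)[OF i2 i1])
  then have "cmod (v x l) <= cmod (J x l) + (cmod (LINT z:{x..}|lborel. ph l x z * (p z * R z l)) + cmod (LINT z:{x..}|lborel. ph l x z * (p z * M1 z l)))"
   using norm_triangle_ineq[of "J x l" "(LINT z:{x..}|lborel. ph l x z * (p z * R z l)) + (LINT z:{x..}|lborel. ph l x z * (p z * M1 z l))"]
    norm_triangle_ineq[of "LINT z:{x..}|lborel. ph l x z * (p z * R z l)" "LINT z:{x..}|lborel. ph l x z * (p z * M1 z l)"]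
   by (simp only: norm_minus_cancel)
  then have "ennreal (cmod (v x l)) <= ennreal (cmod (J x l)) + (ennreal (cmod (LINT z:{x..}|lborel. ph l x z * (p z * R z l))) + ennreal (cmod (LINT z:{x..}|lborel. ph l x z * (p z * M1 z l))))"
   by (simp add: ennreal_plus[symmetric] ennreal_leI del: ennreal_plus)
  also have "ennreal (cmod (LINT z:{x..}|lborel. ph l x z * (p z * R z l))) <= T2 x l"
  proof (rule order_trans[OF set_integral_norm_bound_ennreal[OF i2]], unfold T2_def, rule nn_integral_mono)
   fix z
   show "ennreal (cmod (ph l x z * (p z * R z l))) * indicator {x..} z <= ennreal (\<bar>p z * cmod (k z)\<bar> * cmod (A z l)) * indicator {x..} z"
   proof (cases "z \<in> {x..}")
    case True
    then have "z >= 0" using x by simp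
    then have "cmod (R z l) <= cmod (k z) * cmod (A z l)" using R' by (auto simp: src_bounds_def)
    then have "p z * cmod (R z l) <= p z * (cmod (k z) * cmod (A z l))" by (intro mult_left_mono p_pos)
    then show ?thesis using True p_pos[of z] by (auto simp: norm_mult abs_mult mult_ac intro!: ennreal_leI)
   qed simp
  qed
  also have "ennreal (cmod (LINT z:{x..}|lborel. ph l x z * (p z * M1 z l))) <= T1 n x l"
  proof (rule order_trans[OF set_integral_norm_bound_ennreal[OF i1]], unfold T1_def, rule nn_integral_mono)
   fix z
   show "ennreal (cmod (ph l x z * (p z * M1 z l))) * indicator {x..} z <= ennreal (\<bar>p z * cmod (f z)\<bar> * cmod (u n z l)) * indicator {x..} z"
   proof (cases "z \<in> {x..}")
    case z: True
    then have "p z * cmod (M1 z l) <= p z * (cmod (f z) * cmod (v z l))" using x by (intro mult_left_mono p_pos M1b) auto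
    then show ?thesis using z True p_pos[of z] by (auto simp: u_def norm_mult abs_mult mult_ac intro!: ennreal_leI)
   qed simp
  qed
  finally show ?thesis using True by (simp add: u_def add_left_mono add_right_mono)
 qed
 \<comment> \<open>The factors 2 and 4 come from squaring a sum of three terms by two applications
   of \<open>ennreal_square_sum\<close>.\<close>
 define c where "c = 2 * (pi * W) + 4 * (K * (K * C))"
 have c: "c >= 0" using W K C by (simp add: c_def)
 have ub: "N2 (u n x) <= ennreal (2 * c / (1 + x\<^sup>2))" if x: "x >= 0" for n x
 proof -
  \<comment> \<open>The supremum starts at \<open>x\<close> and not at 0, so that the decay of the
    sources beyond \<open>x\<close> survives the absorption.\<close>
  define S where "S = (SUP z\<in>{x..}. N2 (u n z))"
  have Sup: "N2 (u n z) <= S" if "z >= x" for z unfolding S_def using that by (intro SUP_upper) auto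
  have le: "N2 (u n y) <= ennreal (c / (1 + x\<^sup>2)) + ennreal (1/2) * S" if "y >= x" for y
  proof -
   have y: "y >= 0" using that x by simp
   have "N2 (u n y) <= (NN l. 2 * ennreal ((cmod (J y l))\<^sup>2) + (4 * (T2 y l)\<^sup>2 + 4 * (T1 n y l)\<^sup>2))"
    unfolding N2_def
   proof (rule nn_integral_mono)
    fix l
    have "ennreal ((cmod (u n y l))\<^sup>2) = (ennreal (cmod (u n y l)))\<^sup>2" by (simp add: ennreal_power)
    also have "\<dots> <= (ennreal (cmod (J y l)) + (T2 y l + T1 n y l))\<^sup>2" by (intro power_mono pt y) simp
    also have "\<dots> <= 2 * (ennreal (cmod (J y l)))\<^sup>2 + 2 * (T2 y l + T1 n y l)\<^sup>2" by (rule ennreal_square_sum)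
    also have "\<dots> <= 2 * (ennreal (cmod (J y l)))\<^sup>2 + 2 * (2 * (T2 y l)\<^sup>2 + 2 * (T1 n y l)\<^sup>2)"
     by (intro add_left_mono mult_left_mono ennreal_square_sum) simp
    finally show "ennreal ((cmod (u n y l))\<^sup>2) <= 2 * ennreal ((cmod (J y l))\<^sup>2) + (4 * (T2 y l)\<^sup>2 + 4 * (T1 n y l)\<^sup>2)"
     by (simp add: ennreal_power distrib_left mult.assoc[symmetric])
   qed
   also have "\<dots> = 2 * N2 (J y) + (4 * (NN l. (T2 y l)\<^sup>2) + 4 * (NN l. (T1 n y l)\<^sup>2))"
    unfolding N2_def by (simp add: nn_integral_add nn_integral_cmult)
   also have "\<dots> <= 2 * ennreal (pi * (1 / (1 + y\<^sup>2) * W)) + (4 * ennreal (K * (K * (C / (1 + y\<^sup>2)))) + 4 * (ennreal (1/16) * (ennreal (1/16) * S)))"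
   proof (intro add_mono mult_left_mono)
    have "N2 (J y) <= ennreal pi * (NN z. ennreal ((cmod (p z * g0 z))\<^sup>2) * indicator {y..} z)"
     unfolding J_def by (rule N2_oscillatory[OF wL2_integrable[OF wL2_p[OF g0]]])
    also have "\<dots> <= ennreal pi * (ennreal (1 / (1 + y\<^sup>2)) * ennreal W)"
     by (intro mult_left_mono order_trans[OF wL2_tail[OF _ y]] W(2)) auto
    finally show "N2 (J y) <= ennreal (pi * (1 / (1 + y\<^sup>2) * W))" using W by (simp add: ennreal_mult[symmetric])
    have A: "N2 (A z) <= ennreal (C / (1 + y\<^sup>2))" if "z >= y" for z
    proof -
     have "z >= 0" "y\<^sup>2 <= z\<^sup>2" using that y by (auto intro: power_mono)
     then have "N2 (A z) <= ennreal (C / (1 + z\<^sup>2))" using R' by (auto simp: src_bounds_def)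
     also have "\<dots> <= ennreal (C / (1 + y\<^sup>2))"
      using \<open>y\<^sup>2 <= z\<^sup>2\<close> C by (intro ennreal_leI divide_left_mono) (auto intro!: mult_pos_pos add_pos_nonneg)
     finally show ?thesis .
    qed
    have "(NN l. (T2 y l)\<^sup>2) <= ennreal K * (ennreal K * ennreal (C / (1 + y\<^sup>2)))"
     unfolding T2_def by (rule nn_square_L1[OF _ Am K(2) A]) measurable
    then show "(NN l. (T2 y l)\<^sup>2) <= ennreal (K * (K * (C / (1 + y\<^sup>2))))" using K C by (simp add: ennreal_mult[symmetric])
    show "(NN l. (T1 n y l)\<^sup>2) <= ennreal (1/16) * (ennreal (1/16) * S)"
     unfolding T1_def by (rule nn_square_L1[OF _ um f_small Sup]) (use \<open>y >= x\<close> in auto)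
   qed auto
   also have "\<dots> <= ennreal (c / (1 + x\<^sup>2)) + ennreal (1/2) * S"
   proof -
    have "x\<^sup>2 <= y\<^sup>2" using x \<open>y >= x\<close> by (intro power_mono) auto
    then have cc: "c / (1 + y\<^sup>2) <= c / (1 + x\<^sup>2)"
     using c by (intro divide_left_mono) (auto intro!: mult_pos_pos add_pos_nonneg)
    have "2 * ennreal (pi * (1 / (1 + y\<^sup>2) * W)) + 4 * ennreal (K * (K * (C / (1 + y\<^sup>2)))) = ennreal (c / (1 + y\<^sup>2))"
    proof -
     have "c / (1 + y\<^sup>2) = 2 * (pi * (1 / (1 + y\<^sup>2) * W)) + 4 * (K * (K * (C / (1 + y\<^sup>2))))"
      by (simp add: c_def add_divide_distrib)
     moreover have "2 * ennreal a + 4 * ennreal b = ennreal (2 * a + 4 * b)" if "a >= 0" "b >= 0" for a b :: real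
      using that by (simp add: ennreal_mult)
     moreover have "0 <= pi * (1 / (1 + y\<^sup>2) * W)" "0 <= K * (K * (C / (1 + y\<^sup>2)))" using W K C by auto
     ultimately show ?thesis by (simp only:)
    qed
    \<comment> \<open>The coefficient is in fact 1/64; the value 1/2 is what
      \<open>ennreal_absorb\<close> asks for.\<close>
    moreover have "4 * (ennreal (1/16) * (ennreal (1/16) * S)) <= ennreal (1/2) * S"
    proof -
     have "4 * (ennreal (1/16) * (ennreal (1/16) * S)) = (ennreal 4 * (ennreal (1/16) * ennreal (1/16))) * S"
      by (simp add: mult.assoc)
     also have "ennreal 4 * (ennreal (1/16) * ennreal (1/16)) = ennreal (1/64)"
      by (simp only: ennreal_mult[symmetric] le_numeral_extra divide_nonneg_nonneg zero_le_numeral zero_le_one mult_nonneg_nonneg) simp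
     also have "ennreal (1/64) * S <= ennreal (1/2) * S" by (intro mult_right_mono ennreal_leI) auto
     finally show ?thesis .
    qed
    ultimately show ?thesis using ennreal_leI[OF cc] by (metis add.assoc add_mono)
   qed
   finally show ?thesis .
  qed
  have "S < \<infinity>"
  proof -
   have "N2 (u n z) <= ennreal (M\<^sup>2 * (2 * real n))" if "z >= x" for z
   proof -
    have "N2 (u n z) <= (NN l. ennreal (M\<^sup>2) * indicator {- real n..real n} l)"
     unfolding N2_def
     by (intro nn_integral_mono) (use v_bound that x M_nonneg in \<open>auto simp: u_def indicator_def intro!: ennreal_leI power_mono\<close>)
    also have "\<dots> = ennreal (M\<^sup>2) * ennreal (2 * real n)" by (subst nn_integral_cmult_indicator) auto
    finally show ?thesis by (simp add: ennreal_mult)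
   qed
   then have "S <= ennreal (M\<^sup>2 * (2 * real n))" unfolding S_def by (intro SUP_least) auto
   then show ?thesis by (rule le_ennreal_finite)
  qed
  moreover have "S <= ennreal (c / (1 + x\<^sup>2)) + ennreal (1/2) * S"
   by (subst (1) S_def) (intro SUP_least, use le in auto)
  ultimately have "S <= ennreal (2 * (c / (1 + x\<^sup>2)))" using c by (intro ennreal_absorb) auto
  then show ?thesis using Sup[of x] by (simp add: order_trans)
 qed
 have "N2 (v x) <= ennreal (2 * c / (1 + x\<^sup>2))" if x: "x >= 0" for x
 proof -
  have "N2 (v x) = (NN l. liminf (\<lambda>n. ennreal ((cmod (u n x l))\<^sup>2)))"
   unfolding N2_def
  proof (rule nn_integral_cong)
   fix l :: real
   obtain N where "real N >= \<bar>l\<bar>" using real_arch_simple by blast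
   then have "\<forall>\<^sub>F n in sequentially. ennreal ((cmod (u n x l))\<^sup>2) = ennreal ((cmod (v x l))\<^sup>2)"
    by (intro eventually_sequentiallyI[of N]) (auto simp: u_def indicator_def)
   then have "(\<lambda>n. ennreal ((cmod (u n x l))\<^sup>2)) \<longlonglongrightarrow> ennreal ((cmod (v x l))\<^sup>2)" by (rule tendsto_eventually)
   then show "ennreal ((cmod (v x l))\<^sup>2) = liminf (\<lambda>n. ennreal ((cmod (u n x l))\<^sup>2))"
    by (intro lim_imp_Liminf[symmetric]) auto
  qed
  also have "\<dots> <= liminf (\<lambda>n. N2 (u n x))" unfolding N2_def by (rule nn_integral_liminf) measurable
  also have "\<dots> <= liminf (\<lambda>n. ennreal (2 * c / (1 + x\<^sup>2)))" by (intro Liminf_mono always_eventually allI ub x)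
  finally show ?thesis by (simp add: Liminf_const)
 qed
 then show ?thesis using c by (intro exI[of _ "2 * c"]) auto
qed

text \<open>The increment of \<open>v\<close> in \<open>l\<close> solves an equation of the same
  type. Its sources are the increment of the phase, paid for by the weight, and the increment of
  \<open>M1\<close>, which by the last hypothesis is the unknown increment with coefficient
  \<open>f\<close> up to an error \<open>b\<close> that is of order \<open>h\<close> in L2.\<close>

lemma good_v:
 assumes D: "C0 >= 0" "\<And>h. pmeas (b h)" "\<And>h z. z >= 0 ==> N2 (b h z) <= ennreal (C0 * h\<^sup>2)"
  "\<And>h z l. z >= 0 ==> cmod (M1 z (l + h) - M1 z l) <= cmod (f z) * cmod (v z (l + h) - v z l) + cmod (f z) * cmod (b h z l)"
 shows "good v"
proof -
 obtain Cv where Cv: "Cv >= 0" "\<And>x. x >= 0 ==> N2 (v x) <= ennreal (Cv / (1 + x\<^sup>2))" using L2_bound by blast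
 obtain k A B C where R': "src_bounds R k A B C" using R unfolding src_def by blast
 then have k: "wL2 k" and Rm: "pmeas R" and Am: "pmeas A" and C: "C >= 0" and Bm: "\<And>h. pmeas (B h)" by (auto simp: src_bounds_def)
 note [measurable (raw)] = pmeas_comp[OF Rm] pmeas_comp[OF Am] pmeas_comp[OF Bm] pmeas_comp[OF D(2)]
 note [measurable] = wL2_meas[OF k]
 obtain W0 where W0: "W0 >= 0" "WN g0 <= ennreal W0" using wL2_bound[OF g0] by blast
 obtain Wf where Wf: "Wf >= 0" "WN f <= ennreal Wf" using wL2_bound[OF f] by blast
 obtain Wk where Wk: "Wk >= 0" "WN k <= ennreal Wk" using wL2_bound[OF k] by blast
 have "(NN z. ennreal (cmod (p z * k z))) < \<infinity>"
  using wL2_integrable[OF wL2_p[OF k]] by (simp add: integrable_iff_bounded)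
 then obtain K where K: "K >= 0" "(NN z. ennreal \<bar>p z * cmod (k z)\<bar>) <= ennreal K"
  by (cases "NN z. ennreal (cmod (p z * k z))") (auto simp: norm_mult abs_mult)
 \<comment> \<open>The powers of 2 belong to a sum of six terms squared one at a time. In
   \<open>4 * P^4\<close> one \<open>P\<close> is the Lipschitz constant of \<open>E\<close>, the
   other bounds \<open>p\<close>; the product is squared. The factor pi is Bessel's constant in the
   first term and the integral of \<open>1/(1 + z^2)\<close> in the next two.\<close>
 define c where "c = 2 * (pi * (4 * P^4 * W0)) + 4 * (4 * P^4 * Wf * (Cv * pi)) + 8 * (4 * P^4 * Wk * (C * pi))
  + 16 * (1/16 * (1/16 * C0)) + 32 * (K * (K * C))"
 have c: "c >= 0" using W0 Wf Wk K C D(1) Cv P_ge by (simp add: c_def)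
 have main: "N2 (\<lambda>l. v x (l + h) - v x l) <= ennreal (2 * c * h\<^sup>2)" if x0: "x >= 0" for x h
 proof -
  define d where "d z l = v z (l + h) - v z l" for z l
  have dm: "pmeas d" unfolding d_def by (rule pmeasI) measurable
  note [measurable (raw)] = pmeas_comp[OF dm]
  define t1 where "t1 x l = (LINT z:{x..}|lborel. ph l x z * ((ph h x z - 1) * (p z * g0 z)))" for x l
  define uf where "uf z = 2 * \<bar>h\<bar> * P * P * (z * cmod (f z))" for z
  define uk where "uk z = 2 * \<bar>h\<bar> * P * P * (z * cmod (k z))" for z
  define vh where "vh z l = v z (l + h)" for z l
  define Ah where "Ah z l = A z (l + h)" for z l
  have vhm: "pmeas vh" "pmeas Ah" unfolding vh_def Ah_def by (rule pmeasI; measurable)+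
  note [measurable (raw)] = pmeas_comp[OF vhm(1)] pmeas_comp[OF vhm(2)]
  define T2a where "T2a x l = (NN z. ennreal (\<bar>uf z\<bar> * cmod (vh z l)) * indicator {x..} z)" for x l
  define T2b where "T2b x l = (NN z. ennreal (\<bar>uk z\<bar> * cmod (Ah z l)) * indicator {x..} z)" for x l
  define T3a where "T3a x l = (NN z. ennreal (\<bar>p z * cmod (f z)\<bar> * cmod (d z l)) * indicator {x..} z)" for x l
  define T3b where "T3b x l = (NN z. ennreal (\<bar>p z * cmod (f z)\<bar> * cmod (b h z l)) * indicator {x..} z)" for x l
  define T3c where "T3c x l = (NN z. ennreal (\<bar>p z * cmod (k z)\<bar> * cmod (B h z l)) * indicator {x..} z)" for x l
  have ufm[measurable]: "uf \<in> bor" "uk \<in> bor" unfolding uf_def uk_def by measurable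
  have Tm[measurable]: "T2a x \<in> bor" "T2b x \<in> bor" "T3a x \<in> bor"
   "T3b x \<in> bor" "T3c x \<in> bor" for x
   unfolding T2a_def T2b_def T3a_def T3b_def T3c_def by measurable
  have t1m[measurable]: "t1 x \<in> bor" for x
   unfolding t1_def set_lebesgue_integral_def by measurable
  have i1: "integrable lborel (\<lambda>z. indicator {x..} z *\<^sub>R ((ph h x z - 1) * (p z * g0 z)))" for x
  proof -
   have "set_integrable lborel {x..} (\<lambda>z. (ph h x z - 1) * (p z * g0 z))"
   proof (rule set_integrable_dominated[OF wL2_integrable[OF wL2_p[OF g0]], where c=2])
    show "cmod ((ph h x z - 1) * (cor (p z) * g0 z)) <= 2 * cmod (cor (p z) * g0 z)" for z
     unfolding norm_mult[of "ph h x z - 1"]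
     by (intro mult_right_mono norm_triangle_le_diff) auto
   qed auto
   then show ?thesis by (simp add: set_integrable_def)
  qed
  have pt: "ennreal (cmod (d x l)) <= ennreal (cmod (t1 x l)) + (T2a x l + (T2b x l + (T3b x l + (T3c x l + T3a x l))))"
   if x: "x >= 0" for x l
  proof -
   \<comment> \<open>The increment of the phase acts on \<open>g0\<close> in \<open>t1\<close> and
     on the rest in \<open>s2\<close>. They are kept apart because \<open>g0\<close> is constant in
     \<open>l\<close> and only oscillation makes \<open>t1\<close> square integrable, while
     \<open>M1\<close> and \<open>R\<close> are already square integrable in
     \<open>l\<close>.\<close>
   define s2 where "s2 z = ph l x z * ((ph h x z - 1) * (p z * (M1 z (l + h) + R z (l + h))))" for z
   define s3 where "s3 z = ph l x z * (p z * ((M1 z (l + h) - M1 z l) + (R z (l + h) - R z l)))" for z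
   have I0: "set_integrable lborel {x..} (\<lambda>z. p z * (g0 z + M1 z l + R z l))" for l
    using set_integral_add(1)[OF set_integral_add(1)[OF g0_integrable M1_integrable[OF x, of l]] R_integrable[OF x, of l]]
    by (simp add: distrib_left)
   have I1: "set_integrable lborel {x..} (\<lambda>z. p z * (M1 z l + R z l))" for l
    using set_integral_add(1)[OF M1_integrable[OF x, of l] R_integrable[OF x, of l]] by (simp add: distrib_left)
   have J0: "set_integrable lborel {x..} (\<lambda>z. ph l' x z * (p z * (g0 z + M1 z l + R z l)))" for l l'
    by (intro set_integrable_ph I0) measurable
   have Js1: "set_integrable lborel {x..} (\<lambda>z. ph l x z * ((ph h x z - 1) * (p z * g0 z)))"
    by (intro set_integrable_ph) (use i1 in \<open>auto simp: set_integrable_def\<close>)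
   have Js2: "set_integrable lborel {x..} s2"
    using set_integral_diff(1)[OF set_integrable_ph[OF I1[of "l + h"], of "l + h" x] set_integrable_ph[OF I1[of "l + h"], of l x]]
    unfolding s2_def by (simp add: ph_add algebra_simps)
   have Js3: "set_integrable lborel {x..} s3"
    using set_integrable_ph[OF set_integral_diff(1)[OF I1[of "l + h"] I1[of l]], of l x]
    unfolding s3_def by (simp add: algebra_simps)
   have "d x l = - ((LINT z:{x..}|lborel. ph (l + h) x z * (p z * (g0 z + M1 z (l + h) + R z (l + h)))) - (LINT z:{x..}|lborel. ph l x z * (p z * (g0 z + M1 z l + R z l))))"
    unfolding d_def eq[OF x] by simp
   also have "\<dots> = - (LINT z:{x..}|lborel. ph (l + h) x z * (p z * (g0 z + M1 z (l + h) + R z (l + h))) - ph l x z * (p z * (g0 z + M1 z l + R z l)))"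
    by (subst set_integral_diff(2)[OF J0 J0]) simp
   also have "\<dots> = - (LINT z:{x..}|lborel. ph l x z * ((ph h x z - 1) * (p z * g0 z)) + (s2 z + s3 z))"
    unfolding s2_def s3_def ph_add by (simp add: algebra_simps)
   also have "\<dots> = - (t1 x l + ((LINT z:{x..}|lborel. s2 z) + (LINT z:{x..}|lborel. s3 z)))"
    unfolding t1_def
    by (simp only: set_integral_add(2)[OF Js1 set_integral_add(1)[OF Js2 Js3]] set_integral_add(2)[OF Js2 Js3])
   finally have "cmod (d x l) <= cmod (t1 x l) + (cmod (LINT z:{x..}|lborel. s2 z) + cmod (LINT z:{x..}|lborel. s3 z))"
    using norm_triangle_ineq[of "t1 x l" "(LINT z:{x..}|lborel. s2 z) + (LINT z:{x..}|lborel. s3 z)"]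
     norm_triangle_ineq[of "LINT z:{x..}|lborel. s2 z" "LINT z:{x..}|lborel. s3 z"] by (simp only: norm_minus_cancel)
   then have "ennreal (cmod (d x l)) <= ennreal (cmod (t1 x l)) + (ennreal (cmod (LINT z:{x..}|lborel. s2 z)) + ennreal (cmod (LINT z:{x..}|lborel. s3 z)))"
    by (simp add: ennreal_plus[symmetric] ennreal_leI del: ennreal_plus)
   moreover have "ennreal (cmod (LINT z:{x..}|lborel. s2 z)) <= T2a x l + T2b x l"
   proof -
    have "ennreal (cmod (LINT z:{x..}|lborel. s2 z)) <= (NN z. ennreal (\<bar>uf z\<bar> * cmod (vh z l)) * indicator {x..} z + ennreal (\<bar>uk z\<bar> * cmod (Ah z l)) * indicator {x..} z)"
    proof (rule order_trans[OF set_integral_norm_bound_ennreal[OF Js2]], rule nn_integral_mono)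
     fix z
     show "ennreal (cmod (s2 z)) * indicator {x..} z <= ennreal (\<bar>uf z\<bar> * cmod (vh z l)) * indicator {x..} z + ennreal (\<bar>uk z\<bar> * cmod (Ah z l)) * indicator {x..} z"
     proof (cases "z \<in> {x..}")
      case True
      then have z: "z >= 0" "x <= z" using x by auto
      have m: "cmod (M1 z (l + h) + R z (l + h)) <= cmod (f z) * cmod (v z (l + h)) + cmod (k z) * cmod (A z (l + h))"
       by (rule norm_triangle_le[OF add_mono[OF M1b[OF z(1)]]]) (use R' z in \<open>auto simp: src_bounds_def\<close>)
      have "cmod (s2 z) = cmod (ph h x z - 1) * (p z * cmod (M1 z (l + h) + R z (l + h)))"
       unfolding s2_def using p_pos[of z] by (simp add: norm_mult)
      also have "\<dots> <= (2 * \<bar>h\<bar> * P * z) * (P * (cmod (f z) * cmod (v z (l + h)) + cmod (k z) * cmod (A z (l + h))))"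
       using p_le[of z] p_pos[of z] z P_ge
       by (intro mult_mono ph_minus_one m x z) (auto intro!: mult_nonneg_nonneg add_nonneg_nonneg)
      also have "\<dots> = \<bar>uf z\<bar> * cmod (vh z l) + \<bar>uk z\<bar> * cmod (Ah z l)"
       using z P_ge by (simp add: uf_def uk_def vh_def Ah_def abs_mult algebra_simps)
      finally have "ennreal (cmod (s2 z)) <= ennreal (\<bar>uf z\<bar> * cmod (vh z l) + \<bar>uk z\<bar> * cmod (Ah z l))" by (rule ennreal_leI)
      then show ?thesis using True by simp
     qed simp
    qed
    also have "\<dots> = T2a x l + T2b x l" unfolding T2a_def T2b_def by (rule nn_integral_add) measurable
    finally show ?thesis .
   qed
   moreover have "ennreal (cmod (LINT z:{x..}|lborel. s3 z)) <= T3b x l + (T3c x l + T3a x l)"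
   proof -
    have "ennreal (cmod (LINT z:{x..}|lborel. s3 z)) <= (NN z. ennreal (\<bar>p z * cmod (f z)\<bar> * cmod (b h z l)) * indicator {x..} z +
     (ennreal (\<bar>p z * cmod (k z)\<bar> * cmod (B h z l)) * indicator {x..} z + ennreal (\<bar>p z * cmod (f z)\<bar> * cmod (d z l)) * indicator {x..} z))"
    proof (rule order_trans[OF set_integral_norm_bound_ennreal[OF Js3]], rule nn_integral_mono)
     fix z
     show "ennreal (cmod (s3 z)) * indicator {x..} z <= ennreal (\<bar>p z * cmod (f z)\<bar> * cmod (b h z l)) * indicator {x..} z +
     (ennreal (\<bar>p z * cmod (k z)\<bar> * cmod (B h z l)) * indicator {x..} z + ennreal (\<bar>p z * cmod (f z)\<bar> * cmod (d z l)) * indicator {x..} z)"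
     proof (cases "z \<in> {x..}")
      case True
      then have z: "z >= 0" "x <= z" using x by auto
      have "cmod ((M1 z (l + h) - M1 z l) + (R z (l + h) - R z l)) <= (cmod (f z) * cmod (d z l) + cmod (f z) * cmod (b h z l)) + cmod (k z) * cmod (B h z l)"
       unfolding d_def by (rule norm_triangle_le[OF add_mono[OF D(4)[OF z(1)]]]) (use R' z in \<open>auto simp: src_bounds_def\<close>)
      from mult_left_mono[OF this p_pos(2)[of z]]
      have "p z * cmod ((M1 z (l + h) - M1 z l) + (R z (l + h) - R z l)) <= \<bar>p z * cmod (f z)\<bar> * cmod (b h z l) + (\<bar>p z * cmod (k z)\<bar> * cmod (B h z l) + \<bar>p z * cmod (f z)\<bar> * cmod (d z l))"
       using p_pos[of z] by (simp add: abs_mult distrib_left mult.assoc add_ac)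
      moreover have "cmod (s3 z) = p z * cmod ((M1 z (l + h) - M1 z l) + (R z (l + h) - R z l))"
       unfolding s3_def norm_mult norm_ph norm_of_real using p_pos[of z] by simp
      ultimately have "cmod (s3 z) <= \<bar>p z * cmod (f z)\<bar> * cmod (b h z l) + (\<bar>p z * cmod (k z)\<bar> * cmod (B h z l) + \<bar>p z * cmod (f z)\<bar> * cmod (d z l))"
       by simp
      then have "ennreal (cmod (s3 z)) <= ennreal (\<bar>p z * cmod (f z)\<bar> * cmod (b h z l) + (\<bar>p z * cmod (k z)\<bar> * cmod (B h z l) + \<bar>p z * cmod (f z)\<bar> * cmod (d z l)))" by (rule ennreal_leI)
      then show ?thesis using True by simp
     qed simp
    qed
    also have "\<dots> = T3b x l + (T3c x l + T3a x l)" unfolding T3b_def T3c_def T3a_def by (simp add: nn_integral_add)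
    finally show ?thesis .
   qed
   ultimately have "ennreal (cmod (d x l)) <= ennreal (cmod (t1 x l)) + ((T2a x l + T2b x l) + (T3b x l + (T3c x l + T3a x l)))"
    by (meson add_left_mono add_mono order_trans)
   then show ?thesis by (simp add: add.assoc)
  qed
  define S where "S = (SUP z\<in>{0..}. N2 (d z))"
  have Sup: "N2 (d z) <= S" if "z >= 0" for z unfolding S_def using that by (intro SUP_upper) auto
  have wgt: "(NN z. ennreal ((2 * \<bar>h\<bar> * P * P * (z * cmod (g z)))\<^sup>2)) <= ennreal (4 * P^4 * w * h\<^sup>2)"
   if "WN g <= ennreal w" "w >= 0" "g \<in> bor" for g w
  proof -
   note [measurable] = that(3)
   have "(NN z. ennreal ((2 * \<bar>h\<bar> * P * P * (z * cmod (g z)))\<^sup>2)) <= (NN z. ennreal (4 * P^4 * h\<^sup>2) * ennreal ((1 + z\<^sup>2) * (cmod (g z))\<^sup>2))"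
   proof (rule nn_integral_mono)
    fix z
    have "(2 * \<bar>h\<bar> * P * P * (z * cmod (g z)))\<^sup>2 = (4 * P^4 * h\<^sup>2) * (z\<^sup>2 * (cmod (g z))\<^sup>2)"
     by (simp add: power_mult_distrib power2_eq_square power4_eq_xxxx)
    also have "\<dots> <= (4 * P^4 * h\<^sup>2) * ((1 + z\<^sup>2) * (cmod (g z))\<^sup>2)" by (intro mult_left_mono mult_right_mono) auto
    finally show "ennreal ((2 * \<bar>h\<bar> * P * P * (z * cmod (g z)))\<^sup>2) <= ennreal (4 * P^4 * h\<^sup>2) * ennreal ((1 + z\<^sup>2) * (cmod (g z))\<^sup>2)"
     by (subst ennreal_mult[symmetric]) (auto intro!: ennreal_leI)
   qed
   also have "\<dots> = ennreal (4 * P^4 * h\<^sup>2) * WN g" unfolding WN_def by (rule nn_integral_cmult) measurable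
   also have "\<dots> <= ennreal (4 * P^4 * h\<^sup>2) * ennreal w" by (intro mult_left_mono that) simp
   finally show ?thesis using that by (simp add: ennreal_mult[symmetric] mult_ac)
  qed
  have le: "N2 (d y) <= ennreal (c * h\<^sup>2) + ennreal (1/2) * S" if y: "y >= 0" for y
  proof -
   have "N2 (d y) <= (NN l. 2 * ennreal ((cmod (t1 y l))\<^sup>2) + (4 * (T2a y l)\<^sup>2 + (8 * (T2b y l)\<^sup>2 + (16 * (T3b y l)\<^sup>2 + (32 * (T3c y l)\<^sup>2 + 32 * (T3a y l)\<^sup>2)))))"
    unfolding N2_def
   proof (rule nn_integral_mono)
    fix l
    have sq: "(a + X)\<^sup>2 <= 2 * a\<^sup>2 + 2 * Y" if "X\<^sup>2 <= Y" for a X Y :: ennreal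
     by (rule order_trans[OF ennreal_square_sum]) (intro add_left_mono mult_left_mono that; simp)
    have "ennreal ((cmod (d y l))\<^sup>2) = (ennreal (cmod (d y l)))\<^sup>2" by (simp add: ennreal_power)
    also have "\<dots> <= (ennreal (cmod (t1 y l)) + (T2a y l + (T2b y l + (T3b y l + (T3c y l + T3a y l)))))\<^sup>2" by (intro power_mono pt y) simp
    also have "\<dots> <= 2 * (ennreal (cmod (t1 y l)))\<^sup>2 + 2 * (2 * (T2a y l)\<^sup>2 + 2 * (2 * (T2b y l)\<^sup>2 + 2 * (2 * (T3b y l)\<^sup>2 + 2 * (2 * (T3c y l)\<^sup>2 + 2 * (T3a y l)\<^sup>2))))"
     by (intro sq ennreal_square_sum)
    finally show "ennreal ((cmod (d y l))\<^sup>2) <= 2 * ennreal ((cmod (t1 y l))\<^sup>2) + (4 * (T2a y l)\<^sup>2 + (8 * (T2b y l)\<^sup>2 + (16 * (T3b y l)\<^sup>2 + (32 * (T3c y l)\<^sup>2 + 32 * (T3a y l)\<^sup>2))))"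
     by (simp add: ennreal_power distrib_left mult.assoc[symmetric])
   qed
   also have "\<dots> = 2 * N2 (t1 y) + (4 * (NN l. (T2a y l)\<^sup>2) + (8 * (NN l. (T2b y l)\<^sup>2) + (16 * (NN l. (T3b y l)\<^sup>2)
     + (32 * (NN l. (T3c y l)\<^sup>2) + 32 * (NN l. (T3a y l)\<^sup>2)))))"
    unfolding N2_def by (simp add: nn_integral_add nn_integral_cmult)
   also have "\<dots> <= 2 * ennreal (pi * (4 * P^4 * W0 * h\<^sup>2)) + (4 * ennreal (4 * P^4 * Wf * h\<^sup>2 * (Cv * pi)) + (8 * ennreal (4 * P^4 * Wk * h\<^sup>2 * (C * pi))
     + (16 * ennreal (1/16 * (1/16 * (C0 * h\<^sup>2))) + (32 * ennreal (K * (K * (C * h\<^sup>2))) + 32 * (ennreal (1/16) * (ennreal (1/16) * S))))))"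
   proof (intro add_mono mult_left_mono)
    have "N2 (t1 y) = N2 (\<lambda>l. LINT z:{y..}|lborel. ph l y z * (indicator {y..} z *\<^sub>R ((ph h y z - 1) * (p z * g0 z))))"
     unfolding t1_def set_lebesgue_integral_def by (rule arg_cong[of _ _ N2], rule ext, rule Bochner_Integration.integral_cong) (auto simp: indicator_def)
    also have "\<dots> <= ennreal pi * (NN z. ennreal ((cmod (indicator {y..} z *\<^sub>R ((ph h y z - 1) * (p z * g0 z))))\<^sup>2) * indicator {y..} z)"
     by (rule N2_oscillatory[OF i1])
    also have "\<dots> <= ennreal pi * (NN z. ennreal ((2 * \<bar>h\<bar> * P * P * (z * cmod (g0 z)))\<^sup>2))"
    proof (intro mult_left_mono nn_integral_mono)
     fix z
     show "ennreal ((cmod (indicator {y..} z *\<^sub>R ((ph h y z - 1) * (p z * g0 z))))\<^sup>2) * indicator {y..} z <= ennreal ((2 * \<bar>h\<bar> * P * P * (z * cmod (g0 z)))\<^sup>2)"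
     proof (cases "z \<in> {y..}")
      case True
      then have z: "y <= z" "z >= 0" using y by auto
      have "cmod (ph h y z - 1) * (p z * cmod (g0 z)) <= (2 * \<bar>h\<bar> * P * z) * (P * cmod (g0 z))"
       using p_le[of z] p_pos[of z] z P_ge by (intro mult_mono ph_minus_one y z mult_right_mono) auto
      then have "cmod ((ph h y z - 1) * (p z * g0 z)) <= 2 * \<bar>h\<bar> * P * P * (z * cmod (g0 z))"
       using p_pos[of z] by (simp add: norm_mult mult_ac)
      then show ?thesis using True by (auto intro!: ennreal_leI power_mono)
     qed simp
    qed simp
    also have "\<dots> <= ennreal pi * ennreal (4 * P^4 * W0 * h\<^sup>2)" by (intro mult_left_mono wgt W0) auto
    finally show "N2 (t1 y) <= ennreal (pi * (4 * P^4 * W0 * h\<^sup>2))" using W0 by (simp add: ennreal_mult[symmetric])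
    have "(NN l. (T2a y l)\<^sup>2) <= ennreal (4 * P^4 * Wf * h\<^sup>2) * ennreal (Cv * pi)"
     unfolding T2a_def
    proof (rule nn_square_weight[OF ufm(1) vhm(1) y])
     show "(NN z. ennreal ((uf z)\<^sup>2)) <= ennreal (4 * P^4 * Wf * h\<^sup>2)" unfolding uf_def by (rule wgt) (use Wf in auto)
     show "N2 (vh z) <= ennreal (Cv / (1 + z\<^sup>2))" if "z >= 0" for z
      unfolding vh_def using Cv(2)[OF that] N2_shift[OF v_m, of z h] by simp
    qed (use Cv in auto)
    then show "(NN l. (T2a y l)\<^sup>2) <= ennreal (4 * P^4 * Wf * h\<^sup>2 * (Cv * pi))" using Wf Cv by (simp add: ennreal_mult[symmetric])
    have "(NN l. (T2b y l)\<^sup>2) <= ennreal (4 * P^4 * Wk * h\<^sup>2) * ennreal (C * pi)"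
     unfolding T2b_def
    proof (rule nn_square_weight[OF ufm(2) vhm(2) y])
     show "(NN z. ennreal ((uk z)\<^sup>2)) <= ennreal (4 * P^4 * Wk * h\<^sup>2)" unfolding uk_def by (rule wgt) (use Wk in auto)
     show "N2 (Ah z) <= ennreal (C / (1 + z\<^sup>2))" if "z >= 0" for z
     proof -
      have "A z \<in> bor" by measurable
      from N2_shift[OF this, of h] show ?thesis unfolding Ah_def using R' that by (simp add: src_bounds_def)
     qed
    qed (use C in auto)
    then show "(NN l. (T2b y l)\<^sup>2) <= ennreal (4 * P^4 * Wk * h\<^sup>2 * (C * pi))" using Wk C by (simp add: ennreal_mult[symmetric])
    have "(NN l. (T3b y l)\<^sup>2) <= ennreal (1/16) * (ennreal (1/16) * ennreal (C0 * h\<^sup>2))"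
     unfolding T3b_def by (rule nn_square_L1[OF _ D(2) f_small]) (use D(3) y in auto)
    also have "\<dots> = ennreal (1/16 * (1/16 * (C0 * h\<^sup>2)))"
    proof -
     have "ennreal a * (ennreal a * ennreal b) = ennreal (a * (a * b))" if "a >= 0" "b >= 0" for a b :: real
      using that by (simp add: ennreal_mult)
     then show ?thesis using D(1) by simp
    qed
    finally show "(NN l. (T3b y l)\<^sup>2) <= ennreal (1/16 * (1/16 * (C0 * h\<^sup>2)))" .
    have "(NN l. (T3c y l)\<^sup>2) <= ennreal K * (ennreal K * ennreal (C * h\<^sup>2))"
     unfolding T3c_def by (rule nn_square_L1[OF _ Bm K(2)]) (use R' y in \<open>auto simp: src_bounds_def\<close>)
    then show "(NN l. (T3c y l)\<^sup>2) <= ennreal (K * (K * (C * h\<^sup>2)))" using K C by (simp add: ennreal_mult[symmetric])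
    show "(NN l. (T3a y l)\<^sup>2) <= ennreal (1/16) * (ennreal (1/16) * S)"
     unfolding T3a_def by (rule nn_square_L1[OF _ dm f_small Sup]) (use y in auto)
   qed auto
   also have "\<dots> = ennreal (c * h\<^sup>2) + 32 * (ennreal (1/16) * (ennreal (1/16) * S))"
   proof -
    have "c * h\<^sup>2 = 2 * (pi * (4 * P^4 * W0 * h\<^sup>2)) + (4 * (4 * P^4 * Wf * h\<^sup>2 * (Cv * pi)) + (8 * (4 * P^4 * Wk * h\<^sup>2 * (C * pi))
     + (16 * (1/16 * (1/16 * (C0 * h\<^sup>2))) + 32 * (K * (K * (C * h\<^sup>2))))))"
     unfolding c_def by (simp add: algebra_simps)
    moreover have g: "2 * ennreal a1 + (4 * ennreal a2 + (8 * ennreal a3 + (16 * ennreal a4 + 32 * ennreal a5))) = ennreal (2 * a1 + (4 * a2 + (8 * a3 + (16 * a4 + 32 * a5))))"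
     if "a1 >= 0" "a2 >= 0" "a3 >= 0" "a4 >= 0" "a5 >= 0" for a1 a2 a3 a4 a5 :: real using that by (simp add: ennreal_mult)
    moreover have nn: "0 <= pi * (4 * P^4 * W0 * h\<^sup>2)" "0 <= 4 * P^4 * Wf * h\<^sup>2 * (Cv * pi)" "0 <= 4 * P^4 * Wk * h\<^sup>2 * (C * pi)"
     "0 <= 1/16 * (1/16 * (C0 * h\<^sup>2))" "0 <= K * (K * (C * h\<^sup>2))"
     using W0 Wf Wk K C D(1) Cv P_ge by auto
    ultimately have "ennreal (c * h\<^sup>2) = 2 * ennreal (pi * (4 * P^4 * W0 * h\<^sup>2)) + (4 * ennreal (4 * P^4 * Wf * h\<^sup>2 * (Cv * pi)) + (8 * ennreal (4 * P^4 * Wk * h\<^sup>2 * (C * pi))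
     + (16 * ennreal (1/16 * (1/16 * (C0 * h\<^sup>2))) + 32 * ennreal (K * (K * (C * h\<^sup>2))))))"
     by (simp only: g[OF nn])
    then show ?thesis by (simp only: add.assoc)
   qed
   \<comment> \<open>After five splittings the unknown carries the factor 32, and
     \<open>32/256\<close> is still only 1/8: this is where 1/16 leaves room.\<close>
   also have "32 * (ennreal (1/16) * (ennreal (1/16) * S)) <= ennreal (1/2) * S"
   proof -
    have "32 * (ennreal (1/16) * (ennreal (1/16) * S)) = (ennreal 32 * (ennreal (1/16) * ennreal (1/16))) * S"
     by (simp add: mult.assoc)
    also have "ennreal 32 * (ennreal (1/16) * ennreal (1/16)) = ennreal (1/8)"
     by (simp only: ennreal_mult[symmetric] le_numeral_extra divide_nonneg_nonneg zero_le_numeral zero_le_one mult_nonneg_nonneg) simp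
    also have "ennreal (1/8) * S <= ennreal (1/2) * S" by (intro mult_right_mono ennreal_leI) auto
    finally show ?thesis .
   qed
   finally show ?thesis by (simp add: add_left_mono)
  qed
  \<comment> \<open>The finiteness needed for absorption comes from \<open>L2_bound\<close>, applied
    to \<open>v\<close> and, by shift invariance, to its translate in \<open>l\<close>.\<close>
  have "S < \<infinity>"
  proof -
   have "N2 (d z) <= ennreal (2 * Cv + 2 * Cv)" if z: "z >= 0" for z
   proof -
    have "Cv / (1 + z\<^sup>2) <= Cv" using Cv by (simp add: divide_le_eq mult_le_cancel_left1 add_pos_nonneg)
    then have n: "N2 (v z) <= ennreal Cv" using Cv(2)[OF z] by (meson ennreal_leI order_trans)
    have "N2 (\<lambda>l. v z (l + h) + (- v z l)) <= ennreal (2 * Cv + 2 * Cv)"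
    proof (rule N2_add')
     show "N2 (\<lambda>l. v z (l + h)) <= ennreal Cv" using N2_shift[OF v_m, of z h] n by simp
     show "N2 (\<lambda>l. - v z l) <= ennreal Cv" using n by (simp add: N2_def)
    qed (use Cv in auto)
    then show ?thesis unfolding d_def[abs_def] by simp
   qed
   then have "S <= ennreal (2 * Cv + 2 * Cv)" unfolding S_def by (intro SUP_least) auto
   then show ?thesis by (rule le_ennreal_finite)
  qed
  moreover have "S <= ennreal (c * h\<^sup>2) + ennreal (1/2) * S"
   by (subst (1) S_def) (intro SUP_least, use le in auto)
  ultimately have "S <= ennreal (2 * (c * h\<^sup>2))" using c by (intro ennreal_absorb) auto
  from order_trans[OF Sup[OF x0] this] show ?thesis unfolding d_def[abs_def] by (simp add: mult.assoc)
 qed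
 show ?thesis
  by (rule goodI[OF v_cont M_nonneg Cv(1) _ v_bound Cv(2) main]) (use c in auto)
qed

end

lemma wL2_zero: "wL2 (\<lambda>_. 0)"
 by (simp add: wL2_def WN_def)

text \<open>Dominated convergence along sequences. The moving end point alters the limit of the
  integrand only at \<open>z = fst a\<close>, a null set.\<close>

lemma tail_integral_continuous:
 fixes H :: "real => real => real => complex"
 assumes c: "\<And>z. continuous_on UNIV (\<lambda>(x, l). H z x l)" and m: "\<And>x l. (\<lambda>z. H z x l) \<in> bor"
  and w: "integrable lborel w" and b: "\<And>z x l. cmod (H z x l) <= w z"
 shows "continuous_on UNIV (\<lambda>(x, l). LINT z:{x..}|lborel. H z x l)"
proof (rule continuous_on_sequentiallyI)
 fix q :: "nat => real \<times> real" and a assume q: "q \<longlonglongrightarrow> a"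
 have q1: "(\<lambda>n. fst (q n)) \<longlonglongrightarrow> fst a" using q by (rule tendsto_fst)
 have "(\<lambda>n. \<integral>z. indicator {fst (q n)..} z *\<^sub>R H z (fst (q n)) (snd (q n)) \<partial>lborel)
  \<longlonglongrightarrow> (\<integral>z. indicator {fst a..} z *\<^sub>R H z (fst a) (snd a) \<partial>lborel)"
 proof (rule integral_dominated_convergence[OF _ _ w])
  note [measurable] = m
  show "(\<lambda>z. indicator {fst a..} z *\<^sub>R H z (fst a) (snd a)) \<in> borel_measurable lborel"
   "(\<lambda>z. indicator {fst (q n)..} z *\<^sub>R H z (fst (q n)) (snd (q n))) \<in> borel_measurable lborel" for n by measurable
  show "AE z in lborel. cmod (indicator {fst (q n)..} z *\<^sub>R H z (fst (q n)) (snd (q n))) <= w z" for n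
  proof (rule AE_I2)
   fix z show "cmod (indicator {fst (q n)..} z *\<^sub>R H z (fst (q n)) (snd (q n))) <= w z"
    using b[of z "fst (q n)" "snd (q n)"] order_trans[OF norm_ge_zero b[of z "fst (q n)" "snd (q n)"]] by (simp add: indicator_def)
  qed
  have "AE z in lborel. z \<noteq> fst a" by (rule AE_lborel_singleton)
  then show "AE z in lborel. (\<lambda>n. indicator {fst (q n)..} z *\<^sub>R H z (fst (q n)) (snd (q n))) \<longlonglongrightarrow> indicator {fst a..} z *\<^sub>R H z (fst a) (snd a)"
  proof eventually_elim
   case (elim z)
   have "isCont (\<lambda>(x, l). H z x l) a" using c[of z] continuous_on_eq_continuous_at[OF open_UNIV] by blast
   from isCont_tendsto_compose[OF this q] have H: "(\<lambda>n. H z (fst (q n)) (snd (q n))) \<longlonglongrightarrow> H z (fst a) (snd a)"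
    by (simp add: case_prod_beta)
   have "(\<lambda>n. indicator {fst (q n)..} z :: real) \<longlonglongrightarrow> indicator {fst a..} z"
   proof (rule tendsto_eventually)
    consider "z > fst a" | "z < fst a" using elim by linarith
    then show "\<forall>\<^sub>F n in sequentially. (indicator {fst (q n)..} z :: real) = indicator {fst a..} z"
    proof cases
     case 1
     then show ?thesis using order_tendstoD(2)[OF q1 1] by (auto elim!: eventually_mono simp: indicator_def)
    next
     case 2
     then show ?thesis using order_tendstoD(1)[OF q1 2] by (auto elim!: eventually_mono simp: indicator_def)
    qed
   qed
   then show ?case using H by (rule tendsto_scaleR)
  qed
 qed
 then show "(\<lambda>n. case q n of (x, l) => LINT z:{x..}|lborel. H z x l) \<longlonglongrightarrow> (case a of (x, l) => LINT z:{x..}|lborel. H z x l)"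
  by (simp add: set_lebesgue_integral_def case_prod_beta)
qed

lemma bounded_half_line:
 fixes g :: "real => complex"
 assumes "continuous_on UNIV g" "(g \<longlongrightarrow> 0) at_top"
 obtains B where "B >= 0" "\<And>x. x >= a ==> cmod (g x) <= B"
proof -
 have "\<forall>\<^sub>F x in at_top. dist (g x) 0 < 1" using assms(2) by (rule tendstoD) simp
 then obtain X where X: "\<And>x. x >= X ==> cmod (g x) < 1" by (auto simp: eventually_at_top_linorder)
 have "bounded (g ` {a..X})" by (intro compact_imp_bounded compact_continuous_image continuous_on_subset[OF assms(1)]) auto
 then obtain B where B: "B > 0" "\<And>x. x \<in> {a..X} ==> cmod (g x) <= B" by (auto simp: bounded_pos)
 have "cmod (g x) <= max B 1" if "x >= a" for x
  using B(2)[of x] X[of x] that by (cases "x <= X") auto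
 then show thesis using that[of "max B 1"] by auto
qed

lemma emeasure_half_line: "emeasure lborel {X..} = \<infinity>" "emeasure lborel {..X :: real} = \<infinity>"
proof -
 have top: "x = \<infinity>" if "\<And>n::nat. of_nat n <= x" for x :: ennreal
  using that ennreal_Ex_less_of_nat[of x] by (metis infinity_ennreal_def leD less_top)
 have "of_nat n <= emeasure lborel {X..}" "of_nat n <= emeasure lborel {..X}" for n :: nat
  using emeasure_mono[of "{X..X + real n}" "{X..}" lborel] emeasure_mono[of "{X - real n..X}" "{..X}" lborel]
  by (auto simp: ennreal_of_nat_eq_real_of_nat)
 then show "emeasure lborel {X..} = \<infinity>" "emeasure lborel {..X} = \<infinity>" using top by blast+
qed

text \<open>An integrable derivative gives limits at both ends; a limit other than 0 would keep the
  modulus away from 0 on a half line of infinite measure.\<close>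

lemma AC_integrable_limit_zero:
 assumes "AC g h" "integrable lborel g" "integrable lborel h"
 shows "(g \<longlongrightarrow> 0) at_top" "(g \<longlongrightarrow> 0) at_bot"
proof -
 have inf: "emeasure lborel A = \<infinity> ==> A \<in> sets borel ==> \<exists>x\<in>A. cmod (g x) < e" if "e > 0" for e and A :: "real set"
 proof (rule ccontr)
  assume A: "emeasure lborel A = \<infinity>" "A \<in> sets borel" and "\<not> (\<exists>x\<in>A. cmod (g x) < e)"
  then have ge: "\<And>x. x \<in> A ==> e <= cmod (g x)" by force
  have "ennreal e * emeasure lborel A = (NN x. ennreal e * indicator A x)"
   using A(2) by (simp add: nn_integral_cmult_indicator)
  also have "\<dots> <= (NN x. ennreal (cmod (g x)))"
   by (intro nn_integral_mono) (use ge in \<open>auto simp: indicator_def intro!: ennreal_leI\<close>)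
  also have "\<dots> < \<infinity>" using assms(2) by (simp add: integrable_iff_bounded)
  finally show False using A(1) that by (simp add: ennreal_mult_eq_top_iff)
 qed
 obtain L where L: "(g \<longlongrightarrow> L) at_top" using AC_limits(1)[OF assms(1,3)] by blast
 have "L = 0"
 proof (rule ccontr)
  assume "L \<noteq> 0"
  then have "\<forall>\<^sub>F x in at_top. dist (g x) L < cmod L / 2" using L by (intro tendstoD) auto
  then obtain X where X: "\<And>x. x >= X ==> dist (g x) L < cmod L / 2" by (auto simp: eventually_at_top_linorder)
  note emeasure_half_line(1)[of X]
  from inf[OF _ this, of "cmod L / 2"] \<open>L \<noteq> 0\<close> obtain x where "x >= X" "cmod (g x) < cmod L / 2" by auto
  with X[of x] norm_triangle_sub[of L "g x"] show False by (simp add: dist_norm norm_minus_commute)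
 qed
 then show "(g \<longlongrightarrow> 0) at_top" using L by simp
 obtain L where L: "(g \<longlongrightarrow> L) at_bot" using AC_limits(2)[OF assms(1,3)] by blast
 have "L = 0"
 proof (rule ccontr)
  assume "L \<noteq> 0"
  then have "\<forall>\<^sub>F x in at_bot. dist (g x) L < cmod L / 2" using L by (intro tendstoD) auto
  then obtain X where X: "\<And>x. x <= X ==> dist (g x) L < cmod L / 2" by (auto simp: eventually_at_bot_linorder)
  note emeasure_half_line(2)[of X]
  from inf[OF _ this, of "cmod L / 2"] \<open>L \<noteq> 0\<close> obtain x where "x <= X" "cmod (g x) < cmod L / 2" by auto
  with X[of x] norm_triangle_sub[of L "g x"] show False by (simp add: dist_norm norm_minus_commute)
 qed
 then show "(g \<longlongrightarrow> 0) at_bot" using L by simp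
qed

text \<open>Leibniz coefficients: if the sequences \<open>a\<close>, \<open>b\<close> are the iterated derivatives of two functions then
 \<open>bconv a b\<close> are those of their product.\<close>

definition bconv :: "(nat => complex) => (nat => complex) => nat => complex" where
 "bconv a b k = (\<Sum>i\<le>k. of_nat (k choose i) * (a (k - i) * b i))"

lemma bconv_Suc: "bconv a b (Suc k) = (\<Sum>i\<le>k. of_nat (k choose i) * (a (Suc (k - i)) * b i + a (k - i) * b (Suc i)))"
proof -
 have "bconv a b (Suc k) = a (Suc k) * b 0 + (\<Sum>i\<le>k. of_nat (Suc k choose Suc i) * (a (k - i) * b (Suc i)))"
  unfolding bconv_def by (subst sum.atMost_Suc_shift) simp
 also have "(\<Sum>i\<le>k. of_nat (Suc k choose Suc i) * (a (k - i) * b (Suc i)))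
  = (\<Sum>i\<le>k. of_nat (k choose i) * (a (k - i) * b (Suc i))) + (\<Sum>i\<le>k. of_nat (k choose Suc i) * (a (k - i) * b (Suc i)))"
  by (simp add: sum.distrib[symmetric] distrib_right)
 also have "a (Suc k) * b 0 + (\<dots>) = (\<Sum>i\<le>k. of_nat (k choose i) * (a (k - i) * b (Suc i))) +
  (a (Suc k) * b 0 + (\<Sum>i\<le>k. of_nat (k choose Suc i) * (a (k - i) * b (Suc i))))" by simp
 also have "a (Suc k) * b 0 + (\<Sum>i\<le>k. of_nat (k choose Suc i) * (a (k - i) * b (Suc i)))
  = (\<Sum>i\<le>Suc k. of_nat (k choose i) * (a (Suc k - i) * b i))"
  by (subst sum.atMost_Suc_shift) simp
 also have "\<dots> = (\<Sum>i\<le>k. of_nat (k choose i) * (a (Suc (k - i)) * b i))"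
  by (simp add: Suc_diff_le)
 finally show ?thesis by (simp add: distrib_left sum.distrib)
qed

lemma bconv_AC:
 assumes "\<And>i. i <= k ==> AC (\<lambda>x. a i x) (\<lambda>x. cor (p x) * a (Suc i) x)"
  and "\<And>i. i <= k ==> AC (\<lambda>x. b i x) (\<lambda>x. cor (p x) * b (Suc i) x)"
 shows "AC (\<lambda>x. bconv (\<lambda>i. a i x) (\<lambda>i. b i x) k) (\<lambda>x. cor (p x) * bconv (\<lambda>i. a i x) (\<lambda>i. b i x) (Suc k))"
proof -
 have "AC (\<lambda>x. \<Sum>i\<le>k. of_nat (k choose i) * (a (k - i) x * b i x))
  (\<lambda>x. \<Sum>i\<le>k. of_nat (k choose i) * (cor (p x) * a (Suc (k - i)) x * b i x + a (k - i) x * (cor (p x) * b (Suc i) x)))"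
  by (intro AC_sum AC_cmult AC_mult assms) auto
 then show ?thesis
  by (rule AC_cong) (simp add: bconv_def, simp add: bconv_Suc sum_distrib_left algebra_simps)
qed

declare sum.cong [fundef_cong]

text \<open>The iterated derivatives of a Riccati solution with respect to \<open>E\<close>,
  expressed through its value \<open>v0\<close> and the derivatives \<open>F\<close> of the
  coefficient at one point. Being purely algebraic, the recursion serves both solutions at the
  matching point with the same \<open>F\<close>. The congruence rule for sums lets the termination
  proof see that the indices stay below.\<close>

function (sequential) rser :: "(nat => complex) => real => complex => complex => nat => complex" where
 "rser F l m v0 0 = v0"
| "rser F l m v0 (Suc k) = - (2 * \<i> * l) * rser F l m v0 k + F k + m * (\<Sum>i\<le>k. of_nat (k choose i) * (cnj (F (k - i)) *
   (\<Sum>j\<le>i. of_nat (i choose j) * (rser F l m v0 (i - j) * rser F l m v0 j))))"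
 by pat_completeness auto
termination by (relation "Wellfounded.measure (\<lambda>(_, _, _, _, k). k)") auto

declare sum.cong [fundef_cong del]

lemma rser_Suc: "rser F l m v0 (Suc k) = - (2 * \<i> * l) * rser F l m v0 k + (F k + m * bconv (\<lambda>i. cnj (F i)) (bconv (rser F l m v0) (rser F l m v0)) k)"
 by (simp add: bconv_def)

context profile
begin

lemma small_integral_bound:
 fixes f h :: "real => complex"
 assumes [measurable]: "f \<in> bor" and small: "(NN z. ennreal \<bar>p z * cmod (f z)\<bar>) <= ennreal (1/16)"
  and h: "set_integrable lborel {x..} h" and b: "\<And>z. z >= x ==> cmod (h z) <= c * (p z * cmod (f z))" and c: "c >= 0"
 shows "cmod (LINT z:{x..}|lborel. h z) <= c / 16"
proof -
 have "ennreal (cmod (LINT z:{x..}|lborel. h z)) <= (NN z. ennreal (cmod (h z)) * indicator {x..} z)"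
  by (rule set_integral_norm_bound_ennreal[OF h])
 also have "\<dots> <= (NN z. ennreal c * ennreal \<bar>p z * cmod (f z)\<bar>)"
 proof (rule nn_integral_mono)
  fix z
  show "ennreal (cmod (h z)) * indicator {x..} z <= ennreal c * ennreal \<bar>p z * cmod (f z)\<bar>"
   using b[of z] c p_pos[of z] by (auto simp: indicator_def ennreal_mult[symmetric] abs_mult intro!: ennreal_leI)
 qed
 also have "\<dots> = ennreal c * (NN z. ennreal \<bar>p z * cmod (f z)\<bar>)" by (rule nn_integral_cmult) simp
 also have "\<dots> <= ennreal c * ennreal (1/16)" by (intro mult_left_mono small) simp
 also have "\<dots> = ennreal (c / 16)"
 proof -
  have "ennreal c * ennreal (1/16) = ennreal (c * (1/16))" using c by (intro ennreal_mult[symmetric]) auto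
  then show ?thesis by simp
 qed
 finally show ?thesis using c by (simp add: ennreal_le_iff)
qed

lemma ph_continuous: "continuous_on UNIV (\<lambda>(x, l). ph l x z)"
proof -
 have "continuous_on UNIV (\<lambda>q. E (fst q))" by (rule continuous_on_compose2[OF E_cont]) (auto intro!: continuous_intros)
 then show ?thesis unfolding ph_def case_prod_beta' by (intro continuous_intros)
qed

text \<open>The Riccati equation is solved by contraction in the space of bounded continuous functions
 of \<open>(x, l)\<close>, so joint continuity comes for free.\<close>

lemma riccati_exists:
 fixes f :: "real => complex" and \<mu> :: "real => real"
 assumes f: "wL2 f" and small: "(NN z. ennreal \<bar>p z * cmod (f z)\<bar>) <= ennreal (1/16)"
  and \<mu>: "continuous_on UNIV \<mu>" "\<And>l. \<bar>\<mu> l\<bar> <= 1"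
 obtains v where "continuous_on UNIV (\<lambda>(x, l). v x l)" "\<And>x l. cmod (v x l) <= 1/8"
  "\<And>x l. v x l = - (LINT z:{x..}|lborel. ph l x z * (p z * (f z + \<mu> l * (cnj (f z) * (v z l)\<^sup>2))))"
proof -
 note [measurable] = wL2_meas[OF f]
 define H where "H u z x l = ph l x z * (p z * (f z + \<mu> l * (cnj (f z) * (u z l)\<^sup>2)))" for u :: "real => real => complex" and z x l
 define T where "T u = (\<lambda>(x, l). - (LINT z:{x..}|lborel. H (\<lambda>z l. apply_bcontfun u (z, l)) z x l))" for u :: "(real \<times> real) \<Rightarrow>\<^sub>C complex"
 \<comment> \<open>On a ball of radius at most 1 the integrand is bounded by \<open>2 p |f|\<close>,
   so the image has norm at most \<open>2/16\<close>: this is the radius. The Lipschitz constant of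
   the map is then at most 1/16.\<close>
 define B where "B = cball (0 :: (real \<times> real) \<Rightarrow>\<^sub>C complex) (1/8)"
 have ub: "cmod (apply_bcontfun u q) <= 1/8" if "u \<in> B" for u q
  using norm_bounded[of u q] that by (simp add: B_def)
 have um: "pmeas (\<lambda>z l. apply_bcontfun u (z, l))" for u :: "(real \<times> real) \<Rightarrow>\<^sub>C complex"
  by (rule pmeas_continuous) (simp add: case_prod_beta')
 have Hm: "(\<lambda>z. H (\<lambda>z l. apply_bcontfun u (z, l)) z x l) \<in> bor" for u x l
 proof -
  note [measurable (raw)] = pmeas_comp[OF um]
  show ?thesis unfolding H_def by measurable
 qed
 have Hb: "cmod (H (\<lambda>z l. apply_bcontfun u (z, l)) z x l) <= 2 * (p z * cmod (f z))" if u: "u \<in> B" for u z x l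
 proof -
  have "cmod (f z + \<mu> l * (cnj (f z) * (apply_bcontfun u (z, l))\<^sup>2)) <= cmod (f z) + \<bar>\<mu> l\<bar> * (cmod (f z) * (cmod (apply_bcontfun u (z, l)))\<^sup>2)"
   by (rule order_trans[OF norm_triangle_ineq]) (simp add: norm_mult norm_power)
  also have "\<dots> <= cmod (f z) + 1 * (cmod (f z) * 1)"
   using ub[OF u, of "(z, l)"] by (intro add_left_mono mult_mono \<mu> power_le_one) auto
  finally have "cmod (f z + \<mu> l * (cnj (f z) * (apply_bcontfun u (z, l))\<^sup>2)) <= 2 * cmod (f z)" by simp
  from mult_left_mono[OF this p_pos(2)[of z]] show ?thesis
   using p_pos[of z] by (simp add: H_def norm_mult mult_ac)
 qed
 have wi: "integrable lborel (\<lambda>z. 2 * (p z * cmod (f z)))"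
  using integrable_norm[OF wL2_integrable[OF wL2_p[OF f]]] p_pos by (simp add: norm_mult abs_of_pos)
 have Hi: "set_integrable lborel {x..} (\<lambda>z. H (\<lambda>z l. apply_bcontfun u (z, l)) z x l)" if "u \<in> B" for u x l
  by (rule set_integrable_dominated[OF wL2_integrable[OF wL2_p[OF f]], where c=2])
   (use Hm Hb[OF that] p_pos in \<open>auto simp: norm_mult abs_of_pos\<close>)
 have Tc: "continuous_on UNIV (T u)" if u: "u \<in> B" for u
 proof -
  have "continuous_on UNIV (\<lambda>(x, l). LINT z:{x..}|lborel. H (\<lambda>z l. apply_bcontfun u (z, l)) z x l)"
  proof (rule tail_integral_continuous[OF _ Hm wi Hb[OF u]])
   fix z
   have 1: "continuous_on UNIV (\<lambda>q. \<mu> (snd q))" by (rule continuous_on_compose2[OF \<mu>(1)]) (auto intro!: continuous_intros)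
   have 2: "continuous_on UNIV (\<lambda>q. apply_bcontfun u (z, snd q))"
    by (rule continuous_on_compose2[OF continuous_on_apply_bcontfun[of UNIV u]]) (auto intro!: continuous_intros)
   show "continuous_on UNIV (\<lambda>(x, l). H (\<lambda>z l. apply_bcontfun u (z, l)) z x l)"
    unfolding H_def case_prod_beta' by (intro continuous_intros ph_continuous[unfolded case_prod_beta'] 1 2)
  qed
  from continuous_on_minus[OF this] show ?thesis unfolding T_def by (simp add: case_prod_beta')
 qed
 have Tb: "cmod (T u q) <= 1/8" if "u \<in> B" for u q
  using small_integral_bound[OF _ small Hi[OF that] Hb[OF that]] by (auto simp: T_def case_prod_beta)
 define TT where "TT u = Bcontfun (T u)" for u
 have TTa: "apply_bcontfun (TT u) = T u" if "u \<in> B" for u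
  unfolding TT_def by (rule Bcontfun_inverse, rule bcontfun_normI[OF Tc[OF that] Tb[OF that]])
 have "closed B" unfolding B_def by simp
 note cB = complete_eq_closed[THEN iffD2, OF this]
 have "\<exists>!u. u \<in> B \<and> TT u = u"
 proof (rule Banach_fix[OF cB, where c="1/2"])
  show "B \<noteq> {}" unfolding B_def by simp
  show "TT ` B \<subseteq> B"
  proof (rule image_subsetI)
   fix u assume u: "u \<in> B"
   have "norm (TT u) <= 1/8" by (rule norm_bound) (use Tb[OF u] TTa[OF u] in simp)
   then show "TT u \<in> B" by (simp add: B_def)
  qed
  fix u w assume u: "u \<in> B" and w: "w \<in> B"
  show "dist (TT u) (TT w) <= 1/2 * dist u w"
  proof (rule dist_bound)
   fix q :: "real \<times> real"
   obtain x l where q: "q = (x, l)" by (cases q)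
   let ?u = "\<lambda>z l. apply_bcontfun u (z, l)" and ?w = "\<lambda>z l. apply_bcontfun w (z, l)"
   have "dist (T u q) (T w q) = cmod ((LINT z:{x..}|lborel. H ?w z x l) - (LINT z:{x..}|lborel. H ?u z x l))"
    unfolding T_def q dist_norm by (simp add: norm_minus_commute)
   also have "\<dots> = cmod (LINT z:{x..}|lborel. H ?w z x l - H ?u z x l)"
    by (subst set_integral_diff(2)[OF Hi[OF w] Hi[OF u]]) simp
   also have "\<dots> <= dist u w / 16"
   proof (rule small_integral_bound[OF _ small])
    show "set_integrable lborel {x..} (\<lambda>z. H ?w z x l - H ?u z x l)" by (rule set_integral_diff(1)[OF Hi[OF w] Hi[OF u]])
    fix z
    have "H ?w z x l - H ?u z x l = ph l x z * (p z * (\<mu> l * (cnj (f z) * ((?w z l + ?u z l) * (?w z l - ?u z l)))))"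
     unfolding H_def by (simp add: algebra_simps power2_eq_square)
    then have "cmod (H ?w z x l - H ?u z x l) = p z * cmod (f z) * (\<bar>\<mu> l\<bar> * (cmod (?w z l + ?u z l) * cmod (?w z l - ?u z l)))"
     using p_pos[of z] by (simp add: norm_mult)
    also have "\<dots> <= p z * cmod (f z) * (1 * (1 * dist u w))"
    proof (intro mult_left_mono mult_mono \<mu>)
     show "cmod (?w z l + ?u z l) <= 1" using norm_triangle_le[OF add_mono[OF ub[OF w] ub[OF u]], of "(z, l)" "(z, l)"] by simp
     show "cmod (?w z l - ?u z l) <= dist u w" using dist_bounded[of u "(z, l)" w] by (simp add: dist_norm norm_minus_commute)
    qed (use p_pos[of z] in auto)
    finally show "cmod (H ?w z x l - H ?u z x l) <= dist u w * (p z * cmod (f z))" by (simp add: mult.commute)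
   qed auto
   also have "\<dots> <= 1/2 * dist u w" by simp
   finally show "dist (apply_bcontfun (TT u) q) (apply_bcontfun (TT w) q) <= 1/2 * dist u w" using TTa u w by simp
  qed
 qed auto
 then obtain u where u: "u \<in> B" "TT u = u" by blast
 have fixpt: "apply_bcontfun u (x, l) = - (LINT z:{x..}|lborel. H (\<lambda>z l. apply_bcontfun u (z, l)) z x l)" for x l
 proof -
  have "apply_bcontfun u (x, l) = T u (x, l)" by (rule fun_cong[OF TTa[OF u(1), unfolded u(2)]])
  also have "\<dots> = - (LINT z:{x..}|lborel. H (\<lambda>z l. apply_bcontfun u (z, l)) z x l)" by (simp add: T_def)
  finally show ?thesis .
 qed
 show thesis
 proof (rule that[of "\<lambda>x l. apply_bcontfun u (x, l)"])
  show "continuous_on UNIV (\<lambda>(x, l). apply_bcontfun u (x, l))" by (simp add: case_prod_beta')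
  show "cmod (apply_bcontfun u (x, l)) <= 1/8" for x l by (rule ub[OF u(1)])
  show "apply_bcontfun u (x, l) = - (LINT z:{x..}|lborel. ph l x z * (p z * (f z + \<mu> l * (cnj (f z) * (apply_bcontfun u (z, l))\<^sup>2))))" for x l
   by (rule fixpt[unfolded H_def])
 qed
qed

lemma cis_E_AC: "AC (\<lambda>x. cis (c * E x)) (\<lambda>x. \<i> * c * p x * cis (c * E x))"
proof (rule AC_of_deriv)
 fix x
 have "((\<lambda>x. c * E x) has_vector_derivative c * p x) (at x)"
  using DERIV_cmult[OF E_deriv[of x], of c] by (simp add: has_real_derivative_iff_has_vector_derivative)
 moreover have "(cis has_vector_derivative \<i> * cis t) (at t)" for t
 proof -
  have "((\<lambda>z. exp (\<i> * z)) has_field_derivative \<i> * cis t) (at (cor t))"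
   by (auto intro!: derivative_eq_intros simp: cis_conv_exp)
  from has_vector_derivative_real_field[OF this] show ?thesis by (simp add: cis_conv_exp[abs_def])
 qed
 ultimately have "(cis \<circ> (\<lambda>x. c * E x) has_vector_derivative (c * p x) *\<^sub>R (\<i> * cis (c * E x))) (at x)"
  by (rule vector_diff_chain_at)
 then show "((\<lambda>x. cis (c * E x)) has_vector_derivative \<i> * c * p x * cis (c * E x)) (at x)"
  by (simp add: o_def scaleR_conv_of_real mult_ac)
next
 show "continuous_on UNIV (\<lambda>x. \<i> * c * p x * cis (c * E x))"
  by (intro continuous_intros p_cont E_cont)
qed

text \<open>For each \<open>l\<close> separately the function is bounded, with a bound that may
  depend on \<open>l\<close>; smallness of \<open>f\<close> makes the bound uniform by absorption in
  the supremum. It supplies \<open>v_bound\<close> of \<open>duhamel\<close> for the higher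
  derivatives, where no contraction provides it.\<close>

lemma duhamel_uniform_bound:
 fixes v M1 R :: "real => real => complex" and f g0 :: "real => complex"
 assumes f: "wL2 f" and small: "(NN z. ennreal \<bar>p z * cmod (f z)\<bar>) <= ennreal (1/16)"
  and g0: "wL2 g0" and R: "src R" and M1m: "pmeas M1"
  and M1b: "\<And>z l. z >= 0 ==> cmod (M1 z l) <= cmod (f z) * cmod (v z l)"
  and i: "\<And>x l. x >= 0 ==> set_integrable lborel {x..} (\<lambda>z. ph l x z * (p z * (g0 z + M1 z l + R z l)))"
  and eq: "\<And>x l. x >= 0 ==> v x l = - (LINT z:{x..}|lborel. ph l x z * (p z * (g0 z + M1 z l + R z l)))"
  and bd: "\<And>l. \<exists>B. \<forall>x\<ge>0. cmod (v x l) <= B"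
 shows "\<exists>M. \<forall>x\<ge>0. \<forall>l. cmod (v x l) <= M"
proof -
 note [measurable] = wL2_meas[OF f] wL2_meas[OF g0]
 obtain k A B C where R': "src_bounds R k A B C" using R unfolding src_def by blast
 then have k: "wL2 k" and C: "C >= 0" by (auto simp: src_bounds_def)
 note [measurable] = wL2_meas[OF k]
 have fin: "(NN z. ennreal (p z * cmod (g z))) < \<infinity>" if "wL2 g" for g
  using wL2_integrable[OF wL2_p[OF that]] p_pos by (simp add: integrable_iff_bounded norm_mult abs_of_pos)
 obtain c0 where c0: "c0 >= 0" "(NN z. ennreal (p z * cmod (g0 z))) = ennreal c0"
  using fin[OF g0] by (cases "NN z. ennreal (p z * cmod (g0 z))") auto
 obtain K where K: "K >= 0" "(NN z. ennreal (p z * cmod (k z))) = ennreal K"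
  using fin[OF k] by (cases "NN z. ennreal (p z * cmod (k z))") auto
 have "cmod (v x l) <= 2 * (c0 + C * K)" if x: "x >= 0" for x l
 proof -
  define S where "S = (SUP x\<in>{0..}. cmod (v x l))"
  obtain B where B: "\<And>x. x >= 0 ==> cmod (v x l) <= B" using bd by blast
  have bdd: "bdd_above ((\<lambda>x. cmod (v x l)) ` {0..})" using B by (auto simp: bdd_above_def)
  have Sup: "cmod (v z l) <= S" if "z >= 0" for z unfolding S_def using that by (intro cSUP_upper bdd) auto
  have S0: "S >= 0" using Sup[of 0] norm_ge_zero order_trans by blast
  have "cmod (v y l) <= c0 + C * K + S / 16" if y: "y >= 0" for y
  proof -
   have "ennreal (cmod (v y l)) = ennreal (cmod (LINT z:{y..}|lborel. ph l y z * (p z * (g0 z + M1 z l + R z l))))"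
    unfolding eq[OF y] by simp
   also have "\<dots> <= (NN z. ennreal (cmod (ph l y z * (p z * (g0 z + M1 z l + R z l)))) * indicator {y..} z)"
    by (rule set_integral_norm_bound_ennreal[OF i[OF y]])
   also have "\<dots> <= (NN z. ennreal (p z * cmod (g0 z)) + (ennreal C * ennreal (p z * cmod (k z)) + ennreal S * ennreal \<bar>p z * cmod (f z)\<bar>))"
   proof (rule nn_integral_mono)
    fix z
    show "ennreal (cmod (ph l y z * (p z * (g0 z + M1 z l + R z l)))) * indicator {y..} z
     <= ennreal (p z * cmod (g0 z)) + (ennreal C * ennreal (p z * cmod (k z)) + ennreal S * ennreal \<bar>p z * cmod (f z)\<bar>)"
    proof (cases "z \<in> {y..}")
     case True
     then have z: "z >= 0" using y by simp
     have r: "cmod (R z l) <= cmod (k z) * C"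
     proof -
      have "cmod (R z l) <= cmod (k z) * cmod (A z l)" "cmod (A z l) <= C" using R' z by (auto simp: src_bounds_def)
      then show ?thesis using mult_left_mono[of "cmod (A z l)" C "cmod (k z)"] by simp
     qed
     have m: "cmod (M1 z l) <= cmod (f z) * S" using M1b[OF z, of l] mult_left_mono[OF Sup[OF z], of "cmod (f z)"] by simp
     have "cmod (g0 z + M1 z l + R z l) <= cmod (g0 z) + cmod (f z) * S + cmod (k z) * C"
      using norm_triangle_ineq[of "g0 z + M1 z l" "R z l"] norm_triangle_ineq[of "g0 z" "M1 z l"] r m by linarith
     from mult_left_mono[OF this p_pos(2)[of z]]
     have "cmod (ph l y z * (p z * (g0 z + M1 z l + R z l))) <= p z * cmod (g0 z) + (C * (p z * cmod (k z)) + S * (p z * cmod (f z)))"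
      unfolding norm_mult norm_ph norm_of_real using p_pos[of z] by (simp add: algebra_simps)
     then have "ennreal (cmod (ph l y z * (p z * (g0 z + M1 z l + R z l)))) <= ennreal (p z * cmod (g0 z) + (C * (p z * cmod (k z)) + S * (p z * cmod (f z))))"
      by (rule ennreal_leI)
     also have "\<dots> = ennreal (p z * cmod (g0 z)) + (ennreal C * ennreal (p z * cmod (k z)) + ennreal S * ennreal \<bar>p z * cmod (f z)\<bar>)"
      using C S0 p_pos[of z] by (simp add: ennreal_mult[symmetric] abs_mult)
     finally show ?thesis using True by simp
    qed simp
   qed
   also have "\<dots> = ennreal c0 + (ennreal C * ennreal K + ennreal S * (NN z. ennreal \<bar>p z * cmod (f z)\<bar>))"
    unfolding c0(2)[symmetric] K(2)[symmetric] by (simp add: nn_integral_add nn_integral_cmult)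
   also have "\<dots> <= ennreal c0 + (ennreal C * ennreal K + ennreal S * ennreal (1/16))"
    by (intro add_left_mono mult_left_mono small) simp
   also have "\<dots> = ennreal (c0 + C * K + S / 16)"
   proof -
    have "ennreal S * ennreal (1/16) = ennreal (S / 16)" using S0 ennreal_mult[of S "1/16"] by simp
    then show ?thesis using c0 C K S0 by (simp add: ennreal_mult add.assoc)
   qed
   finally show ?thesis using c0 C K S0 by (subst (asm) ennreal_le_iff) auto
  qed
  then have "S <= c0 + C * K + S / 16" unfolding S_def by (intro cSUP_least) auto
  moreover have "s <= 2 * X" if "s <= X + s / 16" "0 <= X" for s X :: real using that by linarith
  moreover have "0 <= c0 + C * K" using c0(1) mult_nonneg_nonneg[OF C K(1)] by simp
  ultimately have "S <= 2 * (c0 + C * K)" by blast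
  then show ?thesis using Sup[OF x] by simp
 qed
 then show ?thesis by blast
qed

end

text \<open>The sequence \<open>f\<close> lists the derivatives of \<open>f 0\<close> with respect
  to \<open>E\<close>: each is \<open>1/p\<close> times the x-derivative of the previous one. Only
  \<open>f 0\<close> is required to be small. The multiplier \<open>\<mu>\<close> leaves room for
  both applications, constant 1 and a cut-off of \<open>l^2\<close>.\<close>

locale riccati_solution = profile +
 fixes f :: "nat => real => complex" and n :: nat and \<mu> :: "real => real" and L :: real and v :: "real => real => complex"
 assumes f_w: "\<And>k. k <= n ==> wL2 (f k)"
  and f_AC: "\<And>k. k < n ==> AC (f k) (\<lambda>x. p x * f (Suc k) x)"
  and f_small: "(NN z. ennreal \<bar>p z * cmod (f 0 z)\<bar>) <= ennreal (1/16)"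
  and mu_le: "\<And>l. \<bar>\<mu> l\<bar> <= 1" and mu_lip: "\<And>l h. \<bar>\<mu> (l + h) - \<mu> l\<bar> <= L * \<bar>h\<bar>"
  and v_cont: "continuous_on UNIV (\<lambda>(x, l). v x l)" and v_le: "\<And>x l. cmod (v x l) <= 1/8"
  and v_eq: "\<And>x l. v x l = - (LINT z:{x..}|lborel. ph l x z * (p z * (f 0 z + \<mu> l * (cnj (f 0 z) * (v z l)\<^sup>2))))"
begin

lemma mu_cont: "continuous_on UNIV \<mu>"
proof -
 have "(\<bar>L\<bar>)-lipschitz_on UNIV \<mu>"
 proof (rule lipschitz_onI)
  fix x y :: real
  have "\<bar>\<mu> x - \<mu> y\<bar> <= L * \<bar>x - y\<bar>" using mu_lip[of y "x - y"] by simp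
  also have "\<dots> <= \<bar>L\<bar> * \<bar>x - y\<bar>" by (intro mult_right_mono) auto
  finally show "dist (\<mu> x) (\<mu> y) <= \<bar>L\<bar> * dist x y" by (simp add: dist_real_def)
 qed simp
 then show ?thesis by (rule lipschitz_on_continuous_on)
qed

lemmas f0 = f_w[of 0, simplified]
lemmas [measurable] = wL2_meas[OF f0]
lemmas [measurable (raw)] = pmeas_comp[OF pmeas_continuous[OF v_cont]]

definition vs :: "nat => real => real => complex" where
 "vs k x l = rser (\<lambda>i. f i x) l (\<mu> l) (v x l) k"

text \<open>Everything in the k-th equation except the diagonal term. The expression
  \<open>- 2 i l vs k + G k\<close> is read twice: as the recursion for \<open>vs (Suc k)\<close>
  and as the derivative of \<open>vs k\<close> with respect to \<open>E\<close>.\<close>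

definition G :: "nat => real => real => complex" where
 "G k x l = f k x + \<mu> l * bconv (\<lambda>i. cnj (f i x)) (bconv (\<lambda>i. vs i x l) (\<lambda>i. vs i x l)) k"

lemma vs_0: "vs 0 x l = v x l" by (simp add: vs_def)

lemma vs_Suc: "vs (Suc k) x l = - (2 * \<i> * l) * vs k x l + G k x l"
 unfolding vs_def G_def by (rule rser_Suc)

lemma v_integrand: "set_integrable lborel {x..} (\<lambda>z. cis (2 * l * E z) * (p z * (f 0 z + \<mu> l * (cnj (f 0 z) * (v z l)\<^sup>2))))"
proof (rule set_integrable_dominated[OF wL2_integrable[OF wL2_p[OF f0]], where c=2])
 fix z
 have "cmod (f 0 z + \<mu> l * (cnj (f 0 z) * (v z l)\<^sup>2)) <= cmod (f 0 z) + \<bar>\<mu> l\<bar> * (cmod (f 0 z) * (cmod (v z l))\<^sup>2)"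
  by (rule order_trans[OF norm_triangle_ineq]) (simp add: norm_mult norm_power)
 also have "\<dots> <= cmod (f 0 z) + 1 * (cmod (f 0 z) * 1)"
  using v_le[of z l] by (intro add_left_mono mult_mono mu_le power_le_one) auto
 finally have "cmod (f 0 z + \<mu> l * (cnj (f 0 z) * (v z l)\<^sup>2)) <= 2 * cmod (f 0 z)" by simp
 from mult_left_mono[OF this p_pos(2)[of z]]
 show "cmod (cis (2 * l * E z) * (p z * (f 0 z + \<mu> l * (cnj (f 0 z) * (v z l)\<^sup>2)))) <= 2 * cmod (cor (p z) * f 0 z)"
  using p_pos[of z] by (simp add: norm_mult mult_ac)
qed measurable

text \<open>With the integrating factor the integrand no longer depends on \<open>x\<close>, and the
  integral equation can be differentiated.\<close>

lemma v_cis: "cis (2 * l * E x) * v x l = - (LINT z:{x..}|lborel. cis (2 * l * E z) * (p z * (f 0 z + \<mu> l * (cnj (f 0 z) * (v z l)\<^sup>2))))"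
proof -
 have c: "ph l x z = cis (- (2 * l * E x)) * cis (2 * l * E z)" for z by (simp add: ph_def cis_mult algebra_simps)
 have "(LINT z:{x..}|lborel. ph l x z * (p z * (f 0 z + \<mu> l * (cnj (f 0 z) * (v z l)\<^sup>2)))) =
  cis (- (2 * l * E x)) * (LINT z:{x..}|lborel. cis (2 * l * E z) * (p z * (f 0 z + \<mu> l * (cnj (f 0 z) * (v z l)\<^sup>2))))"
  unfolding c mult.assoc by (rule set_integral_mult_right)
 then have "v x l = - (cis (- (2 * l * E x)) * (LINT z:{x..}|lborel. cis (2 * l * E z) * (p z * (f 0 z + \<mu> l * (cnj (f 0 z) * (v z l)\<^sup>2)))))"
  using v_eq[of x l] by simp
 then show ?thesis by (simp add: mult.assoc[symmetric] cis_mult)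
qed

lemma V_AC: "AC (\<lambda>x. cis (2 * l * E x) * v x l) (\<lambda>x. cis (2 * l * E x) * (p x * (f 0 x + \<mu> l * (cnj (f 0 x) * (v x l)\<^sup>2))))"
 unfolding v_cis by (rule AC_upper_integral[OF _ v_integrand]) measurable

lemma v_tendsto_0: "((\<lambda>x. v x l) \<longlongrightarrow> 0) at_top"
proof -
 have "((\<lambda>x. cis (2 * l * E x) * v x l) \<longlongrightarrow> 0) at_top"
  unfolding v_cis using tendsto_minus[OF upper_integral_at_top[OF v_integrand]] by simp
 then have "((\<lambda>x. cmod (cis (2 * l * E x) * v x l)) \<longlongrightarrow> 0) at_top" by (rule tendsto_norm_zero)
 then show ?thesis by (intro tendsto_norm_zero_cancel[of "\<lambda>x. v x l"]) (simp add: norm_mult)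
qed

lemma v_AC: "AC (\<lambda>x. v x l) (\<lambda>x. p x * (- (2 * \<i> * l) * v x l + (f 0 x + \<mu> l * (cnj (f 0 x) * (v x l)\<^sup>2))))"
 using AC_mult[OF cis_E_AC[of "- (2 * l)"] V_AC[of l]]
proof (rule AC_cong)
 have cd: "cis (- (2 * l) * E x) * cis (2 * l * E x) = 1" for x by (simp add: cis_mult)
 have alg: "\<i> * a * q * c * (d * y) + c * (d * (q * g)) = q * (\<i> * a * y + g)" if "c * d = 1" for a q c d y g :: complex
 proof -
  have "\<i> * a * q * c * (d * y) + c * (d * (q * g)) = (c * d) * (q * (\<i> * a * y + g))" by (simp add: algebra_simps)
  then show ?thesis using that by simp
 qed
 show "cis (- (2 * l) * E x) * (cis (2 * l * E x) * v x l) = v x l" for x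
  unfolding mult.assoc[symmetric] cd by simp
 show "\<i> * cor (- (2 * l)) * cor (p x) * cis (- (2 * l) * E x) * (cis (2 * l * E x) * v x l) +
   cis (- (2 * l) * E x) * (cis (2 * l * E x) * (cor (p x) * (f 0 x + cor (\<mu> l) * (cnj (f 0 x) * (v x l)\<^sup>2)))) =
   cor (p x) * (- (2 * \<i> * l) * v x l + (f 0 x + cor (\<mu> l) * (cnj (f 0 x) * (v x l)\<^sup>2)))" for x
  unfolding alg[OF cd] by simp
qed

text \<open>By induction the lower \<open>vs i\<close> are consecutive derivatives of one another,
  so \<open>bconv_AC\<close> differentiates the recursion itself and reproduces it one order
  higher.\<close>

lemma vs_AC: "k <= n ==> AC (\<lambda>x. vs k x l) (\<lambda>x. p x * (- (2 * \<i> * l) * vs k x l + G k x l))"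
proof (induction k rule: less_induct)
 case (less k)
 show ?case
 proof (cases k)
  case 0
  then show ?thesis using v_AC[of l] by (simp add: vs_0 G_def bconv_def power2_eq_square)
 next
  case (Suc j)
  have vd: "AC (\<lambda>x. vs i x l) (\<lambda>x. cor (p x) * vs (Suc i) x l)" if "i <= j" for i
   using less.IH[of i] that Suc less.prems by (simp add: vs_Suc)
  have fd: "AC (f i) (\<lambda>x. cor (p x) * f (Suc i) x)" if "i <= j" for i
   using f_AC[of i] that Suc less.prems by simp
  have cd: "AC (\<lambda>x. cnj (f i x)) (\<lambda>x. cor (p x) * cnj (f (Suc i) x))" if "i <= j" for i
   using AC_cnj[OF fd[OF that]] by simp
  have vv: "AC (\<lambda>x. bconv (\<lambda>i. vs i x l) (\<lambda>i. vs i x l) i) (\<lambda>x. cor (p x) * bconv (\<lambda>i. vs i x l) (\<lambda>i. vs i x l) (Suc i))" if "i <= j" for i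
   using that by (intro bconv_AC[where a="\<lambda>i x. vs i x l" and b="\<lambda>i x. vs i x l"] vd) auto
  have "AC (\<lambda>x. bconv (\<lambda>i. cnj (f i x)) (bconv (\<lambda>i. vs i x l) (\<lambda>i. vs i x l)) j)
   (\<lambda>x. cor (p x) * bconv (\<lambda>i. cnj (f i x)) (bconv (\<lambda>i. vs i x l) (\<lambda>i. vs i x l)) (Suc j))"
   by (rule bconv_AC[where a="\<lambda>i x. cnj (f i x)" and b="\<lambda>i x. bconv (\<lambda>i. vs i x l) (\<lambda>i. vs i x l) i"]) (intro cd vv; simp)+
  from AC_add[OF fd[OF order_refl] AC_cmult[OF this, of "\<mu> l"]]
  have "AC (\<lambda>x. G j x l) (\<lambda>x. p x * G (Suc j) x l)" by (rule AC_cong) (simp_all add: G_def algebra_simps)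
  from AC_add[OF AC_cmult[OF vd[OF order_refl], of "- (2 * \<i> * l)"] this]
  have "AC (\<lambda>x. vs (Suc j) x l) (\<lambda>x. p x * (- (2 * \<i> * l) * vs (Suc j) x l + G (Suc j) x l))"
   by (rule AC_cong) (simp_all add: vs_Suc algebra_simps)
  then show ?thesis using Suc by simp
 qed
qed

lemma f_cont: "k < n ==> continuous_on UNIV (f k)"
 by (rule AC_continuous[OF f_AC])

lemma vs_cont: "k <= n ==> continuous_on UNIV (\<lambda>q. vs k (fst q) (snd q))"
proof (induction k rule: less_induct)
 case (less k)
 show ?case
 proof (cases k)
  case 0
  then show ?thesis using v_cont by (simp add: vs_0 case_prod_beta')
 next
  case (Suc j)
  have vc: "continuous_on UNIV (\<lambda>q. vs i (fst q) (snd q))" if "i <= j" for i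
   using less.IH[of i] that Suc less.prems by simp
  have fc: "continuous_on UNIV (\<lambda>q :: real \<times> real. f i (fst q))" if "i <= j" for i
   by (rule continuous_on_compose2[OF f_cont[of i]]) (use that Suc less.prems in \<open>auto intro!: continuous_intros\<close>)
  have mc: "continuous_on UNIV (\<lambda>q :: real \<times> real. cor (\<mu> (snd q)))"
   by (intro continuous_intros continuous_on_compose2[OF mu_cont]) auto
  show ?thesis unfolding Suc vs_Suc G_def bconv_def
   by (intro continuous_intros vc fc mc) auto
 qed
qed

lemma f_tendsto_0: "k < n ==> (f k \<longlongrightarrow> 0) at_top"
 by (rule AC_integrable_limit_zero(1)[OF f_AC wL2_integrable[OF f_w] wL2_integrable[OF wL2_p[OF f_w]]]) auto

lemma vs_tendsto_0: "k <= n ==> ((\<lambda>x. vs k x l) \<longlongrightarrow> 0) at_top"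
proof (induction k rule: less_induct)
 case (less k)
 show ?case
 proof (cases k)
  case 0
  then show ?thesis using v_tendsto_0 by (simp add: vs_0)
 next
  case (Suc j)
  have v0: "((\<lambda>x. vs i x l) \<longlongrightarrow> 0) at_top" if "i <= j" for i
   using less.IH[of i] that Suc less.prems by simp
  have f0: "((\<lambda>x. f i x) \<longlongrightarrow> 0) at_top" if "i <= j" for i
   using f_tendsto_0[of i] that Suc less.prems by simp
  have "((\<lambda>x. - (2 * \<i> * l) * vs j x l + (f j x + \<mu> l * (\<Sum>i\<le>j. of_nat (j choose i) * (cnj (f (j - i) x) * (\<Sum>i'\<le>i. of_nat (i choose i') * (vs (i - i') x l * vs i' x l)))))) \<longlongrightarrow>
   - (2 * \<i> * l) * 0 + (0 + \<mu> l * (\<Sum>i\<le>j. of_nat (j choose i) * (cnj 0 * (\<Sum>i'\<le>i. of_nat (i choose i') * (0 * 0)))))) at_top"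
   by (intro tendsto_intros v0 f0) auto
  then show ?thesis unfolding Suc vs_Suc G_def bconv_def by simp
 qed
qed

lemma G_integrable:
 assumes "k <= n" "x >= 0"
 shows "set_integrable lborel {x..} (\<lambda>z. p z * G k z l)" "(\<lambda>z. G k z l) \<in> bor"
proof -
 have fm[measurable]: "f i \<in> bor" if "i <= k" for i using f_w[of i] that assms by auto
 have vm: "(\<lambda>z. vs i z l) \<in> bor" if "i <= k" for i
  using AC_meas[OF vs_AC[of i l]] that assms by simp
 have vb: "\<exists>B\<ge>0. \<forall>z\<ge>x. cmod (vs i z l) <= B" if "i <= k" for i
  using bounded_half_line[OF AC_continuous[OF vs_AC[of i l]] vs_tendsto_0[of i l], of x] that assms by (metis order_trans)
 then obtain Bf where Bf: "\<And>i. i <= k ==> Bf i >= 0" "\<And>i z. i <= k ==> z >= x ==> cmod (vs i z l) <= Bf i" by metis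
 have mG: "(\<lambda>z. G k z l) \<in> bor"
  unfolding G_def bconv_def
  by (intro borel_measurable_add borel_measurable_times borel_measurable_sum borel_measurable_const borel_measurable_cnj fm vm) auto
 then show "(\<lambda>z. G k z l) \<in> bor" .
 define w where "w z = cor (\<Sum>i\<le>k. cmod (f i z))" for z
 have ww: "wL2 w"
 proof -
  have "wL2 (\<lambda>z. \<Sum>i\<in>I. cor (cmod (f i z)))" if "finite I" "I \<subseteq> {..n}" for I
   using that by (induction I rule: finite_induct) (auto intro!: wL2_add wL2_abs f_w wL2_zero)
  from this[of "{..k}"] assms show ?thesis unfolding w_def by simp
 qed
 define C where "C = 1 + (\<Sum>i\<le>k. real (k choose i) * (\<Sum>j\<le>i. real (i choose j) * (Bf (i - j) * Bf j)))"
 show "set_integrable lborel {x..} (\<lambda>z. p z * G k z l)"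
 proof (rule set_integrable_dominated[OF wL2_integrable[OF wL2_p[OF ww]], where c=C])
  fix z assume z: "z \<in> {x..}"
  have fw: "cmod (f i z) <= cmod (w z)" if "i <= k" for i
   using member_le_sum[of i "{..k}" "\<lambda>i. cmod (f i z)"] that unfolding w_def norm_of_real by simp
  have S: "cmod (bconv (\<lambda>i. vs i z l) (\<lambda>i. vs i z l) i) <= (\<Sum>j\<le>i. real (i choose j) * (Bf (i - j) * Bf j))" if "i <= k" for i
   unfolding bconv_def
   by (rule sum_norm_le) (use that z Bf in \<open>auto simp: norm_mult intro!: mult_left_mono mult_mono\<close>)
  have "cmod (bconv (\<lambda>i. cnj (f i z)) (bconv (\<lambda>i. vs i z l) (\<lambda>i. vs i z l)) k) <= (\<Sum>i\<le>k. real (k choose i) * (cmod (w z) * (\<Sum>j\<le>i. real (i choose j) * (Bf (i - j) * Bf j))))"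
   by (subst bconv_def, rule sum_norm_le) (auto simp: norm_mult intro!: mult_left_mono mult_mono fw S)
  also have "\<dots> = (C - 1) * cmod (w z)" unfolding C_def by (simp add: sum_distrib_right sum_distrib_left mult_ac)
  finally have b: "cmod (bconv (\<lambda>i. cnj (f i z)) (bconv (\<lambda>i. vs i z l) (\<lambda>i. vs i z l)) k) <= (C - 1) * cmod (w z)" .
  have "cmod (G k z l) <= cmod (f k z) + \<bar>\<mu> l\<bar> * cmod (bconv (\<lambda>i. cnj (f i z)) (bconv (\<lambda>i. vs i z l) (\<lambda>i. vs i z l)) k)"
   unfolding G_def by (rule order_trans[OF norm_triangle_ineq]) (simp add: norm_mult)
  also have "\<dots> <= cmod (w z) + 1 * ((C - 1) * cmod (w z))" by (intro add_mono fw mult_mono mu_le b) auto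
  also have "\<dots> = C * cmod (w z)" by (simp add: algebra_simps)
  finally have "p z * cmod (G k z l) <= p z * (C * cmod (w z))" by (intro mult_left_mono p_pos)
  then show "cmod (p z * G k z l) <= C * cmod (cor (p z) * w z)" using p_pos[of z] by (simp add: norm_mult mult_ac)
 qed (use mG in auto)
qed

text \<open>Back from the differential equation to the Duhamel form that the estimates need; the
  boundary term at infinity drops out by \<open>vs_tendsto_0\<close>.\<close>

lemma vs_eq:
 assumes k: "k <= n" and x: "x >= 0"
 shows "set_integrable lborel {x..} (\<lambda>z. ph l x z * (p z * G k z l))"
  "vs k x l = - (LINT z:{x..}|lborel. ph l x z * (p z * G k z l))"
proof -
 note [measurable] = G_integrable(2)[OF k x, of l]
 have i: "set_integrable lborel {x..} (\<lambda>z. c z * (p z * G k z l))" if [measurable]: "c \<in> bor" and "\<And>z. cmod (c z) = 1" for c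
  using G_integrable(1)[OF k x, of l] unfolding set_integrable_def
  by (rule Bochner_Integration.integrable_bound) (auto simp: norm_mult that(2))
 show "set_integrable lborel {x..} (\<lambda>z. ph l x z * (p z * G k z l))" by (rule i) auto
 have A: "AC (\<lambda>x. cis (2 * l * E x) * vs k x l) (\<lambda>x. cis (2 * l * E x) * (p x * G k x l))"
  using AC_mult[OF cis_E_AC[of "2 * l"] vs_AC[OF k, of l]] by (rule AC_cong) (simp_all add: algebra_simps)
 have t: "((\<lambda>x. cis (2 * l * E x) * vs k x l) \<longlongrightarrow> 0) at_top"
  using tendsto_norm_zero[OF vs_tendsto_0[OF k, of l]] by (intro tendsto_norm_zero_cancel[of "\<lambda>x. cis (2 * l * E x) * vs k x l"]) (simp add: norm_mult)
 have "0 - cis (2 * l * E x) * vs k x l = (LINT z:{x..}|lborel. cis (2 * l * E z) * (p z * G k z l))"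
  by (rule AC_to_limit[OF A _ t]) (rule i; simp)
 from arg_cong[OF this, of uminus] have "cis (2 * l * E x) * vs k x l = - (LINT z:{x..}|lborel. cis (2 * l * E z) * (p z * G k z l))" by simp
 then have "cis (- (2 * l * E x)) * (cis (2 * l * E x) * vs k x l) = - (cis (- (2 * l * E x)) * (LINT z:{x..}|lborel. cis (2 * l * E z) * (p z * G k z l)))"
  by (simp only: mult_minus_right)
 also have "cis (- (2 * l * E x)) * (LINT z:{x..}|lborel. cis (2 * l * E z) * (p z * G k z l)) = (LINT z:{x..}|lborel. cis (- (2 * l * E x)) * (cis (2 * l * E z) * (p z * G k z l)))"
  by (rule set_integral_mult_right[symmetric])
 also have "\<dots> = (LINT z:{x..}|lborel. ph l x z * (p z * G k z l))"
 proof -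
  have "cis (- (2 * l * E x)) * cis (2 * l * E z) = ph l x z" for z by (simp add: ph_def cis_mult algebra_simps)
  then show ?thesis by (simp only: mult.assoc[symmetric])
 qed
 finally show "vs k x l = - (LINT z:{x..}|lborel. ph l x z * (p z * G k z l))" by (simp add: mult.assoc[symmetric] cis_mult)
qed

lemma L_nonneg: "L >= 0" using mu_lip[of 0 1] by simp

lemma good_v: "good v"
proof -
 define M1 where "M1 z l = \<mu> l * (cnj (f 0 z) * (v z l)\<^sup>2)" for z l
 have [measurable]: "\<mu> \<in> bor" by (rule borel_measurable_continuous_onI[OF mu_cont])
 interpret D: duhamel p E P v M1 "\<lambda>z l. 0" "f 0" "f 0" "1/8"
 proof
  show "pmeas M1" unfolding M1_def by (rule pmeasI) measurable
  show "src (\<lambda>z l. 0)" by (rule src_zero)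
  show "v x l = - (LINT z:{x..}|lborel. ph l x z * (p z * (f 0 z + M1 z l + 0)))" for x l using v_eq[of x l] by (simp add: M1_def)
  show "cmod (M1 z l) <= cmod (f 0 z) * cmod (v z l)" for z l
  proof -
   have "cmod (M1 z l) = cmod (f 0 z) * (\<bar>\<mu> l\<bar> * cmod (v z l) * cmod (v z l))" by (simp add: M1_def norm_mult power2_eq_square mult_ac)
   also have "\<dots> <= cmod (f 0 z) * (1 * 1 * cmod (v z l))"
    using v_le[of z l] by (intro mult_left_mono mult_mono mu_le mult_right_mono) auto
   finally show ?thesis by simp
  qed
 qed (use v_cont v_le f0 f_small in auto)
 obtain C where C: "C >= 0" "\<And>x. x >= 0 ==> N2 (v x) <= ennreal (C / (1 + x\<^sup>2))" using D.L2_bound by blast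
 \<comment> \<open>The error term of \<open>D.good_v\<close>: it carries the increment of
   \<open>\<mu>\<close>, of size \<open>L h\<close>, while the increment of the square is at most
   that of \<open>v\<close> since \<open>v\<close> is bounded by 1/8.\<close>
 define b where "b h z l = cor (L * h) * v z l" for h z l
 show ?thesis
 proof (rule D.good_v[of "L\<^sup>2 * C" b])
  show "0 <= L\<^sup>2 * C" using C by simp
  show "pmeas (b h)" for h unfolding b_def by (rule pmeasI) measurable
  show "N2 (b h z) <= ennreal (L\<^sup>2 * C * h\<^sup>2)" if z: "z >= 0" for h z
  proof -
   have "N2 (b h z) <= ennreal ((L * \<bar>h\<bar>)\<^sup>2) * N2 (v z)"
    by (rule N2_bounded_mult) (use L_nonneg in \<open>auto simp: b_def[abs_def] norm_mult abs_mult\<close>)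
   also have "\<dots> <= ennreal ((L * \<bar>h\<bar>)\<^sup>2) * ennreal (C / (1 + z\<^sup>2))" by (intro mult_left_mono C z) simp
   also have "\<dots> = ennreal ((L * \<bar>h\<bar>)\<^sup>2 * (C / (1 + z\<^sup>2)))" using C by (simp add: ennreal_mult[symmetric])
   also have "\<dots> <= ennreal ((L * \<bar>h\<bar>)\<^sup>2 * C)"
    using C by (intro ennreal_leI mult_left_mono) (auto simp: divide_le_eq mult_le_cancel_left1 add_pos_nonneg)
   finally show ?thesis by (simp add: power_mult_distrib mult_ac)
  qed
  fix h z l assume "(z::real) >= 0"
  have "M1 z (l + h) - M1 z l = cnj (f 0 z) * (\<mu> (l + h) * ((v z (l + h) + v z l) * (v z (l + h) - v z l)) + cor (\<mu> (l + h) - \<mu> l) * (v z l * v z l))"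
   unfolding M1_def by (simp add: algebra_simps power2_eq_square)
  then have "cmod (M1 z (l + h) - M1 z l) = cmod (f 0 z) * cmod (\<mu> (l + h) * ((v z (l + h) + v z l) * (v z (l + h) - v z l)) + cor (\<mu> (l + h) - \<mu> l) * (v z l * v z l))"
   by (simp only: norm_mult complex_mod_cnj)
  also have "\<dots> <= cmod (f 0 z) * (1 * (1 * cmod (v z (l + h) - v z l)) + L * \<bar>h\<bar> * (1 * cmod (v z l)))"
  proof (rule mult_left_mono, rule norm_triangle_le, rule add_mono)
   have s: "cmod (v z (l + h) + v z l) <= 1" using norm_triangle_le[OF add_mono[OF v_le v_le], of z "l + h" z l] by simp
   show "cmod (\<mu> (l + h) * ((v z (l + h) + v z l) * (v z (l + h) - v z l))) <= 1 * (1 * cmod (v z (l + h) - v z l))"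
    unfolding norm_mult norm_of_real by (intro mult_mono mu_le s mult_nonneg_nonneg) auto
   show "cmod (cor (\<mu> (l + h) - \<mu> l) * (v z l * v z l)) <= L * \<bar>h\<bar> * (1 * cmod (v z l))"
    unfolding norm_mult norm_of_real using v_le[of z l] L_nonneg by (intro mult_mono mu_lip mult_nonneg_nonneg) auto
  qed simp
  finally show "cmod (M1 z (l + h) - M1 z l) <= cmod (f 0 z) * cmod (v z (l + h) - v z l) + cmod (f 0 z) * cmod (b h z l)"
   using L_nonneg by (simp add: b_def norm_mult abs_mult distrib_left)
 qed
qed

lemma good_mu: "good V ==> good (\<lambda>x l. cor (\<mu> l) * V x l)"
 by (rule good_cmult[where K=1 and L=L])
  (auto intro!: continuous_intros mu_cont mu_le simp: of_real_diff[symmetric] mu_lip simp del: of_real_diff)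

text \<open>For \<open>k >= 1\<close> the equation is linear in \<open>vs k\<close>: the Leibniz sum
  contains it only in the two extreme terms, which combine to \<open>2 v vs k\<close> with
  coefficient \<open>cnj (f 0)\<close>. All else consists of lower derivatives and is a source. The
  same smallness of \<open>f 0\<close> therefore serves every order.\<close>

lemma good_vs: "k <= n ==> good (vs k)"
proof (induction k rule: less_induct)
 case (less k)
 show ?case
 proof (cases "k = 0")
  case True
  then show ?thesis using good_v by (simp add: vs_0[abs_def])
 next
  case False
  have IH: "good (vs i)" if "i < k" for i using less that by simp
  have gS: "good (\<lambda>z l. bconv (\<lambda>i. vs i z l) (\<lambda>i. vs i z l) i)" if "i < k" for i
   unfolding bconv_def using that by (intro good_sum good_scale good_mult IH) auto
  define U where "U z l = (2 * \<mu> l) * v z l" for z l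
  have gU: "good U" using good_scale[OF good_mu[OF good_v], of 2] unfolding U_def[abs_def] by (simp add: mult_ac)
  define M1 where "M1 z l = cnj (f 0 z) * (U z l * vs k z l)" for z l
  \<comment> \<open>The inner part of the square's Leibniz sum; the omitted indices \<open>0\<close>
    and \<open>k\<close> are those that contain \<open>vs k\<close>.\<close>
  define Q where "Q z l = (\<Sum>j\<in>{1..<k}. of_nat (k choose j) * (vs (k - j) z l * vs j z l))" for z l
  have gQ: "good Q" unfolding Q_def[abs_def] by (intro good_sum good_scale good_mult IH) auto
  define R where "R z l = (\<Sum>i<k. (of_nat (k choose i) * cnj (f (k - i) z)) * (\<mu> l * bconv (\<lambda>i. vs i z l) (\<lambda>i. vs i z l) i)) + cnj (f 0 z) * (\<mu> l * Q z l)" for z l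
  have sR: "src R"
   unfolding R_def[abs_def]
  proof (intro src_add src_sum src_mult good_mu gS gQ)
   show "wL2 (\<lambda>z. of_nat (k choose i) * cnj (f (k - i) z))" if "i \<in> {..<k}" for i
    using less.prems by (intro wL2_cmult wL2_cnj f_w) auto
   show "wL2 (\<lambda>z. cnj (f 0 z))" by (intro wL2_cnj f0)
  qed auto
  have Gk: "G k z l = f k z + M1 z l + R z l" for z l
  proof -
   have s1: "bconv (\<lambda>i. cnj (f i z)) (bconv (\<lambda>i. vs i z l) (\<lambda>i. vs i z l)) k = (\<Sum>i<k. of_nat (k choose i) * (cnj (f (k - i) z) * bconv (\<lambda>i. vs i z l) (\<lambda>i. vs i z l) i))
     + cnj (f 0 z) * bconv (\<lambda>i. vs i z l) (\<lambda>i. vs i z l) k"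
    by (subst bconv_def) (simp add: lessThan_Suc_atMost[symmetric])
   have s2: "bconv (\<lambda>i. vs i z l) (\<lambda>i. vs i z l) k = 2 * v z l * vs k z l + Q z l"
   proof -
    have "{..k} = insert 0 (insert k {1..<k})" using False by auto
    then show ?thesis unfolding bconv_def Q_def using False by (simp add: vs_0)
   qed
   have "\<mu> l * (\<Sum>i<k. of_nat (k choose i) * (cnj (f (k - i) z) * bconv (\<lambda>i. vs i z l) (\<lambda>i. vs i z l) i)) =
    (\<Sum>i<k. (of_nat (k choose i) * cnj (f (k - i) z)) * (\<mu> l * bconv (\<lambda>i. vs i z l) (\<lambda>i. vs i z l) i))"
    unfolding sum_distrib_left by (intro sum.cong refl) (simp add: mult_ac)
   then show ?thesis unfolding G_def s1 s2 M1_def R_def U_def by (simp add: algebra_simps)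
  qed
  have Ub: "cmod (U z l) <= 1" for z l
  proof -
   have "cmod (U z l) = 2 * (\<bar>\<mu> l\<bar> * cmod (v z l))" by (simp add: U_def norm_mult)
   also have "\<dots> <= 2 * (1 * (1/8))" by (intro mult_left_mono mult_mono mu_le v_le) auto
   finally show ?thesis by simp
  qed
  have vsc: "continuous_on UNIV (\<lambda>(x, l). vs k x l)" using vs_cont[OF less.prems] by (simp add: case_prod_beta')
  have M1m: "pmeas M1"
  proof -
   note [measurable (raw)] = pmeas_comp[OF pmeas_good[OF gU]] pmeas_comp[OF pmeas_continuous[OF vsc]]
   show ?thesis unfolding M1_def by (rule pmeasI) measurable
  qed
  have M1b: "cmod (M1 z l) <= cmod (f 0 z) * cmod (vs k z l)" for z l
  proof -
   have "cmod (M1 z l) = cmod (f 0 z) * (cmod (U z l) * cmod (vs k z l))" by (simp add: M1_def norm_mult)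
   also have "\<dots> <= cmod (f 0 z) * (1 * cmod (vs k z l))" by (intro mult_left_mono mult_right_mono Ub) auto
   finally show ?thesis by simp
  qed
  note eqs = vs_eq[OF less.prems, unfolded Gk]
  have "\<exists>M. \<forall>x\<ge>0. \<forall>l. cmod (vs k x l) <= M"
  proof (rule duhamel_uniform_bound[OF f0 f_small f_w[OF less.prems] sR M1m M1b eqs])
   show "\<exists>B. \<forall>x\<ge>0. cmod (vs k x l) <= B" for l
    using bounded_half_line[OF AC_continuous[OF vs_AC[OF less.prems, of l]] vs_tendsto_0[OF less.prems, of l], of 0] by blast
  qed auto
  then obtain M where M: "\<And>x l. x >= 0 ==> cmod (vs k x l) <= M" by blast
  interpret D: duhamel p E P "vs k" M1 R "f 0" "f k" M
  proof (rule duhamel.intro[OF profile_axioms], rule duhamel_axioms.intro)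
   show "vs k x l = - (LINT z:{x..}|lborel. ph l x z * (p z * (f k z + M1 z l + R z l)))" if "x >= 0" for x l
    by (rule eqs(2)[OF that])
   show "cmod (vs k x l) <= M" if "x >= 0" for x l by (rule M[OF that])
   show "cmod (M1 z l) <= cmod (f 0 z) * cmod (vs k z l)" for z l by (rule M1b)
  qed (fact vsc f0 f_small f_w[OF less.prems] sR M1m)+
  obtain C where C: "C >= 0" "\<And>x l. x >= 0 ==> cmod (U x l) <= C" "\<And>x. x >= 0 ==> N2 (U x) <= ennreal (C / (1 + x\<^sup>2))"
   "\<And>x h. x >= 0 ==> N2 (\<lambda>l. U x (l + h) - U x l) <= ennreal (C * h\<^sup>2)"
   using goodE[OF gU] by blast
  \<comment> \<open>In the increment of \<open>U * vs k\<close> the part where \<open>U\<close>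
    moves is bounded by the uniform bound \<open>M\<close> of \<open>vs k\<close> times the
    increment of the known function \<open>U\<close>.\<close>
  define b where "b h z l = cor M * (U z (l + h) - U z l)" for h z l
  show ?thesis
  proof (rule D.good_v[of "M\<^sup>2 * C" b])
   show "0 <= M\<^sup>2 * C" using C(1) by simp
   note [measurable (raw)] = pmeas_comp[OF pmeas_good[OF gU]]
   show "pmeas (b h)" for h unfolding b_def by (rule pmeasI) measurable
   show "N2 (b h z) <= ennreal (M\<^sup>2 * C * h\<^sup>2)" if z: "z >= 0" for h z
   proof -
    have "N2 (b h z) <= ennreal (\<bar>M\<bar>\<^sup>2) * N2 (\<lambda>l. U z (l + h) - U z l)"
     by (rule N2_bounded_mult) (auto simp: b_def[abs_def] norm_mult)
    also have "\<dots> <= ennreal (\<bar>M\<bar>\<^sup>2) * ennreal (C * h\<^sup>2)" by (intro mult_left_mono C z) simp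
    finally show ?thesis using C(1) by (simp add: ennreal_mult[symmetric] mult.assoc)
   qed
   fix h z l assume z: "(z::real) >= 0"
   have "M1 z (l + h) - M1 z l = cnj (f 0 z) * (U z (l + h) * (vs k z (l + h) - vs k z l) + (U z (l + h) - U z l) * vs k z l)"
    unfolding M1_def by (simp add: algebra_simps)
   then have "cmod (M1 z (l + h) - M1 z l) = cmod (f 0 z) * cmod (U z (l + h) * (vs k z (l + h) - vs k z l) + (U z (l + h) - U z l) * vs k z l)"
    by (simp only: norm_mult complex_mod_cnj)
   also have "\<dots> <= cmod (f 0 z) * (1 * cmod (vs k z (l + h) - vs k z l) + cmod (U z (l + h) - U z l) * M)"
   proof (intro mult_left_mono norm_triangle_le add_mono)
    show "cmod (U z (l + h) * (vs k z (l + h) - vs k z l)) <= 1 * cmod (vs k z (l + h) - vs k z l)"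
     unfolding norm_mult by (intro mult_right_mono Ub) simp
    show "cmod ((U z (l + h) - U z l) * vs k z l) <= cmod (U z (l + h) - U z l) * M"
     unfolding norm_mult by (intro mult_left_mono M[OF z]) simp
   qed simp
   finally show "cmod (M1 z (l + h) - M1 z l) <= cmod (f 0 z) * cmod (vs k z (l + h) - vs k z l) + cmod (f 0 z) * cmod (b h z l)"
    using M[OF z, of l] order_trans[OF norm_ge_zero M[OF z, of l]] by (simp add: b_def norm_mult distrib_left mult_ac)
  qed
 qed
qed

end

section \<open>The connection formula\<close>

text \<open>Multipliers for \<open>hcl\<close>: they have increments of order \<open>h\<close> in L2
  without being square integrable themselves. Factors such as \<open>1 + ...\<close> and
  exponentials in the connection formula live here, and \<open>hcl\<close> is an ideal over
  them.\<close>

definition bm :: "(real => complex) => bool" where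
 "bm g \<longleftrightarrow> continuous_on UNIV g \<and> (\<exists>C\<ge>0. (\<forall>l. cmod (g l) <= C) \<and> (\<forall>h. N2 (\<lambda>l. g (l + h) - g l) <= ennreal (C * h\<^sup>2)))"

definition hcl :: "(real => complex) => bool" where
 "hcl g \<longleftrightarrow> bm g \<and> N2 g < \<infinity>"

lemma bmI:
 assumes "continuous_on UNIV g" "C1 >= 0" "C2 >= 0" "\<And>l. cmod (g l) <= C1" "\<And>h. N2 (\<lambda>l. g (l + h) - g l) <= ennreal (C2 * h\<^sup>2)"
 shows "bm g"
 unfolding bm_def
proof (intro conjI exI[of _ "C1 + C2"] allI)
 show "cmod (g l) <= C1 + C2" for l using assms(4)[of l] assms(3) by simp
 show "N2 (\<lambda>l. g (l + h) - g l) <= ennreal ((C1 + C2) * h\<^sup>2)" for h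
  by (rule order_trans[OF assms(5)]) (use assms(2) in \<open>auto intro!: ennreal_leI mult_right_mono\<close>)
qed (use assms in auto)

lemma bmE:
 assumes "bm g" obtains C where "C >= 0" "\<And>l. cmod (g l) <= C" "\<And>h. N2 (\<lambda>l. g (l + h) - g l) <= ennreal (C * h\<^sup>2)"
 using assms unfolding bm_def by blast

definition bm_bound :: "real => (real => complex) => bool" where
 "bm_bound C g \<longleftrightarrow> C >= 0 \<and> (\<forall>l. cmod (g l) <= C) \<and> (\<forall>h. N2 (\<lambda>l. g (l + h) - g l) <= ennreal (C * h\<^sup>2))"

lemma bm_boundD:
 assumes "bm_bound C g"
 shows "C >= 0" "cmod (g l) <= C" "N2 (\<lambda>l. g (l + h) - g l) <= ennreal (C * h\<^sup>2)"
 using assms unfolding bm_bound_def by blast+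

lemma bm_boundE: assumes "bm g" obtains C where "bm_bound C g"
 using assms that unfolding bm_def bm_bound_def by blast

lemma bm_cont: "bm g ==> continuous_on UNIV g" by (simp add: bm_def)

lemma bm_meas: "bm g ==> g \<in> bor"
 by (rule borel_measurable_continuous_onI[OF bm_cont])

lemma bm_const: "bm (\<lambda>_. c)"
 by (rule bmI[of _ "cmod c" 0]) (auto simp: N2_def)

lemma bm_add:
 assumes f: "bm f" and g: "bm g" shows "bm (\<lambda>l. f l + g l)"
proof -
 obtain A where "bm_bound A f" using bm_boundE[OF f] .
 note A = bm_boundD[OF this]
 obtain B where "bm_bound B g" using bm_boundE[OF g] .
 note B = bm_boundD[OF this]
 note [measurable] = bm_meas[OF f] bm_meas[OF g]
 show ?thesis
 proof (rule bmI[of _ "A + B" "2*A + 2*B"])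
  show "continuous_on UNIV (\<lambda>l. f l + g l)" by (intro continuous_intros bm_cont f g)
  show "cmod (f l + g l) <= A + B" for l by (rule norm_triangle_le[OF add_mono[OF A(2) B(2)]])
  fix h
  have "N2 (\<lambda>l. (f (l + h) - f l) + (g (l + h) - g l)) <= ennreal (2 * (A * h\<^sup>2) + 2 * (B * h\<^sup>2))"
   by (rule N2_add'[OF _ _ A(3) B(3)]) (use A(1) B(1) in auto)
  then show "N2 (\<lambda>l. f (l + h) + g (l + h) - (f l + g l)) <= ennreal ((2*A + 2*B) * h\<^sup>2)" by (simp add: algebra_simps)
 qed (use A(1) B(1) in auto)
qed

lemma bm_mult:
 assumes f: "bm f" and g: "bm g" shows "bm (\<lambda>l. f l * g l)"
proof -
 obtain A where "bm_bound A f" using bm_boundE[OF f] .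
 note A = bm_boundD[OF this]
 obtain B where "bm_bound B g" using bm_boundE[OF g] .
 note B = bm_boundD[OF this]
 note [measurable] = bm_meas[OF f] bm_meas[OF g]
 show ?thesis
 proof (rule bmI[of _ "A * B" "2 * (A\<^sup>2 * B) + 2 * (B\<^sup>2 * A)"])
  show "continuous_on UNIV (\<lambda>l. f l * g l)" by (intro continuous_intros bm_cont f g)
  show "cmod (f l * g l) <= A * B" for l unfolding norm_mult by (intro mult_mono A B) auto
  fix h
  have 1: "N2 (\<lambda>l. f (l + h) * (g (l + h) - g l)) <= ennreal (A\<^sup>2 * (B * h\<^sup>2))"
  proof -
   have "N2 (\<lambda>l. f (l + h) * (g (l + h) - g l)) <= ennreal (A\<^sup>2) * N2 (\<lambda>l. g (l + h) - g l)"
    by (rule N2_bounded_mult) (auto simp: norm_mult intro!: mult_right_mono A)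
   also have "\<dots> <= ennreal (A\<^sup>2) * ennreal (B * h\<^sup>2)" by (intro mult_left_mono B) auto
   finally show ?thesis using B(1) by (simp add: ennreal_mult[symmetric])
  qed
  have 2: "N2 (\<lambda>l. g l * (f (l + h) - f l)) <= ennreal (B\<^sup>2 * (A * h\<^sup>2))"
  proof -
   have "N2 (\<lambda>l. g l * (f (l + h) - f l)) <= ennreal (B\<^sup>2) * N2 (\<lambda>l. f (l + h) - f l)"
    by (rule N2_bounded_mult) (auto simp: norm_mult intro!: mult_right_mono B)
   also have "\<dots> <= ennreal (B\<^sup>2) * ennreal (A * h\<^sup>2)" by (intro mult_left_mono A) auto
   finally show ?thesis using A(1) by (simp add: ennreal_mult[symmetric])
  qed
  have "N2 (\<lambda>l. f (l + h) * (g (l + h) - g l) + g l * (f (l + h) - f l)) <= ennreal (2 * (A\<^sup>2 * (B * h\<^sup>2)) + 2 * (B\<^sup>2 * (A * h\<^sup>2)))"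
   by (rule N2_add'[OF _ _ 1 2]) (use A(1) B(1) in auto)
  then show "N2 (\<lambda>l. f (l + h) * g (l + h) - f l * g l) <= ennreal ((2 * (A\<^sup>2 * B) + 2 * (B\<^sup>2 * A)) * h\<^sup>2)"
   by (simp add: algebra_simps)
 qed (use A(1) B(1) in auto)
qed

text \<open>Conjugation, inversion and the imaginary exponential are Lipschitz on the ranges that
  occur, so their stability reduces to this comparison of increments.\<close>

lemma bm_compare:
 assumes f: "bm f" and g: "continuous_on UNIV g" "\<And>l. cmod (g l) <= K" and K: "c >= 0"
  and d: "\<And>l h. cmod (g (l + h) - g l) <= c * cmod (f (l + h) - f l)"
 shows "bm g"
proof -
 obtain A where A: "A >= 0" "\<And>h. N2 (\<lambda>l. f (l + h) - f l) <= ennreal (A * h\<^sup>2)" by (rule bmE[OF f]) (rule that)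
 note [measurable] = bm_meas[OF f] borel_measurable_continuous_onI[OF g(1)]
 show ?thesis
 proof (rule bmI[OF g(1) _ _ g(2), of "c\<^sup>2 * A"])
  show "K >= 0" using g(2)[of 0] norm_ge_zero order_trans by blast
  fix h
  have "N2 (\<lambda>l. g (l + h) - g l) <= ennreal (c\<^sup>2) * N2 (\<lambda>l. f (l + h) - f l)"
   by (rule N2_bounded_mult) (auto intro: d)
  also have "\<dots> <= ennreal (c\<^sup>2) * ennreal (A * h\<^sup>2)" by (intro mult_left_mono A) auto
  finally show "N2 (\<lambda>l. g (l + h) - g l) <= ennreal (c\<^sup>2 * A * h\<^sup>2)" using A(1) by (simp add: ennreal_mult[symmetric] mult.assoc)
 qed (use A in auto)
qed

lemma bm_cnj: "bm f ==> bm (\<lambda>l. cnj (f l))"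
proof -
 assume f: "bm f"
 obtain A where "\<And>l. cmod (f l) <= A" by (rule bmE[OF f]) (rule that)
 then show ?thesis
  by (intro bm_compare[OF f, where c=1 and K=A] continuous_intros bm_cont[OF f]) (simp_all add: complex_cnj_diff[symmetric] del: complex_cnj_diff)
qed

lemma bm_inverse:
 assumes f: "bm f" and K: "\<And>l. cmod (f l) >= 1/2" shows "bm (\<lambda>l. inverse (f l))"
proof -
 have nz: "f l \<noteq> 0" for l using K[of l] by auto
 show ?thesis
 proof (rule bm_compare[OF f, where c=4 and K=2])
  show "continuous_on UNIV (\<lambda>l. inverse (f l))" by (intro continuous_intros bm_cont[OF f]) (use nz in auto)
  have iv: "cmod (inverse (f l)) <= 2" for l
   using le_imp_inverse_le[OF K[of l]] by (simp add: norm_inverse)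
  then show "cmod (inverse (f l)) <= 2" for l .
  fix l h
  have "inverse (f (l + h)) - inverse (f l) = - (inverse (f (l + h)) * (f (l + h) - f l) * inverse (f l))"
   by (rule inverse_diff_inverse[OF nz nz])
  then have "cmod (inverse (f (l + h)) - inverse (f l)) = cmod (inverse (f (l + h))) * cmod (f (l + h) - f l) * cmod (inverse (f l))"
   by (simp add: norm_mult)
  also have "\<dots> <= 2 * cmod (f (l + h) - f l) * 2" by (intro mult_mono iv mult_nonneg_nonneg) auto
  finally show "cmod (inverse (f (l + h)) - inverse (f l)) <= 4 * cmod (f (l + h) - f l)" by simp
 qed simp
qed

lemma bm_exp_imaginary:
 assumes f: "bm f" and re: "\<And>l. Re (f l) = 0" shows "bm (\<lambda>l. exp (f l))"
proof (rule bm_compare[OF f, where c=1 and K=1])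
 have e: "exp (f l) = cis (Im (f l))" for l
 proof -
  have "f l = \<i> * Im (f l)" using re[of l] by (simp add: complex_eq_iff)
  then show ?thesis by (metis cis_conv_exp)
 qed
 show "continuous_on UNIV (\<lambda>l. exp (f l))" by (intro continuous_intros bm_cont[OF f])
 show "cmod (exp (f l)) <= 1" for l unfolding e by simp
 fix l h
 have "exp (f (l + h)) - exp (f l) = cis (Im (f l)) * (cis (Im (f (l + h)) - Im (f l)) - 1)"
  unfolding e by (simp add: right_diff_distrib cis_mult)
 then have "cmod (exp (f (l + h)) - exp (f l)) <= \<bar>Im (f (l + h)) - Im (f l)\<bar>"
  using norm_cis_minus_one by (simp add: norm_mult)
 also have "\<dots> <= cmod (f (l + h) - f l)" using abs_Im_le_cmod[of "f (l + h) - f l"] by simp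
 finally show "cmod (exp (f (l + h)) - exp (f l)) <= 1 * cmod (f (l + h) - f l)" by simp
qed simp

lemma N2_reflect:
 assumes [measurable]: "V \<in> bor" shows "N2 (\<lambda>l. V (- l)) = N2 V"
 using nn_integral_real_affine[of "\<lambda>l. ennreal ((cmod (V l))\<^sup>2)" "-1" 0] by (simp add: N2_def)

lemma bm_reflect: assumes f: "bm f" shows "bm (\<lambda>l. f (- l))"
proof -
 obtain A where "bm_bound A f" using bm_boundE[OF f] .
 note A = bm_boundD[OF this]
 note [measurable] = bm_meas[OF f]
 show ?thesis
 proof (rule bmI[of _ A A])
  show "continuous_on UNIV (\<lambda>l. f (- l))" by (rule continuous_on_compose2[OF bm_cont[OF f]]) (auto intro!: continuous_intros)
  show "N2 (\<lambda>l. f (- (l + h)) - f (- l)) <= ennreal (A * h\<^sup>2)" for h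
   using N2_reflect[of "\<lambda>l. f (l + - h) - f l"] A(3)[of "- h"] by simp
 qed (use A in auto)
qed

lemma hcl_bm: "hcl g ==> bm g" by (simp add: hcl_def)

lemma hcl_mult_bm: assumes "hcl g" "bm b" shows "hcl (\<lambda>l. b l * g l)"
proof -
 obtain B where B: "\<And>l. cmod (b l) <= B" by (rule bmE[OF assms(2)]) (rule that)
 have "N2 (\<lambda>l. b l * g l) <= ennreal (B\<^sup>2) * N2 g"
  by (rule N2_bounded_mult) (use bm_meas[OF hcl_bm[OF assms(1)]] bm_meas[OF assms(2)] B in \<open>auto simp: norm_mult intro: mult_right_mono\<close>)
 also have "\<dots> < \<infinity>" using assms(1) by (simp add: hcl_def ennreal_mult_less_top)
 finally show ?thesis using bm_mult[OF assms(2) hcl_bm[OF assms(1)]] by (simp add: hcl_def)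
qed

lemma hcl_scale: "hcl g ==> hcl (\<lambda>l. c * g l)"
 using hcl_mult_bm[OF _ bm_const] .

lemma hcl_add: assumes "hcl f" "hcl g" shows "hcl (\<lambda>l. f l + g l)"
proof -
 have "N2 (\<lambda>l. f l + g l) <= 2 * N2 f + 2 * N2 g"
  by (rule N2_add) (use assms in \<open>auto intro: bm_meas hcl_bm\<close>)
 also have "\<dots> < \<infinity>" using assms by (simp add: hcl_def ennreal_mult_less_top)
 finally show ?thesis using assms bm_add by (simp add: hcl_def)
qed

lemma hcl_diff: "hcl f ==> hcl g ==> hcl (\<lambda>l. f l - g l)"
 using hcl_add[OF _ hcl_scale[of g "-1"], of f] by simp

lemma hcl_zero: "hcl (\<lambda>_. 0)"
 by (simp add: hcl_def bm_const N2_def)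

lemma hcl_sum: "(\<And>i. i \<in> I ==> hcl (V i)) ==> hcl (\<lambda>l. \<Sum>i\<in>I. V i l)"
 by (induction I rule: infinite_finite_induct) (auto intro: hcl_add hcl_zero)

lemma good_hcl: assumes V: "good V" shows "hcl (V 0)"
proof -
 obtain C where "good_bound C V" using good_boundE[OF V] .
 note C = good_boundD[OF this]
 have "bm (V 0)" by (rule bmI[OF pair_cont_snd[OF good_cont[OF V]] C(1) C(1)]) (use C in auto)
 then show ?thesis using le_ennreal_finite[OF C(3)[of 0]] by (simp add: hcl_def)
qed

lemma hcl_reflect: "hcl g ==> hcl (\<lambda>l. g (- l))"
 unfolding hcl_def using bm_reflect N2_reflect bm_meas by auto

text \<open>An artificial dependence on \<open>x\<close>, equal to 1 at \<open>x = 0\<close> and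
  with the required decay, lets \<open>good_cmult\<close> be reused for functions of
  \<open>l\<close> alone.\<close>

lemma hcl_good: assumes g: "hcl g" shows "good (\<lambda>x l. cor (1 / (1 + x\<^sup>2)) * g l)"
proof -
 obtain C where "bm_bound C g" using bm_boundE[OF hcl_bm[OF g]] .
 note C = bm_boundD[OF this]
 obtain K where K: "K >= 0" "N2 g = ennreal K" using g by (cases "N2 g") (auto simp: hcl_def)
 note [measurable] = bm_meas[OF hcl_bm[OF g]]
 define w :: "real => real" where "w x = 1 / (1 + x\<^sup>2)" for x
 have w: "0 <= w x" "w x <= 1" for x by (auto simp: w_def divide_le_eq add_pos_nonneg)
 have p: "1 + x\<^sup>2 \<noteq> 0" for x :: real using add_pos_nonneg[of 1 "x\<^sup>2"] by simp
 have m: "N2 (\<lambda>l. cor (w x) * u l) <= ennreal ((w x)\<^sup>2) * N2 u" if "u \<in> bor" for u x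
  by (rule N2_bounded_mult) (use that w in \<open>auto simp: norm_mult\<close>)
 show ?thesis
  unfolding w_def[symmetric]
 proof (rule goodI[of _ C K C])
  have "continuous_on UNIV (\<lambda>q :: real \<times> real. g (snd q))" by (rule continuous_on_compose2[OF bm_cont[OF hcl_bm[OF g]]]) (auto intro!: continuous_intros)
  then show "continuous_on UNIV (\<lambda>(x, l). cor (w x) * g l)"
   unfolding w_def case_prod_beta' using p by (intro continuous_intros) auto
  fix x :: real
  show "cmod (cor (w x) * g l) <= C" for l
   using mult_mono[OF w(2)[of x] C(2)[of l]] w(1)[of x] by (simp only: norm_mult norm_of_real) simp
  have w2: "(w x)\<^sup>2 <= w x" using w[of x] by (simp add: power2_eq_square mult_left_le)
  have "N2 (\<lambda>l. cor (w x) * g l) <= ennreal ((w x)\<^sup>2) * ennreal K" using m[of g x] K by simp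
  also have "\<dots> = ennreal ((w x)\<^sup>2 * K)" using K by (simp add: ennreal_mult)
  also have "\<dots> <= ennreal (K / (1 + x\<^sup>2))" using mult_right_mono[OF w2 K(1)] by (intro ennreal_leI) (simp add: w_def)
  finally show "N2 (\<lambda>l. cor (w x) * g l) <= ennreal (K / (1 + x\<^sup>2))" .
  fix h
  have "N2 (\<lambda>l. cor (w x) * (g (l + h) - g l)) <= ennreal ((w x)\<^sup>2) * ennreal (C * h\<^sup>2)"
   by (rule order_trans[OF m mult_left_mono[OF C(3)]]) auto
  also have "\<dots> = ennreal ((w x)\<^sup>2 * (C * h\<^sup>2))" using C(1) by (simp add: ennreal_mult)
  also have "\<dots> <= ennreal (C * h\<^sup>2)"
   using w2 w(2)[of x] C(1) by (intro ennreal_leI mult_left_le_one_le) auto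
  finally show "N2 (\<lambda>l. cor (w x) * g (l + h) - cor (w x) * g l) <= ennreal (C * h\<^sup>2)"
   by (simp add: right_diff_distrib)
 qed (use C K in auto)
qed

lemma hcl_lipschitz_mult:
 assumes g: "hcl g" and \<mu>: "continuous_on UNIV \<mu>" "\<And>l. cmod (\<mu> l) <= K" "\<And>l h. cmod (\<mu> (l + h) - \<mu> l) <= L * \<bar>h\<bar>"
 shows "hcl (\<lambda>l. \<mu> l * g l)"
 using good_hcl[OF good_cmult[OF hcl_good[OF g] \<mu>]] by simp

text \<open>The almost everywhere form serves the division by \<open>l\<close>: at
  \<open>l = 0\<close> the convention \<open>inverse 0 = 0\<close> may destroy continuity.\<close>

lemma hcl_H1: assumes g: "hcl g" "AE l in lborel. g l = g' l" "g' \<in> bor" shows "g' \<in> H1_space"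
proof -
 obtain C where "bm_bound C g" using bm_boundE[OF hcl_bm[OF g(1)]] .
 note C = bm_boundD[OF this]
 have ae: "AE l in lborel. g (l + h) = g' (l + h)" for h
 proof -
  have "AE x in distr lborel borel (\<lambda>x. h + x). g x = g' x" unfolding lborel_distr_plus by (rule g(2))
  then show ?thesis
   using bm_meas[OF hcl_bm[OF g(1)]] g(3) by (simp add: AE_distr_iff add.commute)
 qed
 show ?thesis
 proof (rule H1_criterion[OF g(3) _ C(1)])
  have "N2 g' = N2 g" unfolding N2_def by (rule nn_integral_cong_AE) (use g(2) in auto)
  then show "N2 g' < \<infinity>" using g(1) by (simp add: hcl_def)
  fix h
  have "N2 (\<lambda>l. g' (l + h) - g' l) = N2 (\<lambda>l. g (l + h) - g l)"
   unfolding N2_def by (rule nn_integral_cong_AE) (use g(2) ae[of h] in eventually_elim, simp)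
  then show "N2 (\<lambda>l. g' (l + h) - g' l) <= ennreal (C * h\<^sup>2)" using C(3) by simp
 qed
qed

lemma AC_reflect: assumes "AC F f" shows "AC (\<lambda>x. F (- x)) (\<lambda>x. - f (- x))"
 unfolding AC_def
proof (intro conjI allI impI)
 show "(\<lambda>x. - f (- x)) \<in> bor" using AC_borel[OF assms] by measurable
 have e: "indicat_real {a..b} x *\<^sub>R - f (- x) = - ((\<lambda>x. indicat_real {- b..- a} x *\<^sub>R f x) (0 + -1 * x))" for a b x
  by (auto simp: indicator_def)
 show "set_integrable lborel {a..b} (\<lambda>x. - f (- x))" for a b
  unfolding set_integrable_def e
  by (rule integrable_minus, rule lborel_integrable_real_affine) (use AC_integrable[OF assms, of "-b" "-a"] in \<open>auto simp: set_integrable_def\<close>)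
 fix a b :: real assume "a <= b"
 then have "F (- a) - F (- b) = (LINT x:{- b..- a}|lborel. f x)" by (intro AC_eq[OF assms]) simp
 also have "\<dots> = - (LINT x:{a..b}|lborel. - f (- x))"
  unfolding set_lebesgue_integral_def e integral_minus
  using lborel_integral_real_affine[of "-1" "\<lambda>x. indicat_real {- b..- a} x *\<^sub>R f x" 0] by simp
 finally show "F (- b) - F (- a) = (LINT x:{a..b}|lborel. - f (- x))" by (simp add: algebra_simps)
qed

lemma WN_reflect: assumes [measurable]: "g \<in> bor" shows "WN (\<lambda>x. g (- x)) = WN g"
 using nn_integral_real_affine[of "\<lambda>x. ennreal ((1 + x\<^sup>2) * (cmod (g x))\<^sup>2)" "-1" 0] by (simp add: WN_def)

lemma wL2_reflect: assumes "wL2 g" shows "wL2 (\<lambda>x. c * g (- x))"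
proof -
 have [measurable]: "g \<in> bor" using assms by auto
 have "wL2 (\<lambda>x. g (- x))" using assms WN_reflect[of g] by (simp add: wL2_def)
 then show ?thesis by (rule wL2_cmult)
qed

text \<open>Reversing \<open>x\<close> and \<open>l\<close> together, every derivative in
  \<open>x\<close> contributes one sign; the extra minus before \<open>F\<close> is that of the
  source in the reflected equation. This identifies the derivatives of the reflected solution with
  the recursion for the original data.\<close>

lemma rser_reflect:
 "rser (\<lambda>i. - ((-1)^i * F i)) (- l) m v0 k = (-1)^k * rser F l m v0 k"
proof (induction k rule: less_induct)
 case (less k)
 show ?case
 proof (cases k)
  case (Suc j)
  have IH: "rser (\<lambda>i. - ((-1)^i * F i)) (- l) m v0 i = (-1)^i * rser F l m v0 i" if "i <= j" for i
   using less[of i] that Suc by simp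
  have b: "bconv (rser (\<lambda>i. - ((-1)^i * F i)) (- l) m v0) (rser (\<lambda>i. - ((-1)^i * F i)) (- l) m v0) i
   = (-1)^i * bconv (rser F l m v0) (rser F l m v0) i" if "i <= j" for i
   unfolding bconv_def sum_distrib_left
  proof (intro sum.cong refl)
   fix a assume a: "a \<in> {..i}"
   have "(-1)^i = (-1)^(i - a) * (-1 :: complex)^a" using a by (simp add: power_add[symmetric])
   then show "complex_of_nat (i choose a) * (rser (\<lambda>i. - ((-1)^i * F i)) (- l) m v0 (i - a) * rser (\<lambda>i. - ((-1)^i * F i)) (- l) m v0 a)
    = (-1)^i * (complex_of_nat (i choose a) * (rser F l m v0 (i - a) * rser F l m v0 a))"
    using IH[of a] IH[of "i - a"] a that by (simp add: mult_ac)
  qed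
  have "bconv (\<lambda>i. cnj (- ((-1)^i * F i))) (bconv (rser (\<lambda>i. - ((-1)^i * F i)) (- l) m v0) (rser (\<lambda>i. - ((-1)^i * F i)) (- l) m v0)) j
   = - ((-1)^j * bconv (\<lambda>i. cnj (F i)) (bconv (rser F l m v0) (rser F l m v0)) j)"
   unfolding bconv_def[of _ "bconv (rser (\<lambda>i. - ((-1)^i * F i)) (- l) m v0) (rser (\<lambda>i. - ((-1)^i * F i)) (- l) m v0)"]
    bconv_def[of _ "bconv (rser F l m v0) (rser F l m v0)"] sum_distrib_left sum_negf[symmetric]
  proof (intro sum.cong refl)
   fix a assume a: "a \<in> {..j}"
   have "(-1)^j = (-1)^(j - a) * (-1 :: complex)^a" using a by (simp add: power_add[symmetric])
   then show "complex_of_nat (j choose a) * (cnj (- ((-1)^(j - a) * F (j - a))) * bconv (rser (\<lambda>i. - ((-1)^i * F i)) (- l) m v0) (rser (\<lambda>i. - ((-1)^i * F i)) (- l) m v0) a)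
    = - ((-1)^j * (complex_of_nat (j choose a) * (cnj (F (j - a)) * bconv (rser F l m v0) (rser F l m v0) a)))"
    using b[of a] a by (simp add: mult_ac)
  qed
  then show ?thesis unfolding Suc rser_Suc using IH[of j] by (simp add: algebra_simps)
 qed simp
qed

text \<open>The hypotheses of \<open>riccati_solution\<close> before a solution is chosen. The
  normalisation \<open>E_0\<close> makes the phase trivial at the matching point and survives
  reflection.\<close>

locale riccati_data = profile +
 fixes f :: "nat => real => complex" and n :: nat and \<mu> :: "real => real" and L :: real
 assumes f_w: "\<And>k. k <= n ==> wL2 (f k)"
  and f_AC: "\<And>k. k < n ==> AC (f k) (\<lambda>x. p x * f (Suc k) x)"
  and f_small: "(NN z. ennreal \<bar>p z * cmod (f 0 z)\<bar>) <= ennreal (1/16)"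
  and mu_le: "\<And>l. \<bar>\<mu> l\<bar> <= 1" and mu_lip: "\<And>l h. \<bar>\<mu> (l + h) - \<mu> l\<bar> <= L * \<bar>h\<bar>"
  and E_0: "E 0 = 0"
begin

lemma mu_cont: "continuous_on UNIV \<mu>"
proof -
 have "(\<bar>L\<bar>)-lipschitz_on UNIV \<mu>"
 proof (rule lipschitz_onI)
  fix x y :: real
  have "\<bar>\<mu> x - \<mu> y\<bar> <= L * \<bar>x - y\<bar>" using mu_lip[of y "x - y"] by simp
  also have "\<dots> <= \<bar>L\<bar> * \<bar>x - y\<bar>" by (intro mult_right_mono) auto
  finally show "dist (\<mu> x) (\<mu> y) <= \<bar>L\<bar> * dist x y" by (simp add: dist_real_def)
 qed simp
 then show ?thesis by (rule lipschitz_on_continuous_on)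
qed

lemma solution:
 obtains v where "riccati_solution p E P f n \<mu> L v"
proof -
 obtain v where "continuous_on UNIV (\<lambda>(x, l). v x l)" "\<And>x l. cmod (v x l) <= 1/8"
  "\<And>x l. v x l = - (LINT z:{x..}|lborel. ph l x z * (p z * (f 0 z + \<mu> l * (cnj (f 0 z) * (v z l)\<^sup>2))))"
  by (rule riccati_exists[OF f_w[OF le0] f_small mu_cont mu_le]) (rule that)
 then have "riccati_solution p E P f n \<mu> L v"
  by (intro riccati_solution.intro profile_axioms riccati_solution_axioms.intro f_w f_AC f_small mu_le mu_lip)
 then show thesis by (rule that)
qed

text \<open>Reflection exchanges the two ends of the line, so a solution decaying at plus infinity
  for these data yields one decaying at minus infinity for the original data, once \<open>l\<close>
  is reversed as well.\<close>

lemma reflected: "riccati_data (\<lambda>x. p (- x)) (\<lambda>x. - E (- x)) P (\<lambda>k x. - ((-1)^k * f k (- x))) n (\<lambda>l. \<mu> (- l)) L"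
proof
 show "continuous_on UNIV (\<lambda>x. p (- x))" by (rule continuous_on_compose2[OF p_cont]) (auto intro!: continuous_intros)
 show "((\<lambda>x. - E (- x)) has_real_derivative p (- x)) (at x)" for x
 proof -
  have "((\<lambda>x. E (- x)) has_real_derivative p (- x) * - 1) (at x)"
   by (rule DERIV_chain2[where g="\<lambda>x. - x"]) (auto intro!: E_deriv derivative_eq_intros)
  from DERIV_minus[OF this] show ?thesis by simp
 qed
 show "wL2 (\<lambda>x. - ((-1)^k * f k (- x)))" if "k <= n" for k
  using wL2_reflect[OF f_w[OF that], of "- ((-1)^k)"] by simp
 show "AC (\<lambda>x. - ((-1)^k * f k (- x))) (\<lambda>x. cor (p (- x)) * - ((-1) ^ Suc k * f (Suc k) (- x)))" if "k < n" for k
  using AC_cmult[OF AC_reflect[OF f_AC[OF that]], of "- ((-1)^k)"] by (rule AC_cong) simp_all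
 have [measurable]: "f 0 \<in> bor" using f_w[of 0] by auto
 show "(NN z. ennreal \<bar>p (- z) * cmod (- ((-1) ^ 0 * f 0 (- z)))\<bar>) <= ennreal (1/16)"
  using f_small nn_integral_real_affine[of "\<lambda>z. ennreal \<bar>p z * cmod (f 0 z)\<bar>" "-1" 0] by simp
 show "\<bar>\<mu> (- (l + h)) - \<mu> (- l)\<bar> <= L * \<bar>h\<bar>" for l h using mu_lip[of "- l" "- h"] by simp
qed (use p_ge p_le mu_le E_0 in auto)

end

context riccati_solution
begin

text \<open>For the reflected solution this is the exponent in the connection formula at
  \<open>x = 0\<close>, up to \<open>\<mu>\<close> and a sign. The integrand contains a number minus
  its conjugate, so the exponent is imaginary.\<close>

definition K :: "real => complex" where
 "K l = (LINT z:{0..}|lborel. p z * (f 0 z * cnj (v z l) - cnj (f 0 z) * v z l))"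

lemma K_integrable: "set_integrable lborel {0..} (\<lambda>z. p z * (f 0 z * cnj (v z l) - cnj (f 0 z) * v z l))"
 and K_bound: "cmod (p z * (f 0 z * cnj (v z l) - cnj (f 0 z) * v z l)) <= 1 * (p z * cmod (f 0 z))"
proof -
 have "cmod (f 0 z * cnj (v z l) - cnj (f 0 z) * v z l) <= cmod (f 0 z) * cmod (v z l) + cmod (f 0 z) * cmod (v z l)" for z
  by (rule order_trans[OF norm_triangle_ineq4]) (simp add: norm_mult)
 also have "cmod (f 0 z) * cmod (v z l) + cmod (f 0 z) * cmod (v z l) <= cmod (f 0 z)" for z
  using mult_left_mono[OF v_le[of z l] norm_ge_zero, of "f 0 z"] norm_ge_zero[of "f 0 z"] by linarith
 finally have *: "cmod (f 0 z * cnj (v z l) - cnj (f 0 z) * v z l) <= cmod (f 0 z)" for z .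
 show b: "cmod (p z * (f 0 z * cnj (v z l) - cnj (f 0 z) * v z l)) <= 1 * (p z * cmod (f 0 z))" for z
  using mult_left_mono[OF *[of z] p_pos(2)[of z]] p_pos[of z] by (simp add: norm_mult)
 show "set_integrable lborel {0..} (\<lambda>z. p z * (f 0 z * cnj (v z l) - cnj (f 0 z) * v z l))"
  by (rule set_integrable_dominated[OF wL2_integrable[OF wL2_p[OF f0]], where c=1])
   (use b p_pos in \<open>auto simp: norm_mult abs_of_pos\<close>)
qed

lemma K_hcl: "hcl K"
proof -
 obtain C where "good_bound C v" using good_boundE[OF good_v] .
 note C = good_boundD[OF this]
 let ?H = "\<lambda>z l. p z * (f 0 z * cnj (v z l) - cnj (f 0 z) * v z l)"
 have wi: "integrable lborel (\<lambda>z. 1 * (p z * cmod (f 0 z)))"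
  using integrable_norm[OF wL2_integrable[OF wL2_p[OF f0]]] p_pos by (simp add: norm_mult abs_of_pos)
 have "continuous_on UNIV (\<lambda>(x, l). LINT z:{x..}|lborel. ?H z l)"
 proof (rule tail_integral_continuous[OF _ _ wi K_bound])
  fix z
  have "continuous_on UNIV (\<lambda>q :: real \<times> real. v z (snd q))"
   by (rule continuous_on_compose2[OF pair_cont_snd[OF v_cont, of z]]) (auto intro!: continuous_intros)
  then show "continuous_on UNIV (\<lambda>(x :: real, l). ?H z l)" unfolding case_prod_beta' by (intro continuous_intros)
 qed measurable
 from pair_cont_snd[OF this, of 0] have cont: "continuous_on UNIV K" by (simp add: K_def[abs_def])
 have [measurable]: "K \<in> bor" by (rule borel_measurable_continuous_onI[OF cont])
 have bd: "cmod (K l) <= 1 / 16" for l unfolding K_def by (rule small_integral_bound[OF _ f_small K_integrable K_bound]) auto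
 \<comment> \<open>One estimate for \<open>K\<close> and for its increments: \<open>a\<close> is
   \<open>v\<close> or its increment, and the integrand is at most \<open>2 p |f 0| |a|\<close>; the
   4 is the square of this 2.\<close>
 have gen: "N2 u <= ennreal (4 * A)" if um[measurable]: "u \<in> bor" and a: "pmeas a" and A: "A >= 0" "\<And>z. z >= 0 ==> N2 (a z) <= ennreal A"
  and ui: "\<And>l. set_integrable lborel {0..} (g l)" "\<And>l. u l = (LINT z:{0..}|lborel. g l z)" "\<And>l z. cmod (g l z) <= 2 * (p z * cmod (f 0 z) * cmod (a z l))"
  for u a A and g :: "real => real => complex"
 proof -
  note [measurable (raw)] = pmeas_comp[OF a]
  have "N2 u <= (NN l. 4 * (NN z. ennreal (\<bar>p z * cmod (f 0 z)\<bar> * cmod (a z l)) * indicator {0..} z)\<^sup>2)"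
   unfolding N2_def
  proof (rule nn_integral_mono)
   fix l
   have "ennreal (cmod (u l)) <= (NN z. ennreal (cmod (g l z)) * indicator {0..} z)"
    unfolding ui(2) by (rule set_integral_norm_bound_ennreal[OF ui(1)])
   also have "\<dots> <= (NN z. 2 * (ennreal (\<bar>p z * cmod (f 0 z)\<bar> * cmod (a z l)) * indicator {0..} z))"
   proof (rule nn_integral_mono)
    fix z
    have "ennreal (cmod (g l z)) <= ennreal (2 * (\<bar>p z * cmod (f 0 z)\<bar> * cmod (a z l)))"
     using ui(3)[of l z] p_pos[of z] by (intro ennreal_leI) (simp add: abs_mult)
    then show "ennreal (cmod (g l z)) * indicator {0..} z <= 2 * (ennreal (\<bar>p z * cmod (f 0 z)\<bar> * cmod (a z l)) * indicator {0..} z)"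
     by (simp add: indicator_def ennreal_mult)
   qed
   also have "\<dots> = 2 * (NN z. ennreal (\<bar>p z * cmod (f 0 z)\<bar> * cmod (a z l)) * indicator {0..} z)" by (rule nn_integral_cmult) measurable
   finally have "(ennreal (cmod (u l)))\<^sup>2 <= (2 * (NN z. ennreal (\<bar>p z * cmod (f 0 z)\<bar> * cmod (a z l)) * indicator {0..} z))\<^sup>2"
    by (rule power_mono) simp
   then show "ennreal ((cmod (u l))\<^sup>2) <= 4 * (NN z. ennreal (\<bar>p z * cmod (f 0 z)\<bar> * cmod (a z l)) * indicator {0..} z)\<^sup>2"
    by (simp add: ennreal_power power_mult_distrib)
  qed
  also have "\<dots> = 4 * (NN l. (NN z. ennreal (\<bar>p z * cmod (f 0 z)\<bar> * cmod (a z l)) * indicator {0..} z)\<^sup>2)"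
   by (rule nn_integral_cmult) measurable
  also have "\<dots> <= 4 * (ennreal (1/16) * (ennreal (1/16) * ennreal A))"
   by (intro mult_left_mono nn_square_L1[OF _ a f_small A(2)]) auto
  also have "\<dots> <= 4 * (1 * (1 * ennreal A))"
   by (intro mult_left_mono mult_mono) (auto simp: ennreal_le_1)
  also have "\<dots> = ennreal (4 * A)" using A(1) by (simp add: ennreal_mult)
  finally show ?thesis .
 qed
 have d: "N2 (\<lambda>l. K (l + h) - K l) <= ennreal (4 * (C * h\<^sup>2))" for h
 proof (rule gen[where a="\<lambda>z l. v z (l + h) - v z l" and g="\<lambda>l z. ?H z (l + h) - ?H z l"])
  show "pmeas (\<lambda>z l. v z (l + h) - v z l)" by (rule pmeasI) measurable
  show "set_integrable lborel {0..} (\<lambda>z. ?H z (l + h) - ?H z l)" for l by (rule set_integral_diff(1)[OF K_integrable K_integrable])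
  show "K (l + h) - K l = (LINT z:{0..}|lborel. ?H z (l + h) - ?H z l)" for l
   unfolding K_def by (rule set_integral_diff(2)[OF K_integrable K_integrable, symmetric])
  fix l z
  have "?H z (l + h) - ?H z l = p z * (f 0 z * cnj (v z (l + h) - v z l) - cnj (f 0 z) * (v z (l + h) - v z l))" by (simp add: algebra_simps)
  then have "cmod (?H z (l + h) - ?H z l) = p z * cmod (f 0 z * cnj (v z (l + h) - v z l) - cnj (f 0 z) * (v z (l + h) - v z l))"
   using p_pos[of z] by (simp only: norm_mult norm_of_real abs_of_pos)
  also have "\<dots> <= p z * (cmod (f 0 z) * cmod (v z (l + h) - v z l) + cmod (f 0 z) * cmod (v z (l + h) - v z l))"
  proof (intro mult_left_mono p_pos)
   show "cmod (f 0 z * cnj (v z (l + h) - v z l) - cnj (f 0 z) * (v z (l + h) - v z l)) <= cmod (f 0 z) * cmod (v z (l + h) - v z l) + cmod (f 0 z) * cmod (v z (l + h) - v z l)"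
    by (rule order_trans[OF norm_triangle_ineq4]) (simp only: norm_mult complex_mod_cnj order_refl)
  qed
  finally show "cmod (?H z (l + h) - ?H z l) <= 2 * (p z * cmod (f 0 z) * cmod (v z (l + h) - v z l))" by (simp add: mult.assoc)
 next
  show "(\<lambda>l. K (l + h) - K l) \<in> bor" by measurable
  show "C * h\<^sup>2 >= 0" using C(1) by simp
  show "N2 (\<lambda>l. v z (l + h) - v z l) <= ennreal (C * h\<^sup>2)" if "z >= 0" for z by (rule C(4)[OF that])
 qed
 have "N2 K <= ennreal (4 * C)"
 proof (rule gen[where a=v and g="\<lambda>l z. ?H z l"])
  show "pmeas v" by (rule pmeas_continuous[OF v_cont])
  show "N2 (v z) <= ennreal C" if "z >= 0" for z
   by (rule order_trans[OF C(3)[OF that]]) (use C in \<open>auto intro!: ennreal_leI simp: divide_le_eq mult_le_cancel_left1 add_pos_nonneg\<close>)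
  fix l z
  have "cmod (?H z l) = p z * cmod (f 0 z * cnj (v z l) - cnj (f 0 z) * v z l)" using p_pos[of z] by (simp only: norm_mult norm_of_real abs_of_pos)
  also have "\<dots> <= p z * (cmod (f 0 z) * cmod (v z l) + cmod (f 0 z) * cmod (v z l))"
   by (intro mult_left_mono p_pos order_trans[OF norm_triangle_ineq4]) (simp add: norm_mult)
  finally show "cmod (?H z l) <= 2 * (p z * cmod (f 0 z) * cmod (v z l))" by (simp add: mult.assoc)
 next
  show "K \<in> bor" by measurable
  show "set_integrable lborel {0..} (\<lambda>z. ?H z l)" for l by (rule K_integrable)
  show "K l = (LINT z:{0..}|lborel. ?H z l)" for l by (rule K_def)
 qed (rule C(1))
 moreover have "bm K" by (rule bmI[OF cont _ _ bd, of "4 * C"]) (use C(1) d in \<open>auto simp: mult.assoc\<close>)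
 ultimately show ?thesis using le_ennreal_finite by (auto simp: hcl_def)
qed

end

context riccati_data
begin

text \<open>Let \<open>u\<close> be the solution that decays at minus infinity. The quotient
  \<open>(v - u) / (1 + \<mu> cnj u v)\<close>, with its phase, solves a linear equation with an
  integrable coefficient depending on \<open>u\<close> alone. Hence it is known along the whole line
  from its value at 0. At minus infinity \<open>u\<close> vanishes and the quotient becomes
  \<open>v\<close>, so the limit \<open>r\<close> is an explicit expression in \<open>u\<close> and
  \<open>v\<close> at 0, where both are controlled.\<close>

lemma riccati_limit:
 obtains v and r :: "real => complex" where "\<And>x l. cmod (v x l) <= 1/8"
  "\<And>l. AC (\<lambda>x. v x l) (\<lambda>x. p x * (- (2 * \<i> * l) * v x l + (f 0 x + \<mu> l * (cnj (f 0 x) * (v x l)\<^sup>2))))"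
  "\<And>l. ((\<lambda>x. v x l) \<longlongrightarrow> 0) at_top"
  "\<And>l. ((\<lambda>x. cis (2 * l * E x) * v x l) \<longlongrightarrow> r l) at_bot"
  "\<And>j. j <= n ==> hcl (\<lambda>l. cor l ^ j * r l)"
proof -
 obtain v where "riccati_solution p E P f n \<mu> L v" using solution .
 then interpret V: riccati_solution p E P f n \<mu> L v .
 interpret Rd: riccati_data "\<lambda>x. p (- x)" "\<lambda>x. - E (- x)" P "\<lambda>k x. - ((-1)^k * f k (- x))" n "\<lambda>l. \<mu> (- l)" L
  by (rule reflected)
 obtain w where "riccati_solution (\<lambda>x. p (- x)) (\<lambda>x. - E (- x)) P (\<lambda>k x. - ((-1)^k * f k (- x))) n (\<lambda>l. \<mu> (- l)) L w" using Rd.solution .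
 then interpret W: riccati_solution "\<lambda>x. p (- x)" "\<lambda>x. - E (- x)" P "\<lambda>k x. - ((-1)^k * f k (- x))" n "\<lambda>l. \<mu> (- l)" L w .
 define u where "u x l = w (- x) (- l)" for x l
 have u_le: "cmod (u x l) <= 1/8" for x l unfolding u_def by (rule W.v_le)
 have u_AC: "AC (\<lambda>x. u x l) (\<lambda>x. p x * (- (2 * \<i> * l) * u x l + (f 0 x + \<mu> l * (cnj (f 0 x) * (u x l)\<^sup>2))))" for l
  using AC_reflect[OF W.v_AC[of "- l"]] unfolding u_def by (rule AC_cong) (simp_all add: algebra_simps)
 have u_lim: "((\<lambda>x. u x l) \<longlongrightarrow> 0) at_bot" for l
  using W.v_tendsto_0[of "- l"] unfolding u_def by (simp add: filterlim_at_bot_mirror)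
 define vp where "vp k l = V.vs k 0 l" for k l
 \<comment> \<open>The sign undoes the reflection of \<open>k\<close> derivatives; by
   \<open>rser_reflect\<close> \<open>vm\<close> obeys the same recursion as \<open>vp\<close>, with
   the same \<open>F\<close> and \<open>l\<close>, started from \<open>u 0 l\<close>.\<close>
 define vm where "vm k l = (-1)^k * W.vs k 0 (- l)" for k l
 define F where "F i = f i 0" for i
 have vp: "vp k l = rser F l (\<mu> l) (v 0 l) k" for k l by (simp add: vp_def V.vs_def F_def[abs_def])
 have vm: "vm k l = rser F l (\<mu> l) (u 0 l) k" for k l
 proof -
  have "W.vs k 0 (- l) = rser (\<lambda>i. - ((-1)^i * F i)) (- l) (\<mu> l) (u 0 l) k" by (simp add: W.vs_def F_def u_def)
  also have "\<dots> = (-1)^k * rser F l (\<mu> l) (u 0 l) k" by (rule rser_reflect)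
  finally have "W.vs k 0 (- l) = (-1)^k * rser F l (\<mu> l) (u 0 l) k" .
  then have "vm k l = ((-1)^k * (-1)^k) * rser F l (\<mu> l) (u 0 l) k" unfolding vm_def by (simp add: mult.assoc)
  also have "(-1)^k * (-1)^k = (1 :: complex)" by (simp add: power_add[symmetric])
  finally show ?thesis by simp
 qed
 have hp: "hcl (vp k)" if "k <= n" for k using good_hcl[OF V.good_vs[OF that]] by (simp add: vp_def[abs_def])
 have hm: "hcl (vm k)" if "k <= n" for k
  unfolding vm_def[abs_def] by (intro hcl_scale hcl_reflect[of "W.vs k 0"] good_hcl W.good_vs that)
 have hmu: "hcl (\<lambda>l. cor (\<mu> l) * g l)" if "hcl g" for g
  by (rule hcl_lipschitz_mult[OF that, where K=1 and L=L])
   (auto intro!: continuous_intros mu_cont mu_le simp: of_real_diff[symmetric] mu_lip simp del: of_real_diff)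
 define D where "D k l = vp k l - vm k l" for k l
 \<comment> \<open>Each factor \<open>2 i l\<close> is traded by the recursion for the next
   derivative. The terms \<open>F k\<close> are constant in \<open>l\<close>, hence not square
   integrable, but cancel in the difference of the two solutions; what remains of the products is a
   multiplier times some \<open>D i\<close> of lower or equal order.\<close>
 have hD: "j + k <= n ==> hcl (\<lambda>l. (2 * \<i> * l)^j * D k l)" for j k
 proof (induction j arbitrary: k)
  case 0
  then show ?case unfolding D_def by (simp add: hcl_diff hp hm)
 next
  case (Suc j)
  have dd: "hcl (\<lambda>l. (2 * \<i> * l)^j * D a l)" if "a <= Suc k" for a using Suc.IH[of a] Suc.prems that by simp
  have e: "(2 * \<i> * l)^Suc j * D k l = cor (\<mu> l) * (\<Sum>i\<le>k. (of_nat (k choose i) * cnj (F (k - i))) * (\<Sum>a\<le>i. of_nat (i choose a) *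
    (vp a l * ((2 * \<i> * l)^j * D (i - a) l) + vm (i - a) l * ((2 * \<i> * l)^j * D a l)))) - (2 * \<i> * l)^j * D (Suc k) l" for l
  proof -
   define Bp where "Bp = bconv (\<lambda>i. cnj (F i)) (bconv (\<lambda>i. vp i l) (\<lambda>i. vp i l)) k"
   define Bm where "Bm = bconv (\<lambda>i. cnj (F i)) (bconv (\<lambda>i. vm i l) (\<lambda>i. vm i l)) k"
   have s: "vp (Suc k) l = - (2 * \<i> * l) * vp k l + (F k + \<mu> l * Bp)" "vm (Suc k) l = - (2 * \<i> * l) * vm k l + (F k + \<mu> l * Bm)"
    unfolding Bp_def Bm_def vp vm by (rule rser_Suc)+
   have e1: "2 * \<i> * l * D k l = \<mu> l * (Bp - Bm) - D (Suc k) l" unfolding D_def s by (simp add: algebra_simps)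
   have e2: "(2 * \<i> * l)^j * (Bp - Bm) = (\<Sum>i\<le>k. (of_nat (k choose i) * cnj (F (k - i))) * (\<Sum>a\<le>i. of_nat (i choose a) *
    (vp a l * ((2 * \<i> * l)^j * D (i - a) l) + vm (i - a) l * ((2 * \<i> * l)^j * D a l))))"
   proof -
    have q: "(2 * \<i> * l)^j * (vp (i - a) l * vp a l - vm (i - a) l * vm a l) = vp a l * ((2 * \<i> * l)^j * D (i - a) l) + vm (i - a) l * ((2 * \<i> * l)^j * D a l)" for i a
     unfolding D_def by (simp add: algebra_simps)
    show ?thesis
     unfolding q[symmetric] Bp_def Bm_def bconv_def sum_subtractf[symmetric] sum_distrib_left
     by (intro sum.cong refl) (simp add: algebra_simps sum_subtractf sum_distrib_left)
   qed
   have "(2 * \<i> * l)^j * (2 * \<i> * l * D k l) = cor (\<mu> l) * (\<Sum>i\<le>k. (of_nat (k choose i) * cnj (F (k - i))) * (\<Sum>a\<le>i. of_nat (i choose a) *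
    (vp a l * ((2 * \<i> * l)^j * D (i - a) l) + vm (i - a) l * ((2 * \<i> * l)^j * D a l)))) - (2 * \<i> * l)^j * D (Suc k) l"
    by (simp only: e1 e2[symmetric] right_diff_distrib mult.left_commute[of "(2 * \<i> * l)^j" "cor (\<mu> l)"])
   then show ?thesis by (simp only: power_Suc2 mult.assoc)
  qed
  show ?case unfolding e
   by (intro hcl_diff hmu hcl_sum hcl_scale hcl_add hcl_mult_bm dd hcl_bm[OF hp] hcl_bm[OF hm]) (use Suc.prems in auto)
 qed
 \<comment> \<open>Not square integrable because of the 1, hence treated as a multiplier; the bounds
   1/8 keep it away from zero, so its inverse is one as well.\<close>
 define S0 where "S0 l = 1 + cor (\<mu> l) * (cnj (u 0 l) * v 0 l)" for l
 have hS: "bm S0"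
 proof -
  have "bm (\<lambda>l. cnj (vm 0 l))" by (rule bm_cnj[OF hcl_bm[OF hm]]) simp
  then have "hcl (\<lambda>l. cor (\<mu> l) * (cnj (vm 0 l) * vp 0 l))" by (intro hmu hcl_mult_bm hp) auto
  then show ?thesis unfolding S0_def[abs_def] by (intro bm_add bm_const hcl_bm) (simp add: vp vm)
 qed
 have Sb: "cmod (1 + cor (\<mu> l) * (cnj a * b)) >= 1/2" if "cmod a <= 1/8" "cmod b <= 1/8" for l a b
 proof -
  have "cmod (cor (\<mu> l) * (cnj a * b)) <= 1 * (1/8 * (1/8))"
   unfolding norm_mult norm_of_real complex_mod_cnj by (intro mult_mono mu_le that) auto
  moreover have "1 - cmod (cor (\<mu> l) * (cnj a * b)) <= cmod (1 + cor (\<mu> l) * (cnj a * b))"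
   using norm_diff_ineq[of 1 "cor (\<mu> l) * (cnj a * b)"] by simp
  ultimately show ?thesis by linarith
 qed
 define I where "I l = (LINT z:{..0}|lborel. p z * (cnj (f 0 z) * u z l - f 0 z * cnj (u z l)))" for l
 have IK: "I l = W.K (- l)" and Ii: "set_integrable lborel {..x} (\<lambda>z. p z * (cnj (f 0 z) * u z l - f 0 z * cnj (u z l)))" for l x
 proof -
  let ?g = "\<lambda>z. cor (p z) * (cnj (f 0 z) * u z l - f 0 z * cnj (u z l))"
  have e: "indicator {0..} z *\<^sub>R (cor (p (- z)) * (- ((- 1) ^ 0 * f 0 (- z)) * cnj (w z (- l)) - cnj (- ((- 1) ^ 0 * f 0 (- z))) * w z (- l)))
   = (\<lambda>z. indicator {..0} z *\<^sub>R ?g z) (0 + -1 * z)" for z :: real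
   by (auto simp: indicator_def u_def algebra_simps)
  show "I l = W.K (- l)"
   unfolding I_def W.K_def set_lebesgue_integral_def e
   using lborel_integral_real_affine[of "-1" "\<lambda>z. indicator {..0} z *\<^sub>R ?g z" 0] by simp
  have "AC (\<lambda>x. u x l) (\<lambda>x. p x * (- (2 * \<i> * l) * u x l + (f 0 x + \<mu> l * (cnj (f 0 x) * (u x l)\<^sup>2))))" by (rule u_AC)
  note [measurable] = AC_meas[OF this]
  show "set_integrable lborel {..x} ?g"
  proof (rule set_integrable_dominated[OF wL2_integrable[OF wL2_p[OF V.f0]], where c=1])
   fix z
   have "cmod (cnj (f 0 z) * u z l - f 0 z * cnj (u z l)) <= cmod (f 0 z) * cmod (u z l) + cmod (f 0 z) * cmod (u z l)"
    by (rule order_trans[OF norm_triangle_ineq4]) (simp add: norm_mult)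
   also have "\<dots> <= cmod (f 0 z)" using mult_left_mono[OF u_le[of z l] norm_ge_zero, of "f 0 z"] norm_ge_zero[of "f 0 z"] by linarith
   finally show "cmod (?g z) <= 1 * cmod (cor (p z) * f 0 z)" using p_pos[of z] by (simp add: norm_mult)
  qed measurable
 qed
 have reK: "Re (I l) = 0" for l
 proof -
  have "Re (I l) = (LINT z:{..0}|lborel. Re (p z * (cnj (f 0 z) * u z l - f 0 z * cnj (u z l))))"
   unfolding I_def set_lebesgue_integral_def using Ii[of 0 l] by (subst integral_Re[symmetric]) (auto simp: set_integrable_def)
  also have "\<dots> = 0" by (simp add: set_lebesgue_integral_def)
  finally show ?thesis .
 qed
 \<comment> \<open>The exponent is imaginary, so \<open>bm_exp_imaginary\<close> applies: modulus 1
   and increments no larger than those of the exponent.\<close>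
 define ex where "ex l = exp (- (cor (\<mu> l) * I l))" for l
 have hex: "bm ex"
  unfolding ex_def
 proof (rule bm_exp_imaginary)
  have "hcl I" using hcl_reflect[OF W.K_hcl] by (simp add: IK[abs_def])
  from hcl_bm[OF hcl_scale[OF hmu[OF this], of "-1"]] show "bm (\<lambda>l. - (cor (\<mu> l) * I l))" by simp
  show "Re (- (cor (\<mu> l) * I l)) = 0" for l using reK[of l] by simp
 qed
 define r where "r l = ex l * (inverse (S0 l) * D 0 l)" for l
 have lim: "((\<lambda>x. cis (2 * l * E x) * v x l) \<longlongrightarrow> r l) at_bot" for l
 proof -
  define m where "m = cor (\<mu> l)"
  have cm: "cnj m = m" by (simp add: m_def)
  define S where "S x = 1 + m * (cnj (u x l) * v x l)" for x
  define g where "g x = cor (p x) * (cnj (f 0 x) * u x l - f 0 x * cnj (u x l))" for x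
  have Snz: "S x \<noteq> 0" for x using Sb[OF u_le V.v_le, of l x l x l] unfolding S_def m_def by auto
  define q where "q x = f 0 x" for x
  define pp where "pp x = cor (p x)" for x
  have vA: "AC (\<lambda>x. v x l) (\<lambda>x. pp x * (- (2 * \<i> * l) * v x l + (q x + m * (cnj (q x) * (v x l)\<^sup>2))))"
   using V.v_AC[of l] by (simp add: m_def q_def pp_def)
  have uA: "AC (\<lambda>x. u x l) (\<lambda>x. pp x * (- (2 * \<i> * l) * u x l + (q x + m * (cnj (q x) * (u x l)\<^sup>2))))"
   using u_AC[of l] by (simp add: m_def q_def pp_def)
  have cA: "AC (\<lambda>x. cnj (u x l)) (\<lambda>x. pp x * ((2 * \<i> * l) * cnj (u x l) + (cnj (q x) + m * (q x * (cnj (u x l))\<^sup>2))))"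
   using AC_cnj[OF uA] by (rule AC_cong) (simp_all add: pp_def cm)
  have SA: "AC S (\<lambda>x. m * pp x * (cnj (q x) * v x l + q x * cnj (u x l)) * S x)"
   using AC_add[OF AC_const[of 1] AC_cmult[OF AC_mult[OF cA vA], of m]]
   by (rule AC_cong) (simp_all add: S_def algebra_simps power2_eq_square)
  have DA: "AC (\<lambda>x. v x l - u x l) (\<lambda>x. pp x * (- (2 * \<i> * l) + m * (cnj (q x) * (v x l + u x l))) * (v x l - u x l))"
   using AC_diff[OF vA uA] by (rule AC_cong) (simp_all add: algebra_simps power2_eq_square)
  \<comment> \<open>For \<open>\<mu> = 1\<close> and apart from the phase, this is the image of
    \<open>v\<close> under the rotation of the Riemann sphere that takes \<open>u\<close> to 0.
    Normalising the difference in this way removes the dependence on \<open>v\<close> from the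
    coefficient of its equation.\<close>
  define Q where "Q x = cis (2 * l * E x) * ((v x l - u x l) * inverse (S x))" for x
  have QA: "AC Q (\<lambda>x. m * g x * Q x)"
   using AC_mult[OF cis_E_AC[of "2 * l"] AC_mult[OF DA AC_inverse[OF SA Snz]]]
  proof (rule AC_cong)
   show "cis (2 * l * E x) * ((v x l - u x l) * inverse (S x)) = Q x" for x by (simp add: Q_def)
   fix x
   have alg: "\<i> * L2 * pq * c * (dd * si) + c * (pq * (- (\<i> * L2) + mm * (qc * (vv + uu))) * dd * si + dd * (- (mm * pq * (qc * vv + qq * uc) * s) / s\<^sup>2))
    = mm * (pq * (qc * uu - qq * uc)) * (c * (dd * si))" if "s \<noteq> 0" "si = inverse s" for L2 pq c dd si mm qc vv uu qq uc s :: complex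
   proof -
    have h: "- (mm * pq * (qc * vv + qq * uc) * s) / s\<^sup>2 = - (mm * pq * (qc * vv + qq * uc) * si)"
     using that by (simp add: power2_eq_square divide_inverse)
    show ?thesis unfolding h by (simp add: algebra_simps)
   qed
   show "\<i> * cor (2 * l) * cor (p x) * cis (2 * l * E x) * ((v x l - u x l) * inverse (S x)) +
    cis (2 * l * E x) * (pp x * (- (2 * \<i> * cor l) + m * (cnj (q x) * (v x l + u x l))) * (v x l - u x l) * inverse (S x) +
     (v x l - u x l) * (- (m * pp x * (cnj (q x) * v x l + q x * cnj (u x l)) * S x) / (S x)\<^sup>2)) = m * g x * Q x"
    using alg[OF Snz[of x] refl, of "cor (2 * l)" "cor (p x)" "cis (2 * l * E x)" "v x l - u x l" m "cnj (q x)" "v x l" "u x l" "q x" "cnj (u x l)"]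
    by (simp add: g_def Q_def pp_def q_def mult_ac)
  qed
  have Ui: "set_integrable lborel {..x} g" for x using Ii[of x l] by (simp add: g_def[abs_def])
  have gm: "g \<in> bor"
   unfolding g_def[abs_def] using wL2_meas[OF V.f0, measurable] AC_meas[OF uA, measurable] by measurable
  define J where "J x = (LINT z:{..x}|lborel. g z)" for x
  have JA: "AC J g" unfolding J_def[abs_def] by (rule AC_lower_integral[OF gm Ui])
  have J0: "(J \<longlongrightarrow> 0) at_bot" unfolding J_def[abs_def] by (rule lower_integral_at_bot[OF Ui])
  \<comment> \<open>\<open>J\<close> starts at minus infinity, so the correcting factor tends to 1
    there and the constant value of \<open>Y\<close> is the limit sought.\<close>
  define Y where "Y x = Q x * exp (- m * J x)" for x
  have "AC Y (\<lambda>x. 0)"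
   using AC_mult[OF QA AC_exp[OF AC_cmult[OF JA, of "- m"]]] by (rule AC_cong) (simp_all add: Y_def algebra_simps)
  from AC_zero_const[OF this] have Yc: "Y x = Y 0" for x by blast
  have "Y 0 = r l"
   unfolding Y_def Q_def r_def ex_def S0_def S_def D_def vp vm J_def g_def I_def m_def by (simp add: E_0 mult_ac)
  then have Qe: "Q x = r l * exp (m * J x)" for x
  proof -
   have e0: "Q x * (exp (- m * J x) * exp (m * J x)) = r l * exp (m * J x)" using Yc[of x] \<open>Y 0 = r l\<close> by (simp add: Y_def mult.assoc[symmetric])
   have e1: "exp (- m * J x) * exp (m * J x) = 1" by (simp add: exp_minus)
   show ?thesis using e0 unfolding e1 by simp
  qed
  have "((\<lambda>x. r l * exp (m * J x)) \<longlongrightarrow> r l * exp (m * 0)) at_bot" by (intro tendsto_intros J0)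
  then have Ql: "(Q \<longlongrightarrow> r l) at_bot" by (simp add: Qe[abs_def])
  have uv0: "((\<lambda>x. cnj (u x l) * v x l) \<longlongrightarrow> 0) at_bot"
  proof (rule Lim_null_comparison[of _ "\<lambda>x. cmod (u x l)"])
   show "\<forall>\<^sub>F x in at_bot. norm (cnj (u x l) * v x l) <= cmod (u x l)"
    using V.v_le by (intro always_eventually allI) (simp add: norm_mult mult_left_le order_trans[OF V.v_le])
   show "((\<lambda>x. cmod (u x l)) \<longlongrightarrow> 0) at_bot" by (rule tendsto_norm_zero[OF u_lim])
  qed
  have "((\<lambda>x. 1 + m * (cnj (u x l) * v x l)) \<longlongrightarrow> 1 + m * 0) at_bot" by (intro tendsto_intros uv0)
  then have Sl: "(S \<longlongrightarrow> 1) at_bot" by (simp add: S_def[abs_def])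
  have cu: "((\<lambda>x. cis (2 * l * E x) * u x l) \<longlongrightarrow> 0) at_bot"
   by (rule tendsto_norm_zero_cancel) (use tendsto_norm_zero[OF u_lim[of l]] in \<open>simp add: norm_mult\<close>)
  have "((\<lambda>x. Q x * S x + cis (2 * l * E x) * u x l) \<longlongrightarrow> r l * 1 + 0) at_bot" by (intro tendsto_intros Ql Sl cu)
  moreover have "Q x * S x + cis (2 * l * E x) * u x l = cis (2 * l * E x) * v x l" for x
  proof -
   have "Q x * S x = cis (2 * l * E x) * (v x l - u x l)" using Snz[of x] by (simp add: Q_def)
   then show ?thesis by (simp only: right_diff_distrib) simp
  qed
  ultimately show ?thesis by simp
 qed
 have hr: "hcl (\<lambda>l. cor l ^ j * r l)" if "j <= n" for j
 proof -
  have "hcl (\<lambda>l. ex l * (inverse (S0 l) * ((1 / (2 * \<i>))^j * ((2 * \<i> * l)^j * D 0 l))))"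
  proof (rule hcl_mult_bm[OF hcl_mult_bm hex])
   show "hcl (\<lambda>l. (1 / (2 * \<i>))^j * ((2 * \<i> * l)^j * D 0 l))" by (rule hcl_scale[OF hD[of j 0]]) (use that in simp)
   show "bm (\<lambda>l. inverse (S0 l))"
   proof (rule bm_inverse[OF hS])
    show "1/2 <= cmod (S0 l)" for l unfolding S0_def by (rule Sb[OF u_le V.v_le])
   qed
  qed
  moreover have "ex l * (inverse (S0 l) * ((1 / (2 * \<i>))^j * ((2 * \<i> * l)^j * D 0 l))) = cor l ^ j * r l" for l
  proof -
   have e1: "(1 / (2 * \<i>))^j * ((2 * \<i> * l)^j * z) = cor l ^ j * z" for z
    unfolding mult.assoc[symmetric] power_mult_distrib[symmetric] by simp
   show ?thesis unfolding r_def e1 by (simp only: mult_ac)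
  qed
  ultimately show ?thesis by simp
 qed
 show thesis by (rule that[OF V.v_le V.v_AC V.v_tendsto_0 lim hr])
qed

end

section \<open>Jost solutions\<close>

text \<open>Ties the base point of the integral to the filter for limits there, so that both Jost
  solutions are treated at once.\<close>

definition endpoint :: "ereal => real filter => bool" where
 "endpoint s F \<longleftrightarrow> (s = \<infinity> \<and> F = at_top) \<or> (s = -\<infinity> \<and> F = at_bot)"

lemma endpoint_nontrivial: "endpoint s F ==> F \<noteq> bot"
 unfolding endpoint_def by (elim disjE conjE) simp_all

lemma interval_lebesgue_integral_infinity:
 "interval_lebesgue_integrable lebesgue \<infinity> (ereal x) g \<longleftrightarrow> set_integrable lebesgue {x<..} g"
 "interval_lebesgue_integrable lebesgue (-\<infinity>) (ereal x) g \<longleftrightarrow> set_integrable lebesgue {..<x} g"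
 "interval_lebesgue_integral lebesgue \<infinity> (ereal x) g = - (LINT y:{x<..}|lebesgue. g y)"
 "interval_lebesgue_integral lebesgue (-\<infinity>) (ereal x) g = (LINT y:{..<x}|lebesgue. g y)"
 by (simp_all add: interval_lebesgue_integrable_def interval_lebesgue_integral_def einterval_eq_Ici einterval_eq_Iic)

lemma set_integral_lebesgue_lborel:
 fixes g g' :: "real => complex"
 assumes g: "g \<in> borel_measurable lebesgue" and g': "g' \<in> bor" and ae: "AE x in lborel. g x = g' x"
  and A: "A \<in> sets borel" "B \<in> sets borel" "AE x in lborel. x \<in> A \<longleftrightarrow> x \<in> B"
 shows "set_integrable lebesgue A g \<longleftrightarrow> set_integrable lborel B g'" "(LINT x:A|lebesgue. g x) = (LINT x:B|lborel. g' x)"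
proof -
 have "AE x in lborel. indicator A x *\<^sub>R g x = indicator B x *\<^sub>R g' x"
  using ae A(3) by eventually_elim (auto simp: indicator_def)
 then have ae2: "AE x in lebesgue. indicator A x *\<^sub>R g x = indicator B x *\<^sub>R g' x" by (rule AE_completion)
 have m': "(\<lambda>x. indicator B x *\<^sub>R g' x) \<in> bor" using g' A by measurable
 then have m'': "(\<lambda>x. indicator B x *\<^sub>R g' x) \<in> borel_measurable lebesgue" by (intro measurable_completion) simp
 have "A \<in> sets lebesgue" using A by simp
 then have m: "(\<lambda>x. indicator A x *\<^sub>R g x) \<in> borel_measurable lebesgue" using g by measurable
 show "set_integrable lebesgue A g \<longleftrightarrow> set_integrable lborel B g'"
  unfolding set_integrable_def integrable_cong_AE[OF m m'' ae2] by (rule lebesgue_integral_borel(2)[OF m'])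
 show "(LINT x:A|lebesgue. g x) = (LINT x:B|lborel. g' x)"
  unfolding set_lebesgue_integral_def integral_cong_AE[OF m m'' ae2] by (rule lebesgue_integral_borel(1)[OF m'])
qed

lemma measurable_exhausting_integrable:
 fixes g :: "real => complex"
 assumes "\<And>n. set_integrable lebesgue (A n) g" "\<And>x. \<forall>\<^sub>F n in sequentially. x \<in> A n"
 shows "g \<in> borel_measurable lebesgue"
proof (rule borel_measurable_LIMSEQ_metric)
 show "(\<lambda>x. indicator (A n) x *\<^sub>R g x) \<in> borel_measurable lebesgue" for n
  using assms(1)[of n] by (auto simp: set_integrable_def intro: borel_measurable_integrable)
 show "(\<lambda>n. indicator (A n) x *\<^sub>R g x) \<longlonglongrightarrow> g x" for x
  by (rule tendsto_eventually) (use assms(2)[of x] in \<open>auto elim: eventually_mono\<close>)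
qed

lemma AE_half_lines: "AE y in lborel. y \<in> {x<..} \<longleftrightarrow> y \<in> {x..}" "AE y in lborel. y \<in> {..<x} \<longleftrightarrow> y \<in> {..x}" for x :: real
 using AE_lborel_singleton[of x] by (eventually_elim, auto)+

abbreviation (input) half_integrable :: "ereal => real => (real => 'a::{banach, second_countable_topology}) => bool"
 where "half_integrable s x \<equiv> interval_lebesgue_integrable lebesgue s (ereal x)"
abbreviation (input) half_integral :: "ereal => real => (real => 'a::{banach, second_countable_topology}) => 'a"
 where "half_integral s x \<equiv> interval_lebesgue_integral lebesgue s (ereal x)"

lemma indefinite_integral_measurable:
 assumes "endpoint s F" and i: "\<And>x. half_integrable s x g"
 shows "(g :: real => complex) \<in> borel_measurable lebesgue"
 using assms(1)[unfolded endpoint_def]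
proof (elim disjE conjE)
 assume s: "s = \<infinity>"
 show ?thesis
 proof (rule measurable_exhausting_integrable[where A="\<lambda>n. {- real n<..}"])
  show "set_integrable lebesgue {- real n<..} g" for n using i[of "- real n"] unfolding s interval_lebesgue_integral_infinity .
  show "\<forall>\<^sub>F n in sequentially. x \<in> {- real n<..}" for x
   using eventually_gt_at_top[of "nat \<lceil>- x\<rceil>"] by eventually_elim (simp, linarith)
 qed
next
 assume s: "s = - \<infinity>"
 show ?thesis
 proof (rule measurable_exhausting_integrable[where A="\<lambda>n. {..< real n}"])
  show "set_integrable lebesgue {..< real n} g" for n using i[of "real n"] unfolding s interval_lebesgue_integral_infinity .
  show "\<forall>\<^sub>F n in sequentially. x \<in> {..< real n}" for x
   using eventually_gt_at_top[of "nat \<lceil>x\<rceil>"] by eventually_elim (simp, linarith)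
 qed
qed

lemma indefinite_integral:
 fixes g :: "real => complex"
 assumes e: "endpoint s F" and i: "\<And>x. half_integrable s x g"
  and g': "g' \<in> bor" "AE x in lborel. g x = g' x"
 shows "AC (\<lambda>x. half_integral s x g) g'"
  "((\<lambda>x. half_integral s x g) \<longlongrightarrow> 0) F"
proof -
 note gm = indefinite_integral_measurable[OF e i]
 have "AC (\<lambda>x. half_integral s x g) g' \<and> ((\<lambda>x. half_integral s x g) \<longlongrightarrow> 0) F"
  using e[unfolded endpoint_def]
 proof (elim disjE conjE)
  assume s: "s = \<infinity>" "F = at_top"
  note c = set_integral_lebesgue_lborel[OF gm g' _ _ AE_half_lines(1)]
  have si: "set_integrable lborel {x..} g'" for x
   using i[of x] unfolding s interval_lebesgue_integral_infinity by (subst (asm) c(1)) auto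
  show ?thesis
   unfolding s interval_lebesgue_integral_infinity
   using AC_upper_integral[OF g'(1) si] tendsto_minus[OF upper_integral_at_top[OF si]] by (simp add: c(2))
 next
  assume s: "s = - \<infinity>" "F = at_bot"
  note c = set_integral_lebesgue_lborel[OF gm g' _ _ AE_half_lines(2)]
  have si: "set_integrable lborel {..x} g'" for x
   using i[of x] unfolding s interval_lebesgue_integral_infinity by (subst (asm) c(1)) auto
  show ?thesis
   unfolding s interval_lebesgue_integral_infinity
   using AC_lower_integral[OF g'(1) si] lower_integral_at_bot[OF si] by (simp add: c(2))
 qed
 then show "AC (\<lambda>x. half_integral s x g) g'"
  "((\<lambda>x. half_integral s x g) \<longlongrightarrow> 0) F" by auto
qed

lemma indefinite_integral_continuous:
 fixes g :: "real => complex"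
 assumes e: "endpoint s F" and i: "\<And>x. half_integrable s x g"
 shows "continuous_on UNIV (\<lambda>x. half_integral s x g)"
  "((\<lambda>x. half_integral s x g) \<longlongrightarrow> 0) F"
proof -
 obtain g' where g': "g' \<in> bor" "AE x in lborel. g x = g' x"
  using borel_version[OF indefinite_integral_measurable[OF assms]] .
 from AC_continuous[OF indefinite_integral(1)[OF assms g']] indefinite_integral(2)[OF assms g']
 show "continuous_on UNIV (\<lambda>x. half_integral s x g)"
  "((\<lambda>x. half_integral s x g) \<longlongrightarrow> 0) F" by auto
qed

text \<open>The way back from a differential equation with boundary value to the integral. The
  constant \<open>c\<close> stays outside because it will be the spectral parameter up to sign, and
  for \<open>l = 0\<close> integrability of \<open>h\<close> cannot be recovered from
  \<open>c * h\<close>.\<close>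

lemma AC_indefinite_integral:
 assumes e: "endpoint s F" and G: "AC G (\<lambda>x. c * h x)" "(G \<longlongrightarrow> L) F"
  and g: "integrable lborel h" "g \<in> borel_measurable lebesgue" "AE x in lborel. g x = h x"
 shows "half_integrable s x g" "c * half_integral s x g = G x - L"
proof -
 have [measurable]: "h \<in> bor" using g(1) by auto
 have si: "set_integrable lborel A h" if "A \<in> sets borel" for A
  using g(1) integrable_mult_indicator[of A lborel h] that by (simp add: set_integrable_def)
 have sc: "set_integrable lborel A (\<lambda>x. c * h x)" if "A \<in> sets borel" for A
  using si[OF that] by simp
 have "half_integrable s x g \<and> c * half_integral s x g = G x - L"
  using e[unfolded endpoint_def]
 proof (elim disjE conjE)
  assume s: "s = \<infinity>" "F = at_top"
  note c = set_integral_lebesgue_lborel[OF g(2) _ g(3) _ _ AE_half_lines(1)]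
  show ?thesis
   unfolding s interval_lebesgue_integral_infinity
   using AC_to_limit[OF G(1) sc, of x L] G(2) si[of "{x..}"] s by (simp add: c algebra_simps)
 next
  assume s: "s = - \<infinity>" "F = at_bot"
  note c = set_integral_lebesgue_lborel[OF g(2) _ g(3) _ _ AE_half_lines(2)]
  show ?thesis
   unfolding s interval_lebesgue_integral_infinity
   using AC_from_limit[OF G(1) sc, of x L] G(2) si[of "{..x}"] s by (simp add: c algebra_simps)
 qed
 then show "half_integrable s x g" "c * half_integral s x g = G x - L" by auto
qed

lemma bounded_linear_entry: "bounded_linear (\<lambda>v :: complex^2^2. v $ i $ j)"
 by (rule bounded_linear_compose[OF bounded_linear_vec_nth bounded_linear_vec_nth])

lemma integrable_matrix_iff:
 fixes f :: "real => complex^2^2"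
 shows "integrable M f \<longleftrightarrow> (\<forall>i j. integrable M (\<lambda>x. f x $ i $ j))"
proof (intro iffI allI)
 show "integrable M (\<lambda>x. f x $ i $ j)" if "integrable M f" for i j
  by (rule integrable_bounded_linear[OF bounded_linear_entry that])
 assume f: "\<forall>i j. integrable M (\<lambda>x. f x $ i $ j)"
 have b: "bounded_linear (\<lambda>c. axis i (axis j c) :: complex^2^2)" for i j
  unfolding linear_conv_bounded_linear[symmetric] by (rule linearI) (auto simp: vec_eq_iff axis_def)
 have "f x = (\<Sum>i\<in>UNIV. \<Sum>j\<in>UNIV. axis i (axis j (f x $ i $ j)))" for x
  by (auto simp: vec_eq_iff forall_2 sum_2 axis_def)
 then have e: "f = (\<lambda>x. \<Sum>i\<in>UNIV. \<Sum>j\<in>UNIV. axis i (axis j (f x $ i $ j)))" by blast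
 show "integrable M f"
  by (subst e) (intro Bochner_Integration.integrable_sum integrable_bounded_linear[OF b] f[rule_format])
qed

lemma interval_integral_matrix:
 fixes f :: "real => complex^2^2"
 shows "interval_lebesgue_integrable M a b f \<longleftrightarrow> (\<forall>i j. interval_lebesgue_integrable M a b (\<lambda>x. f x $ i $ j))" (is ?A)
  "interval_lebesgue_integrable M a b f ==> interval_lebesgue_integral M a b f $ i $ j = interval_lebesgue_integral M a b (\<lambda>x. f x $ i $ j)"
proof -
 show ?A by (auto simp: interval_lebesgue_integrable_def set_integrable_def integrable_matrix_iff)
 have *: "(LINT x:A|M. f x) $ i $ j = (LINT x:A|M. f x $ i $ j)" if "set_integrable M A f" for A
  unfolding set_lebesgue_integral_def
  using integral_bounded_linear[OF bounded_linear_entry that[unfolded set_integrable_def], of i j] by simp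
 show "interval_lebesgue_integrable M a b f ==> interval_lebesgue_integral M a b f $ i $ j = interval_lebesgue_integral M a b (\<lambda>x. f x $ i $ j)"
  by (simp add: interval_lebesgue_integrable_def interval_lebesgue_integral_def * split: if_splits)
qed

lemma jost_integrand_entries:
 "jost_integrand q l m x y $ 1 $ 1 = 1 * (q y * m y $ 2 $ 1)"
 "jost_integrand q l m x y $ 1 $ 2 = cis (2 * l * x) * (cis (- 2 * l * y) * q y * m y $ 2 $ 2)"
 "jost_integrand q l m x y $ 2 $ 1 = - cis (- 2 * l * x) * (cis (2 * l * y) * cnj (q y) * m y $ 1 $ 1)"
 "jost_integrand q l m x y $ 2 $ 2 = - 1 * (cnj (q y) * m y $ 1 $ 2)"
proof -
 define t where "t = l * (x - y)"
 have c: "cis t * cis (- t) = 1" by (simp add: cis_mult)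
 have c2: "cis t * cis t = cis (2 * l * x) * cis (- 2 * l * y)" "cis (- t) * cis (- t) = cis (- 2 * l * x) * cis (2 * l * y)"
  by (simp_all add: cis_mult t_def algebra_simps)
 have e: "jost_integrand q l m x y $ 1 $ 1 = (cis t * cis (- t)) * (q y * m y $ 2 $ 1)"
  "jost_integrand q l m x y $ 1 $ 2 = (cis t * cis t) * (q y * m y $ 2 $ 2)"
  "jost_integrand q l m x y $ 2 $ 1 = - (cis (- t) * cis (- t)) * (cnj (q y) * m y $ 1 $ 1)"
  "jost_integrand q l m x y $ 2 $ 2 = - (cis t * cis (- t)) * (cnj (q y) * m y $ 1 $ 2)"
  by (simp_all add: jost_integrand_def t_def[symmetric] exp_i_sigma3_def potential_def matrix_matrix_mult_def sum_2 mult_ac)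
 show "jost_integrand q l m x y $ 1 $ 1 = 1 * (q y * m y $ 2 $ 1)"
  "jost_integrand q l m x y $ 1 $ 2 = cis (2 * l * x) * (cis (- 2 * l * y) * q y * m y $ 2 $ 2)"
  "jost_integrand q l m x y $ 2 $ 1 = - cis (- 2 * l * x) * (cis (2 * l * y) * cnj (q y) * m y $ 1 $ 1)"
  "jost_integrand q l m x y $ 2 $ 2 = - 1 * (cnj (q y) * m y $ 1 $ 2)"
  unfolding e c c2 by (simp_all only: mult.assoc mult_minus_left)
qed

lemma interval_integrable_scale_iff:
 fixes g :: "real => complex"
 assumes "c \<noteq> 0"
 shows "interval_lebesgue_integrable M a b (\<lambda>y. c * g y) \<longleftrightarrow> interval_lebesgue_integrable M a b g"
proof
 assume "interval_lebesgue_integrable M a b (\<lambda>y. c * g y)"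
 then have "interval_lebesgue_integrable M a b (\<lambda>y. inverse c * (c * g y))" by (rule interval_lebesgue_integrable_mult_right)
 then show "interval_lebesgue_integrable M a b g" using assms by (simp add: mult.assoc[symmetric] del: interval_lebesgue_integrable_mult_right)
qed auto

text \<open>The phase in \<open>x\<close> is pulled out of each integral, which turns every entry
  into an indefinite integral of an integrand that no longer depends on the end point.\<close>

lemma jost_equation_entries:
 "jost_equation s q l m \<longleftrightarrow> (\<forall>x.
  half_integrable s x (\<lambda>y. q y * m y $ 2 $ 1) \<and>
  half_integrable s x (\<lambda>y. cis (- 2 * l * y) * q y * m y $ 2 $ 2) \<and>
  half_integrable s x (\<lambda>y. cis (2 * l * y) * cnj (q y) * m y $ 1 $ 1) \<and>
  half_integrable s x (\<lambda>y. cnj (q y) * m y $ 1 $ 2) \<and>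
  m x $ 1 $ 1 = 1 - l * half_integral s x (\<lambda>y. q y * m y $ 2 $ 1) \<and>
  m x $ 1 $ 2 = - cor l * (cis (2 * l * x) * half_integral s x (\<lambda>y. cis (- 2 * l * y) * q y * m y $ 2 $ 2)) \<and>
  m x $ 2 $ 1 = l * (cis (- 2 * l * x) * half_integral s x (\<lambda>y. cis (2 * l * y) * cnj (q y) * m y $ 1 $ 1)) \<and>
  m x $ 2 $ 2 = 1 + l * half_integral s x (\<lambda>y. cnj (q y) * m y $ 1 $ 2))"
proof -
 have i: "half_integrable s x (jost_integrand q l m x) \<longleftrightarrow>
  half_integrable s x (\<lambda>y. q y * m y $ 2 $ 1) \<and>
  half_integrable s x (\<lambda>y. cis (- 2 * l * y) * q y * m y $ 2 $ 2) \<and>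
  half_integrable s x (\<lambda>y. cis (2 * l * y) * cnj (q y) * m y $ 1 $ 1) \<and>
  half_integrable s x (\<lambda>y. cnj (q y) * m y $ 1 $ 2)" for x
  unfolding interval_integral_matrix(1) forall_2 jost_integrand_entries
  using interval_integrable_scale_iff[of 1] interval_integrable_scale_iff[of "cis (2 * l * x)"]
   interval_integrable_scale_iff[of "- cis (- 2 * l * x)"] interval_integrable_scale_iff[of "- 1"]
  by (simp only: cis_neq_zero neg_equal_0_iff_equal one_neq_zero not_False_eq_True simp_thms conj_assoc)
 have m: "m x = mat 1 - l *\<^sub>R V \<longleftrightarrow> m x $ 1 $ 1 = 1 - l * V $ 1 $ 1 \<and> m x $ 1 $ 2 = - cor l * V $ 1 $ 2 \<and>
   m x $ 2 $ 1 = - cor l * V $ 2 $ 1 \<and> m x $ 2 $ 2 = 1 - l * V $ 2 $ 2" for x V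
  by (auto simp: vec_eq_iff forall_2 mat_def scaleR_conv_of_real[where 'a=complex])
 show ?thesis
  unfolding jost_equation_def
 proof (rule all_cong1)
  fix x
  let ?I = "half_integral s x"
  show "half_integrable s x (jost_integrand q l m x) \<and> m x = mat 1 - l *\<^sub>R ?I (jost_integrand q l m x) \<longleftrightarrow>
   half_integrable s x (\<lambda>y. q y * m y $ 2 $ 1) \<and>
  half_integrable s x (\<lambda>y. cis (- 2 * l * y) * q y * m y $ 2 $ 2) \<and>
  half_integrable s x (\<lambda>y. cis (2 * l * y) * cnj (q y) * m y $ 1 $ 1) \<and>
  half_integrable s x (\<lambda>y. cnj (q y) * m y $ 1 $ 2) \<and>
  m x $ 1 $ 1 = 1 - l * ?I (\<lambda>y. q y * m y $ 2 $ 1) \<and>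
  m x $ 1 $ 2 = - cor l * (cis (2 * l * x) * ?I (\<lambda>y. cis (- 2 * l * y) * q y * m y $ 2 $ 2)) \<and>
  m x $ 2 $ 1 = l * (cis (- 2 * l * x) * ?I (\<lambda>y. cis (2 * l * y) * cnj (q y) * m y $ 1 $ 1)) \<and>
  m x $ 2 $ 2 = 1 + l * ?I (\<lambda>y. cnj (q y) * m y $ 1 $ 2)"
  proof (cases "half_integrable s x (jost_integrand q l m x)")
   case True
   note V = interval_integral_matrix(2)[OF True]
   have "?I (jost_integrand q l m x) $ 1 $ 1 = 1 * ?I (\<lambda>y. q y * m y $ 2 $ 1)"
    "?I (jost_integrand q l m x) $ 1 $ 2 = cis (2 * l * x) * ?I (\<lambda>y. cis (- 2 * l * y) * q y * m y $ 2 $ 2)"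
    "?I (jost_integrand q l m x) $ 2 $ 1 = - cis (- 2 * l * x) * ?I (\<lambda>y. cis (2 * l * y) * cnj (q y) * m y $ 1 $ 1)"
    "?I (jost_integrand q l m x) $ 2 $ 2 = - 1 * ?I (\<lambda>y. cnj (q y) * m y $ 1 $ 2)"
    unfolding V jost_integrand_entries by (rule interval_lebesgue_integral_mult_right)+
   then show ?thesis using True unfolding m i by simp
  qed (use i in blast)
 qed
qed

section \<open>The off-diagonal Zakharov-Shabat system and the scattering coefficients\<close>

text \<open>The coefficient matrix is skew-Hermitian, so the Hermitian product of two solutions is
  constant. Boundedness of the Jost solutions and their uniqueness from boundary values both follow
  from this.\<close>

definition zs_system :: "(real => complex) => (real => complex) => (real => complex) => bool" where
 "zs_system k y z \<longleftrightarrow> AC y (\<lambda>x. - k x * z x) \<and> AC z (\<lambda>x. cnj (k x) * y x)"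

lemma zs_inner:
 assumes "zs_system k y z" "zs_system k y' z'"
 shows "cnj (y x) * y' x + cnj (z x) * z' x = cnj (y t) * y' t + cnj (z t) * z' t"
proof -
 have A: "AC y (\<lambda>x. - k x * z x)" "AC z (\<lambda>x. cnj (k x) * y x)" "AC y' (\<lambda>x. - k x * z' x)" "AC z' (\<lambda>x. cnj (k x) * y' x)"
  using assms by (auto simp: zs_system_def)
 have "AC (\<lambda>x. cnj (y x) * y' x + cnj (z x) * z' x) (\<lambda>x. 0)"
  using AC_add[OF AC_mult[OF AC_cnj[OF A(1)] A(3)] AC_mult[OF AC_cnj[OF A(2)] A(4)]]
  by (rule AC_cong) (simp_all add: algebra_simps)
 from AC_zero_const[OF this] show ?thesis .
qed

lemma zs_lincomb:
 assumes "zs_system k y z" "zs_system k y' z'"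
 shows "zs_system k (\<lambda>x. a * y x + b * y' x) (\<lambda>x. a * z x + b * z' x)"
proof -
 have A: "AC y (\<lambda>x. - k x * z x)" "AC z (\<lambda>x. cnj (k x) * y x)" "AC y' (\<lambda>x. - k x * z' x)" "AC z' (\<lambda>x. cnj (k x) * y' x)"
  using assms by (auto simp: zs_system_def)
 show ?thesis
  unfolding zs_system_def
 proof
  show "AC (\<lambda>x. a * y x + b * y' x) (\<lambda>x. - k x * (a * z x + b * z' x))"
   using AC_add[OF AC_cmult[OF A(1), of a] AC_cmult[OF A(3), of b]] by (rule AC_cong) (simp_all add: algebra_simps)
  show "AC (\<lambda>x. a * z x + b * z' x) (\<lambda>x. cnj (k x) * (a * y x + b * y' x))"
   using AC_add[OF AC_cmult[OF A(2), of a] AC_cmult[OF A(4), of b]] by (rule AC_cong) (simp_all add: algebra_simps)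
 qed
qed

text \<open>The symmetry that makes the second column of each Jost matrix a conjugate of the first,
  and gives \<open>transition_matrix\<close> its shape.\<close>

lemma zs_conj:
 assumes "zs_system k y z" shows "zs_system k (\<lambda>x. - cnj (z x)) (\<lambda>x. cnj (y x))"
proof -
 have A: "AC y (\<lambda>x. - k x * z x)" "AC z (\<lambda>x. cnj (k x) * y x)"
  using assms by (auto simp: zs_system_def)
 show ?thesis
  unfolding zs_system_def using AC_minus[OF AC_cnj[OF A(2)]] AC_cnj[OF A(1)] by simp
qed

lemma zs_norm_const:
 assumes "zs_system k y z" "(y \<longlongrightarrow> a) F" "(z \<longlongrightarrow> b) F" "F \<noteq> bot"
 shows "(cmod (y x))\<^sup>2 + (cmod (z x))\<^sup>2 = (cmod a)\<^sup>2 + (cmod b)\<^sup>2"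
proof -
 have n: "cor ((cmod (y t))\<^sup>2 + (cmod (z t))\<^sup>2) = cnj (y t) * y t + cnj (z t) * z t" for t
  by (simp only: of_real_add complex_norm_square mult.commute)
 have c: "(cmod (y t))\<^sup>2 + (cmod (z t))\<^sup>2 = (cmod (y x))\<^sup>2 + (cmod (z x))\<^sup>2" for t
  using zs_inner[OF assms(1,1), of t x] unfolding n[symmetric] of_real_eq_iff .
 have "((\<lambda>t. (cmod (y t))\<^sup>2 + (cmod (z t))\<^sup>2) \<longlongrightarrow> (cmod a)\<^sup>2 + (cmod b)\<^sup>2) F"
  by (intro tendsto_intros assms)
 moreover have "(\<lambda>t. (cmod (y t))\<^sup>2 + (cmod (z t))\<^sup>2) = (\<lambda>t. (cmod (y x))\<^sup>2 + (cmod (z x))\<^sup>2)" by (intro ext c)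
 ultimately have "((\<lambda>t :: real. (cmod (y x))\<^sup>2 + (cmod (z x))\<^sup>2) \<longlongrightarrow> (cmod a)\<^sup>2 + (cmod b)\<^sup>2) F" by (rule subst[rotated])
 then show ?thesis by (rule tendsto_unique[OF assms(4) tendsto_const])
qed

text \<open>The difference of the solutions has limit zero at the end point and constant
  norm.\<close>

lemma zs_unique:
 assumes "zs_system k y z" "zs_system k y' z'" "(y \<longlongrightarrow> a) F" "(z \<longlongrightarrow> b) F" "(y' \<longlongrightarrow> a) F" "(z' \<longlongrightarrow> b) F" "F \<noteq> bot"
 shows "y x = y' x" "z x = z' x"
proof -
 have "(cmod (1 * y x + (-1) * y' x))\<^sup>2 + (cmod (1 * z x + (-1) * z' x))\<^sup>2 = (cmod (1 * a + (-1) * a))\<^sup>2 + (cmod (1 * b + (-1) * b))\<^sup>2"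
  by (rule zs_norm_const[OF zs_lincomb[OF assms(1,2)] _ _ assms(7)]) (intro tendsto_intros assms)+
 then show "y x = y' x" "z x = z' x" by (simp_all add: sum_power2_eq_zero_iff)
qed

lemma AC_cis: "AC (\<lambda>x. cis (c * x)) (\<lambda>x. \<i> * c * cis (c * x))"
proof -
 interpret profile "\<lambda>_. 1" "\<lambda>x. x" 1 by unfold_locales auto
 show ?thesis using cis_E_AC[of c] by simp
qed

text \<open>The Jost solutions in the gauge \<open>exp (- i l x \<sigma>\<^sub>3) \<psi>\<close>, where they solve a system without
 diagonal part.\<close>

lemma jost_equation_iff:
 fixes l :: real and Q q :: "real => complex"
 assumes e: "endpoint s F" and q: "q \<in> borel_measurable lebesgue" "AE x in lborel. q x = Q x"
  and Q: "integrable lborel Q" and bd: "bounded (range m)"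
 defines "k \<equiv> (\<lambda>x. cor l * (cis (- 2 * l * x) * Q x))"
 shows "jost_equation s q l m \<longleftrightarrow>
  zs_system k (\<lambda>x. m x $ 1 $ 1) (\<lambda>x. cis (2 * l * x) * m x $ 2 $ 1) \<and>
  ((\<lambda>x. m x $ 1 $ 1) \<longlongrightarrow> 1) F \<and> ((\<lambda>x. cis (2 * l * x) * m x $ 2 $ 1) \<longlongrightarrow> 0) F \<and>
  zs_system k (\<lambda>x. cis (- 2 * l * x) * m x $ 1 $ 2) (\<lambda>x. m x $ 2 $ 2) \<and>
  ((\<lambda>x. cis (- 2 * l * x) * m x $ 1 $ 2) \<longlongrightarrow> 0) F \<and> ((\<lambda>x. m x $ 2 $ 2) \<longlongrightarrow> 1) F" (is "_ \<longleftrightarrow> ?R")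
proof
 let ?I = "\<lambda>g x. half_integral s x g"
 have [measurable]: "Q \<in> bor" using Q by auto
 have cc: "cis (- 2 * l * x) * (cis (2 * l * x) * z) = z" "cis (2 * l * x) * (cis (- 2 * l * x) * z) = z" for x z
  by (simp_all add: mult.assoc[symmetric] cis_mult)
 have kz: "k x * (cis (2 * l * x) * z) = cor l * (Q x * z)" for x z
 proof -
  have "k x * (cis (2 * l * x) * z) = cor l * (Q x * (cis (- 2 * l * x) * (cis (2 * l * x) * z)))"
   by (simp only: k_def mult_ac)
  then show ?thesis unfolding cc .
 qed
 have ck: "cnj (k x) = cor l * (cis (2 * l * x) * cnj (Q x))" for x by (simp add: k_def cis_cnj)
 have ckz: "cnj (k x) * (cis (- 2 * l * x) * z) = cor l * (cnj (Q x) * z)" for x z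
 proof -
  have "cnj (k x) * (cis (- 2 * l * x) * z) = cor l * (cnj (Q x) * (cis (2 * l * x) * (cis (- 2 * l * x) * z)))"
   by (simp only: ck mult_ac)
  then show ?thesis unfolding cc .
 qed
 have cm: "(\<lambda>x. cis (c * x)) \<in> bor" for c :: real by (rule AC_meas[OF AC_cis])
 note cm2[measurable] = cm[of "2 * l"] cm[of "- 2 * l"]
 {
  assume "jost_equation s q l m"
  note J = this[unfolded jost_equation_entries, rule_format]
  have i1: "\<And>x. half_integrable s x (\<lambda>y. q y * m y $ 2 $ 1)"
   and i2: "\<And>x. half_integrable s x (\<lambda>y. cis (- 2 * l * y) * q y * m y $ 2 $ 2)"
   and i3: "\<And>x. half_integrable s x (\<lambda>y. cis (2 * l * y) * cnj (q y) * m y $ 1 $ 1)"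
   and i4: "\<And>x. half_integrable s x (\<lambda>y. cnj (q y) * m y $ 1 $ 2)"
   using J by blast+
  define I1 where "I1 = ?I (\<lambda>y. q y * m y $ 2 $ 1)"
  define I2 where "I2 = ?I (\<lambda>y. cis (- 2 * l * y) * q y * m y $ 2 $ 2)"
  define I3 where "I3 = ?I (\<lambda>y. cis (2 * l * y) * cnj (q y) * m y $ 1 $ 1)"
  define I4 where "I4 = ?I (\<lambda>y. cnj (q y) * m y $ 1 $ 2)"
  have J': "m x $ 1 $ 1 = 1 - l * I1 x \<and> m x $ 1 $ 2 = - cor l * (cis (2 * l * x) * I2 x) \<and>
   m x $ 2 $ 1 = l * (cis (- 2 * l * x) * I3 x) \<and> m x $ 2 $ 2 = 1 + l * I4 x" for x
   using J[of x] unfolding I1_def I2_def I3_def I4_def by (elim conjE) (intro conjI; assumption)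
  note J1 = J'[THEN conjunct1] and J2 = J'[THEN conjunct2, THEN conjunct1] and J3 = J'[THEN conjunct2, THEN conjunct2, THEN conjunct1]
   and J4 = J'[THEN conjunct2, THEN conjunct2, THEN conjunct2]
  have m11: "m x $ 1 $ 1 = 1 + (- cor l) * I1 x" and m22: "m x $ 2 $ 2 = 1 + l * I4 x" for x
   using J1[of x] J4[of x] by simp_all
  have cd: "cis (- 2 * l * x) * (d * (cis (2 * l * x) * z)) = d * z" "cis (2 * l * x) * (d * (cis (- 2 * l * x) * z)) = d * z" for x z d
   by (simp_all only: mult.left_commute[of "cis _" d] cc)
  have m12: "cis (- 2 * l * x) * m x $ 1 $ 2 = - cor l * I2 x" and m21: "cis (2 * l * x) * m x $ 2 $ 1 = l * I3 x" for x
   unfolding J2 J3 cd by (rule refl)+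
  have c: "continuous_on UNIV I1" "continuous_on UNIV I2" "continuous_on UNIV I3" "continuous_on UNIV I4"
   unfolding I1_def I2_def I3_def I4_def by (rule indefinite_integral_continuous(1)[OF e], rule i1 i2 i3 i4)+
  have [measurable]: "I1 \<in> bor" "I2 \<in> bor" "I3 \<in> bor" "I4 \<in> bor"
   using c by (auto intro: borel_measurable_continuous_onI)
  have M12: "m x $ 1 $ 2 = cis (2 * l * x) * (- cor l * I2 x)" and M21: "m x $ 2 $ 1 = cis (- 2 * l * x) * (l * I3 x)" for x
   unfolding m12[symmetric] m21[symmetric] cc by (rule refl)+
  \<comment> \<open>Measurability of \<open>m\<close> has to be read off the equation: every entry
    is a phase times an affine function of a continuous indefinite integral.\<close>
  have mm[measurable]: "(\<lambda>x. m x $ 1 $ 1) \<in> bor" "(\<lambda>x. m x $ 1 $ 2) \<in> bor"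
   "(\<lambda>x. m x $ 2 $ 1) \<in> bor" "(\<lambda>x. m x $ 2 $ 2) \<in> bor"
   unfolding m11 M12 M21 m22 by measurable
  have A1: "AC I1 (\<lambda>y. Q y * m y $ 2 $ 1)" and A2: "AC I2 (\<lambda>y. cis (- 2 * l * y) * Q y * m y $ 2 $ 2)"
   and A3: "AC I3 (\<lambda>y. cis (2 * l * y) * cnj (Q y) * m y $ 1 $ 1)" and A4: "AC I4 (\<lambda>y. cnj (Q y) * m y $ 1 $ 2)"
   unfolding I1_def I2_def I3_def I4_def
   by (rule indefinite_integral(1)[OF e], rule i1 i2 i3 i4, measurable, use q(2) in eventually_elim, simp)+
  have "(I1 \<longlongrightarrow> 0) F" "(I2 \<longlongrightarrow> 0) F" "(I3 \<longlongrightarrow> 0) F" "(I4 \<longlongrightarrow> 0) F"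
   unfolding I1_def I2_def I3_def I4_def by (rule indefinite_integral_continuous(2)[OF e], rule i1 i2 i3 i4)+
  note t = tendsto_add[OF tendsto_const[of 1] tendsto_mult_left[OF this(1), of "- cor l"]] tendsto_mult_left[OF this(2), of "- cor l"]
   tendsto_mult_left[OF this(3), of l] tendsto_add[OF tendsto_const[of 1] tendsto_mult_left[OF this(4), of l]]
  have "zs_system k (\<lambda>x. m x $ 1 $ 1) (\<lambda>x. cis (2 * l * x) * m x $ 2 $ 1)"
   unfolding zs_system_def
  proof
   show "AC (\<lambda>x. m x $ 1 $ 1) (\<lambda>x. - k x * (cis (2 * l * x) * m x $ 2 $ 1))"
    by (rule AC_cong[OF AC_add[OF AC_const[of 1] AC_cmult[OF A1, of "- cor l"]]]) (simp_all only: m11 mult_minus_left kz add_0)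
   show "AC (\<lambda>x. cis (2 * l * x) * m x $ 2 $ 1) (\<lambda>x. cnj (k x) * m x $ 1 $ 1)"
    by (rule AC_cong[OF AC_cmult[OF A3, of l]]) (simp only: m21, simp only: ck mult.assoc)
  qed
  moreover have "zs_system k (\<lambda>x. cis (- 2 * l * x) * m x $ 1 $ 2) (\<lambda>x. m x $ 2 $ 2)"
   unfolding zs_system_def
  proof
   show "AC (\<lambda>x. cis (- 2 * l * x) * m x $ 1 $ 2) (\<lambda>x. - k x * m x $ 2 $ 2)"
    by (rule AC_cong[OF AC_cmult[OF A2, of "- cor l"]]) (simp only: m12, simp only: k_def mult.assoc mult_minus_left)
   show "AC (\<lambda>x. m x $ 2 $ 2) (\<lambda>x. cnj (k x) * (cis (- 2 * l * x) * m x $ 1 $ 2))"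
    by (rule AC_cong[OF AC_add[OF AC_const[of 1] AC_cmult[OF A4, of l]]]) (simp_all only: m22 ckz add_0)
  qed
  ultimately show ?R using t unfolding m11 m12 m21 m22 by simp
 }
 assume R: ?R
 note A1 = R[THEN conjunct1, unfolded zs_system_def, THEN conjunct1] and A3 = R[THEN conjunct1, unfolded zs_system_def, THEN conjunct2]
  and A2 = R[THEN conjunct2, THEN conjunct2, THEN conjunct2, THEN conjunct1, unfolded zs_system_def, THEN conjunct1]
  and A4 = R[THEN conjunct2, THEN conjunct2, THEN conjunct2, THEN conjunct1, unfolded zs_system_def, THEN conjunct2]
 have M12: "m x $ 1 $ 2 = cis (2 * l * x) * (cis (- 2 * l * x) * m x $ 1 $ 2)" and M21: "m x $ 2 $ 1 = cis (- 2 * l * x) * (cis (2 * l * x) * m x $ 2 $ 1)" for x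
  unfolding cc by (rule refl)+
 have mm[measurable]: "(\<lambda>x. m x $ 1 $ 1) \<in> bor" "(\<lambda>x. m x $ 1 $ 2) \<in> bor"
   "(\<lambda>x. m x $ 2 $ 1) \<in> bor" "(\<lambda>x. m x $ 2 $ 2) \<in> bor"
  using AC_meas[OF A1] AC_meas[OF A4] borel_measurable_times[OF cm2(1) AC_meas[OF A2]] borel_measurable_times[OF cm2(2) AC_meas[OF A3]]
  unfolding M12[symmetric] M21[symmetric] by auto
 \<comment> \<open>In this direction integrability must be proved, and boundedness of
   \<open>m\<close> together with integrability of \<open>Q\<close> gives it; in the other direction
   it is part of \<open>jost_equation\<close>.\<close>
 obtain B where B: "\<And>x. norm (m x) <= B" using bd by (auto simp: bounded_iff)
 have mB: "cmod (m x $ i $ j) <= B" for x i j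
  using order_trans[OF Finite_Cartesian_Product.norm_nth_le[of "m x $ i" j] Finite_Cartesian_Product.norm_nth_le[of "m x" i]] B[of x] by simp
 have int: "integrable lborel (\<lambda>x. d x * m x $ i $ j)"
  if d: "d \<in> bor" "\<And>x. cmod (d x) <= cmod (Q x)" and m: "(\<lambda>x. m x $ i $ j) \<in> bor" for d i j
 proof (rule Bochner_Integration.integrable_bound)
  show "integrable lborel (\<lambda>x. cor B * Q x)" using Q by simp
  show "(\<lambda>x. d x * m x $ i $ j) \<in> borel_measurable lborel" using d(1) m by measurable
  have "cmod (d x * m x $ i $ j) <= cmod (Q x) * B" for x unfolding norm_mult by (intro mult_mono d mB) auto
  moreover have "B >= 0" using order_trans[OF norm_ge_zero B] .
  ultimately show "AE x in lborel. norm (d x * m x $ i $ j) <= norm (cor B * Q x)" by (simp add: norm_mult mult.commute)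
 qed
 have lb: "f \<in> borel_measurable lebesgue" if "f \<in> bor" for f :: "real => complex"
  by (rule measurable_completion) (use that in simp)
 note [measurable] = q(1) lb[OF cm2(1)] lb[OF cm2(2)] lb[OF mm(1)] lb[OF mm(2)] lb[OF mm(3)] lb[OF mm(4)]
 have aq: "AE x in lborel. d x * q x * e x = d x * Q x * e x" "AE x in lborel. d x * cnj (q x) * e x = d x * cnj (Q x) * e x" for d e :: "real => complex"
  using q(2) by (eventually_elim, simp)+
 have A1': "AC (\<lambda>x. m x $ 1 $ 1) (\<lambda>x. cor (- l) * (1 * Q x * m x $ 2 $ 1))"
  using A1 by (rule AC_cong) (simp_all only: mult_minus_left kz of_real_minus mult_1_left)
 have A2': "AC (\<lambda>x. cis (- 2 * l * x) * m x $ 1 $ 2) (\<lambda>x. cor (- l) * (cis (- 2 * l * x) * Q x * m x $ 2 $ 2))"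
  using A2 by (rule AC_cong) (simp_all only: k_def mult.assoc mult_minus_left of_real_minus)
 have A3': "AC (\<lambda>x. cis (2 * l * x) * m x $ 2 $ 1) (\<lambda>x. cor l * (cis (2 * l * x) * cnj (Q x) * m x $ 1 $ 1))"
  using A3 by (rule AC_cong) (simp_all only: ck mult.assoc)
 have A4': "AC (\<lambda>x. m x $ 2 $ 2) (\<lambda>x. cor l * (1 * cnj (Q x) * m x $ 1 $ 2))"
  using A4 by (rule AC_cong) (simp_all only: ckz mult_1_left)
 have lim: "((\<lambda>x. m x $ 1 $ 1) \<longlongrightarrow> 1) F" "((\<lambda>x. cis (2 * l * x) * m x $ 2 $ 1) \<longlongrightarrow> 0) F"
  "((\<lambda>x. cis (- 2 * l * x) * m x $ 1 $ 2) \<longlongrightarrow> 0) F" "((\<lambda>x. m x $ 2 $ 2) \<longlongrightarrow> 1) F" using R by blast+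
 note E1 = AC_indefinite_integral[OF e A1' lim(1) int _ aq(1)]
 note E2 = AC_indefinite_integral[OF e A2' lim(3) int _ aq(1)]
 note E3 = AC_indefinite_integral[OF e A3' lim(2) int _ aq(2)]
 note E4 = AC_indefinite_integral[OF e A4' lim(4) int _ aq(2)]
 have F1: "half_integrable s x (\<lambda>y. 1 * q y * m y $ 2 $ 1)"
  "cor (- l) * ?I (\<lambda>y. 1 * q y * m y $ 2 $ 1) x = m x $ 1 $ 1 - 1" for x
  by (rule E1; measurable; simp add: norm_mult)+
 have F2: "half_integrable s x (\<lambda>y. cis (- 2 * l * y) * q y * m y $ 2 $ 2)"
  "cor (- l) * ?I (\<lambda>y. cis (- 2 * l * y) * q y * m y $ 2 $ 2) x = cis (- 2 * l * x) * m x $ 1 $ 2 - 0" for x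
  by (rule E2; measurable; simp add: norm_mult)+
 have F3: "half_integrable s x (\<lambda>y. cis (2 * l * y) * cnj (q y) * m y $ 1 $ 1)"
  "cor l * ?I (\<lambda>y. cis (2 * l * y) * cnj (q y) * m y $ 1 $ 1) x = cis (2 * l * x) * m x $ 2 $ 1 - 0" for x
  by (rule E3; measurable; simp add: norm_mult)+
 have F4: "half_integrable s x (\<lambda>y. 1 * cnj (q y) * m y $ 1 $ 2)"
  "cor l * ?I (\<lambda>y. 1 * cnj (q y) * m y $ 1 $ 2) x = m x $ 2 $ 2 - 1" for x
  by (rule E4; measurable; simp add: norm_mult)+
 show "jost_equation s q l m"
  unfolding jost_equation_entries
 proof (intro allI conjI)
  fix x
  show "m x $ 1 $ 1 = 1 - l * ?I (\<lambda>y. q y * m y $ 2 $ 1) x" using F1(2)[of x] by (simp add: algebra_simps)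
  show "m x $ 2 $ 2 = 1 + l * ?I (\<lambda>y. cnj (q y) * m y $ 1 $ 2) x" using F4(2)[of x] by (simp add: algebra_simps)
  have "m x $ 1 $ 2 = cis (2 * l * x) * (cor (- l) * ?I (\<lambda>y. cis (- 2 * l * y) * q y * m y $ 2 $ 2) x)"
   unfolding F2(2) diff_0_right by (rule M12)
  then show "m x $ 1 $ 2 = - cor l * (cis (2 * l * x) * ?I (\<lambda>y. cis (- 2 * l * y) * q y * m y $ 2 $ 2) x)" by (simp only: mult_ac of_real_minus)
  have "m x $ 2 $ 1 = cis (- 2 * l * x) * (cor l * ?I (\<lambda>y. cis (2 * l * y) * cnj (q y) * m y $ 1 $ 1) x)"
   unfolding F3(2) diff_0_right by (rule M21)
  then show "m x $ 2 $ 1 = l * (cis (- 2 * l * x) * ?I (\<lambda>y. cis (2 * l * y) * cnj (q y) * m y $ 1 $ 1) x)" by (simp only: mult_ac)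
 qed (use F1(1) F2(1) F3(1) F4(1) in simp_all)
qed

lemma norm_matrix_le: "norm (v :: complex^2^2) <= (\<Sum>i\<in>UNIV. \<Sum>j\<in>UNIV. cmod (v $ i $ j))"
proof -
 have "norm v <= (\<Sum>i\<in>UNIV. norm (v $ i))" unfolding norm_vec_def[of v] by (rule L2_set_le_sum) simp
 also have "\<dots> <= (\<Sum>i\<in>UNIV. \<Sum>j\<in>UNIV. cmod (v $ i $ j))"
  by (rule sum_mono) (unfold norm_vec_def[of "v $ _"], rule L2_set_le_sum, simp)
 finally show ?thesis .
qed

text \<open>Resolves the definite description in \<open>jost_m\<close>. One solution of the system
  with the right boundary values is enough: the conserved norm bounds it by 1,
  \<open>zs_conj\<close> supplies the second column, and \<open>zs_unique\<close> excludes any other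
  bounded solution.\<close>

lemma jost_m_eqI:
 fixes Q q :: "real => complex"
 assumes e: "endpoint s F" and q: "q \<in> borel_measurable lebesgue" "AE x in lborel. q x = Q x" and Q: "integrable lborel Q"
  and z: "zs_system (\<lambda>x. cor l * (cis (- 2 * l * x) * Q x)) y z" "(y \<longlongrightarrow> 1) F" "(z \<longlongrightarrow> 0) F"
 shows "jost_m s q l = (\<lambda>x. vector [vector [y x, - (cis (2 * l * x) * cnj (z x))], vector [cis (- 2 * l * x) * z x, cnj (y x)]])"
  (is "_ = ?m")
 unfolding jost_m_def
proof (rule the_equality)
 note F = endpoint_nontrivial[OF e]
 have cc: "cis (- 2 * l * x) * (cis (2 * l * x) * z) = z" "cis (2 * l * x) * (cis (- 2 * l * x) * z) = z" for x z
  by (simp_all add: mult.assoc[symmetric] cis_mult)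
 have n: "(cmod (y x))\<^sup>2 + (cmod (z x))\<^sup>2 = 1" for x using zs_norm_const[OF z F, of x] by simp
 have b: "cmod (y x) <= 1" "cmod (z x) <= 1" for x
 proof -
  have "(cmod (y x))\<^sup>2 <= 1" "(cmod (z x))\<^sup>2 <= 1"
   using n[of x] zero_le_power2[of "cmod (y x)"] zero_le_power2[of "cmod (z x)"] by linarith+
  then show "cmod (y x) <= 1" "cmod (z x) <= 1" by (simp_all add: power_le_one_iff abs_square_le_1)
 qed
 have "norm (?m x) <= 4" for x
 proof -
  have "norm (?m x) <= (\<Sum>i\<in>UNIV. \<Sum>j\<in>UNIV. cmod (?m x $ i $ j))" by (rule norm_matrix_le)
  also have "\<dots> <= 4" using b[of x] by (simp add: sum_2 norm_mult)
  finally show ?thesis .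
 qed
 then have bd: "bounded (range ?m)" by (auto simp: bounded_iff)
 have me: "?m x $ 1 $ 1 = y x" "cis (2 * l * x) * ?m x $ 2 $ 1 = z x" "cis (- 2 * l * x) * ?m x $ 1 $ 2 = - cnj (z x)" "?m x $ 2 $ 2 = cnj (y x)" for x
  by (simp_all only: vector_2 mult_minus_right cc)
 have "((\<lambda>x. - cnj (z x)) \<longlongrightarrow> - cnj 0) F" "((\<lambda>x. cnj (y x)) \<longlongrightarrow> cnj 1) F" by (intro tendsto_intros z)+
 then have "jost_equation s q l ?m"
  unfolding jost_equation_iff[OF e q Q bd] me using z zs_conj[OF z(1)] by simp
 then show "bounded (range ?m) \<and> jost_equation s q l ?m" using bd by blast
 fix m assume m: "bounded (range m) \<and> jost_equation s q l m"
 note R = m[THEN conjunct2, unfolded jost_equation_iff[OF e q Q m[THEN conjunct1]]]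
 show "m = ?m"
 proof
  fix x
  have 1: "m x $ 1 $ 1 = y x" "cis (2 * l * x) * m x $ 2 $ 1 = z x"
   using zs_unique[OF R[THEN conjunct1] z(1) _ _ z(2,3) F] R by blast+
  have 2: "cis (- 2 * l * x) * m x $ 1 $ 2 = - cnj (z x)" "m x $ 2 $ 2 = cnj (y x)"
  proof -
   have l: "((\<lambda>x. - cnj (z x)) \<longlongrightarrow> 0) F" "((\<lambda>x. cnj (y x)) \<longlongrightarrow> 1) F" using tendsto_minus[OF tendsto_cnj[OF z(3)]] tendsto_cnj[OF z(2)] by simp_all
   show "cis (- 2 * l * x) * m x $ 1 $ 2 = - cnj (z x)" "m x $ 2 $ 2 = cnj (y x)"
    using zs_unique[OF R[THEN conjunct2, THEN conjunct2, THEN conjunct2, THEN conjunct1] zs_conj[OF z(1)] _ _ l F] R by blast+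
  qed
  have "m x $ 2 $ 1 = cis (- 2 * l * x) * z x" unfolding 1(2)[symmetric] cc ..
  moreover have "m x $ 1 $ 2 = - (cis (2 * l * x) * cnj (z x))"
   using cc(2)[of x "m x $ 1 $ 2", symmetric] unfolding 2(1) mult_minus_right .
  ultimately show "m x = ?m x" using 1(1) 2(2) by (simp add: vec_eq_iff forall_2)
 qed
qed

text \<open>The linear solution is recovered from the ratio of its components: the first component
  is the exponential of minus a primitive of \<open>l Q w\<close>, normalised at the chosen end. An
  exponential has a nonzero limit at the other end, and this is what yields that the coefficient
  \<open>a\<close> does not vanish.\<close>

lemma zs_of_riccati:
 fixes l :: real and Q w :: "real => complex"
 assumes e: "endpoint s F" and Q: "integrable lborel Q"
  and w: "AC w (\<lambda>x. - (2 * \<i> * l) * w x + l * cnj (Q x) + l * (Q x * (w x)\<^sup>2))" "\<And>x. cmod (w x) <= M" "(w \<longlongrightarrow> 0) F"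
 obtains y a where "zs_system (\<lambda>x. cor l * (cis (- 2 * l * x) * Q x)) y (\<lambda>x. cis (2 * l * x) * w x * y x)"
  "(y \<longlongrightarrow> 1) F" "((\<lambda>x. cis (2 * l * x) * w x * y x) \<longlongrightarrow> 0) F" "(y \<longlongrightarrow> a) at_bot" "a \<noteq> 0"
proof -
 note [measurable] = AC_meas[OF w(1)]
 have [measurable]: "Q \<in> bor" using Q by auto
 define g where "g x = cor l * Q x * w x" for x
 have gi: "integrable lborel g"
  unfolding g_def
 proof (rule Bochner_Integration.integrable_bound)
  show "integrable lborel (\<lambda>x. cor (\<bar>l\<bar> * M) * Q x)" using Q by simp
  have "M >= 0" using w(2)[of 0] norm_ge_zero order_trans by blast
  moreover have "\<bar>l\<bar> * cmod (Q x) * cmod (w x) <= \<bar>l\<bar> * cmod (Q x) * M" for x by (intro mult_left_mono w(2)) auto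
  ultimately show "AE x in lborel. norm (cor l * Q x * w x) <= norm (cor (\<bar>l\<bar> * M) * Q x)"
   by (intro AE_I2) (simp add: norm_mult abs_mult mult_ac)
 qed measurable
 have si: "set_integrable lborel A g" if "A \<in> sets borel" for A
  using gi integrable_mult_indicator[of A lborel g] that by (simp add: set_integrable_def)
 define G0 where "G0 x = - (LINT y:{x..}|lborel. g y)" for x
 have G0: "AC G0 g" unfolding G0_def[abs_def] by (rule AC_upper_integral) (use gi si in auto)
 obtain L where L: "(G0 \<longlongrightarrow> L) F"
  using AC_limits[OF G0 gi] e by (auto simp: endpoint_def)
 obtain L' where L': "(G0 \<longlongrightarrow> L') at_bot" using AC_limits[OF G0 gi] by auto
 define y where "y x = exp (L - G0 x)" for x
 have yA: "AC y (\<lambda>x. y x * - g x)"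
  using AC_exp[OF AC_diff[OF AC_const[of L] G0]] by (rule AC_cong) (simp_all add: y_def)
 define z where "z x = cis (2 * l * x) * w x * y x" for x
 have cc: "cis (- 2 * l * x) * (cis (2 * l * x) * z) = z" for x z
  by (simp add: mult.assoc[symmetric] cis_mult)
 show thesis
 proof (rule that[of y "exp (L - L')"])
  show "zs_system (\<lambda>x. cor l * (cis (- 2 * l * x) * Q x)) y (\<lambda>x. cis (2 * l * x) * w x * y x)"
   unfolding zs_system_def
  proof
   have "cor l * (cis (- 2 * l * x) * Q x) * (cis (2 * l * x) * w x * y x) = g x * y x" for x
   proof -
    have "cor l * (cis (- 2 * l * x) * Q x) * (cis (2 * l * x) * w x * y x)
     = cis (- 2 * l * x) * (cis (2 * l * x) * (cor l * Q x * w x * y x))" by (simp only: mult_ac)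
    then show ?thesis unfolding cc g_def .
   qed
   then show "AC y (\<lambda>x. - (cor l * (cis (- 2 * l * x) * Q x)) * (cis (2 * l * x) * w x * y x))"
    by (intro AC_cong[OF yA]) (simp_all only: mult_minus_left mult_minus_right mult.commute[of "y _" "g _"])
   show "AC (\<lambda>x. cis (2 * l * x) * w x * y x) (\<lambda>x. cnj (cor l * (cis (- 2 * l * x) * Q x)) * y x)"
    using AC_mult[OF AC_mult[OF AC_cis[of "2 * l"] w(1)] yA]
    by (rule AC_cong) (simp_all add: g_def cis_cnj algebra_simps power2_eq_square)
  qed
  have "((\<lambda>x. exp (L - G0 x)) \<longlongrightarrow> exp (L - L)) F" by (intro tendsto_intros L)
  then show y1: "(y \<longlongrightarrow> 1) F" by (simp add: y_def[abs_def])
  show "(y \<longlongrightarrow> exp (L - L')) at_bot" unfolding y_def[abs_def] by (intro tendsto_intros L')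
  have "((\<lambda>x. cis (2 * l * x) * w x) \<longlongrightarrow> 0) F"
   by (rule tendsto_norm_zero_cancel) (use tendsto_norm_zero[OF w(3)] in \<open>simp add: norm_mult\<close>)
  from tendsto_mult[OF this y1] show "((\<lambda>x. cis (2 * l * x) * w x * y x) \<longlongrightarrow> 0) F" by simp
 qed simp
qed

text \<open>The Jost solution normalised at minus infinity and its conjugate have limits (1, 0) and
  (0, 1) there. So \<open>a\<close> and \<open>b\<close> are the limits of the first column of the
  other Jost solution, and their ratio is the limit of the Riccati solution with its phase. The
  second solution \<open>u\<close> serves to construct the Jost matrix at minus infinity.\<close>

lemma scattering_ratio:
 fixes l :: real and Q w u :: "real => complex"
 assumes q: "q \<in> borel_measurable lebesgue" "AE x in lborel. q x = Q x" and Q: "integrable lborel Q"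
  and w: "AC w (\<lambda>x. - (2 * \<i> * l) * w x + l * cnj (Q x) + l * (Q x * (w x)\<^sup>2))" "\<And>x. cmod (w x) <= M" "(w \<longlongrightarrow> 0) at_top"
  and u: "AC u (\<lambda>x. - (2 * \<i> * l) * u x + l * cnj (Q x) + l * (Q x * (u x)\<^sup>2))" "\<And>x. cmod (u x) <= M" "(u \<longlongrightarrow> 0) at_bot"
  and r: "((\<lambda>x. cis (2 * l * x) * w x) \<longlongrightarrow> r) at_bot"
 shows "scattering_a q l \<noteq> 0" "scattering_b q l / scattering_a q l = r"
proof -
 define k where "k x = cor l * (cis (- 2 * l * x) * Q x)" for x
 have e: "endpoint \<infinity> at_top" "endpoint (-\<infinity>) at_bot" by (auto simp: endpoint_def)
 obtain y a where y: "zs_system k y (\<lambda>x. cis (2 * l * x) * w x * y x)" "(y \<longlongrightarrow> 1) at_top"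
  "((\<lambda>x. cis (2 * l * x) * w x * y x) \<longlongrightarrow> 0) at_top" "(y \<longlongrightarrow> a) at_bot" "a \<noteq> 0"
  using zs_of_riccati[OF e(1) Q w] unfolding k_def[abs_def] .
 define z where "z x = cis (2 * l * x) * w x * y x" for x
 note y = y[folded z_def]
 obtain y' c where y': "zs_system k y' (\<lambda>x. cis (2 * l * x) * u x * y' x)" "(y' \<longlongrightarrow> 1) at_bot"
  "((\<lambda>x. cis (2 * l * x) * u x * y' x) \<longlongrightarrow> 0) at_bot" "(y' \<longlongrightarrow> c) at_bot" "c \<noteq> 0"
  using zs_of_riccati[OF e(2) Q u] unfolding k_def[abs_def] .
 define z' where "z' x = cis (2 * l * x) * u x * y' x" for x
 note y' = y'[folded z'_def]
 have zb: "(z \<longlongrightarrow> r * a) at_bot" unfolding z_def[abs_def] by (intro tendsto_intros r y(4))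
 note Jp = jost_m_eqI[OF e(1) q Q y(1-3)[unfolded k_def[abs_def]]] and Jm = jost_m_eqI[OF e(2) q Q y'(1-3)[unfolded k_def[abs_def]]]
 have ci: "cis (- (l * x)) * cis (l * x) = 1" for x by (simp add: cis_mult)
 \<comment> \<open>The second column of the matrix identity is the conjugate of the first, so four
   scalar equations reduce to two.\<close>
 have T: "jost_psi \<infinity> q l x = jost_psi (-\<infinity>) q l x ** transition_matrix A B \<longleftrightarrow>
  y x = A * y' x + B * (- cnj (z' x)) \<and> z x = A * z' x + B * cnj (y' x)" (is "?L \<longleftrightarrow> ?R") for A B x
 proof -
  define p where "p = cis (l * x)"
  define p' where "p' = cis (- (l * x))"
  have pp: "p' * p = 1" by (simp add: p_def p'_def cis_mult)
  have c2: "cis (2 * l * x) = p * p" "cis (- 2 * l * x) = p' * p'" unfolding p_def p'_def cis_mult by (rule arg_cong[where f=cis], simp)+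
  have nz: "p \<noteq> 0" "p' \<noteq> 0" by (simp_all add: p_def p'_def)
  have en: "jost_psi \<infinity> q l x = vector [vector [p * y x, - (p * cnj (z x))], vector [p' * z x, p' * cnj (y x)]]"
  "jost_psi (-\<infinity>) q l x = vector [vector [p * y' x, - (p * cnj (z' x))], vector [p' * z' x, p' * cnj (y' x)]]"
   unfolding jost_psi_def Jp Jm exp_i_sigma3_def matrix_matrix_mult_def p_def[symmetric] p'_def[symmetric] c2 using pp
   by (simp_all add: vec_eq_iff forall_2 sum_2 mult_ac)
  have "?L \<longleftrightarrow> p * y x = p * (A * y' x + B * (- cnj (z' x))) \<and> p' * z x = p' * (A * z' x + B * cnj (y' x)) \<and>
   p * cnj (z x) = p * cnj (A * z' x + B * cnj (y' x)) \<and> p' * cnj (y x) = p' * cnj (A * y' x + B * (- cnj (z' x)))"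
   unfolding en transition_matrix_def matrix_matrix_mult_def
   by (auto simp: vec_eq_iff forall_2 sum_2 algebra_simps)
  also have "\<dots> \<longleftrightarrow> ?R" using nz by (auto simp del: complex_cnj_add complex_cnj_mult)
  finally show ?thesis .
 qed
 \<comment> \<open>Limits at minus infinity force the values of the coefficients; conversely equal
   limits give the identity by \<open>zs_unique\<close>. Both are needed for the definite
   description in \<open>scattering_coeffs\<close>.\<close>
 have S: "(\<forall>x. jost_psi \<infinity> q l x = jost_psi (-\<infinity>) q l x ** transition_matrix A B) \<longleftrightarrow> A = a \<and> B = r * a" for A B
 proof
  have lim: "((\<lambda>x. A * y' x + B * (- cnj (z' x))) \<longlongrightarrow> A) at_bot" "((\<lambda>x. A * z' x + B * cnj (y' x)) \<longlongrightarrow> B) at_bot" for A B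
   using tendsto_add[OF tendsto_mult_left[OF y'(2), of A] tendsto_mult_left[OF tendsto_minus[OF tendsto_cnj[OF y'(3)]], of B]]
    tendsto_add[OF tendsto_mult_left[OF y'(3), of A] tendsto_mult_left[OF tendsto_cnj[OF y'(2)], of B]] by simp_all
  {
   assume "\<forall>x. jost_psi \<infinity> q l x = jost_psi (-\<infinity>) q l x ** transition_matrix A B"
   then have yz: "y = (\<lambda>x. A * y' x + B * (- cnj (z' x)))" "z = (\<lambda>x. A * z' x + B * cnj (y' x))" unfolding T by (auto simp: fun_eq_iff)
   show "A = a \<and> B = r * a"
    using tendsto_unique[OF _ lim(1)[of A B, folded yz(1)] y(4)] tendsto_unique[OF _ lim(2)[of A B, folded yz(2)] zb] by simp
  }
  assume "A = a \<and> B = r * a"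
  then show "\<forall>x. jost_psi \<infinity> q l x = jost_psi (-\<infinity>) q l x ** transition_matrix A B"
   unfolding T using zs_unique[OF y(1) zs_lincomb[OF y'(1) zs_conj[OF y'(1)], of a "r * a"] y(4) zb lim(1)[of a "r * a"] lim(2)[of a "r * a"]] by auto
 qed
 have "scattering_coeffs q l = (a, r * a)"
  unfolding scattering_coeffs_def S by (rule the_equality) auto
 then show "scattering_a q l \<noteq> 0" "scattering_b q l / scattering_a q l = r"
  using y(5) by (simp_all add: scattering_a_def scattering_b_def)
qed

section \<open>Representatives of the potential\<close>

lemma weighted_L2:
 assumes g: "g \<in> borel_measurable lebesgue" "AE x in lborel. g x = G x" and G: "G \<in> bor"
 shows "(\<lambda>x. cor (bracket x) * g x) \<in> L2 ==> wL2 G"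
  "wL2 G ==> WN G = ennreal ((L2_norm (\<lambda>x. cor (bracket x) * g x))\<^sup>2)"
proof -
 have bm[measurable]: "bracket \<in> bor" unfolding bracket_def[abs_def] by measurable
 have b2: "(cmod (cor (bracket x) * z))\<^sup>2 = (1 + x\<^sup>2) * (cmod z)\<^sup>2" for x z
  by (simp add: norm_mult power_mult_distrib bracket_def add_nonneg_nonneg)
 have ae: "AE x in lebesgue. (cmod (cor (bracket x) * g x))\<^sup>2 = (1 + x\<^sup>2) * (cmod (G x))\<^sup>2"
  using AE_completion[OF g(2)] by eventually_elim (simp add: b2)
 have bl: "bracket \<in> borel_measurable lebesgue" by (rule measurable_completion) simp
 have mg: "(\<lambda>x. (cmod (cor (bracket x) * g x))\<^sup>2) \<in> borel_measurable lebesgue" using bl g(1) by measurable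
 have mG: "(\<lambda>x. (1 + x\<^sup>2) * (cmod (G x))\<^sup>2) \<in> borel_measurable lborel" using G by measurable
 then have mG': "(\<lambda>x. (1 + x\<^sup>2) * (cmod (G x))\<^sup>2) \<in> borel_measurable lebesgue" by (rule measurable_completion)
 {
  assume "(\<lambda>x. cor (bracket x) * g x) \<in> L2"
  then have "integrable lebesgue (\<lambda>x. (cmod (cor (bracket x) * g x))\<^sup>2)" by (simp add: L2_def)
  then have "integrable lebesgue (\<lambda>x. (1 + x\<^sup>2) * (cmod (G x))\<^sup>2)" by (subst integrable_cong_AE[OF mG' mg]) (use ae in \<open>auto elim: eventually_mono\<close>)
  then have i: "integrable lborel (\<lambda>x. (1 + x\<^sup>2) * (cmod (G x))\<^sup>2)" by (subst (asm) integrable_completion[OF mG])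
  have "(NN x. ennreal ((1 + x\<^sup>2) * (cmod (G x))\<^sup>2)) = ennreal (\<integral>x. (1 + x\<^sup>2) * (cmod (G x))\<^sup>2 \<partial>lborel)"
   by (rule nn_integral_eq_integral[OF i]) auto
  then show "wL2 G" using G by (simp add: wL2_def WN_def)
 }
 assume "wL2 G"
 then have i: "integrable lborel (\<lambda>x. (1 + x\<^sup>2) * (cmod (G x))\<^sup>2)"
  using mG by (intro integrableI_nonneg) (auto simp: wL2_def WN_def)
 have "(L2_norm (\<lambda>x. cor (bracket x) * g x))\<^sup>2 = (\<integral>x. (cmod (cor (bracket x) * g x))\<^sup>2 \<partial>lebesgue)"
  by (simp add: L2_norm_def)
 also have "\<dots> = (\<integral>x. (1 + x\<^sup>2) * (cmod (G x))\<^sup>2 \<partial>lebesgue)" by (rule integral_cong_AE[OF mg mG' ae])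
 also have "\<dots> = (\<integral>x. (1 + x\<^sup>2) * (cmod (G x))\<^sup>2 \<partial>lborel)" by (rule integral_completion[OF mG])
 finally have e: "(L2_norm (\<lambda>x. cor (bracket x) * g x))\<^sup>2 = (\<integral>x. (1 + x\<^sup>2) * (cmod (G x))\<^sup>2 \<partial>lborel)" .
 show "WN G = ennreal ((L2_norm (\<lambda>x. cor (bracket x) * g x))\<^sup>2)"
  unfolding e WN_def by (rule nn_integral_eq_integral[OF i]) auto
qed

text \<open>\<open>X_space\<close> provides the derivatives of \<open>q\<close> order by order;
  testing with \<open>deriv \<phi>\<close> shows that consecutive ones are first derivatives of each
  other.\<close>

lemma weak_derivative_step:
 assumes "has_weak_derivative j f g" "has_weak_derivative (Suc j) f h"
 shows "has_weak_derivative 1 g h"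
 unfolding has_weak_derivative_def
proof (intro conjI allI impI)
 show "locally_integrable g" "locally_integrable h" using assms by (auto simp: has_weak_derivative_def)
 fix \<phi> assume \<phi>: "test_function \<phi>"
 have e: "(deriv ^^ j) (deriv \<phi>) = (deriv ^^ Suc j) \<phi>" by (simp add: funpow_swap1)
 have "(-1) ^ j * (\<integral>x. cor (deriv \<phi> x) * g x \<partial>lebesgue) = (\<integral>x. cor ((deriv ^^ Suc j) \<phi> x) * f x \<partial>lebesgue)"
  using assms(1) test_deriv[OF \<phi>] unfolding has_weak_derivative_def e[symmetric] by metis
 also have "\<dots> = (-1) ^ Suc j * (\<integral>x. cor (\<phi> x) * h x \<partial>lebesgue)"
  using assms(2) \<phi> unfolding has_weak_derivative_def by blast
 finally have "(-1) ^ j * ((-1) ^ j * (\<integral>x. cor (deriv \<phi> x) * g x \<partial>lebesgue)) = (-1) ^ j * ((-1) ^ Suc j * (\<integral>x. cor (\<phi> x) * h x \<partial>lebesgue))"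
  by (rule arg_cong)
 moreover have "(-1) ^ j * ((-1) ^ j * z) = z" for z :: complex by (simp add: mult.assoc[symmetric] power_add[symmetric])
 ultimately show "(\<integral>x. cor ((deriv ^^ 1) \<phi> x) * g x \<partial>lebesgue) = (- 1) ^ 1 * (\<integral>x. cor (\<phi> x) * h x \<partial>lebesgue)"
  by (simp add: mult.assoc)
qed

lemma X_space_representative:
 assumes q: "q \<in> X_space (n + 1)"
 obtains Q where "AE x in lborel. q x = Q 0 x" "\<And>k. k <= n + 1 ==> wL2 (Q k)" "\<And>k. k <= n ==> AC (Q k) (Q (Suc k))"
  "WN (Q 0) <= ennreal ((X1_norm q)\<^sup>2)" "WN (Q 1) <= ennreal ((X1_norm q)\<^sup>2)"
proof -
 have "\<forall>j. \<exists>g. j <= n + 1 \<longrightarrow> has_weak_derivative j q g \<and> (\<lambda>x. cor (bracket x) * g x) \<in> L2"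
  using q unfolding X_space_def by blast
 then obtain g where g: "\<And>j. j <= n + 1 ==> has_weak_derivative j q (g j)"
  "\<And>j. j <= n + 1 ==> (\<lambda>x. cor (bracket x) * g j x) \<in> L2" by metis
 have gm: "g j \<in> borel_measurable lebesgue" if "j <= n + 1" for j
  using g(1)[OF that] locally_integrable_measurable by (auto simp: has_weak_derivative_def)
 have "\<forall>j. \<exists>h. j <= n + 1 \<longrightarrow> h \<in> bor \<and> (AE x in lborel. g j x = h x)"
  using borel_version[OF gm] by metis
 then obtain h where h: "\<And>j. j <= n + 1 ==> h j \<in> bor" "\<And>j. j <= n + 1 ==> AE x in lborel. g j x = h j x" by metis
 have "\<forall>j. \<exists>F. j <= n \<longrightarrow> AC F (h (Suc j)) \<and> (AE x in lborel. g j x = F x)"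
 proof (intro allI)
  fix j
  show "\<exists>F. j <= n \<longrightarrow> AC F (h (Suc j)) \<and> (AE x in lborel. g j x = F x)"
  proof (cases "j <= n")
   case True
   then have wd: "has_weak_derivative 1 (g j) (g (Suc j))" by (intro weak_derivative_step[of j q]) (auto intro: g)
   from weak_derivative_AC[OF wd h(1)[of "Suc j"] h(2)[of "Suc j"]] True show ?thesis by auto
  qed auto
 qed
 then obtain F where F: "\<And>j. j <= n ==> AC (F j) (h (Suc j))" "\<And>j. j <= n ==> AE x in lborel. g j x = F j x" by metis
 \<comment> \<open>Up to order \<open>n\<close> there are absolutely continuous representatives; at
   the top order only a Borel version remains.\<close>
 define Q where "Q j = (if j <= n then F j else h j)" for j
 have Qm: "Q j \<in> bor" if "j <= n + 1" for j
  using AC_meas[OF F(1), of j] h(1)[OF that] by (simp add: Q_def)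
 have Qg: "AE x in lborel. g j x = Q j x" if "j <= n + 1" for j
  using F(2)[of j] h(2)[OF that] by (simp add: Q_def)
 have w: "wL2 (Q k)" if "k <= n + 1" for k by (rule weighted_L2(1)[OF gm[OF that] Qg[OF that] Qm[OF that] g(2)[OF that]])
 have A: "AC (Q k) (Q (Suc k))" if k: "k <= n" for k
 proof -
  have "AE x in lborel. h (Suc k) x = Q (Suc k) x" using h(2)[of "Suc k"] Qg[of "Suc k"] k by (auto elim: eventually_elim2)
  then have "AC (F k) (Q (Suc k))" by (rule AC_cong_AE[OF F(1)[OF k]]) (use Qm[of "Suc k"] k in auto)
  then show ?thesis using k by (simp add: Q_def)
 qed
 have lq: "locally_integrable q" using g(1)[of 0] by (simp add: has_weak_derivative_def)
 \<comment> \<open>For \<open>j = 0\<close> the definition supplies some weak derivative of order 0,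
   which has yet to be identified with \<open>q\<close>.\<close>
 have "has_weak_derivative 0 q q" using lq by (simp add: has_weak_derivative_def)
 from weak_derivative_unique[OF this g(1)[of 0]] have "AE x in lborel. q x = g 0 x" by (simp add: AE_completion_iff)
 then have q0: "AE x in lborel. q x = Q 0 x" using Qg[of 0] by (auto elim: eventually_elim2)
 have wd: "has_weak_derivative 1 q (weak_derivative 1 q)"
  unfolding weak_derivative_def by (rule someI[of _ "g 1"]) (rule g(1), simp)
 from weak_derivative_unique[OF this g(1)[of 1]] have "AE x in lborel. weak_derivative 1 q x = g 1 x" by (simp add: AE_completion_iff)
 then have q1: "AE x in lborel. weak_derivative 1 q x = Q 1 x" using Qg[of 1] by (auto elim: eventually_elim2)
 define N0 where "N0 = L2_norm (\<lambda>x. cor (bracket x) * q x)"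
 define N1 where "N1 = L2_norm (\<lambda>x. cor (bracket x) * weak_derivative 1 q x)"
 have N: "0 <= N0" "0 <= N1" by (simp_all add: N0_def N1_def L2_norm_def)
 have W: "WN (Q 0) = ennreal (N0\<^sup>2)" "WN (Q 1) = ennreal (N1\<^sup>2)"
  unfolding N0_def N1_def using wd q0 q1 lq
  by (auto intro!: weighted_L2(2) locally_integrable_measurable Qm w simp: has_weak_derivative_def)
 have "X1_norm q = N0 + N1" by (simp add: X1_norm_def N0_def N1_def)
 then have "N0\<^sup>2 <= (X1_norm q)\<^sup>2" "N1\<^sup>2 <= (X1_norm q)\<^sup>2" using N by (auto intro!: power_mono)
 then have "WN (Q 0) <= ennreal ((X1_norm q)\<^sup>2)" "WN (Q 1) <= ennreal ((X1_norm q)\<^sup>2)" unfolding W by (auto intro: ennreal_leI)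
 with q0 w A show thesis by (intro that[of Q])
qed

section \<open>Transformation of the potential\<close>

text \<open>\<open>Wc k\<close> is the space X_k in terms of absolutely continuous representatives.
  Functions such as \<open>p\<close> or exponentials of primitives do not decay and belong only to
  \<open>Bc\<close>, where the function is merely bounded but its derivative is weighted;
  \<open>Bc k\<close> is an algebra that acts on \<open>Wc k\<close>.\<close>

fun Wc :: "nat => (real => complex) => bool" where
 "Wc 0 g \<longleftrightarrow> wL2 g" |
 "Wc (Suc k) g \<longleftrightarrow> wL2 g \<and> (\<exists>g'. AC g g' \<and> Wc k g')"

fun Bc :: "nat => (real => complex) => bool" where
 "Bc 0 b \<longleftrightarrow> b \<in> bor \<and> (\<exists>C. \<forall>x. cmod (b x) <= C)" |
 "Bc (Suc k) b \<longleftrightarrow> (\<exists>C. \<forall>x. cmod (b x) <= C) \<and> (\<exists>b'. AC b b' \<and> Wc k b')"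

lemma Wc_wL2: "Wc k g ==> wL2 g" by (cases k) auto

lemma Bc_meas: "Bc k b ==> b \<in> bor" by (cases k) (auto intro: AC_meas)

lemma Bc_bounded: assumes "Bc k b" obtains C where "\<And>x. cmod (b x) <= C" using assms by (cases k) auto

lemma Wc_Suc: "Wc (Suc k) g ==> Wc k g"
proof (induction k arbitrary: g)
 case (Suc k)
 then show ?case by (metis Wc.simps(2))
qed simp

lemma Bc_Suc: "Bc (Suc k) b ==> Bc k b"
proof (cases k)
 case (Suc j)
 assume "Bc (Suc k) b"
 then obtain C b' where "\<forall>x. cmod (b x) <= C" "AC b b'" "Wc k b'" unfolding Bc.simps by blast
 then show ?thesis using Wc_Suc[of j b'] unfolding Suc Bc.simps by blast
qed (auto intro: AC_meas)

lemma Wc_add: "Wc k f ==> Wc k g ==> Wc k (\<lambda>x. f x + g x)"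
proof (induction k arbitrary: f g)
 case (Suc k)
 then obtain f' g' where "AC f f'" "Wc k f'" "AC g g'" "Wc k g'" by auto
 with Suc show ?case using AC_add[of f f' g g'] by (auto intro: wL2_add)
qed (auto intro: wL2_add)

lemma Wc_cmult: "Wc k f ==> Wc k (\<lambda>x. c * f x)"
proof (induction k arbitrary: f)
 case (Suc k)
 then obtain f' where "AC f f'" "Wc k f'" by auto
 with Suc show ?case using AC_cmult[of f f' c] by (auto intro: wL2_cmult)
qed (auto intro: wL2_cmult)

lemma Wc_cnj: "Wc k f ==> Wc k (\<lambda>x. cnj (f x))"
proof (induction k arbitrary: f)
 case (Suc k)
 then obtain f' where "AC f f'" "Wc k f'" by auto
 with Suc show ?case using AC_cnj[of f f'] by (auto intro: wL2_cnj)
qed (auto intro: wL2_cnj)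

lemma Bc_I: "(\<And>x. cmod (b x) <= C) ==> AC b b' ==> Wc k b' ==> Bc (Suc k) b" by auto

lemma bounded_of_limits:
 fixes g :: "real => complex"
 assumes "continuous_on UNIV g" "(g \<longlongrightarrow> a) at_top" "(g \<longlongrightarrow> b) at_bot"
 obtains C where "\<And>x. cmod (g x) <= C"
proof -
 have half: "\<exists>C. \<forall>x\<ge>0. cmod (h x) <= C" if h: "continuous_on UNIV h" "(h \<longlongrightarrow> a) at_top" for h :: "real => complex" and a
 proof -
  have c: "continuous_on UNIV (\<lambda>x. h x - a)" by (intro continuous_intros h)
  have l: "((\<lambda>x. h x - a) \<longlongrightarrow> 0) at_top" using tendsto_diff[OF h(2) tendsto_const[of a]] by simp
  obtain B where B: "\<And>x. x >= 0 ==> cmod (h x - a) <= B" by (rule bounded_half_line[OF c l, of 0]) (rule that)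
  have "cmod (h x) <= B + cmod a" if "x >= 0" for x
   using norm_triangle_ineq[of "h x - a" a] B[OF that] by simp
  then show ?thesis by blast
 qed
 obtain C1 where C1: "\<And>x. x >= 0 ==> cmod (g x) <= C1" using half[OF assms(1,2)] by blast
 have "continuous_on UNIV (\<lambda>x. g (- x))" by (rule continuous_on_compose2[OF assms(1)]) (auto intro!: continuous_intros)
 moreover have "((\<lambda>x. g (- x)) \<longlongrightarrow> b) at_top" using assms(3) by (simp add: filterlim_at_bot_mirror)
 ultimately obtain C2 where C2: "\<And>x. x >= 0 ==> cmod (g (- x)) <= C2" using half by blast
 have "cmod (g x) <= max C1 C2" for x using C1[of x] C2[of "- x"] by (cases "x >= 0") auto
 then show thesis by (rule that)
qed

text \<open>Weighted square integrability makes the derivative integrable, so the function has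
  limits at both ends and is bounded.\<close>

lemma AC_Wc_Bc:
 assumes "AC g g'" "Wc k g'" shows "Bc (Suc k) g"
proof -
 have i: "integrable lborel g'" using wL2_integrable[OF Wc_wL2[OF assms(2)]] .
 obtain a b where l: "(g \<longlongrightarrow> a) at_top" "(g \<longlongrightarrow> b) at_bot" using AC_limits[OF assms(1) i] by blast
 obtain C where C: "\<And>x. cmod (g x) <= C" by (rule bounded_of_limits[OF AC_continuous[OF assms(1)] l]) (rule that)
 show ?thesis by (rule Bc_I[OF C assms])
qed

lemma Wc_Bc: "Wc (Suc k) g ==> Bc (Suc k) g" using AC_Wc_Bc by auto

text \<open>In the product rule the roles alternate: \<open>g\<close> is the bounded factor for
  \<open>b'\<close>, and \<open>b\<close> is the bounded factor for \<open>g'\<close>.\<close>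

lemma Wc_mult: "Bc k b ==> Wc k g ==> Wc k (\<lambda>x. b x * g x)"
proof (induction k arbitrary: b g)
 case 0
 then show ?case by (auto intro: wL2_mult_bounded)
next
 case (Suc k)
 obtain b' where b': "AC b b'" "Wc k b'" using Suc.prems(1) by auto
 obtain g' where g': "AC g g'" "Wc k g'" using Suc.prems(2) by auto
 obtain C where C: "\<And>x. cmod (b x) <= C" by (rule Bc_bounded[OF Suc.prems(1)]) (rule that)
 have "wL2 (\<lambda>x. b x * g x)" by (rule wL2_mult_bounded[OF Wc_wL2[OF Suc.prems(2)] Bc_meas[OF Suc.prems(1)] C])
 moreover have "Wc k (\<lambda>x. g x * b' x + b x * g' x)"
  by (rule Wc_add[OF Suc.IH[OF Bc_Suc[OF Wc_Bc[OF Suc.prems(2)]] b'(2)] Suc.IH[OF Bc_Suc[OF Suc.prems(1)] g'(2)]])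
 moreover have "AC (\<lambda>x. b x * g x) (\<lambda>x. g x * b' x + b x * g' x)"
  using AC_mult[OF b'(1) g'(1)] by (rule AC_cong) simp_all
 ultimately show ?case unfolding Wc.simps by blast
qed

lemma Bc_const: "Bc k (\<lambda>_. c)"
proof -
 have "Wc j (\<lambda>_. 0)" for j
 proof (induction j)
  case (Suc j)
  then show ?case using AC_const[of 0] wL2_zero by auto
 qed (simp add: wL2_zero)
 then show ?thesis using AC_const[of c] by (cases k) auto
qed

lemma Bc_add: assumes "Bc k b" "Bc k c" shows "Bc k (\<lambda>x. b x + c x)"
proof -
 obtain C where C: "\<And>x. cmod (b x) <= C" by (rule Bc_bounded[OF assms(1)]) (rule that)
 obtain D where D: "\<And>x. cmod (c x) <= D" by (rule Bc_bounded[OF assms(2)]) (rule that)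
 have CD: "cmod (b x + c x) <= C + D" for x by (rule norm_triangle_le[OF add_mono[OF C D]])
 show ?thesis
 proof (cases k)
  case 0
  then show ?thesis using assms CD by auto
 next
  case (Suc j)
  then obtain b' c' where d: "AC b b'" "Wc j b'" "AC c c'" "Wc j c'" using assms by auto
  show ?thesis unfolding Suc by (rule Bc_I[OF CD AC_add[OF d(1,3)] Wc_add[OF d(2,4)]])
 qed
qed

lemma Bc_mult: assumes "Bc k b" "Bc k c" shows "Bc k (\<lambda>x. b x * c x)"
proof -
 obtain C where C: "\<And>x. cmod (b x) <= C" by (rule Bc_bounded[OF assms(1)]) (rule that)
 obtain D where D: "\<And>x. cmod (c x) <= D" by (rule Bc_bounded[OF assms(2)]) (rule that)
 have C0: "C >= 0" using C[of 0] norm_ge_zero order_trans by blast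
 have CD: "cmod (b x * c x) <= C * D" for x unfolding norm_mult by (intro mult_mono C D C0) auto
 show ?thesis
 proof (cases k)
  case 0
  then show ?thesis using assms CD by auto
 next
  case (Suc j)
  then obtain b' c' where d: "AC b b'" "Wc j b'" "AC c c'" "Wc j c'" using assms by auto
  have "Wc j (\<lambda>x. c x * b' x + b x * c' x)"
   using assms unfolding Suc by (intro Wc_add Wc_mult d) (rule Bc_Suc, assumption)+
  moreover have "AC (\<lambda>x. b x * c x) (\<lambda>x. c x * b' x + b x * c' x)"
   using AC_mult[OF d(1,3)] by (rule AC_cong) simp_all
  ultimately show ?thesis unfolding Suc by (intro Bc_I[OF CD]) auto
 qed
qed

lemma Bc_cnj: assumes "Bc k b" shows "Bc k (\<lambda>x. cnj (b x))"
proof -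
 obtain C where C: "\<And>x. cmod (b x) <= C" by (rule Bc_bounded[OF assms(1)]) (rule that)
 show ?thesis
 proof (cases k)
  case 0
  then show ?thesis using assms by auto
 next
  case (Suc j)
  then obtain b' where d: "AC b b'" "Wc j b'" using assms by auto
  have "cmod (cnj (b x)) <= C" for x using C[of x] by simp
  then show ?thesis unfolding Suc by (rule Bc_I[OF _ AC_cnj[OF d(1)] Wc_cnj[OF d(2)]])
 qed
qed

lemma Bc_inverse: assumes "Bc k b" "\<And>x. c <= cmod (b x)" "c > 0" shows "Bc k (\<lambda>x. inverse (b x))"
 using assms(1)
proof (induction k)
 case 0
 have "cmod (inverse (b x)) <= inverse c" for x unfolding norm_inverse by (rule le_imp_inverse_le[OF assms(2,3)])
 then show ?case using 0 by auto
next
 case (Suc k)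
 have nz: "b x \<noteq> 0" for x using assms(2)[of x] assms(3) by auto
 obtain b' where b: "AC b b'" "Wc k b'" using Suc.prems by auto
 have i: "Bc k (\<lambda>x. inverse (b x))" by (rule Suc.IH[OF Bc_Suc[OF Suc.prems]])
 then have "Wc k (\<lambda>x. - 1 * ((inverse (b x) * inverse (b x)) * b' x))" by (intro Wc_cmult Wc_mult Bc_mult b)
 moreover have "AC (\<lambda>x. inverse (b x)) (\<lambda>x. - 1 * ((inverse (b x) * inverse (b x)) * b' x))"
  using AC_inverse[OF b(1) nz] by (rule AC_cong) (simp_all add: divide_inverse power2_eq_square)
 moreover obtain C where "\<And>x. cmod (inverse (b x)) <= C" by (rule Bc_bounded[OF i]) (rule that)
 ultimately show ?case unfolding Bc.simps by blast
qed

lemma Bc_exp: assumes "Bc k b" shows "Bc k (\<lambda>x. exp (b x))"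
proof -
 obtain C where C: "\<And>x. cmod (b x) <= C" by (rule Bc_bounded[OF assms(1)]) (rule that)
 have e: "cmod (exp (b x)) <= exp C" for x
  using complex_Re_le_cmod[of "b x"] C[of x] by simp
 show ?thesis
  using assms
 proof (induction k)
  case 0
  then show ?case using e by auto
 next
  case (Suc k)
  obtain b' where b: "AC b b'" "Wc k b'" using Suc.prems by auto
  have "Wc k (\<lambda>x. exp (b x) * b' x)" by (rule Wc_mult[OF Suc.IH[OF Bc_Suc[OF Suc.prems]] b(2)])
  then show ?case by (rule Bc_I[OF e AC_exp[OF b(1)]])
 qed
qed

text \<open>\<open>AC_chain\<close> is stated for holomorphic outer functions, so the real root is
  taken as \<open>csqrt\<close> on the slit plane.\<close>

lemma AC_sqrt:
 assumes N: "AC (\<lambda>x. cor (a x)) N'" "\<And>x. 1 <= a x"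
 shows "AC (\<lambda>x. cor (sqrt (a x))) (\<lambda>x. inverse (cor (sqrt (a x))) * (1/2 * N' x))"
proof -
 have S: "open (- (\<real>\<^sub>\<le>\<^sub>0 :: complex set))" by (simp add: open_Compl)
 have m: "cor (a x) \<in> - \<real>\<^sub>\<le>\<^sub>0" for x using N(2)[of x] by auto
 have d: "(csqrt has_field_derivative inverse (2 * csqrt z)) (at z)" if "z \<in> - \<real>\<^sub>\<le>\<^sub>0" for z
  using that by (intro has_field_derivative_csqrt) auto
 have c: "continuous_on (- \<real>\<^sub>\<le>\<^sub>0) (\<lambda>z. inverse (2 * csqrt z))"
  by (intro continuous_intros continuous_on_csqrt) auto
 have e: "csqrt (cor (a x)) = cor (sqrt (a x))" for x
  using N(2)[of x] by (simp add: of_real_sqrt[symmetric])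
 show ?thesis
  using AC_chain[OF N(1) S m d c] unfolding e by (rule AC_cong) (auto simp: field_simps)
qed

text \<open>Differentiation with respect to \<open>E\<close> is \<open>1/p\<close> times the
  x-derivative; multiplication by \<open>ip\<close> in \<open>Bc\<close> keeps each step in the
  weighted class.\<close>

lemma derivative_sequence:
 assumes "Wc n g" "Bc n ip" "\<And>x. p x * ip x = 1"
 shows "\<exists>f. f 0 = g \<and> (\<forall>k\<le>n. wL2 (f k)) \<and> (\<forall>k<n. AC (f k) (\<lambda>x. p x * f (Suc k) x))"
 using assms(1,2)
proof (induction n arbitrary: g)
 case 0
 then show ?case by (intro exI[of _ "\<lambda>_. g"]) simp
next
 case (Suc n)
 obtain g' where g': "AC g g'" "Wc n g'" using Suc.prems(1) by auto
 have "Wc n (\<lambda>x. ip x * g' x)" by (rule Wc_mult[OF Bc_Suc[OF Suc.prems(2)] g'(2)])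
 from Suc.IH[OF this Bc_Suc[OF Suc.prems(2)]] obtain f where f: "f 0 = (\<lambda>x. ip x * g' x)" "\<And>k. k <= n ==> wL2 (f k)"
  "\<And>k. k < n ==> AC (f k) (\<lambda>x. p x * f (Suc k) x)" by blast
 have "AC g (\<lambda>x. p x * f 0 x)"
  using g'(1) by (rule AC_cong) (simp_all add: f(1) mult.assoc[symmetric] assms(3))
 then show ?case
  using f(2,3) Wc_wL2[OF Suc.prems(1)]
  by (intro exI[of _ "case_nat g f"]) (auto simp: less_Suc_eq_0_disj le_Suc_eq split: nat.split)
qed

text \<open>With \<open>p = sqrt (1 + q q\<^sup>*)\<close>, the fixed point \<open>w0 = - i q\<^sup>* / (1 + p)\<close> of the leading part of the Riccati
 equation and the Moebius map \<open>v \<mapsto> (v + w0) / (1 - w0\<^sup>* v)\<close>, the terms of the equation that grow with \<open>l\<close> become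
 diagonal.\<close>

lemma moebius_identity:
 fixes Q w0 v s p w0' l :: complex
 assumes w0: "w0 = - (\<i> * cnj Q * s)" and cs: "cnj s = s" and sp: "s * (1 + p) = 1" and pp: "p * p = 1 + Q * cnj Q"
  and D: "1 - cnj w0 * v \<noteq> 0"
  and h: "h * (2 * p * s) = 1"
  and dv: "dv = ((cnj w0 * w0' - w0 * cnj w0') * h - 2 * \<i> * l * p) * v + (- w0' * h) + (- cnj w0' * h) * v\<^sup>2"
 shows "(dv + w0') * inverse (1 - cnj w0 * v) + (v + w0) * (- (- (cnj w0' * v + cnj w0 * dv)) / (1 - cnj w0 * v)\<^sup>2)
  = - (2 * \<i> * l) * ((v + w0) * inverse (1 - cnj w0 * v)) + l * cnj Q + l * (Q * ((v + w0) * inverse (1 - cnj w0 * v))\<^sup>2)"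
proof -
 define c where "c = cnj w0"
 define d where "d = cnj w0'"
 define D where "D = 1 - c * v"
 have c: "c = \<i> * Q * s" by (simp add: c_def w0 cs)
 have qq: "Q * cnj Q = p * p - 1" using pp by simp
 have "s * s * (Q * cnj Q) = (s * p) * (s * p) - s * s" unfolding qq by (simp add: algebra_simps)
 also have sp1: "s * p = 1 - s" using sp by (simp add: algebra_simps)
 finally have r: "s * s * (Q * cnj Q) = 1 - 2 * s" by (simp add: algebra_simps)
 have rho: "c * w0 = 1 - 2 * s" unfolding c w0 using r by (simp add: algebra_simps)
 have "2 * p * s = 2 * (s * p)" by (simp only: mult_ac)
 then have sp': "2 * p * s = 1 + c * w0" unfolding rho sp1 by simp
 have Dn: "D \<noteq> 0" using assms(5) by (simp add: D_def c_def)
 have hn: "h * (1 + c * w0) = 1" using h sp' by simp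
 have dvr: "dv * (1 + c * w0) = (c * w0' - w0 * d) * v - 2 * \<i> * l * p * v * (1 + c * w0) - w0' - d * v\<^sup>2"
 proof -
  have "dv * (1 + c * w0) = (c * w0' - w0 * d) * (h * (1 + c * w0)) * v - 2 * \<i> * l * p * v * (1 + c * w0) - w0' * (h * (1 + c * w0)) - d * (h * (1 + c * w0)) * v\<^sup>2"
   unfolding dv c_def[symmetric] d_def[symmetric] by (simp add: algebra_simps)
  then show ?thesis unfolding hn by simp
 qed
 have num: "(dv + w0') * D + (v + w0) * (d * v + c * dv) = - (2 * \<i> * l * p * v * (1 + c * w0))"
 proof -
  have "(dv + w0') * D + (v + w0) * (d * v + c * dv) = dv * (1 + c * w0) + w0' - w0' * c * v + d * v\<^sup>2 + w0 * d * v"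
   unfolding D_def by (simp add: algebra_simps power2_eq_square)
  then show ?thesis unfolding dvr by (simp add: algebra_simps)
 qed
 have sq: "s * cnj Q = \<i> * w0" "s * Q = - \<i> * c" unfolding c w0 by (simp_all add: algebra_simps)
 have s2: "2 * s = 1 - c * w0" using rho by simp
 have rhs: "s * (- (2 * \<i> * l) * ((v + w0) * D) + l * cnj Q * D\<^sup>2 + l * Q * (v + w0)\<^sup>2) = s * (- (2 * \<i> * l * p * v * (1 + c * w0)))"
 proof -
  have "s * (- (2 * \<i> * l) * ((v + w0) * D) + l * cnj Q * D\<^sup>2 + l * Q * (v + w0)\<^sup>2)
   = - \<i> * l * ((2 * s) * ((v + w0) * D)) + l * (s * cnj Q) * D\<^sup>2 + l * (s * Q) * (v + w0)\<^sup>2" by (simp add: algebra_simps)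
  also have "\<dots> = - \<i> * l * ((1 - c * w0) * ((v + w0) * D) - w0 * D\<^sup>2 + c * (v + w0)\<^sup>2)"
   unfolding sq s2 by (simp add: algebra_simps)
  also have "(1 - c * w0) * ((v + w0) * D) - w0 * D\<^sup>2 + c * (v + w0)\<^sup>2 = v * (1 + c * w0) * (1 + c * w0)"
   unfolding D_def by (simp add: algebra_simps power2_eq_square)
  also have "- \<i> * l * (v * (1 + c * w0) * (1 + c * w0)) = s * (- (2 * \<i> * l * p * v * (1 + c * w0)))"
   unfolding sp'[symmetric] by (simp add: algebra_simps)
  finally show ?thesis .
 qed
 have "s \<noteq> 0" using sp by auto
 then have rhs': "- (2 * \<i> * l) * ((v + w0) * D) + l * cnj Q * D\<^sup>2 + l * Q * (v + w0)\<^sup>2 = - (2 * \<i> * l * p * v * (1 + c * w0))"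
  using rhs mult_left_cancel[of s] by blast
 have "(dv + w0') * inverse D + (v + w0) * (- (- (d * v + c * dv)) / D\<^sup>2) = ((dv + w0') * D + (v + w0) * (d * v + c * dv)) / D\<^sup>2"
  using Dn by (simp add: field_simps power2_eq_square)
 also have "\<dots> = (- (2 * \<i> * l) * ((v + w0) * D) + l * cnj Q * D\<^sup>2 + l * Q * (v + w0)\<^sup>2) / D\<^sup>2"
  unfolding num rhs' ..
 also have "\<dots> = - (2 * \<i> * l) * ((v + w0) * inverse D) + l * cnj Q + l * (Q * ((v + w0) * inverse D)\<^sup>2)"
  using Dn by (simp add: field_simps power2_eq_square)
 finally show ?thesis by (simp only: c_def d_def D_def)
qed

lemma Bc_sqrt:
 assumes "Bc k (\<lambda>x. cor (a x))" "\<And>x. 1 <= a x" shows "Bc k (\<lambda>x. cor (sqrt (a x)))"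
proof -
 obtain C where C: "\<And>x. cmod (cor (a x)) <= C" by (rule Bc_bounded[OF assms(1)]) (rule that)
 have p1: "1 <= sqrt (a x)" for x using assms(2) by simp
 have b: "cmod (cor (sqrt (a x))) <= sqrt C" for x using C[of x] assms(2)[of x] by simp
 show ?thesis
  using assms(1)
 proof (induction k)
  case 0
  then have "(\<lambda>x. cor (a x)) \<in> bor" by simp
  then have "(\<lambda>x. Re (cor (a x))) \<in> bor" by measurable
  then have "a \<in> bor" by simp
  then have "(\<lambda>x. cor (sqrt (a x))) \<in> bor" by measurable
  then show ?case using b by auto
 next
  case (Suc k)
  obtain N' where N: "AC (\<lambda>x. cor (a x)) N'" "Wc k N'" using Suc.prems by auto
  have "Bc k (\<lambda>x. inverse (cor (sqrt (a x))))"
  proof (rule Bc_inverse[OF Suc.IH[OF Bc_Suc[OF Suc.prems]], of 1])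
   show "1 <= cmod (cor (sqrt (a x)))" for x unfolding norm_of_real using p1[of x] by linarith
  qed simp
  then have "Wc k (\<lambda>x. inverse (cor (sqrt (a x))) * (1/2 * N' x))" by (rule Wc_mult[OF _ Wc_cmult[OF N(2)]])
  then show ?case by (rule Bc_I[OF b AC_sqrt[OF N(1) assms(2)]])
 qed
qed

text \<open>The bound \<open>pi < 4\<close> turns the weighted norm 1/32 into the L1 norm 1/16 asked
  for by \<open>riccati_data\<close>.\<close>

lemma small_L1:
 assumes "g \<in> bor" "WN g <= ennreal ((1/32)\<^sup>2)"
 shows "(NN x. ennreal (cmod (g x))) <= ennreal (1/16)"
proof -
 let ?I = "NN x. ennreal (cmod (g x))"
 have "?I\<^sup>2 <= ennreal pi * WN g" by (rule WN_L1[OF assms(1)])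
 also have "\<dots> <= ennreal 4 * ennreal ((1/32)\<^sup>2)" using pi_less_4 by (intro mult_mono assms(2) ennreal_leI) auto
 also have "\<dots> = ennreal ((1/16)\<^sup>2)" by (subst ennreal_mult[symmetric]) (simp_all add: power2_eq_square)
 finally have le: "?I\<^sup>2 <= ennreal ((1/16)\<^sup>2)" .
 then have "?I \<noteq> \<infinity>" by (auto simp: power2_eq_square ennreal_mult_top top_unique)
 then obtain t where t: "?I = ennreal t" "t >= 0" by (cases ?I) auto
 have "t\<^sup>2 <= (1/16)\<^sup>2" using le t by (simp add: ennreal_power)
 then have "t <= 1/16" by (rule power2_le_imp_le) simp
 then show ?thesis using t by (simp add: ennreal_leI)
qed

text \<open>Moving the origin to \<open>w0\<close> brings in the derivative \<open>w0'\<close>. It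
  yields the source, bounded by \<open>|Q1|\<close>, and a diagonal term free of \<open>l\<close>.
  The latter is imaginary and is removed by the gauge factor \<open>exp (IB)\<close> of modulus 1;
  division by \<open>p\<close> then gives the form of \<open>riccati_data\<close> with
  \<open>\<mu> = 1\<close>.\<close>

lemma potential_riccati:
 assumes Q: "AC Q Q1" "Wc n Q1" "wL2 Q" and small: "WN Q1 <= ennreal ((1/32)\<^sup>2)"
 obtains w :: "real => real => complex" and R where
  "\<And>l x. cmod (w l x) <= 2"
  "\<And>l. AC (w l) (\<lambda>x. - (2 * \<i> * cor l) * w l x + cor l * cnj (Q x) + cor l * (Q x * (w l x)\<^sup>2))"
  "\<And>l. (w l \<longlongrightarrow> 0) at_top" "\<And>l. ((\<lambda>x. cis (2 * l * x) * w l x) \<longlongrightarrow> R l) at_bot"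
  "\<And>j. j <= n ==> hcl (\<lambda>l. cor l ^ j * R l)"
proof -
 note [measurable] = AC_meas[OF Q(1)] AC_borel[OF Q(1)]
 have QB: "Bc n Q" by (rule Bc_Suc[OF AC_Wc_Bc[OF Q(1,2)]])
 obtain C where C: "\<And>x. cmod (Q x) <= C" by (rule Bc_bounded[OF QB]) (rule that)
 define a where "a x = 1 + (cmod (Q x))\<^sup>2" for x
 define pr where "pr x = sqrt (a x)" for x
 define p where "p x = cor (pr x)" for x
 have a1: "1 <= a x" for x by (simp add: a_def)
 have p1: "1 <= pr x" for x using a1 by (simp add: pr_def)
 have p0: "0 < pr x" "p x \<noteq> 0" for x using p1[of x] by (auto simp: p_def)
 have pr2: "(pr x)\<^sup>2 = 1 + (cmod (Q x))\<^sup>2" for x using a1[of x] by (simp add: pr_def a_def)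
 have aQ: "cor (a x) = 1 + Q x * cnj (Q x)" for x by (simp add: a_def complex_norm_square[symmetric])
 have pp: "p x * p x = 1 + Q x * cnj (Q x)" for x
  unfolding aQ[symmetric] p_def of_real_mult[symmetric] using pr2[of x] by (simp add: power2_eq_square a_def)
 have aA: "AC (\<lambda>x. cor (a x)) (\<lambda>x. Q1 x * cnj (Q x) + Q x * cnj (Q1 x))"
  using AC_add[OF AC_const[of 1] AC_mult[OF Q(1) AC_cnj[OF Q(1)]]] by (rule AC_cong) (simp_all add: aQ)
 define p' where "p' x = inverse (p x) * (1/2 * (Q1 x * cnj (Q x) + Q x * cnj (Q1 x)))" for x
 have pA: "AC p p'" using AC_sqrt[OF aA a1] by (rule AC_cong) (simp_all add: p_def pr_def p'_def)
 have aB: "Bc n (\<lambda>x. cor (a x))" unfolding aQ by (intro Bc_add Bc_mult Bc_cnj Bc_const QB)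
 have pB: "Bc n p" unfolding p_def[abs_def] pr_def[abs_def] by (rule Bc_sqrt[OF aB a1])
 define ip where "ip x = inverse (p x)" for x
 have ipB: "Bc n ip" unfolding ip_def[abs_def]
  by (rule Bc_inverse[OF pB, of 1]) (use p1 p0(1) in \<open>simp_all add: p_def abs_of_pos\<close>)
 have p'W: "Wc n p'"
 proof -
  have "Wc n (\<lambda>x. ip x * (1/2 * (cnj (Q x) * Q1 x + Q x * cnj (Q1 x))))"
   by (intro Wc_mult Wc_cmult Wc_add Wc_cnj Q(2) QB Bc_cnj ipB)
  then show ?thesis by (simp add: p'_def[abs_def] ip_def mult.commute[of "cnj (Q _)"])
 qed
 define s where "s x = inverse (1 + p x)" for x
 define sr where "sr x = 1 / (1 + pr x)" for x
 have ss: "s x = cor (sr x)" for x by (simp add: s_def sr_def p_def divide_inverse)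
 have sr: "0 < sr x" "sr x * (1 + pr x) = 1" for x using p0(1)[of x] by (simp_all add: sr_def add_pos_pos)
 have n1: "1 + p x \<noteq> 0" for x
 proof -
  have "1 + p x = cor (1 + pr x)" by (simp add: p_def)
  then show ?thesis using p0(1)[of x] by (simp only: of_real_eq_0_iff; simp?)
 qed
 have sB: "Bc n s" unfolding s_def[abs_def]
 proof (rule Bc_inverse[OF Bc_add[OF Bc_const pB], of 1])
  show "1 <= cmod (1 + p x)" for x
  proof -
   have "1 + p x = cor (1 + pr x)" by (simp add: p_def)
   then show ?thesis using p0(1)[of x] by (simp only: norm_of_real; simp?)
  qed
 qed simp
 have sA: "AC s (\<lambda>x. - 1 * ((s x * s x) * p' x))"
  using AC_inverse[OF AC_add[OF AC_const[of 1] pA] n1] by (rule AC_cong) (simp_all add: s_def divide_inverse power2_eq_square)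
 \<comment> \<open>The small root of \<open>cnj Q - 2 i w + Q w^2 = 0\<close>. Where
   \<open>Q\<close> is nonzero, the other root is \<open>- 1 / cnj w0\<close>, the antipodal point,
   so the Moebius map is a rotation of the sphere that takes 0 and infinity to the two roots. The
   linearisation at \<open>w0\<close> has the rate \<open>- 2 i l p\<close>, the origin of the
   profile \<open>p\<close>.\<close>
 define w0 where "w0 x = - (\<i> * cnj (Q x) * s x)" for x
 define w0' where "w0' x = - \<i> * (s x * cnj (Q1 x) + cnj (Q x) * (- 1 * ((s x * s x) * p' x)))" for x
 have w0A: "AC w0 w0'"
  using AC_cmult[OF AC_mult[OF AC_cnj[OF Q(1)] sA], of "- \<i>"]
  by (rule AC_cong) (simp_all add: w0_def w0'_def algebra_simps)
 have w0'W: "Wc n w0'" unfolding w0'_def[abs_def]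
  by (intro Wc_cmult Wc_add Wc_mult Bc_mult sB Wc_cnj Q(2) Bc_cnj QB p'W)
 have w0B: "Bc n w0"
 proof -
  have "Bc n (\<lambda>x. (- \<i>) * (cnj (Q x) * s x))" by (intro Bc_mult Bc_const Bc_cnj QB sB)
  then show ?thesis by (simp add: w0_def[abs_def] mult.assoc)
 qed
 have Qp: "cmod (Q x) <= pr x" for x
  by (rule power2_le_imp_le) (use pr2[of x] p0(1)[of x] in auto)
 have w0Q: "cmod (w0 x) <= cmod (Q x)" "cmod (w0 x) <= 1" for x
 proof -
  have e: "cmod (w0 x) = cmod (Q x) * sr x" using sr(1)[of x] by (simp add: w0_def ss norm_mult)
  have "sr x <= 1" using p0(1)[of x] by (simp add: sr_def)
  then show "cmod (w0 x) <= cmod (Q x)" unfolding e using mult_left_mono[of "sr x" 1 "cmod (Q x)"] by simp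
  have "cmod (Q x) * sr x <= (1 + pr x) * sr x" using Qp[of x] sr(1)[of x] by (intro mult_right_mono) auto
  then show "cmod (w0 x) <= 1" unfolding e using sr(2)[of x] by (simp add: mult.commute)
 qed
 have w0'Q: "cmod (w0' x) <= cmod (Q1 x)" for x
 proof -
  let ?P = "pr x" and ?S = "sr x"
  have "cmod (p' x) = inverse ?P * (1/2 * cmod (Q1 x * cnj (Q x) + Q x * cnj (Q1 x)))"
   using p0(1)[of x] by (simp add: p'_def p_def norm_mult norm_inverse)
  also have "\<dots> <= inverse ?P * (1/2 * (2 * (cmod (Q1 x) * cmod (Q x))))"
   using p0(1)[of x] norm_triangle_ineq[of "Q1 x * cnj (Q x)" "Q x * cnj (Q1 x)"]
   by (intro mult_left_mono) (auto simp: norm_mult mult.commute)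
  finally have p': "cmod (p' x) <= inverse ?P * (cmod (Q1 x) * cmod (Q x))" by simp
  have "cmod (w0' x) = cmod (s x * cnj (Q1 x) + cnj (Q x) * (- 1 * ((s x * s x) * p' x)))" by (simp only: w0'_def norm_mult norm_minus_cancel norm_ii mult_1_left)
  also have "\<dots> <= ?S * cmod (Q1 x) + cmod (Q x) * ((?S * ?S) * cmod (p' x))"
   by (rule order_trans[OF norm_triangle_ineq]) (use sr(1)[of x] in \<open>simp add: ss norm_mult\<close>)
  also have "\<dots> <= ?S * cmod (Q1 x) + cmod (Q x) * ((?S * ?S) * (inverse ?P * (cmod (Q1 x) * cmod (Q x))))"
   using sr(1)[of x] p' by (intro add_left_mono mult_left_mono) auto
  also have "\<dots> = cmod (Q1 x) * (?S + ?S * ?S * (cmod (Q x))\<^sup>2 * inverse ?P)" by (simp add: power2_eq_square algebra_simps)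
  also have "\<dots> <= cmod (Q1 x) * 1"
  proof (rule mult_left_mono)
   have q2: "(cmod (Q x))\<^sup>2 = (?P - 1) * (1 + ?P)" using pr2[of x] by (simp add: power2_eq_square algebra_simps)
   have "?S * ?S * (cmod (Q x))\<^sup>2 = ?S * (?P - 1) * (?S * (1 + ?P))" unfolding q2 by (simp only: mult_ac)
   then have e: "?S * ?S * (cmod (Q x))\<^sup>2 = ?S * (?P - 1)" unfolding sr(2) by simp
   \<comment> \<open>With \<open>S = 1/(1 + P)\<close> the claim is
     \<open>2 P - 1 <= P (1 + P)\<close>. The constant 1 in the bound by \<open>|Q1|\<close> lets
     the smallness of \<open>Q1\<close> pass to the source without loss.\<close>
   have "?S * (?P + (?P - 1)) <= ?S * (?P * (1 + ?P))"
   proof (rule mult_left_mono)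
    have "0 <= (?P - 1)\<^sup>2" by simp
    then show "?P + (?P - 1) <= ?P * (1 + ?P)" using p1[of x] by (simp add: power2_eq_square algebra_simps)
   qed (use sr(1)[of x] in simp)
   also have "\<dots> = ?P" using sr(2)[of x] by (simp add: mult.left_commute)
   finally have "?S * (?P + (?P - 1)) * inverse ?P <= ?P * inverse ?P" using p0(1)[of x] by (intro mult_right_mono) auto
   then show "?S + ?S * ?S * (cmod (Q x))\<^sup>2 * inverse ?P <= 1" unfolding e using p0(1)[of x] by (simp add: field_simps)
  qed simp
  finally show ?thesis by simp
 qed
 \<comment> \<open>The inverse of \<open>1 + |w0|^2\<close>; it is at most 1, so it does not enlarge
   the source.\<close>
 define hr where "hr x = inverse (2 * pr x * sr x)" for x
 define h where "h x = inverse (2 * p x * s x)" for x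
 have psr: "1 <= 2 * pr x * sr x" for x
 proof -
  have "sr x * (1 + pr x) <= sr x * (2 * pr x)" using p1[of x] sr(1)[of x] by (intro mult_left_mono) auto
  then show ?thesis unfolding sr(2) by (simp add: mult_ac)
 qed
 have hh: "h x = cor (hr x)" for x by (simp add: h_def hr_def p_def ss)
 have hr: "0 < hr x" "hr x <= 1" for x
 proof -
  have "0 < 2 * pr x * sr x" using psr[of x] by linarith
  then show "0 < hr x" unfolding hr_def by (rule positive_imp_inverse_positive)
  show "hr x <= 1" unfolding hr_def using le_imp_inverse_le[OF psr[of x]] by simp
 qed
 have h1: "h x * (2 * p x * s x) = 1" for x
  unfolding h_def by (rule left_inverse) (use p0 sr(1)[of x] in \<open>auto simp: ss\<close>)
 have hB: "Bc n h" unfolding h_def[abs_def]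
 proof (rule Bc_inverse[OF Bc_mult[OF Bc_mult[OF Bc_const pB] sB], of 1])
  fix x
  have "2 * p x * s x = cor (2 * pr x * sr x)" by (simp add: p_def ss)
  then show "1 <= cmod (2 * p x * s x)" using psr[of x] by (simp only: norm_of_real; simp?)
 qed simp
 define u where "u x = - w0' x * h x" for x
 have uQ: "cmod (u x) <= cmod (Q1 x)" for x
 proof -
  have "cmod (u x) = cmod (w0' x) * hr x" using hr(1)[of x] by (simp add: u_def hh norm_mult)
  also have "\<dots> <= cmod (w0' x) * 1" using hr(2)[of x] by (intro mult_left_mono) auto
  finally show ?thesis using w0'Q[of x] by simp
 qed
 define bet where "bet x = (cnj (w0 x) * w0' x - w0 x * cnj (w0' x)) * h x" for x
 have betW: "Wc n bet"
 proof -
  have "Wc n (\<lambda>x. h x * (cnj (w0 x) * w0' x + (- 1) * (w0 x * cnj (w0' x))))"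
   by (intro Wc_mult Wc_add Wc_cmult Wc_cnj w0'W hB w0B Bc_cnj)
  then show ?thesis by (simp add: bet_def[abs_def] mult.commute[of "h _"])
 qed
 note beti = wL2_integrable[OF Wc_wL2[OF betW]]
 have bsi: "set_integrable lborel A bet" if "A \<in> sets borel" for A
  using beti integrable_mult_indicator[of A lborel bet] that by (simp add: set_integrable_def)
 \<comment> \<open>The primitive that vanishes at plus infinity. The gauge factor tends to 1 there
   and to the constant \<open>exp L\<close> at minus infinity, so it neither disturbs the decay of
   \<open>w\<close> nor adds a dependence on \<open>l\<close>.\<close>
 define IB where "IB x = - (LINT y:{x..}|lborel. bet y)" for x
 have IBA: "AC IB bet" unfolding IB_def[abs_def] by (rule AC_upper_integral) (use beti bsi in auto)
 have "((\<lambda>x. - (LINT y:{x..}|lborel. bet y)) \<longlongrightarrow> - 0) at_top" by (intro tendsto_minus upper_integral_at_top[OF bsi, of 0]) simp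
 then have IB0: "(IB \<longlongrightarrow> 0) at_top" by (simp add: IB_def[abs_def])
 obtain L where L: "(IB \<longlongrightarrow> L) at_bot" using AC_limits(2)[OF IBA beti] by blast
 have IBc: "cnj (IB x) = - IB x" for x
 proof -
  have "AC (\<lambda>x. IB x + cnj (IB x)) (\<lambda>x. 0)"
   using AC_add[OF IBA AC_cnj[OF IBA]] by (rule AC_cong) (simp_all add: bet_def hh algebra_simps)
  from AC_zero_const[OF this] have "(\<lambda>t. IB t + cnj (IB t)) = (\<lambda>t. IB x + cnj (IB x))" by blast
  moreover have "((\<lambda>t. IB t + cnj (IB t)) \<longlongrightarrow> 0 + cnj 0) at_top" by (intro tendsto_intros IB0)
  ultimately have "((\<lambda>t :: real. IB x + cnj (IB x)) \<longlongrightarrow> 0) at_top" by simp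
  then have "IB x + cnj (IB x) = 0" by (simp add: tendsto_const_iff)
  then show ?thesis by (simp add: add_eq_0_iff)
 qed
 have ReIB: "Re (IB x) = 0" for x using IBc[of x] by (simp add: complex_eq_iff)
 have nE: "cmod (exp (IB x)) = 1" "cmod (exp (- IB x)) = 1" for x by (simp_all add: ReIB)
 have cE: "cnj (exp (- IB x)) = exp (IB x)" for x by (simp add: exp_cnj IBc)
 have EE: "exp (IB x) * exp (- IB x) = 1" for x by (simp add: exp_minus)
 have IBB: "Bc n IB" by (rule Bc_Suc[OF AC_Wc_Bc[OF IBA betW]])
 \<comment> \<open>The source divided by \<open>p\<close> and conjugated by the gauge factor,
   spelled as products of a bounded and a weighted function to match the closure rules.\<close>
 define f0 where "f0 x = ip x * (exp (- 1 * IB x) * (h x * (- 1 * w0' x)))" for x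
 have f0W: "Wc n f0" unfolding f0_def[abs_def]
  by (intro Wc_mult Wc_cmult ipB hB w0'W Bc_exp Bc_mult Bc_const IBB)
 have pf: "p x * f0 x = u x * exp (- IB x)" for x using p0(2)[of x] by (simp add: f0_def ip_def u_def)
 obtain f where f: "f 0 = f0" "\<And>k. k <= n ==> wL2 (f k)" "\<And>k. k < n ==> AC (f k) (\<lambda>x. p x * f (Suc k) x)"
  using derivative_sequence[OF f0W ipB, of p] p0(2) by (auto simp: ip_def)
 have pcont: "continuous_on UNIV p" by (rule AC_continuous[OF pA])
 have prcont: "continuous_on UNIV pr" using continuous_on_Re[OF pcont] by (simp add: p_def)
 have pm: "p \<in> bor" by (rule borel_measurable_continuous_onI[OF pcont])
 have "p absolutely_integrable_on {c..d}" for c d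
  using absolutely_integrable_continuous_real pcont continuous_on_subset by blast
 from AC_primitive[OF pm this] obtain G where G: "AC G p" "G 0 = 0" by blast
 define E where "E x = Re (G x)" for x
 have Ed: "(E has_real_derivative pr x) (at x)" for x
  using bounded_linear.has_vector_derivative[OF bounded_linear_Re AC_deriv[OF G(1) pcont]]
  unfolding has_real_derivative_iff_has_vector_derivative E_def[abs_def] by (simp add: p_def)
 have "pr x <= sqrt (1 + C\<^sup>2)" for x
  unfolding pr_def a_def using power_mono[OF C[of x], of 2] by simp
 then interpret riccati_data pr E "sqrt (1 + C\<^sup>2)" f n "\<lambda>_. 1" 0
 proof (unfold_locales)
  have "(NN z. ennreal \<bar>pr z * cmod (f 0 z)\<bar>) <= (NN z. ennreal (cmod (Q1 z)))"
  proof (rule nn_integral_mono)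
   fix z
   have "\<bar>pr z * cmod (f 0 z)\<bar> = cmod (p z * f0 z)" using p0(1)[of z] by (simp add: f(1) p_def norm_mult)
   also have "\<dots> <= cmod (Q1 z)" unfolding pf norm_mult nE using uQ[of z] by simp
   finally show "ennreal \<bar>pr z * cmod (f 0 z)\<bar> <= ennreal (cmod (Q1 z))" by (rule ennreal_leI)
  qed
  also have "\<dots> <= ennreal (1/16)" by (rule small_L1[OF _ small]) measurable
  finally show "(NN z. ennreal \<bar>pr z * cmod (f 0 z)\<bar>) <= ennreal (1/16)" .
  show "AC (f k) (\<lambda>x. cor (pr x) * f (Suc k) x)" if "k < n" for k using f(3)[OF that] by (simp add: p_def)
 qed (use prcont p1 Ed f(2) G(2) in \<open>auto simp: E_def\<close>)
 obtain v :: "real => real => complex" and r :: "real => complex" where v: "\<And>x l. cmod (v x l) <= 1/8"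
  "\<And>l. AC (\<lambda>x. v x l) (\<lambda>x. cor (pr x) * (- (2 * \<i> * l) * v x l + (f 0 x + cor 1 * (cnj (f 0 x) * (v x l)\<^sup>2))))"
  "\<And>l. ((\<lambda>x. v x l) \<longlongrightarrow> 0) at_top"
  "\<And>l. ((\<lambda>x. cis (2 * l * E x) * v x l) \<longlongrightarrow> r l) at_bot"
  "\<And>j. j <= n ==> hcl (\<lambda>l. cor l ^ j * r l)"
  by (rule riccati_limit) (rule that)
 define vt where "vt l x = exp (IB x) * v x l" for l x
 have nvt: "cmod (vt l x) = cmod (v x l)" for l x by (simp only: vt_def norm_mult nE mult_1_left)
 define dv where "dv l x = ((cnj (w0 x) * w0' x - w0 x * cnj (w0' x)) * h x - 2 * \<i> * cor l * p x) * vt l x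
  + (- w0' x * h x) + (- cnj (w0' x) * h x) * (vt l x)\<^sup>2" for l x
 have vtA: "AC (vt l) (dv l)" for l
  using AC_mult[OF AC_exp[OF IBA] v(2)[of l]]
 proof (rule AC_cong)
  fix x
  have 1: "exp (IB x) * (p x * f0 x) = - w0' x * h x"
   unfolding pf u_def using EE[of x] by (simp add: mult.commute mult.left_commute)
  have cpf: "p x * cnj (f0 x) = - cnj (w0' x) * h x * exp (IB x)"
  proof -
   have "cnj (p x * f0 x) = cnj (u x * exp (- IB x))" unfolding pf ..
   then show ?thesis unfolding complex_cnj_mult cE by (simp add: p_def u_def hh)
  qed
  have "exp (IB x) * bet x * v x l + exp (IB x) * (p x * (- (2 * \<i> * cor l) * v x l + (f0 x + 1 * (cnj (f0 x) * (v x l)\<^sup>2))))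
   = (bet x - 2 * \<i> * cor l * p x) * vt l x + exp (IB x) * (p x * f0 x) + exp (IB x) * (p x * cnj (f0 x)) * (v x l)\<^sup>2"
   unfolding vt_def by (simp add: algebra_simps)
  also have "\<dots> = dv l x"
   unfolding 1 cpf dv_def bet_def[symmetric] by (simp add: vt_def power2_eq_square algebra_simps)
  finally show "exp (IB x) * bet x * v x l + exp (IB x) * (cor (pr x) * (- (2 * \<i> * cor l) * v x l + (f 0 x + cor 1 * (cnj (f 0 x) * (v x l)\<^sup>2)))) = dv l x"
   by (simp only: p_def f(1) of_real_1)
 qed (simp add: vt_def)
 \<comment> \<open>\<open>|w0| <= 1\<close> and \<open>|v| <= 1/8\<close> keep the pole of the
   Moebius map at a distance.\<close>
 have Dn: "7/8 <= cmod (1 - cnj (w0 x) * vt l x)" for l x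
 proof -
  have "cmod (cnj (w0 x) * vt l x) <= 1 * (1/8)" unfolding norm_mult nvt complex_mod_cnj by (intro mult_mono w0Q(2) v(1)) auto
  then show ?thesis using norm_triangle_ineq2[of 1 "cnj (w0 x) * vt l x"] by simp
 qed
 have Dz: "1 - cnj (w0 x) * vt l x \<noteq> 0" for l x using Dn[of x l] by auto
 define w where "w l x = (vt l x + w0 x) * inverse (1 - cnj (w0 x) * vt l x)" for l x
 have wb: "cmod (w l x) <= 2" for l x
 proof -
  have "cmod (vt l x + w0 x) <= 1/8 + 1" using norm_triangle_le[OF add_mono[OF v(1)[of x l] w0Q(2)[of x], folded nvt]] .
  moreover have "cmod (inverse (1 - cnj (w0 x) * vt l x)) <= inverse (7/8)" unfolding norm_inverse by (rule le_imp_inverse_le[OF Dn]) simp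
  ultimately have "cmod (w l x) <= (1/8 + 1) * inverse (7/8)" unfolding w_def norm_mult by (intro mult_mono) auto
  then show ?thesis by simp
 qed
 have wA: "AC (w l) (\<lambda>x. - (2 * \<i> * cor l) * w l x + cor l * cnj (Q x) + cor l * (Q x * (w l x)\<^sup>2))" for l
  using AC_mult[OF AC_add[OF vtA w0A] AC_inverse[OF AC_diff[OF AC_const[of 1] AC_mult[OF AC_cnj[OF w0A] vtA[of l]]] Dz]]
 proof (rule AC_cong)
  fix x
  have sc: "cnj (s x) = s x" by (simp add: ss)
  have sp: "s x * (1 + p x) = 1" unfolding s_def by (rule left_inverse[OF n1])
  show "(dv l x + w0' x) * inverse (1 - cnj (w0 x) * vt l x) + (vt l x + w0 x) * (- (0 - (cnj (w0' x) * vt l x + cnj (w0 x) * dv l x)) / (1 - cnj (w0 x) * vt l x)\<^sup>2)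
   = - (2 * \<i> * cor l) * w l x + cor l * cnj (Q x) + cor l * (Q x * (w l x)\<^sup>2)"
   using moebius_identity[OF w0_def sc sp pp Dz h1 dv_def, of l] unfolding w_def diff_0 .
 qed (simp add: w_def)
 have Q0: "(Q \<longlongrightarrow> 0) at_top" "(Q \<longlongrightarrow> 0) at_bot"
  using AC_integrable_limit_zero[OF Q(1) wL2_integrable[OF Q(3)] wL2_integrable[OF Wc_wL2[OF Q(2)]]] by auto
 have w00: "(w0 \<longlongrightarrow> 0) at_top" "(w0 \<longlongrightarrow> 0) at_bot"
  by (rule Lim_null_comparison[OF _ tendsto_norm_zero[OF Q0(1)]] Lim_null_comparison[OF _ tendsto_norm_zero[OF Q0(2)]],
   intro always_eventually allI w0Q(1))+
 have wtop: "(w l \<longlongrightarrow> 0) at_top" for l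
 proof -
  have vt0: "(vt l \<longlongrightarrow> 0) at_top"
   by (rule Lim_null_comparison[OF _ tendsto_norm_zero[OF v(3)[of l]]]) (intro always_eventually allI, simp add: nvt)
  have "((\<lambda>x. (vt l x + w0 x) * inverse (1 - cnj (w0 x) * vt l x)) \<longlongrightarrow> (0 + 0) * inverse (1 - cnj 0 * 0)) at_top"
   by (intro tendsto_intros vt0 w00) simp
  then show ?thesis by (simp add: w_def[abs_def])
 qed
 \<comment> \<open>The phase of \<open>v\<close> is linear in \<open>E\<close>, that of
   \<open>w\<close> in \<open>x\<close>. Their difference has a limit because \<open>1 - p\<close>
   is quadratic in \<open>Q\<close> and hence integrable.\<close>
 have GA: "AC (\<lambda>x. cor x - G x) (\<lambda>x. 1 - p x)"
 proof (rule AC_diff[OF AC_of_deriv G(1)])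
  show "((\<lambda>x. cor x) has_vector_derivative 1) (at x)" for x
   using has_vector_derivative_of_real[OF DERIV_ident[of "at x"]] by simp
 qed simp
 have gi: "integrable lborel (\<lambda>x. 1 - p x)"
 proof -
  have "1 - p x = - (s x * cnj (Q x)) * Q x" for x
  proof -
   have "s x * (Q x * cnj (Q x)) = s x * (p x * p x - 1)" using pp[of x] by simp
   also have "\<dots> = (s x * (1 + p x)) * (p x - 1)" by (simp add: algebra_simps)
   also have "s x * (1 + p x) = 1" unfolding s_def by (rule left_inverse[OF n1])
   finally show ?thesis by (simp add: algebra_simps)
  qed
  moreover have "wL2 (\<lambda>x. - 1 * ((s x * cnj (Q x)) * Q x))"
  proof (rule Wc_wL2[of n])
   have "Wc n Q" by (rule Wc_Suc) (use Q in auto)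
   then show "Wc n (\<lambda>x. - 1 * ((s x * cnj (Q x)) * Q x))" by (intro Wc_cmult Wc_mult Bc_mult sB Bc_cnj QB)
  qed
  ultimately have "wL2 (\<lambda>x. 1 - p x)" by simp
  then show ?thesis by (rule wL2_integrable)
 qed
 obtain c' where "((\<lambda>x. cor x - G x) \<longlongrightarrow> c') at_bot" using AC_limits(2)[OF GA gi] by blast
 from tendsto_Re[OF this] have c: "((\<lambda>x. x - E x) \<longlongrightarrow> Re c') at_bot" by (simp add: E_def)
 \<comment> \<open>The limiting shift between the phases survives as the factor
   \<open>cis (2 l Re c')\<close>, a Lipschitz multiplier of modulus 1.\<close>
 define R where "R l = cis (2 * l * Re c') * (exp L * r l)" for l
 have wbot: "((\<lambda>x. cis (2 * l * x) * w l x) \<longlongrightarrow> R l) at_bot" for l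
 proof -
  have cv: "((\<lambda>x. cis (2 * l * (x - E x)) * (exp (IB x) * (cis (2 * l * E x) * v x l))) \<longlongrightarrow> R l) at_bot"
   unfolding R_def cis_conv_exp by (intro tendsto_intros c L v(4)[unfolded cis_conv_exp])
  have cw: "((\<lambda>x. cis (2 * l * x) * w0 x) \<longlongrightarrow> 0) at_bot"
   by (rule Lim_null_comparison[OF _ tendsto_norm_zero[OF w00(2)]]) (intro always_eventually allI, simp add: norm_mult)
  have wv: "((\<lambda>x. cnj (w0 x) * vt l x) \<longlongrightarrow> 0) at_bot"
  proof (rule Lim_null_comparison[OF _ tendsto_norm_zero[OF w00(2)]], intro always_eventually allI)
   fix x
   have "cmod (vt l x) <= 1" using v(1)[of x l] by (simp add: nvt)
   then show "norm (cnj (w0 x) * vt l x) <= norm (w0 x)" by (simp add: norm_mult mult_left_le)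
  qed
  have "((\<lambda>x. (cis (2 * l * (x - E x)) * (exp (IB x) * (cis (2 * l * E x) * v x l)) + cis (2 * l * x) * w0 x) * inverse (1 - cnj (w0 x) * vt l x))
   \<longlongrightarrow> (R l + 0) * inverse (1 - 0)) at_bot"
   by (intro tendsto_intros cv cw wv) simp
  moreover have "(cis (2 * l * (x - E x)) * (exp (IB x) * (cis (2 * l * E x) * v x l)) + cis (2 * l * x) * w0 x) * inverse (1 - cnj (w0 x) * vt l x) = cis (2 * l * x) * w l x" for x
  proof -
   have "cis (2 * l * (x - E x)) * cis (2 * l * E x) = cis (2 * l * x)" by (simp add: cis_mult algebra_simps)
   then have e: "cis (2 * l * (x - E x)) * (exp (IB x) * (cis (2 * l * E x) * v x l)) = cis (2 * l * x) * vt l x"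
    unfolding vt_def by (metis mult.assoc mult.commute)
   show ?thesis unfolding w_def e by (simp only: distrib_left mult.assoc[symmetric])
  qed
  ultimately show ?thesis by simp
 qed
 have hR: "hcl (\<lambda>l. cor l ^ j * R l)" if "j <= n" for j
 proof -
  have "hcl (\<lambda>l. cis (2 * l * Re c') * (exp L * (cor l ^ j * r l)))"
  proof (rule hcl_lipschitz_mult[OF hcl_scale[OF v(5)[OF that]], where K=1 and L="2 * \<bar>Re c'\<bar>"])
   show "continuous_on UNIV (\<lambda>l. cis (2 * l * Re c'))" by (intro continuous_intros)
   fix l h :: real
   have "2 * (l + h) * Re c' = 2 * l * Re c' + 2 * h * Re c'" by (simp add: algebra_simps)
   then have "cis (2 * (l + h) * Re c') - cis (2 * l * Re c') = cis (2 * l * Re c') * (cis (2 * h * Re c') - 1)"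
    by (simp only: cis_mult[symmetric] right_diff_distrib mult_1_right)
   then have "cmod (cis (2 * (l + h) * Re c') - cis (2 * l * Re c')) = cmod (cis (2 * h * Re c') - 1)" by (simp only: norm_mult norm_cis mult_1_left)
   also have "\<dots> <= \<bar>2 * h * Re c'\<bar>" by (rule norm_cis_minus_one)
   finally show "cmod (cis (2 * (l + h) * Re c') - cis (2 * l * Re c')) <= 2 * \<bar>Re c'\<bar> * \<bar>h\<bar>" by (simp add: abs_mult mult_ac)
  qed simp
  then show ?thesis by (simp add: R_def mult_ac)
 qed
 show thesis by (rule that[OF wb wA wtop wbot hR])
qed

section \<open>Small spectral parameters and the scattering quotient\<close>

lemma Wc_sequence:
 assumes "\<And>k. k <= N ==> wL2 (Q k)" "\<And>k. k < N ==> AC (Q k) (Q (Suc k))"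
 shows "k + m <= N ==> Wc m (Q k)"
proof (induction m arbitrary: k)
 case (Suc m)
 have "AC (Q k) (Q (Suc k)) \<and> Wc m (Q (Suc k))" using Suc.IH[of "Suc k"] Suc.prems assms(2)[of k] by simp
 then show ?case using assms(1)[of k] Suc.prems by auto
qed (use assms(1) in simp)

lemma Wc_reflect: "Wc k g ==> Wc k (\<lambda>x. c * g (- x))"
proof (induction k arbitrary: g c)
 case (Suc k)
 then obtain g' where g': "AC g g'" "Wc k g'" by auto
 have "AC (\<lambda>x. c * g (- x)) (\<lambda>x. - c * g' (- x))"
  using AC_cmult[OF AC_reflect[OF g'(1)], of c] by (rule AC_cong) simp_all
 then show ?case using Suc.IH[OF g'(2), of "- c"] wL2_reflect[of g c] Suc.prems by auto
qed (auto intro: wL2_reflect)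

text \<open>The identity on \<open>[-1, 1]\<close>, cut off outside: its square replaces
  \<open>l^2\<close> as quadratic coefficient, since \<open>\<mu>\<close> must be bounded by 1 and
  Lipschitz.\<close>

definition clip :: "real => real" where
 "clip l = max (- 1) (min 1 l)"

lemma clip_props: "\<bar>clip l\<bar> <= 1" "\<bar>clip x - clip y\<bar> <= \<bar>x - y\<bar>" "continuous_on UNIV clip" "\<bar>l\<bar> <= 1 ==> clip l = l"
 unfolding clip_def by (auto intro!: continuous_intros)

text \<open>After dividing \<open>w\<close> by \<open>l\<close> the source is \<open>cnj Q\<close>,
  free of \<open>l\<close>, and the equation already has the required form with
  \<open>p = 1\<close>. Here smallness of \<open>Q\<close> itself is used, and no derivative of
  \<open>Q\<close>. The Lipschitz constant 2 comes from \<open>|clip + clip| <= 2\<close>.\<close>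

lemma small_parameter:
 assumes Q: "wL2 Q" and small: "WN Q <= ennreal ((1/32)\<^sup>2)"
 obtains w and \<rho> :: "real => complex" where "\<And>l x. cmod (w l x) <= 1/8" "hcl \<rho>"
  "\<And>l. AC (w l) (\<lambda>x. - (2 * \<i> * cor l) * w l x + cnj (Q x) + cor ((clip l)\<^sup>2) * (Q x * (w l x)\<^sup>2))"
  "\<And>l. (w l \<longlongrightarrow> 0) at_top" "\<And>l. ((\<lambda>x. cis (2 * l * x) * w l x) \<longlongrightarrow> \<rho> l) at_bot"
proof -
 have [measurable]: "Q \<in> bor" using Q by auto
 interpret riccati_data "\<lambda>_. 1" "\<lambda>x. x" 1 "\<lambda>_ x. cnj (Q x)" 0 "\<lambda>l. (clip l)\<^sup>2" 2
 proof
  show "wL2 (\<lambda>x. cnj (Q x))" by (rule wL2_cnj[OF Q])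
  show "(NN z. ennreal \<bar>1 * cmod (cnj (Q z))\<bar>) <= ennreal (1/16)" using small_L1[OF _ small] by simp
  show "\<bar>(clip l)\<^sup>2\<bar> <= 1" for l using clip_props(1)[of l] by (simp add: abs_square_le_1)
  fix l h
  have "\<bar>(clip (l + h))\<^sup>2 - (clip l)\<^sup>2\<bar> = \<bar>clip (l + h) + clip l\<bar> * \<bar>clip (l + h) - clip l\<bar>"
   by (simp add: abs_mult[symmetric] power2_eq_square algebra_simps)
  also have "\<dots> <= 2 * \<bar>h\<bar>"
   using clip_props(1)[of "l + h"] clip_props(1)[of l] clip_props(2)[of "l + h" l] by (intro mult_mono) auto
  finally show "\<bar>(clip (l + h))\<^sup>2 - (clip l)\<^sup>2\<bar> <= 2 * \<bar>h\<bar>" .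
 qed auto
 obtain v :: "real => real => complex" and r :: "real => complex" where v: "\<And>x l. cmod (v x l) <= 1/8"
  "\<And>l. AC (\<lambda>x. v x l) (\<lambda>x. cor 1 * (- (2 * \<i> * l) * v x l + (cnj (Q x) + cor ((clip l)\<^sup>2) * (cnj (cnj (Q x)) * (v x l)\<^sup>2))))"
  "\<And>l. ((\<lambda>x. v x l) \<longlongrightarrow> 0) at_top"
  "\<And>l. ((\<lambda>x. cis (2 * l * x) * v x l) \<longlongrightarrow> r l) at_bot"
  "\<And>j. j <= 0 ==> hcl (\<lambda>l. cor l ^ j * r l)"
  by (rule riccati_limit) (rule that)
 show thesis
 proof (rule that[of "\<lambda>l x. v x l" r])
  show "AC (\<lambda>x. v x l) (\<lambda>x. - (2 * \<i> * cor l) * v x l + cnj (Q x) + cor ((clip l)\<^sup>2) * (Q x * (v x l)\<^sup>2))" for l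
   using v(2)[of l] by (rule AC_cong) simp_all
  show "hcl r" using v(5)[of 0] by simp
 qed (rule v)+
qed

lemma hcl_clip: assumes "hcl g" shows "hcl (\<lambda>l. cor (clip l) * g l)"
proof (rule hcl_lipschitz_mult[OF assms, where K=1 and L=1])
 show "continuous_on UNIV (\<lambda>l. cor (clip l))" by (intro continuous_intros clip_props)
 show "cmod (cor (clip l)) <= 1" for l using clip_props(1) by simp
 show "cmod (cor (clip (l + h)) - cor (clip l)) <= 1 * \<bar>h\<bar>" for l h
  unfolding of_real_diff[symmetric] norm_of_real using clip_props(2)[of "l + h" l] by simp
qed

text \<open>Together with \<open>hcl_clip\<close> this divides by \<open>l\<close> away from 0: the
  product of both multipliers is \<open>1/l\<close> for \<open>\<bar>l\<bar> >= 1\<close>.\<close>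

lemma hcl_inverse_max: assumes "hcl g" shows "hcl (\<lambda>l. cor (inverse (max 1 \<bar>l\<bar>)) * g l)"
proof (rule hcl_lipschitz_mult[OF assms, where K=1 and L=1])
 let ?M = "\<lambda>l :: real. max 1 \<bar>l\<bar>"
 have i: "inverse (?M l) <= 1" "0 <= inverse (?M l)" for l using le_imp_inverse_le[of 1 "?M l"] by (auto simp: le_max_iff_disj)
 show "continuous_on UNIV (\<lambda>l. cor (inverse (?M l)))" by (intro continuous_intros) (auto simp: max_def)
 show "cmod (cor (inverse (?M l))) <= 1" for l unfolding norm_of_real using i[of l] by simp
 fix l h
 have "inverse (?M (l + h)) - inverse (?M l) = - (inverse (?M (l + h)) * (?M (l + h) - ?M l) * inverse (?M l))"
  by (rule inverse_diff_inverse) (auto simp: max_def)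
 then have "\<bar>inverse (?M (l + h)) - inverse (?M l)\<bar> = inverse (?M (l + h)) * \<bar>?M (l + h) - ?M l\<bar> * inverse (?M l)"
  using i by (simp only: abs_minus_cancel abs_mult abs_of_nonneg)
 also have "\<dots> <= 1 * \<bar>?M (l + h) - ?M l\<bar> * 1" using i by (intro mult_mono) auto
 also have "\<dots> <= \<bar>h\<bar>" by (auto simp: max_def)
 finally show "cmod (cor (inverse (?M (l + h))) - cor (inverse (?M l))) <= 1 * \<bar>h\<bar>"
  by (simp only: of_real_diff[symmetric] norm_of_real mult_1_left)
qed

text \<open>The solution \<open>u\<close> that decays at minus infinity is that of the reflected
  potential, with \<open>l\<close> reversed; reflection preserves the norms, so
  \<open>potential_riccati\<close> applies twice. With this \<open>u\<close> fixed,
  \<open>scattering_ratio\<close> is used for two different Riccati solutions at plus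
  infinity.\<close>

lemma scattering_quotient:
 assumes q: "q \<in> X_space (n + 1)" and d: "X1_norm q < 1/32"
 obtains R \<rho> where "\<And>l. scattering_a q l \<noteq> 0" "\<And>l. scattering_b q l / scattering_a q l = R l"
  "\<And>j. j <= n ==> hcl (\<lambda>l. cor l ^ j * R l)" "hcl \<rho>" "\<And>l. \<bar>l\<bar> <= 1 ==> R l = cor l * \<rho> l"
proof -
 obtain Qs where Q0: "AE x in lborel. q x = Qs 0 x" and Qw: "\<And>k. k <= n + 1 ==> wL2 (Qs k)"
  and QA: "\<And>k. k <= n ==> AC (Qs k) (Qs (Suc k))"
  and W: "WN (Qs 0) <= ennreal ((X1_norm q)\<^sup>2)" "WN (Qs 1) <= ennreal ((X1_norm q)\<^sup>2)"
  by (rule X_space_representative[OF q]) (rule that)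
 define Q where "Q = Qs 0"
 define Q1 where "Q1 = Qs 1"
 have X0: "0 <= X1_norm q" by (simp add: X1_norm_def L2_norm_def)
 have le: "ennreal ((X1_norm q)\<^sup>2) <= ennreal ((1/32)\<^sup>2)" by (intro ennreal_leI power_mono X0) (use d in simp)
 have small: "WN Q <= ennreal ((1/32)\<^sup>2)" "WN Q1 <= ennreal ((1/32)\<^sup>2)"
  unfolding Q_def Q1_def by (rule order_trans[OF W(1) le] order_trans[OF W(2) le])+
 have A: "AC Q Q1" using QA[of 0] by (simp add: Q_def Q1_def)
 have Qw0: "wL2 Q" using Qw[of 0] by (simp add: Q_def)
 have W1: "Wc n Q1" unfolding Q1_def by (rule Wc_sequence[of "n + 1" Qs]) (auto intro: Qw QA)
 have Qi: "integrable lborel Q" by (rule wL2_integrable[OF Qw0])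
 have qm: "q \<in> borel_measurable lebesgue" using q by (auto simp: X_space_def L2_def)
 obtain w :: "real => real => complex" and R where w: "\<And>l x. cmod (w l x) <= 2"
  "\<And>l. AC (w l) (\<lambda>x. - (2 * \<i> * cor l) * w l x + cor l * cnj (Q x) + cor l * (Q x * (w l x)\<^sup>2))"
  "\<And>l. (w l \<longlongrightarrow> 0) at_top" "\<And>l. ((\<lambda>x. cis (2 * l * x) * w l x) \<longlongrightarrow> R l) at_bot"
  "\<And>j. j <= n ==> hcl (\<lambda>l. cor l ^ j * R l)"
  by (rule potential_riccati[OF A W1 Qw0 small(2)]) (rule that)
 define Qr where "Qr x = 1 * Q (- x)" for x
 define Qr1 where "Qr1 x = - 1 * Q1 (- x)" for x
 have Ar: "AC Qr Qr1" using AC_reflect[OF A] by (rule AC_cong) (simp_all add: Qr_def Qr1_def)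
 have Wr: "Wc n Qr1" unfolding Qr1_def[abs_def] by (rule Wc_reflect[OF W1])
 have Qwr: "wL2 Qr" unfolding Qr_def[abs_def] by (rule wL2_reflect[OF Qw0])
 have "WN Qr1 = WN (\<lambda>x. Q1 (- x))" by (simp add: WN_def Qr1_def)
 also have "\<dots> = WN Q1" using AC_borel[OF A] by (rule WN_reflect)
 finally have smallr: "WN Qr1 <= ennreal ((1/32)\<^sup>2)" using small(2) by simp
 obtain w' :: "real => real => complex" and R' where w': "\<And>l x. cmod (w' l x) <= 2"
  "\<And>l. AC (w' l) (\<lambda>x. - (2 * \<i> * cor l) * w' l x + cor l * cnj (Qr x) + cor l * (Qr x * (w' l x)\<^sup>2))"
  "\<And>l. (w' l \<longlongrightarrow> 0) at_top" "\<And>l. ((\<lambda>x. cis (2 * l * x) * w' l x) \<longlongrightarrow> R' l) at_bot"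
  "\<And>j. j <= n ==> hcl (\<lambda>l. cor l ^ j * R' l)"
  by (rule potential_riccati[OF Ar Wr Qwr smallr]) (rule that)
 define u where "u l x = w' (- l) (- x)" for l x
 have uA: "AC (u l) (\<lambda>x. - (2 * \<i> * cor l) * u l x + cor l * cnj (Q x) + cor l * (Q x * (u l x)\<^sup>2))" for l
  using AC_reflect[OF w'(2)[of "- l"]] by (rule AC_cong) (simp_all add: u_def Qr_def)
 have ub: "cmod (u l x) <= 2" for l x unfolding u_def by (rule w'(1))
 have u0: "(u l \<longlongrightarrow> 0) at_bot" for l
  using w'(3)[of "- l"] unfolding u_def[abs_def] by (simp add: filterlim_at_bot_mirror)
 note S = scattering_ratio[OF qm Q0[folded Q_def] Qi _ _ _ uA ub u0]
 have SR: "scattering_a q l \<noteq> 0" "scattering_b q l / scattering_a q l = R l" for l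
  by (rule S[OF w(2,1,3,4)])+
 obtain z and \<rho> :: "real => complex" where z: "\<And>l x. cmod (z l x) <= 1/8" "hcl \<rho>"
  "\<And>l. AC (z l) (\<lambda>x. - (2 * \<i> * cor l) * z l x + cnj (Q x) + cor ((clip l)\<^sup>2) * (Q x * (z l x)\<^sup>2))"
  "\<And>l. (z l \<longlongrightarrow> 0) at_top" "\<And>l. ((\<lambda>x. cis (2 * l * x) * z l x) \<longlongrightarrow> \<rho> l) at_bot"
  by (rule small_parameter[OF Qw0 small(1)]) (rule that)
 \<comment> \<open>The quotient is determined by \<open>q\<close> and \<open>l\<close> alone, so the
   solution \<open>l z\<close>, available for \<open>\<bar>l\<bar> <= 1\<close>, must give the same
   value as \<open>w\<close>.\<close>
 have R\<rho>: "R l = cor l * \<rho> l" if l: "\<bar>l\<bar> <= 1" for l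
 proof -
  have "scattering_b q l / scattering_a q l = cor l * \<rho> l"
  proof (rule S(2))
   show "AC (\<lambda>x. cor l * z l x) (\<lambda>x. - (2 * \<i> * cor l) * (cor l * z l x) + cor l * cnj (Q x) + cor l * (Q x * (cor l * z l x)\<^sup>2))"
    using AC_cmult[OF z(3)[of l], of "cor l"]
    by (rule AC_cong) (simp_all add: clip_props(4)[OF l] power_mult_distrib algebra_simps)
   show "cmod (cor l * z l x) <= 2" for x
    unfolding norm_mult norm_of_real using mult_mono[OF l z(1)[of l x]] by simp
   show "((\<lambda>x. cor l * z l x) \<longlongrightarrow> 0) at_top" using tendsto_mult_left[OF z(4)[of l], of "cor l"] by simp
   show "((\<lambda>x. cis (2 * l * x) * (cor l * z l x)) \<longlongrightarrow> cor l * \<rho> l) at_bot"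
    using tendsto_mult_left[OF z(5)[of l], of "cor l"] by (simp add: mult.left_commute)
  qed
  then show ?thesis using SR(2) by simp
 qed
 show thesis by (rule that[OF SR w(5) z(2) R\<rho>])
qed

theorem theorem2:
  shows "\<exists>\<delta>>0. \<forall>n q. q \<in> X_space (n + 1) \<and> X1_norm q < \<delta> \<longrightarrow>
           (\<forall>l. scattering_a q l \<noteq> 0) \<and>
           (\<lambda>l. inverse (complex_of_real l) * (scattering_b q l / scattering_a q l)) \<in> H1_space \<and>
           (\<forall>j\<le>n. (\<lambda>l. complex_of_real l ^ j * (scattering_b q l / scattering_a q l)) \<in> H1_space)"
proof -
 have main: "(\<forall>l. scattering_a q l \<noteq> 0) \<and>
     (\<lambda>l. inverse (cor l) * (scattering_b q l / scattering_a q l)) \<in> H1_space \<and>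
     (\<forall>j\<le>n. (\<lambda>l. cor l ^ j * (scattering_b q l / scattering_a q l)) \<in> H1_space)"
  if q: "q \<in> X_space (n + 1)" "X1_norm q < 1/32" for n q
 proof -
  obtain R \<rho> where S: "\<And>l. scattering_a q l \<noteq> 0" "\<And>l. scattering_b q l / scattering_a q l = R l"
   and h: "\<And>j. j <= n ==> hcl (\<lambda>l. cor l ^ j * R l)" "hcl \<rho>"
   and \<rho>: "\<And>l. \<bar>l\<bar> <= 1 ==> R l = cor l * \<rho> l"
   by (rule scattering_quotient[OF q]) (rule that)
  have R: "hcl R" using h(1)[of 0] by simp
  have [measurable]: "R \<in> bor" by (rule bm_meas[OF hcl_bm[OF R]])
  \<comment> \<open>A gluing without case distinction. For \<open>\<bar>l\<bar> <= 1\<close> the sum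
    is \<open>l^2 \<rho> + (\<rho> - l^2 \<rho>)\<close>, which is \<open>\<rho>\<close>; for
    \<open>\<bar>l\<bar> >= 1\<close> the first term is \<open>R/l\<close> and the bracket vanishes
    because \<open>clip l\<close> has square 1.\<close>
  let ?g = "\<lambda>l. cor (clip l) * (cor (inverse (max 1 \<bar>l\<bar>)) * R l) + (\<rho> l - cor (clip l) * (cor (clip l) * \<rho> l))"
  have g: "?g l = inverse (cor l) * R l" if l: "l \<noteq> 0" for l
  proof (cases "\<bar>l\<bar> <= 1")
   case True
   then show ?thesis using l \<rho>[OF True] by (simp add: clip_props(4) max_def)
  next
   case False
   then have "clip l * inverse (max 1 \<bar>l\<bar>) = inverse l" "clip l * clip l = 1"
    by (auto simp: clip_def max_def min_def abs_if split: if_splits)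
   then have "cor (clip l) * cor (inverse (max 1 \<bar>l\<bar>)) = inverse (cor l)"
    "cor (clip l) * cor (clip l) = 1"
    unfolding of_real_mult[symmetric] of_real_inverse[symmetric] by simp_all
   then show ?thesis by (simp only: mult.assoc[symmetric]) simp
  qed
  have "hcl ?g" by (rule hcl_add[OF hcl_clip[OF hcl_inverse_max[OF R]] hcl_diff[OF h(2) hcl_clip[OF hcl_clip[OF h(2)]]]])
  then have "(\<lambda>l. inverse (cor l) * R l) \<in> H1_space"
  proof (rule hcl_H1)
   show "AE l in lborel. ?g l = inverse (cor l) * R l"
    using AE_lborel_singleton[of "0 :: real"] by eventually_elim (rule g)
  qed measurable
  moreover have "(\<lambda>l. cor l ^ j * R l) \<in> H1_space" if "j <= n" for j
   by (rule hcl_H1[OF h(1)[OF that]]) auto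
  ultimately show ?thesis using S(1) unfolding S(2) by blast
 qed
 show ?thesis
  by (rule exI[of _ "1/32"]) (use main in auto)
qed

end
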